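(* Let $k\ge1$ be a fixed integer and $v\ne 0$ an integer. Then: (1) There is a rational number $c_v$ (depending on $k$ and $v$) such that for every $H>0$, $$\#\{p\le x:\ p\text{ prime},\ |c_{p-1}(k)|=v\}=c_vA\,\mathrm{Li}(x)+O\Big(\frac{x}{\log^H x}\Big),$$ where the implied constant depends at most on $k$ and $H$. (2) If in addition Conjecture 1 (stated in the context) holds, then the density of primes $p$ with $c_{p-1}(k)=v$ exists and equals $c_vA/2$.
   Context: $c_n(m)=\sum_{1\le j\le n,\,(j,n)=1}e^{2\pi i jm/n}$ is the Ramanujan sum. $A=\prod_p\big(1-\frac1{p(p-1)}\big)$ is Artin's constant, $\mathrm{Li}(x)=\int_2^x dt/\log t$, $\pi(x)$ is the number of primes $\le x$, and the density of a set of primes $P$ is $\lim_{x\to\infty}\pi(x)^{-1}\#\{p\le x:p\in P\}$. For a prime $q$, $\nu_q(n)$ is the exponent of $q$ in $n$. For a finite (possibly empty) set $S=\{q_1<\dots<q_t\}$ of primes put $\nu_S(n)=(\nu_{q_1}(n),\dots,\nu_{q_t}(n))$; $n$ is $S$-squarefree if $q^2\nmid n$ for every prime $q\notin S$; $\mu_S(n)=(-1)^{\#\{q\mid n:\,q\notin S\}}$ if $n$ is $S$-squarefree and $\mu_S(n)=0$ otherwise. Conjecture 1: for every such $S$ and every tuple $(e_1,\dots,e_t)$ of nonnegative integers, $\sum_{p\le x,\ \nu_S(p-1)=(e_1,\dots,e_t)}\mu_S(p-1)=o(\pi(x))$ as $x\to\infty$.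
   Formalization: In part (1) the condition |c_{p-1}(k)| = v is taken as |c_{p-1}(k)| = |v|; read literally, a negative v gives an empty set and c_v = 0, which contradicts part (2), for example for k = 1, v = -1 under Conjecture 1. *)

theory Defs
  imports
    "HOL-Analysis.Analysis"
    "HOL-Library.Landau_Symbols"
    "HOL-Computational_Algebra.Primes"
begin

definition ramanujan_sum :: "nat \<Rightarrow> nat \<Rightarrow> complex" where
  "ramanujan_sum n m =
     (\<Sum>j | 1 \<le> j \<and> j \<le> n \<and> coprime j n.
        exp (2 * complex_of_real pi * \<i> * of_nat j * of_nat m / of_nat n))"

definition artin_constant :: real where
  "artin_constant =
     (\<Prod>p. if prime p then 1 - 1 / (real p * (real p - 1)) else 1)"

definition Li :: "real \<Rightarrow> real" where
  "Li x = integral {2..x} (\<lambda>t. 1 / ln t)"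

definition prime_count :: "nat set \<Rightarrow> real \<Rightarrow> real" where
  "prime_count P x = real (card {p. prime p \<and> real p \<le> x \<and> p \<in> P})"

definition primes_pi :: "real \<Rightarrow> real" where
  "primes_pi x = real (card {p::nat. prime p \<and> real p \<le> x})"

definition has_prime_density :: "nat set \<Rightarrow> real \<Rightarrow> bool" where
  "has_prime_density P d \<longleftrightarrow> ((\<lambda>x. prime_count P x / primes_pi x) \<longlongrightarrow> d) at_top"

definition nu_tuple :: "nat set \<Rightarrow> nat \<Rightarrow> nat list" where
  "nu_tuple S n = map (\<lambda>q. multiplicity q n) (sorted_list_of_set S)"

definition S_squarefree :: "nat set \<Rightarrow> nat \<Rightarrow> bool" where
  "S_squarefree S n \<longleftrightarrow> (\<forall>q. prime q \<and> q \<notin> S \<longrightarrow> \<not> q ^ 2 dvd n)"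

definition mu_S :: "nat set \<Rightarrow> nat \<Rightarrow> int" where
  "mu_S S n =
     (if S_squarefree S n then (-1) ^ card {q. prime q \<and> q dvd n \<and> q \<notin> S} else 0)"

definition conjecture1 :: bool where
  "conjecture1 \<longleftrightarrow>
     (\<forall>S. finite S \<and> (\<forall>q\<in>S. prime q) \<longrightarrow>
       (\<forall>es. length es = card S \<longrightarrow>
         (\<lambda>x::real. real_of_int
            (\<Sum>p | prime p \<and> real p \<le> x \<and> nu_tuple S (p - 1) = es. mu_S S (p - 1)))
         \<in> o[at_top](primes_pi)))"

end

theory Submission
  imports
    Defs
    "HOL-Number_Theory.Number_Theory"
    "HOL-Complex_Analysis.Complex_Analysis"
    "HOL-Probability.Probability"
    "HOL-Real_Asymp.Real_Asymp"
begin

text \<open>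
  With \<open>S\<close> the set of primes dividing \<open>k\<close>, multiplicativity gives \<open>c\<^sub>n(k) = \<mu>\<^sub>S(n) h(\<nu>\<^sub>S(n))\<close> with an explicit
  function \<open>h\<close> that is nonzero on finitely many tuples only. Hence \<open>|c\<^sub>p\<^sub>-\<^sub>1(k)| = v\<close> says that \<open>p - 1\<close> is
  \<open>S\<close>-squarefree with its valuations at \<open>S\<close> in a finite list, and Conjecture 1 says that both signs are equally
  frequent. The primes with a given tuple are counted by inclusion-exclusion over the moduli \<open>m d\<^sup>2\<close>, with \<open>d\<close> up to
  a power of \<open>log x\<close>; the resulting Euler product differs from Artin's constant in the factors at \<open>S\<close> only.

  This needs the Siegel-Walfisz theorem for the residue class 1. Siegel's bound for \<open>L(1, \<chi>)\<close> is proved by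
  Estermann's method and the lower bounds for \<open>L\<close> on \<open>Re s > 1\<close> by the inequality \<open>3 + 4 cos \<theta> + cos 2\<theta> \<ge> 0\<close>, whence
  every derivative of \<open>L'/L\<close> is bounded up to the line \<open>Re s = 1\<close> by a power of \<open>|t|\<close> and a small power of the modulus.
  No zero-free region or contour shift is used: the \<open>j\<close>-th derivative is the Dirichlet series with
  coefficients \<open>\<Lambda>(n) \<chi>(n) log\<^sup>j n\<close>, and smoothing by a Fejer kernel turns a bound for it into a saving of
  nearly \<open>log\<^sup>j x\<close> in the sum of \<open>\<Lambda>(n) \<chi>(n)\<close>.
\<close>

section \<open>Dirichlet characters\<close>

text \<open>Only an arbitrary fixed power of \<open>log x\<close> has to be saved, and this shapes
  the proof. The moduli stay below a power of \<open>log x\<close>, so each estimate may lose a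
  small power of q. That is the loss in Siegel's bound, and the exponent is chosen after the number
  j of differentiations, so losing it once per derivative is harmless. The obstacle is a real zero
  close to 1. For a complex character the 3-4-1 inequality involves its square, whose L-function has
  no pole. For a real one it involves zeta, so a neighbourhood of s = 1 must be covered by the value
  L(1) itself, with a radius that shrinks with that value. Characters are taken modulo q as they
  stand, primitive or not. Two real characters that come from the same primitive one are compared
  through their Euler factors at the primes dividing the moduli. The sieve needs convergence of the
  sum of reciprocal totients over moduli of size d^2. Hence totient D must exceed a power of D with
  exponent above 1/2; the exponent 3/4 is extracted from the prime counts themselves.\<close>

definition dchar :: "nat \<Rightarrow> (nat \<Rightarrow> complex) \<Rightarrow> bool" where
  "dchar q \<xi> \<longleftrightarrow> (\<forall>m n. \<xi> (m * n) = \<xi> m * \<xi> n) \<and> (\<forall>m n. [m = n] (mod q) \<longrightarrow> \<xi> m = \<xi> n)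
     \<and> (\<forall>n. \<xi> n \<noteq> 0 \<longleftrightarrow> coprime n q)"

text \<open>A character on a subgroup \<open>H\<close> of the units modulo \<open>q\<close>; these are extended one generator at a time.\<close>

definition pchar :: "nat \<Rightarrow> nat set \<Rightarrow> (nat \<Rightarrow> complex) \<Rightarrow> bool" where
  "pchar q H \<psi> \<longleftrightarrow> (\<forall>h\<in>H. coprime h q) \<and> 1 \<in> H \<and> (\<forall>m\<in>H. \<forall>n\<in>H. m * n \<in> H \<and> \<psi> (m * n) = \<psi> m * \<psi> n)
     \<and> (\<forall>m\<in>H. \<forall>n. [m = n] (mod q) \<longrightarrow> n \<in> H \<and> \<psi> n = \<psi> m) \<and> (\<forall>m\<in>H. \<psi> m \<noteq> 0)"

lemma pchar_coprime: assumes "pchar q H \<psi>" "h \<in> H" shows "coprime h q"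
  using bspec[OF conjunct1[OF assms(1)[unfolded pchar_def]] assms(2)] .

lemma pchar_one_mem: assumes "pchar q H \<psi>" shows "1 \<in> H"
  using conjunct1[OF conjunct2[OF assms[unfolded pchar_def]]] .

lemma pchar_closed_mult: assumes "pchar q H \<psi>" "m \<in> H" "n \<in> H" shows "m * n \<in> H \<and> \<psi> (m * n) = \<psi> m * \<psi> n"
  using bspec[OF bspec[OF conjunct1[OF conjunct2[OF conjunct2[OF assms(1)[unfolded pchar_def]]]] assms(2)] assms(3)] .

lemmas pchar_closed = pchar_closed_mult[THEN conjunct1]
lemmas pchar_mult = pchar_closed_mult[THEN conjunct2]

lemma pchar_cong_both: assumes "pchar q H \<psi>" "m \<in> H" "[m = n] (mod q)" shows "n \<in> H \<and> \<psi> n = \<psi> m"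
  using mp[OF spec[OF bspec[OF conjunct1[OF conjunct2[OF conjunct2[OF conjunct2[OF assms(1)[unfolded pchar_def]]]]] assms(2)]] assms(3)] .

lemmas pchar_cong_mem = pchar_cong_both[THEN conjunct1]
lemmas pchar_cong = pchar_cong_both[THEN conjunct2]

lemma pchar_nz: assumes "pchar q H \<psi>" "m \<in> H" shows "\<psi> m \<noteq> 0"
  using bspec[OF conjunct2[OF conjunct2[OF conjunct2[OF conjunct2[OF assms(1)[unfolded pchar_def]]]]] assms(2)] .

lemma pchar_one: assumes "pchar q H \<psi>" shows "\<psi> 1 = 1"
proof -
  have "\<psi> 1 = \<psi> 1 * \<psi> 1" using pchar_mult[OF assms pchar_one_mem[OF assms] pchar_one_mem[OF assms]] by simp
  then show ?thesis using pchar_nz[OF assms pchar_one_mem[OF assms]] by simp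
qed

lemma pchar_power: "pchar q H \<psi> \<Longrightarrow> h \<in> H \<Longrightarrow> h ^ i \<in> H \<and> \<psi> (h ^ i) = \<psi> h ^ i"
proof (induction i)
  case 0
  then show ?case using pchar_one[OF 0(1)] pchar_one_mem[OF 0(1)] by simp
next
  case (Suc i)
  then show ?case using pchar_closed[OF Suc.prems(1,2), of "h ^ i"] pchar_mult[OF Suc.prems(1,2), of "h ^ i"] by simp
qed

text \<open>By Euler's theorem \<open>h ^ (totient q - 1)\<close> is an inverse of h modulo q, and
  it lies in H. Thus a multiplicatively closed set of naturals behaves like a subgroup of residue
  classes.\<close>

lemma pchar_cancel:
  assumes "pchar q H \<psi>" "h \<in> H" "coprime g q" "h * g \<in> H"
  shows "g \<in> H"
proof -
  let ?u = "h ^ (totient q - 1)"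
  have "coprime h q" using pchar_coprime assms by blast
  show ?thesis
  proof (cases "totient q = 0")
    \<comment> \<open>Here q = 0: congruence is equality, and 1 is the only number coprime to
      0.\<close>
    case True
    then have "q = 0" by simp
    then have "h = 1" "g = 1" using assms \<open>coprime h q\<close> by auto
    then show ?thesis using assms by simp
  next
    case False
    have "?u * (h * g) \<in> H"
      using pchar_power[OF assms(1,2)] assms pchar_closed by blast
    moreover have "?u * (h * g) = h ^ totient q * g"
      using False by (metis mult.assoc mult.commute power_minus_mult neq0_conv)
    moreover have "[h ^ totient q * g = 1 * g] (mod q)"
      using euler_theorem[OF \<open>coprime h q\<close>] cong_mult cong_refl by blast
    ultimately show ?thesis using pchar_cong_mem[OF assms(1)] by (metis mult_1)
  qed
qed

text \<open>m is the order of g in the quotient of the units by H, and z is any m-th root of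
  \<open>\<psi> (g ^ m)\<close>. Elements of the larger group have the form h g^i and receive the
  value \<open>\<psi> h * z ^ i\<close>. This does not depend on the representation, because g^k
  lies in H only for multiples k of m, where both prescriptions agree.\<close>

lemma pchar_extend:
  assumes q: "q > 0" and H: "pchar q H \<psi>" and g: "coprime g q"
    and m: "m > 0" "g ^ m \<in> H" "\<And>i. 0 < i \<Longrightarrow> i < m \<Longrightarrow> g ^ i \<notin> H" and z: "z ^ m = \<psi> (g ^ m)"
  shows "\<exists>H' \<psi>'. pchar q H' \<psi>' \<and> H \<subseteq> H' \<and> g \<in> H' \<and> \<psi>' g = z \<and> (\<forall>h\<in>H. \<psi>' h = \<psi> h)"
proof -
  have gi: "coprime (g ^ i) q" for i using g by simp
  have dvd: "m dvd k \<and> \<psi> (g ^ k) = z ^ k" if "g ^ k \<in> H" for k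
  proof -
    have *: "(g ^ m) ^ (k div m) \<in> H \<and> \<psi> ((g ^ m) ^ (k div m)) = \<psi> (g ^ m) ^ (k div m)"
      using pchar_power[OF H m(2)] by blast
    have "g ^ k = (g ^ m) ^ (k div m) * g ^ (k mod m)"
      by (simp flip: power_mult power_add)
    with that * have "g ^ (k mod m) \<in> H" using pchar_cancel[OF H _ gi] by metis
    with m have "k mod m = 0" using mod_less_divisor by blast
    then have "m dvd k" by auto
    moreover have "\<psi> (g ^ k) = z ^ k"
    proof -
      have "\<psi> (g ^ k) = (z ^ m) ^ (k div m)" using * \<open>g ^ k = _\<close> \<open>k mod m = 0\<close> z by simp
      also have "\<dots> = z ^ k" using \<open>m dvd k\<close> by (metis dvd_mult_div_cancel power_mult)
      finally show ?thesis .
    qed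
    ultimately show ?thesis by simp
  qed
  have aux: "\<psi> h * z ^ i = \<psi> h' * z ^ j" if hh: "h \<in> H" "h' \<in> H" "[h * g ^ i = h' * g ^ j] (mod q)" "i \<le> j" for h h' i j
  proof -
    have "[h * g ^ i = (h' * g ^ (j - i)) * g ^ i] (mod q)"
      using hh by (metis mult.assoc power_add le_add_diff_inverse2)
    then have c: "[h = h' * g ^ (j - i)] (mod q)"
      using gi cong_mult_rcancel_nat by blast
    then have "h' * g ^ (j - i) \<in> H" and p: "\<psi> (h' * g ^ (j - i)) = \<psi> h"
      using pchar_cong_mem[OF H hh(1)] pchar_cong[OF H hh(1)] by blast+
    then have gH: "g ^ (j - i) \<in> H" using pchar_cancel[OF H hh(2) gi] by blast
    have "\<psi> h = \<psi> h' * z ^ (j - i)" using p dvd[OF gH] pchar_mult[OF H hh(2) gH] by simp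
    then show ?thesis using hh(4) by (metis mult.assoc power_add le_add_diff_inverse2)
  qed
  have wd: "\<psi> h * z ^ i = \<psi> h' * z ^ j" if "h \<in> H" "h' \<in> H" "[h * g ^ i = h' * g ^ j] (mod q)" for h h' i j
    using aux[of h h' i j] aux[of h' h j i] that by (metis cong_sym nle_le)
  define R where "R n h i \<longleftrightarrow> h \<in> H \<and> [n = h * g ^ i] (mod q)" for n h i
  define H' where "H' = {n. \<exists>h i. R n h i}"
  define \<psi>' where "\<psi>' n = (THE w. \<exists>h i. R n h i \<and> w = \<psi> h * z ^ i)" for n
  have val: "\<psi>' n = \<psi> h * z ^ i" if "R n h i" for n h i
    unfolding \<psi>'_def
  proof (rule the_equality)
    show "\<exists>ha ia. R n ha ia \<and> \<psi> h * z ^ i = \<psi> ha * z ^ ia" using that by blast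
  next
    fix w assume "\<exists>h i. R n h i \<and> w = \<psi> h * z ^ i"
    then obtain h' j where "R n h' j" "w = \<psi> h' * z ^ j" by blast
    then show "w = \<psi> h * z ^ i" using that wd[of h' h j i] unfolding R_def by (metis cong_sym cong_trans)
  qed
  have Rmult: "R (n * n') (h * h') (i + i')" if "R n h i" "R n' h' i'" for n n' h h' i i'
  proof -
    have "[n * n' = (h * g ^ i) * (h' * g ^ i')] (mod q)" using that cong_mult unfolding R_def by blast
    moreover have "h * h' \<in> H" using that pchar_closed[OF H] unfolding R_def by blast
    ultimately show ?thesis unfolding R_def by (simp add: power_add mult_ac)
  qed
  have RH: "R h h 0" if "h \<in> H" for h using that by (simp add: R_def)
  have one: "1 \<in> H" by (rule pchar_one_mem[OF H])
  have Rg: "R g 1 1" using one by (simp add: R_def)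
  have zn: "z \<noteq> 0" using z m pchar_nz[OF H m(2)] by (auto simp: power_0_left)
  have "pchar q H' \<psi>'"
    unfolding pchar_def
  proof (intro conjI ballI allI impI)
    fix h assume "h \<in> H'"
    then obtain a i where R: "R h a i" by (auto simp: H'_def)
    then have "coprime (a * g ^ i) q" using pchar_coprime[OF H] gi by (simp add: R_def)
    then show "coprime h q" using R unfolding R_def using cong_imp_coprime cong_sym by blast
    show "\<psi>' h \<noteq> 0" using val[OF R] zn pchar_nz[OF H] R by (simp add: R_def)
    fix n assume c: "[h = n] (mod q)"
    have R': "R n a i" using R c unfolding R_def by (meson cong_sym cong_trans)
    show "n \<in> H'" using R' by (auto simp: H'_def)
    show "\<psi>' n = \<psi>' h" using val[OF R] val[OF R'] by simp
  next
    show "1 \<in> H'" using RH[OF one] by (auto simp: H'_def)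
  next
    fix n n' assume "n \<in> H'" "n' \<in> H'"
    then obtain a i b j where R: "R n a i" "R n' b j" by (auto simp: H'_def)
    show "n * n' \<in> H'" using Rmult[OF R] by (auto simp: H'_def)
    have "\<psi> (a * b) = \<psi> a * \<psi> b" using R pchar_mult[OF H] by (simp add: R_def)
    then show "\<psi>' (n * n') = \<psi>' n * \<psi>' n'" using val[OF R(1)] val[OF R(2)] val[OF Rmult[OF R]]
      by (simp add: power_add mult_ac)
  qed
  moreover have "H \<subseteq> H'" "g \<in> H'" "\<psi>' g = z" "\<forall>h\<in>H. \<psi>' h = \<psi> h"
    using RH Rg val[OF Rg] val[OF RH] pchar_one[OF H] by (auto simp: H'_def)
  ultimately show ?thesis by blast
qed

lemma exists_least_power:
  assumes "q > 0" "pchar q H \<psi>" "coprime g q"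
  obtains m where "m > 0" "g ^ m \<in> H" "\<And>i. 0 < i \<Longrightarrow> i < m \<Longrightarrow> g ^ i \<notin> H"
proof -
  have "[1 = g ^ totient q] (mod q)" using euler_theorem[OF assms(3)] by (simp add: cong_sym_eq)
  then have "g ^ totient q \<in> H" using pchar_cong_mem[OF assms(2) pchar_one_mem[OF assms(2)]] by blast
  then have ex: "\<exists>m. m > 0 \<and> g ^ m \<in> H" using assms(1) by (intro exI[of _ "totient q"]) simp
  show ?thesis
    using LeastI_ex[OF ex] not_less_Least[of _ "\<lambda>m. m > 0 \<and> g ^ m \<in> H"] that by blast
qed

lemma complex_root_exists:
  fixes w :: complex assumes "m > 0" obtains z where "z ^ m = w"
proof (cases "w = 0")
  case True then show ?thesis using that[of 0] assms by simp
next
  case False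
  have "exp (ln w / of_nat m) ^ m = w" using assms False by (simp flip: exp_of_nat_mult)
  then show ?thesis using that by blast
qed

text \<open>Each step adjoins one generator and lowers the number of residues outside H. Once H
  contains all units, extension by zero is a Dirichlet character.\<close>

lemma pchar_extend_full:
  assumes "q > 0" "pchar q H \<psi>"
  shows "\<exists>\<xi>. dchar q \<xi> \<and> (\<forall>h\<in>H. \<xi> h = \<psi> h)"
  using assms(2)
proof (induction "card ({n. n < q \<and> coprime n q} - H)" arbitrary: H \<psi> rule: less_induct)
  case less
  show ?case
  proof (cases "\<exists>g. coprime g q \<and> g \<notin> H")
    case False
    define \<xi> where "\<xi> n = (if coprime n q then \<psi> n else 0)" for n
    have "dchar q \<xi>"
      unfolding dchar_def
    proof (intro conjI allI impI)
      fix m n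
      show "\<xi> (m * n) = \<xi> m * \<xi> n" using pchar_mult[OF less.prems] False by (simp add: \<xi>_def)
      assume c: "[m = n] (mod q)"
      then have "coprime m q \<longleftrightarrow> coprime n q" by (meson cong_imp_coprime cong_sym)
      then show "\<xi> m = \<xi> n" using pchar_cong[OF less.prems _ c] False by (simp add: \<xi>_def)
    next
      fix n show "(\<xi> n \<noteq> 0) = coprime n q" using pchar_nz[OF less.prems] False by (auto simp: \<xi>_def)
    qed
    moreover have "\<forall>h\<in>H. \<xi> h = \<psi> h" using pchar_coprime[OF less.prems] by (simp add: \<xi>_def)
    ultimately show ?thesis by blast
  next
    case True
    then obtain g where g: "coprime g q" "g \<notin> H" by blast
    obtain m where m: "m > 0" "g ^ m \<in> H" "\<And>i. 0 < i \<Longrightarrow> i < m \<Longrightarrow> g ^ i \<notin> H"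
      using exists_least_power[OF assms(1) less.prems g(1)] by blast
    obtain z where z: "z ^ m = \<psi> (g ^ m)"
      using m complex_root_exists by metis
    obtain H' \<psi>' where H': "pchar q H' \<psi>'" "H \<subseteq> H'" "g \<in> H'" "\<forall>h\<in>H. \<psi>' h = \<psi> h"
      using pchar_extend[OF assms(1) less.prems g(1) m z] by blast
    have c: "[g = g mod q] (mod q)" by simp
    have "g mod q \<in> {n. n < q \<and> coprime n q} - H" "g mod q \<in> H'"
      using g assms(1) pchar_cong_mem[OF less.prems, of "g mod q" g] pchar_cong_mem[OF H'(1,3) c]
        cong_imp_coprime[OF c] by (auto simp: cong_sym_eq)
    then have "card ({n. n < q \<and> coprime n q} - H') < card ({n. n < q \<and> coprime n q} - H)"
      using H'(2) by (intro psubset_card_mono) auto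
    from less.hyps[OF this H'(1)] show ?thesis using H' by (metis subsetD)
  qed
qed

lemma dchar_mult: "dchar q \<xi> \<Longrightarrow> \<xi> (m * n) = \<xi> m * \<xi> n"
  unfolding dchar_def by blast

lemma dchar_cong: "dchar q \<xi> \<Longrightarrow> [m = n] (mod q) \<Longrightarrow> \<xi> m = \<xi> n"
  unfolding dchar_def by blast

lemma dchar_nz: "dchar q \<xi> \<Longrightarrow> \<xi> n \<noteq> 0 \<longleftrightarrow> coprime n q"
  unfolding dchar_def by blast

lemma dcharI:
  assumes "\<And>m n. \<xi> (m * n) = \<xi> m * \<xi> n" "\<And>m n. [m = n] (mod q) \<Longrightarrow> \<xi> m = \<xi> n" "\<And>n. \<xi> n \<noteq> 0 \<longleftrightarrow> coprime n q"
  shows "dchar q \<xi>"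
  unfolding dchar_def using assms by blast

lemma dchar_1: "dchar q \<xi> \<Longrightarrow> \<xi> (Suc 0) = 1"
  using dchar_mult[of q \<xi> 1 1] dchar_nz[of q \<xi> 1] by simp

lemma dchar_power: "dchar q \<xi> \<Longrightarrow> \<xi> (m ^ n) = \<xi> m ^ n"
  by (induction n) (auto simp: dchar_mult dchar_1)

lemma dchar_root: "dchar q \<xi> \<Longrightarrow> coprime n q \<Longrightarrow> \<xi> n ^ totient q = 1"
  using dchar_cong[of q \<xi> "n ^ totient q" 1] euler_theorem[of n q] by (simp add: dchar_power dchar_1)

lemma dchar_norm: 
  assumes "q > 0" "dchar q \<xi>" shows "norm (\<xi> n) = (if coprime n q then 1 else 0)"
proof (cases "coprime n q")
  case True
  have "norm (\<xi> n) ^ totient q = 1" using dchar_root[OF assms(2) True] by (metis norm_one norm_power)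
  then show ?thesis using True assms(1) power_eq_1_iff[of "norm (\<xi> n)" "totient q"] by simp
qed (use dchar_nz[OF assms(2)] in auto)

text \<open>A character is determined by its values at 0, ..., q - 1, each of which is 0 or a root
  of unity of order dividing totient q.\<close>

lemma finite_dchars: assumes "q > 0" shows "finite {\<xi>. dchar q \<xi>}"
proof -
  let ?R = "insert 0 {z::complex. z ^ totient q = 1}"
  have "finite ?R" using assms finite_roots_unity[of "totient q"] by (simp add: Suc_le_eq)
  then have fin: "finite (PiE {..<q} (\<lambda>_. ?R))" by (intro finite_PiE) auto
  have "inj_on (\<lambda>\<xi>. restrict \<xi> {..<q}) {\<xi>. dchar q \<xi>}"
  proof (rule inj_onI)
    fix \<xi> \<psi> :: "nat \<Rightarrow> complex" assume d: "\<xi> \<in> {\<xi>. dchar q \<xi>}" "\<psi> \<in> {\<xi>. dchar q \<xi>}"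
      and e: "restrict \<xi> {..<q} = restrict \<psi> {..<q}"
    show "\<xi> = \<psi>"
    proof
      fix n
      have "\<xi> n = \<xi> (n mod q)" "\<psi> n = \<psi> (n mod q)" using d by (auto intro!: dchar_cong)
      moreover have "\<xi> (n mod q) = \<psi> (n mod q)" using fun_cong[OF e, of "n mod q"] assms by simp
      ultimately show "\<xi> n = \<psi> n" by simp
    qed
  qed
  moreover have "(\<lambda>\<xi>. restrict \<xi> {..<q}) ` {\<xi>. dchar q \<xi>} \<subseteq> PiE {..<q} (\<lambda>_. ?R)"
  proof (intro image_subsetI restrict_PiE_iff[THEN iffD2] ballI)
    fix \<xi> n assume "\<xi> \<in> {\<xi>. dchar q \<xi>}"
    then have "dchar q \<xi>" by simp
    then show "\<xi> n \<in> ?R" using dchar_root[of q \<xi> n] dchar_nz[of q \<xi> n] by (cases "coprime n q") auto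
  qed
  ultimately show ?thesis using fin by (meson finite_imageD finite_subset)
qed

lemma dchar_mult_dchar:
  assumes "dchar q \<xi>" "dchar q \<psi>" shows "dchar q (\<lambda>n. \<xi> n * \<psi> n)"
proof (rule dcharI)
  fix m n
  show "\<xi> (m * n) * \<psi> (m * n) = \<xi> m * \<psi> m * (\<xi> n * \<psi> n)"
    using dchar_mult[OF assms(1)] dchar_mult[OF assms(2)] by simp
  show "\<xi> m * \<psi> m = \<xi> n * \<psi> n" if "[m = n] (mod q)"
    using dchar_cong[OF assms(1) that] dchar_cong[OF assms(2) that] by simp
  show "(\<xi> n * \<psi> n \<noteq> 0) = coprime n q"
    using dchar_nz[OF assms(1), of n] dchar_nz[OF assms(2), of n] by auto
qed

lemma dchar_cnj: assumes "dchar q \<xi>" shows "dchar q (\<lambda>n. cnj (\<xi> n))"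
proof (rule dcharI)
  fix m n
  show "cnj (\<xi> (m * n)) = cnj (\<xi> m) * cnj (\<xi> n)" using dchar_mult[OF assms] by simp
  show "cnj (\<xi> m) = cnj (\<xi> n)" if "[m = n] (mod q)" using dchar_cong[OF assms that] by simp
  show "(cnj (\<xi> n) \<noteq> 0) = coprime n q" using dchar_nz[OF assms, of n] by auto
qed

text \<open>Start from the trivial character on the class of 1. If a has order m >= 2 modulo q, a
  primitive m-th root of unity may be prescribed at a, and this is not 1.\<close>

lemma exists_dchar_separating:
  assumes q: "q > 0" and a: "coprime a q" "\<not> [a = 1] (mod q)"
  shows "\<exists>\<xi>. dchar q \<xi> \<and> \<xi> a \<noteq> 1"
proof -
  define H where "H = {n. [n = 1] (mod q)}"
  have H: "pchar q H (\<lambda>_. 1)"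
    unfolding pchar_def H_def
  proof (intro conjI ballI allI impI; (elim CollectE)?)
    fix h assume "[h = 1] (mod q)" then show "coprime h q" using cong_imp_coprime[of 1 h q] by (simp add: cong_sym_eq)
  next
    fix m n assume "[m = 1] (mod q)" "[n = 1] (mod q)"
    then show "m * n \<in> {n. [n = 1] (mod q)}" using cong_mult[of m 1 q n 1] by simp
  next
    fix m n assume "[m = 1] (mod q)" "[m = n] (mod q)"
    then show "n \<in> {n. [n = 1] (mod q)}" by (metis cong_sym cong_trans mem_Collect_eq)
  qed auto
  obtain m where m: "m > 0" "a ^ m \<in> H" "\<And>i. 0 < i \<Longrightarrow> i < m \<Longrightarrow> a ^ i \<notin> H"
    using exists_least_power[OF q H a(1)] by blast
  have "m \<noteq> 1" using m(2) a(2) by (auto simp: H_def)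
  then have "m \<ge> 2" using m(1) by simp
  define z where "z = cis (2 * pi / m)"
  have "z ^ m = 1" using m(1) by (simp add: z_def Complex.DeMoivre)
  have "z \<noteq> 1"
  proof
    assume "z = 1"
    then have "cos (2 * pi / m) = 1" unfolding z_def by (metis cis.sel(1) one_complex.sel(1))
    moreover have "0 < 2 * pi / m" "2 * pi / m \<le> pi" using \<open>m \<ge> 2\<close> m(1) by (auto simp: field_simps)
    then have "cos (2 * pi / m) < cos 0" by (intro cos_monotone_0_pi) auto
    ultimately show False by simp
  qed
  obtain H' \<psi>' where "pchar q H' \<psi>'" "a \<in> H'" "\<psi>' a = z"
    using pchar_extend[OF q H a(1) m] \<open>z ^ m = 1\<close> by blast
  then show ?thesis using pchar_extend_full[OF q] \<open>z \<noteq> 1\<close> by metis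
qed

section \<open>Sums over periods and orthogonality\<close>

definition nonprincipal :: "nat \<Rightarrow> (nat \<Rightarrow> complex) \<Rightarrow> bool" where
  "nonprincipal q \<xi> \<longleftrightarrow> (\<exists>n. coprime n q \<and> \<xi> n \<noteq> 1)"

text \<open>The map n -> a n + b permutes the residues. Scaling by a shows that the sum of a
  nonprincipal character over a period vanishes; the shift by b lets the period start
  anywhere.\<close>

lemma sum_period:
  fixes f :: "nat \<Rightarrow> 'a::comm_monoid_add"
  assumes "q > 0" "\<And>m n. [m = n] (mod q) \<Longrightarrow> f m = f n" and that: "coprime a q"
  shows "(\<Sum>n<q. f (a * n + b)) = (\<Sum>n<q. f n)"
proof -
  have inj: "inj_on (\<lambda>n. (a * n + b) mod q) {..<q}"
  proof (rule inj_onI)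
    fix x y assume xy: "x \<in> {..<q}" "y \<in> {..<q}" "(a * x + b) mod q = (a * y + b) mod q"
    then have "[a * x + b = a * y + b] (mod q)" by (simp add: Cong.cong_def)
    then have "[x = y] (mod q)" using that by (simp add: cong_add_rcancel_nat cong_mult_lcancel_nat)
    then show "x = y" using xy by (simp add: Cong.cong_def)
  qed
  then have "(\<lambda>n. (a * n + b) mod q) ` {..<q} = {..<q}"
    using assms(1) by (intro endo_inj_surj) auto
  then have "(\<Sum>n<q. f n) = (\<Sum>n<q. f ((a * n + b) mod q))"
    using sum.reindex[OF inj, of f] by simp
  also have "\<dots> = (\<Sum>n<q. f (a * n + b))"
    by (intro sum.cong refl assms(2)) simp
  finally show ?thesis by simp
qed

lemma nonprincipal_sum_zero:
  assumes "q > 0" "dchar q \<xi>" "nonprincipal q \<xi>"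
  shows "(\<Sum>n<q. \<xi> (n + b)) = 0"
proof -
  obtain a where a: "coprime a q" "\<xi> a \<noteq> 1" using assms(3) by (auto simp: nonprincipal_def)
  have *: "(\<Sum>n<q. \<xi> (a * n + b)) = (\<Sum>n<q. \<xi> n)" if "coprime a q" for a b
    using sum_period[OF assms(1) _ that, of \<xi>] dchar_cong[OF assms(2)] by blast
  have "\<xi> a * (\<Sum>n<q. \<xi> n) = (\<Sum>n<q. \<xi> n)"
    using *[OF a(1), of 0] by (simp add: sum_distrib_left dchar_mult[OF assms(2)])
  then have "(\<Sum>n<q. \<xi> n) = 0" using a(2) by simp
  then show ?thesis using *[of 1 b] by simp
qed

text \<open>Complete periods cancel, and fewer than q terms of norm at most 1 remain.\<close>

lemma nonprincipal_partial_sums: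
  assumes "q > 0" "dchar q \<xi>" "nonprincipal q \<xi>"
  shows "norm (\<Sum>n=1..N. \<xi> n) \<le> real q"
proof -
  have *: "norm (\<Sum>n<N. \<xi> (n + b)) \<le> real q" for b
  proof (induction N arbitrary: b rule: less_induct)
    case (less N)
    show ?case
    proof (cases "N < q")
      case True
      have "norm (\<Sum>n<N. \<xi> (n + b)) \<le> (\<Sum>n<N. 1)"
        by (rule sum_norm_le) (auto simp: dchar_norm[OF assms(1,2)])
      also have "\<dots> \<le> real q" using True by simp
      finally show ?thesis .
    next
      case False
      then have "{..<N} = {..<q} \<union> {q..<N}" by auto
      then have "(\<Sum>n<N. \<xi> (n + b)) = (\<Sum>n<q. \<xi> (n + b)) + (\<Sum>n=q..<N. \<xi> (n + b))"
        by (simp add: sum.union_disjoint ivl_disj_int)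
      also have "(\<Sum>n=q..<N. \<xi> (n + b)) = (\<Sum>n<N - q. \<xi> (n + (q + b)))"
        using sum.shift_bounds_nat_ivl[of "\<lambda>n. \<xi> (n + b)" 0 q "N - q"] False
        by (simp add: atLeast0LessThan add.assoc)
      finally show ?thesis
        using less.IH[of "N - q" "q + b"] assms False by (simp add: nonprincipal_sum_zero)
    qed
  qed
  have "(\<Sum>n=1..N. \<xi> n) = (\<Sum>n<N. \<xi> (n + 1))"
    by (rule sum.reindex_bij_witness[of _ "\<lambda>n. n + 1" "\<lambda>n. n - 1"]) auto
  then show ?thesis using *[of 1] by simp
qed

text \<open>The number of characters comes out of a double count, the sum of
  \<open>\<xi> (m + 1)\<close> over one period and over all characters. Summed over m first, only
  the principal character survives and gives totient q. Summed over the characters first, only m = 0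
  survives and gives their number.\<close>

lemma dchar_orthogonality:
  assumes q: "q > 0"
  shows "(\<Sum>\<xi> | dchar q \<xi>. \<xi> n) = (if [n = 1] (mod q) then of_nat (totient q) else 0)"
proof -
  let ?X = "{\<xi>. dchar q \<xi>}"
  have fin: "finite ?X" by (rule finite_dchars[OF q])
  have zero: "(\<Sum>\<xi>\<in>?X. \<xi> n) = 0" if "\<not> [n = 1] (mod q)" for n
  proof (cases "coprime n q")
    case False
    then show ?thesis using dchar_nz by (intro sum.neutral) auto
  next
    case True
    obtain \<psi> where \<psi>: "dchar q \<psi>" "\<psi> n \<noteq> 1" using exists_dchar_separating[OF q True \<open>\<not> [n = 1] (mod q)\<close>] by blast
    \<comment> \<open>The conjugate of \<psi> inverts \<psi> on units, so multiplication by \<psi>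
      permutes the characters. The sum therefore reproduces itself with the factor
      \<open>\<psi> n\<close>, which differs from 1.\<close>
    have inv: "\<psi> m * (cnj (\<psi> m) * \<xi> m) = \<xi> m" "cnj (\<psi> m) * (\<psi> m * \<xi> m) = \<xi> m" if "dchar q \<xi>" for \<xi> m
    proof -
      have "coprime m q \<Longrightarrow> \<psi> m * cnj (\<psi> m) = 1"
        using dchar_norm[OF q \<psi>(1), of m] by (simp add: complex_norm_square[symmetric])
      moreover have "\<not> coprime m q \<Longrightarrow> \<xi> m = 0" using dchar_nz[OF that] by blast
      ultimately show "\<psi> m * (cnj (\<psi> m) * \<xi> m) = \<xi> m" "cnj (\<psi> m) * (\<psi> m * \<xi> m) = \<xi> m"
        by (cases "coprime m q"; simp add: mult.assoc[symmetric] mult.commute[of "cnj (\<psi> m)"])+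
    qed
    have "(\<Sum>\<xi>\<in>?X. \<xi> n) = (\<Sum>\<xi>\<in>?X. \<psi> n * \<xi> n)"
      using inv by (intro sum.reindex_bij_witness[of _ "\<lambda>\<xi> m. \<psi> m * \<xi> m" "\<lambda>\<xi> m. cnj (\<psi> m) * \<xi> m"])
         (auto intro!: dchar_mult_dchar dchar_cnj \<psi>)
    also have "\<dots> = \<psi> n * (\<Sum>\<xi>\<in>?X. \<xi> n)" by (rule sum_distrib_left[symmetric])
    finally have "(1 - \<psi> n) * (\<Sum>\<xi>\<in>?X. \<xi> n) = 0" by (simp only: left_diff_distrib mult_1 diff_self)
    then show ?thesis using \<psi>(2) by simp
  qed
  have one: "(\<Sum>\<xi>\<in>?X. \<xi> n) = of_nat (card ?X)" if "[n = 1] (mod q)" for n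
  proof -
    have "(\<Sum>\<xi>\<in>?X. \<xi> n) = (\<Sum>\<xi>\<in>?X. 1)"
      using that dchar_cong dchar_1 by (intro sum.cong) fastforce+
    then show ?thesis by simp
  qed
  define \<xi>0 :: "nat \<Rightarrow> complex" where "\<xi>0 n = (if coprime n q then 1 else 0)" for n
  have \<xi>0: "dchar q \<xi>0" unfolding dchar_def \<xi>0_def
    by (auto dest: cong_imp_coprime cong_sym[THEN cong_imp_coprime])
  have "(\<Sum>m<q. \<Sum>\<xi>\<in>?X. \<xi> (m + 1)) = (\<Sum>\<xi>\<in>?X. \<Sum>m<q. \<xi> (m + 1))" by (rule sum.swap)
  also have "\<dots> = (\<Sum>\<xi>\<in>?X. if \<xi> = \<xi>0 then \<Sum>m<q. \<xi> (m + 1) else 0)"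
  proof (intro sum.cong refl)
    fix \<xi> assume \<xi>: "\<xi> \<in> ?X"
    have "nonprincipal q \<xi>" if "\<xi> \<noteq> \<xi>0"
    proof (rule ccontr)
      assume "\<not> nonprincipal q \<xi>"
      then have "\<xi> m = \<xi>0 m" for m using \<xi> dchar_nz[of q \<xi> m] by (auto simp: nonprincipal_def \<xi>0_def)
      then show False using that by blast
    qed
    then show "(\<Sum>m<q. \<xi> (m + 1)) = (if \<xi> = \<xi>0 then \<Sum>m<q. \<xi> (m + 1) else 0)"
      using \<xi> nonprincipal_sum_zero[OF q, of \<xi> 1] by auto
  qed
  also have "\<dots> = (\<Sum>m<q. \<xi>0 (m + 1))" using fin \<xi>0 by simp
  also have "\<dots> = of_nat (card {m\<in>{..<q}. coprime (m + 1) q})"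
    by (simp add: \<xi>0_def sum.If_cases Int_def)
  also have "card {m\<in>{..<q}. coprime (m + 1) q} = totient q"
    unfolding totient_def
    by (rule bij_betw_same_card[of "\<lambda>m. m + 1"], rule bij_betwI[of _ _ _ "\<lambda>m. m - 1"])
       (auto simp: totatives_def)
  finally have A: "(\<Sum>m<q. \<Sum>\<xi>\<in>?X. \<xi> (m + 1)) = of_nat (totient q)" .
  have "(\<Sum>m<q. \<Sum>\<xi>\<in>?X. \<xi> (m + 1)) = (\<Sum>m<q. if m = 0 then of_nat (card ?X) else 0)"
  proof (intro sum.cong refl)
    fix m assume m: "m \<in> {..<q}"
    have "[m + 1 = 1] (mod q) \<longleftrightarrow> m = 0"
      using m cong_add_rcancel_0_nat[of m 1 q] by (auto simp: Cong.cong_def)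
    then show "(\<Sum>\<xi>\<in>?X. \<xi> (m + 1)) = (if m = 0 then of_nat (card ?X) else 0)"
      using zero[of "m + 1"] one[of "m + 1"] by auto
  qed
  then have "of_nat (card ?X) = (of_nat (totient q) :: complex)" using A q by simp
  then show ?thesis using zero one by auto
qed

section \<open>Dirichlet series\<close>

text \<open>Summation starts at n = 0, where \<open>0 powr _ = 0\<close> removes the term. As a
  plain \<open>suminf\<close> the same constant also denotes the conditionally convergent series to
  the left of Re s = 1.\<close>

definition dser :: "(nat \<Rightarrow> complex) \<Rightarrow> complex \<Rightarrow> complex" where
  "dser a s = (\<Sum>n. a n * of_nat n powr (-s))"

text \<open>Growth below every positive power is preserved by multiplication with log n, hence by
  differentiating the series, and it gives absolute convergence for Re s > 1.\<close>

definition subpoly :: "(nat \<Rightarrow> complex) \<Rightarrow> bool" where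
  "subpoly a \<longleftrightarrow> (\<forall>\<delta>>0. \<exists>C. \<forall>n>0. norm (a n) \<le> C * real n powr \<delta>)"

text \<open>Covers characters, the constant 1, products, and characters with the multiples of some
  primes removed, so that zeta and all L-functions are treated alike.\<close>

definition cmult :: "(nat \<Rightarrow> complex) \<Rightarrow> bool" where
  "cmult \<xi> \<longleftrightarrow> \<xi> 1 = 1 \<and> (\<forall>m n. \<xi> (m * n) = \<xi> m * \<xi> n) \<and> (\<forall>n. norm (\<xi> n) \<le> 1)"

lemma norm_npow: "norm (of_nat n powr (-s) :: complex) = real n powr (- Re s)"
  by (cases "n = 0") (simp_all add: powr_def Ln_of_nat)

lemma subpolyE:
  assumes "subpoly a" "\<delta> > 0"
  obtains C where "C \<ge> 0" "\<And>n. n > 0 \<Longrightarrow> norm (a n) \<le> C * real n powr \<delta>"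
proof -
  obtain C where C: "\<And>n. n > 0 \<Longrightarrow> norm (a n) \<le> C * real n powr \<delta>"
    using assms unfolding subpoly_def by blast
  have "0 \<le> C" using C[of 1] norm_ge_zero[of "a 1"] by (simp del: norm_ge_zero)
  with C that show ?thesis by blast
qed

lemma subpoly_summable:
  assumes "subpoly a" "Re s > 1"
  shows "summable (\<lambda>n. norm (a n * of_nat n powr (-s)))"
proof -
  obtain C where C: "C \<ge> 0" "\<And>n. n > 0 \<Longrightarrow> norm (a n) \<le> C * real n powr ((Re s - 1) / 2)"
    using subpolyE[OF assms(1), of "(Re s - 1) / 2"] assms(2) by auto
  have "summable (\<lambda>n. C * real n powr (- (Re s + 1) / 2))"
    using assms(2) by (intro summable_mult) (simp add: summable_real_powr_iff)
  then show ?thesis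
  proof (rule summable_comparison_test'[where N = 0])
    fix n :: nat
    show "norm (norm (a n * of_nat n powr - s)) \<le> C * real n powr (- (Re s + 1) / 2)"
    proof (cases "n = 0")
      case False
      then have "norm (a n) * real n powr (- Re s) \<le> C * real n powr ((Re s - 1) / 2) * real n powr (- Re s)"
        using C(2)[of n] by (intro mult_right_mono) auto
      also have "\<dots> = C * real n powr (- (Re s + 1) / 2)"
      proof -
        have "(Re s - 1) / 2 + (- Re s) = - (Re s + 1) / 2" by (simp add: field_simps)
        then show ?thesis unfolding mult.assoc powr_add[symmetric] by argo
      qed
      finally show ?thesis by (simp add: norm_mult norm_npow)
    qed simp
  qed
qed

lemma dser_summable: "subpoly a \<Longrightarrow> Re s > 1 \<Longrightarrow> summable (\<lambda>n. a n * of_nat n powr (-s))"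
  by (rule summable_norm_cancel[OF subpoly_summable])

lemma dser_sums: "subpoly a \<Longrightarrow> Re s > 1 \<Longrightarrow> (\<lambda>n. a n * of_nat n powr (-s)) sums dser a s"
  unfolding dser_def by (rule summable_sums[OF dser_summable])

lemma subpoly_bounded: assumes "\<And>n. n > 0 \<Longrightarrow> norm (a n) \<le> C" shows "subpoly a"
  unfolding subpoly_def
proof (intro allI impI exI)
  fix \<delta> :: real and n :: nat assume d: "\<delta> > 0" and n: "n > 0"
  have "norm (a n) \<le> C * 1" using assms n by simp
  also have "\<dots> \<le> C * real n powr \<delta>"
    using assms[of 1] norm_ge_zero[of "a 1"] n d by (intro mult_left_mono ge_one_powr_ge_zero) linarith+
  finally show "norm (a n) \<le> C * real n powr \<delta>" .
qed

lemma subpoly_dominated: assumes "subpoly a" "\<And>n. n > 0 \<Longrightarrow> norm (b n) \<le> norm (a n)" shows "subpoly b"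
  unfolding subpoly_def
proof (intro allI impI)
  fix \<delta> :: real assume "\<delta> > 0"
  then obtain C where "\<And>n. n > 0 \<Longrightarrow> norm (a n) \<le> C * real n powr \<delta>" using subpolyE[OF assms(1)] by metis
  then have "norm (b n) \<le> C * real n powr \<delta>" if "n > 0" for n using assms(2)[OF that] that order_trans by blast
  then show "\<exists>C. \<forall>n>0. norm (b n) \<le> C * real n powr \<delta>" by blast
qed

lemma subpoly_add: assumes "subpoly a" "subpoly b" shows "subpoly (\<lambda>n. a n + b n)"
  unfolding subpoly_def
proof (intro allI impI)
  fix \<delta> :: real assume d: "\<delta> > 0"
  obtain C D where "\<And>n. n > 0 \<Longrightarrow> norm (a n) \<le> C * real n powr \<delta>" "\<And>n. n > 0 \<Longrightarrow> norm (b n) \<le> D * real n powr \<delta>"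
    using subpolyE[OF assms(1) d] subpolyE[OF assms(2) d] by metis
  then have "norm (a n + b n) \<le> (C + D) * real n powr \<delta>" if "n > 0" for n
    using norm_triangle_ineq[of "a n" "b n"] that unfolding distrib_right by (meson add_mono order_trans)
  then show "\<exists>C. \<forall>n>0. norm (a n + b n) \<le> C * real n powr \<delta>" by blast
qed

lemma subpoly_uminus: "subpoly a \<Longrightarrow> subpoly (\<lambda>n. - a n)"
  by (simp add: subpoly_def)

lemma subpoly_ln: assumes "subpoly a" shows "subpoly (\<lambda>n. a n * of_real (ln (real n)))"
  unfolding subpoly_def
proof (intro allI impI)
  fix \<delta> :: real assume d: "\<delta> > 0"
  then obtain C where C: "C \<ge> 0" "\<And>n. n > 0 \<Longrightarrow> norm (a n) \<le> C * real n powr (\<delta> / 2)"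
    using subpolyE[OF assms, of "\<delta> / 2"] by auto
  have "norm (a n * of_real (ln (real n))) \<le> (C * (2 / \<delta>)) * real n powr \<delta>" if n: "n > 0" for n
  proof -
    have "norm (a n * of_real (ln (real n))) = norm (a n) * ln (real n)" using n by (simp add: norm_mult)
    also have "\<dots> \<le> (C * real n powr (\<delta> / 2)) * (real n powr (\<delta> / 2) / (\<delta> / 2))"
      using C n d ln_powr_bound[of "real n" "\<delta> / 2"] by (intro mult_mono) auto
    also have "\<dots> = (C * (2 / \<delta>)) * (real n powr (\<delta> / 2) * real n powr (\<delta> / 2))" by simp
    also have "real n powr (\<delta> / 2) * real n powr (\<delta> / 2) = real n powr \<delta>" by (simp flip: powr_add)
    finally show ?thesis .
  qed
  then show "\<exists>C. \<forall>n>0. norm (a n * of_real (ln (real n))) \<le> C * real n powr \<delta>" by blast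
qed

lemma subpoly_ln_power: "subpoly a \<Longrightarrow> subpoly (\<lambda>n. a n * of_real (ln (real n)) ^ j)"
proof (induction j)
  case (Suc j)
  from subpoly_ln[OF Suc.IH[OF Suc.prems]] show ?case by (simp add: mult_ac)
qed simp

text \<open>Termwise differentiation on the half-plane Re s >= c with c halfway between 1 and Re s;
  there the differentiated series is dominated by its absolutely convergent value at c.\<close>

lemma dser_has_deriv:
  assumes "subpoly a" "Re s > 1"
  shows "(dser a has_field_derivative - dser (\<lambda>n. a n * of_real (ln (real n))) s) (at s)"
proof -
  define c where "c = (1 + Re s) / 2"
  have c: "c > 1" "c < Re s" using assms(2) by (auto simp: c_def)
  define S where "S = {s. Re s \<ge> c}"
  have int: "s \<in> interior S"
  proof (rule interiorI)
    show "open {s. Re s > c}" by (simp add: open_halfspace_Re_gt)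
  qed (use c in \<open>auto simp: S_def\<close>)
  have "((\<lambda>s. \<Sum>n. a n * of_nat n powr (-s)) has_field_derivative
           (\<Sum>n. - (a n * of_real (ln (real n)) * of_nat n powr (-s)))) (at s)"
  proof (rule has_field_derivative_series'(2)[where S = S and ?x0.0 = s])
    show "convex S" unfolding S_def by (simp add: convex_halfspace_Re_ge)
  next
    fix n :: nat and x :: complex
    show "((\<lambda>s. a n * of_nat n powr (-s)) has_field_derivative - (a n * of_real (ln (real n)) * of_nat n powr (-x))) (at x within S)"
    proof (cases "n = 0")
      case False
      then show ?thesis
      proof -
        have "((\<lambda>s. of_nat n powr (-s)) has_field_derivative (Ln (of_nat n) * of_nat n powr (-x)) * (-1)) (at x within S)"
          by (rule DERIV_chain2[OF has_field_derivative_powr_right]) (use False in \<open>auto intro!: derivative_eq_intros\<close>)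
        from DERIV_cmult[OF this, of "a n"] show ?thesis using False by (simp add: Ln_of_nat mult_ac)
      qed
    qed simp
  next
    show "uniformly_convergent_on S (\<lambda>n x. \<Sum>i<n. - (a i * of_real (ln (real i)) * of_nat i powr (-x)))"
    proof (rule Weierstrass_m_test')
      show "summable (\<lambda>n. norm (a n * of_real (ln (real n)) * of_nat n powr (- complex_of_real c)))"
        using c by (intro subpoly_summable subpoly_ln assms) simp
    next
      fix n x assume x: "x \<in> S"
      show "norm (- (a n * of_real (ln (real n)) * of_nat n powr (-x)))
         \<le> norm (a n * of_real (ln (real n)) * of_nat n powr (- complex_of_real c))"
      proof (cases "n = 0")
        case False
        then show ?thesis using x unfolding S_def
          by (auto simp: norm_mult norm_npow intro!: mult_left_mono powr_mono)
      qed simp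
    qed
  next
    show "s \<in> S" using c by (simp add: S_def)
    show "summable (\<lambda>n. a n * of_nat n powr - s)" by (rule dser_summable[OF assms])
  qed (rule int)
  then have "((\<lambda>s. dser a s) has_field_derivative - dser (\<lambda>n. a n * of_real (ln (real n))) s) (at s)"
    unfolding dser_def using suminf_minus[OF dser_summable[OF subpoly_ln[OF assms(1)] assms(2)]] by simp
  then show ?thesis .
qed

lemma open_Re_gt: "open {s. Re s > c}"
  by (simp add: open_halfspace_Re_gt)

lemma dser_holomorphic: assumes "subpoly a" shows "dser a holomorphic_on {s. Re s > 1}"
  unfolding holomorphic_on_open[OF open_Re_gt]
proof
  fix s assume "s \<in> {s. Re s > 1}"
  then show "\<exists>f'. (dser a has_field_derivative f') (at s)" using dser_has_deriv[OF assms, of s] by (intro exI) simp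
qed

lemma dser_higher_deriv:
  assumes "subpoly a" "Re s > 1"
  shows "(deriv ^^ j) (dser a) s = (-1) ^ j * dser (\<lambda>n. a n * of_real (ln (real n)) ^ j) s"
  using assms(2)
proof (induction j arbitrary: s)
  case (Suc j)
  have "eventually (\<lambda>w. w \<in> {s. Re s > 1}) (nhds s)"
    by (rule eventually_nhds_in_open) (use Suc.prems open_Re_gt in auto)
  then have "eventually (\<lambda>w. (deriv ^^ j) (dser a) w = (-1) ^ j * dser (\<lambda>n. a n * of_real (ln (real n)) ^ j) w) (nhds s)"
    by eventually_elim (use Suc.IH in auto)
  then have "deriv ((deriv ^^ j) (dser a)) s = deriv (\<lambda>w. (-1) ^ j * dser (\<lambda>n. a n * of_real (ln (real n)) ^ j) w) s"
    by (rule deriv_cong_ev) simp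
  also have "\<dots> = (-1) ^ j * (- dser (\<lambda>n. a n * of_real (ln (real n)) ^ j * of_real (ln (real n))) s)"
    by (intro DERIV_imp_deriv DERIV_cmult dser_has_deriv subpoly_ln_power assms Suc.prems)
  finally show ?case by (simp add: mult_ac)
qed simp

lemma dser_add: "subpoly a \<Longrightarrow> subpoly b \<Longrightarrow> Re s > 1 \<Longrightarrow> dser (\<lambda>n. a n + b n) s = dser a s + dser b s"
  unfolding dser_def using suminf_add[OF dser_summable dser_summable, of a s b s] unfolding distrib_right by simp

lemma dser_uminus: "subpoly a \<Longrightarrow> Re s > 1 \<Longrightarrow> dser (\<lambda>n. - a n) s = - dser a s"
  unfolding dser_def using suminf_minus[OF dser_summable, of a s] by simp

lemma dser_cong: "(\<And>n. n > 0 \<Longrightarrow> a n = b n) \<Longrightarrow> dser a s = dser b s"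
  unfolding dser_def
proof (intro suminf_cong)
  fix n assume *: "\<And>n. n > 0 \<Longrightarrow> a n = b n"
  show "a n * of_nat n powr - s = b n * of_nat n powr - s" using *[of n] by (cases "n = 0") auto
qed

text \<open>Absolute convergence allows the double sum over (d, m) to be regrouped by n = d
  m.\<close>

lemma dser_mult:
  assumes a: "subpoly a" and b: "subpoly b" and s: "Re s > 1"
  shows "dser a s * dser b s = dser (\<lambda>n. \<Sum>d | d dvd n. a d * b (n div d)) s"
proof -
  let ?u = "\<lambda>n. a n * of_nat n powr (-s)" and ?v = "\<lambda>n. b n * of_nat n powr (-s)"
  define f where "f = (\<lambda>(d, m). ?u d * ?v m)"
  have hu: "(?u has_sum dser a s) UNIV" and hv: "(?v has_sum dser b s) UNIV"
    using norm_summable_imp_has_sum[OF subpoly_summable[OF a s] dser_sums[OF a s]]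
      norm_summable_imp_has_sum[OF subpoly_summable[OF b s] dser_sums[OF b s]] by auto
  have au: "(\<lambda>n. norm (?u n)) summable_on UNIV" and av: "(\<lambda>n. norm (?v n)) summable_on UNIV"
    using subpoly_summable[OF a s] subpoly_summable[OF b s]
    by (intro norm_summable_imp_summable_on; simp)+
  have "(\<lambda>x. norm (f x)) summable_on (UNIV \<times> UNIV)"
    unfolding Infinite_Sum.abs_summable_on_Sigma_iff
  proof (intro conjI ballI)
    fix x
    show "(\<lambda>y. norm (f (x, y))) summable_on UNIV"
      using summable_on_cmult_right[OF av, of "norm (?u x)"] unfolding f_def by (simp only: norm_mult prod.case)
  next
    have "(\<Sum>\<^sub>\<infinity>y. norm (f (x, y))) = norm (?u x) * (\<Sum>\<^sub>\<infinity>y. norm (?v y))" for x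
      unfolding f_def by (simp add: norm_mult mult.assoc infsum_cmult_right')
    then show "(\<lambda>x. norm (\<Sum>\<^sub>\<infinity>y. norm (f (x, y)))) summable_on UNIV"
      using summable_on_cmult_left[OF au, of "\<bar>\<Sum>\<^sub>\<infinity>y. norm (?v y)\<bar>"] by (simp add: abs_mult norm_mult)
  qed
  then have fs: "f summable_on (UNIV \<times> UNIV)" by (rule Infinite_Sum.abs_summable_summable)
  have "(f has_sum (dser a s * dser b s)) (UNIV \<times> UNIV)"
  proof (rule has_sum_SigmaI)
    show "((\<lambda>y. f (x, y)) has_sum (?u x * dser b s)) UNIV" for x
      unfolding f_def using has_sum_cmult_right[OF hv, of "?u x"] by simp
    show "((\<lambda>x. ?u x * dser b s) has_sum dser a s * dser b s) UNIV"
      by (rule has_sum_cmult_left[OF hu])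
  qed (rule fs)
  then have P: "(f has_sum (dser a s * dser b s)) ({0<..} \<times> {0<..})"
    by (rule has_sum_cong_neutral[THEN iffD1, rotated -1]) (auto simp: f_def)
  let ?T = "Sigma {0<..} (\<lambda>n::nat. {d. d dvd n})"
  let ?g = "\<lambda>(n, d). a d * b (n div d) * of_nat n powr (-s)"
  \<comment> \<open>Only positive entries are matched, since 0 has infinitely many divisors; the
    discarded terms vanish.\<close>
  have bij: "bij_betw (\<lambda>(n, d). (d, n div d)) ?T ({0<..} \<times> {0<..})"
  proof (rule bij_betwI[of _ _ _ "\<lambda>(d, m). (d * m, d)"])
    show "(\<lambda>(n, d). (d, n div d)) \<in> ?T \<rightarrow> {0<..} \<times> {0<..}"
    proof
      fix x assume "x \<in> ?T"
      then obtain n d where x: "x = (n, d)" "n > 0" "d dvd n" by auto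
      then have "d > 0" "n div d > 0" using dvd_pos_nat[of n d] dvd_imp_le[of d n] by (auto simp: div_greater_zero_iff)
      then show "(\<lambda>(n, d). (d, n div d)) x \<in> {0<..} \<times> {0<..}" using x by simp
    qed
    show "(\<lambda>(d, m). (d * m, d)) \<in> {0<..} \<times> {0<..} \<rightarrow> ?T" by auto
  qed auto
  have "(?g has_sum (dser a s * dser b s)) ?T"
  proof -
    have A: "((\<lambda>x. f ((\<lambda>(n, d). (d, n div d)) x)) has_sum (dser a s * dser b s)) ?T"
      using has_sum_reindex_bij_betw[OF bij, of f] P by blast
    have B: "f ((\<lambda>(n, d). (d, n div d)) x) = ?g x" if "x \<in> ?T" for x
    proof -
      obtain n d where x: "x = (n, d)" "n > 0" "d dvd n" using \<open>x \<in> ?T\<close> by auto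
      then have "of_nat n = (of_nat d * of_nat (n div d) :: complex)" by (metis dvd_mult_div_cancel of_nat_mult)
      moreover have "(of_nat d * of_nat (n div d) :: complex) powr (-s) = of_nat d powr (-s) * of_nat (n div d) powr (-s)"
        by (intro powr_times_real) auto
      ultimately show ?thesis using x by (simp add: f_def)
    qed
    show ?thesis by (rule has_sum_cong[THEN iffD1, OF _ A]) (rule B)
  qed
  then have "((\<lambda>n. \<Sum>d | d dvd n. ?g (n, d)) has_sum (dser a s * dser b s)) {0<..}"
    by (rule has_sum_SigmaD) (auto intro!: has_sum_finiteI)
  then have "((\<lambda>n. (\<Sum>d | d dvd n. a d * b (n div d)) * of_nat n powr (-s)) has_sum (dser a s * dser b s)) UNIV"
    by (rule has_sum_cong_neutral[THEN iffD1, rotated -1]) (auto simp: sum_distrib_right)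
  from sums_unique[OF has_sum_imp_sums[OF this]] show ?thesis by (simp add: dser_def)
qed

section \<open>Logarithmic derivative and logarithm of L-functions\<close>

lemma cmult_norm: "cmult \<xi> \<Longrightarrow> norm (\<xi> n) \<le> 1"
  unfolding cmult_def by blast

lemma cmult_mult: "cmult \<xi> \<Longrightarrow> \<xi> (m * n) = \<xi> m * \<xi> n"
  unfolding cmult_def by blast

lemma cmult_1: "cmult \<xi> \<Longrightarrow> \<xi> (Suc 0) = 1"
  unfolding cmult_def One_nat_def by blast

lemma cmultI: "\<xi> (Suc 0) = 1 \<Longrightarrow> (\<And>m n. \<xi> (m * n) = \<xi> m * \<xi> n) \<Longrightarrow> (\<And>n. norm (\<xi> n) \<le> 1) \<Longrightarrow> cmult \<xi>"
  unfolding cmult_def One_nat_def by blast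

lemma cmult_one: "cmult (\<lambda>_. 1)" by (simp add: cmult_def)

lemma cmult_times: assumes "cmult \<xi>" "cmult \<psi>" shows "cmult (\<lambda>n. \<xi> n * \<psi> n)"
proof (rule cmultI)
  show "\<xi> (Suc 0) * \<psi> (Suc 0) = 1" using assms by (simp add: cmult_1)
  show "\<xi> (m * n) * \<psi> (m * n) = \<xi> m * \<psi> m * (\<xi> n * \<psi> n)" for m n
    using cmult_mult[OF assms(1)] cmult_mult[OF assms(2)] by simp
  show "norm (\<xi> n * \<psi> n) \<le> 1" for n
    unfolding norm_mult by (intro mult_le_one cmult_norm assms) simp
qed

lemma cmult_subpoly: "cmult \<xi> \<Longrightarrow> subpoly \<xi>"
  by (rule subpoly_bounded[of _ 1]) (simp add: cmult_norm)

lemma subpoly_mangoldt: assumes "cmult \<xi>" shows "subpoly (\<lambda>n. mangoldt n * \<xi> n)"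
proof (rule subpoly_dominated[OF subpoly_ln[OF cmult_subpoly[OF cmult_one]]])
  fix n :: nat assume n: "n > 0"
  have "mangoldt n * norm (\<xi> n) \<le> ln n * 1"
    using n by (intro mult_mono mangoldt_le cmult_norm[OF assms]) (auto simp: mangoldt_nonneg)
  then show "norm (mangoldt n * \<xi> n) \<le> norm (1 * complex_of_real (ln (real n)))"
    using n by (simp add: norm_mult)
qed

text \<open>The convolution of \<open>mangoldt\<close> with 1 is the logarithm, and this identity
  survives multiplication by a completely multiplicative \<xi>.\<close>

lemma L_deriv:
  assumes "cmult \<xi>" "Re s > 1"
  shows "(dser \<xi> has_field_derivative - (dser (\<lambda>n. mangoldt n * \<xi> n) s * dser \<xi> s)) (at s)"
proof -
  have "dser (\<lambda>n. mangoldt n * \<xi> n) s * dser \<xi> s = dser (\<lambda>n. \<Sum>d | d dvd n. mangoldt d * \<xi> d * \<xi> (n div d)) s"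
    by (intro dser_mult subpoly_mangoldt cmult_subpoly assms)
  also have "\<dots> = dser (\<lambda>n. \<xi> n * of_real (ln (real n))) s"
  proof (rule dser_cong)
    fix n :: nat assume n: "n > 0"
    have "(\<Sum>d | d dvd n. mangoldt d * \<xi> d * \<xi> (n div d)) = (\<Sum>d | d dvd n. mangoldt d * \<xi> n)"
      by (intro sum.cong refl) (auto simp: mult.assoc cmult_mult[OF assms(1), symmetric])
    also have "\<dots> = (\<Sum>d | d dvd n. mangoldt d) * \<xi> n" by (simp add: sum_distrib_right)
    also have "\<dots> = \<xi> n * of_real (ln (real n))" using n by (simp add: mangoldt_sum)
    finally show "(\<Sum>d | d dvd n. mangoldt d * \<xi> d * \<xi> (n div d)) = \<xi> n * of_real (ln (real n))" .
  qed
  finally show ?thesis using dser_has_deriv[OF cmult_subpoly[OF assms(1)] assms(2)] by simp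
qed

text \<open>The coefficients of log zeta: 1/k at a prime power p^k and 0 elsewhere, including n = 0
  and n = 1.\<close>

definition lcoef :: "nat \<Rightarrow> real" where "lcoef n = mangoldt n / ln (real n)"

lemma lcoef_nonneg: "lcoef n \<ge> 0"
  by (cases "n = 0") (auto simp: lcoef_def mangoldt_nonneg)

lemma lcoef_le_1: "lcoef n \<le> 1"
proof (cases "n \<le> 1")
  case True
  then have "n = 0 \<or> n = Suc 0" by auto
  then show ?thesis by (auto simp: lcoef_def)
next
  case False
  then show ?thesis using mangoldt_le[of n] by (simp add: lcoef_def)
qed

lemma lcoef_ln: "lcoef n * ln (real n) = mangoldt n"
proof (cases "n \<le> 1")
  case True
  then have "n = 0 \<or> n = Suc 0" by auto
  then show ?thesis by (auto simp: lcoef_def)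
next
  case False
  then show ?thesis by (simp add: lcoef_def)
qed

definition logL :: "(nat \<Rightarrow> complex) \<Rightarrow> complex \<Rightarrow> complex" where
  "logL \<xi> = dser (\<lambda>n. of_real (lcoef n) * \<xi> n)"

lemma subpoly_lcoef: "cmult \<xi> \<Longrightarrow> subpoly (\<lambda>n. of_real (lcoef n) * \<xi> n)"
  by (rule subpoly_bounded[of _ 1])
     (auto simp: norm_mult abs_of_nonneg lcoef_nonneg intro!: mult_le_one lcoef_le_1 cmult_norm)

lemma logL_deriv:
  assumes "cmult \<xi>" "Re s > 1"
  shows "(logL \<xi> has_field_derivative - dser (\<lambda>n. mangoldt n * \<xi> n) s) (at s)"
proof -
  have "of_real (lcoef n) * \<xi> n * of_real (ln (real n)) = mangoldt n * \<xi> n" for n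
  proof -
    have "of_real (lcoef n) * \<xi> n * of_real (ln (real n)) = of_real (lcoef n * ln (real n)) * \<xi> n" by simp
    then show ?thesis unfolding lcoef_ln by simp
  qed
  then have "(\<lambda>n. of_real (lcoef n) * \<xi> n * of_real (ln (real n))) = (\<lambda>n. mangoldt n * \<xi> n)" by blast
  then show ?thesis
    unfolding logL_def using dser_has_deriv[OF subpoly_lcoef[OF assms(1)] assms(2)] by argo
qed

text \<open>For x >= 2 the terms with n >= 2 are at most 2^(2 - x) times their size at 2, so only
  the first coefficient survives.\<close>

lemma dser_tendsto:
  assumes "subpoly a"
  shows "((\<lambda>x. dser a (of_real x)) \<longlongrightarrow> a 1) at_top"
proof -
  define K where "K = (\<Sum>n. norm (a n * of_nat n powr (-2)))"
  have sK: "summable (\<lambda>n. norm (a n * of_nat n powr (-2)))" by (rule subpoly_summable[OF assms]) simp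
  have bound: "norm (dser a (of_real x) - a 1) \<le> K * 2 powr (2 - x)" if x: "x \<ge> 2" for x
  proof -
    let ?f = "\<lambda>n. a n * of_nat n powr (- complex_of_real x)"
    let ?g = "\<lambda>n. if n = 1 then 0 else ?f n"
    have sf: "summable (\<lambda>n. norm (?f n))" using x by (intro subpoly_summable[OF assms]) simp
    have "(\<lambda>n. if n = 1 then a 1 else 0) sums a 1" using sums_single[of 1 "\<lambda>_. a 1"] by simp
    from sums_diff[OF summable_sums[OF summable_norm_cancel[OF sf]] this]
    have "(\<lambda>n. ?f n - (if n = 1 then a 1 else 0)) sums (dser a (of_real x) - a 1)" by (simp add: dser_def)
    also have "(\<lambda>n. ?f n - (if n = 1 then a 1 else 0)) = ?g" by auto
    finally have g: "?g sums (dser a (of_real x) - a 1)" .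
    have le: "norm (?g n) \<le> norm (a n * of_nat n powr (-2)) * 2 powr (2 - x)" for n
    proof (cases "n \<le> 1")
      case True
      then have "n = 0 \<or> n = 1" by auto
      then show ?thesis by auto
    next
      case False
      have "real n powr (-x) = real n powr (-2) * real n powr (2 - x)" by (simp flip: powr_add)
      also have "\<dots> \<le> real n powr (-2) * 2 powr (2 - x)"
        using False x by (intro mult_left_mono powr_mono2') auto
      finally have "norm (a n) * real n powr (-x) \<le> norm (a n) * (real n powr (-2) * 2 powr (2 - x))"
        by (rule mult_left_mono) simp
      then show ?thesis using False norm_npow[of n 2] norm_npow[of n "of_real x"] by (simp add: norm_mult mult.assoc)
    qed
    have "norm (\<Sum>n. ?g n) \<le> (\<Sum>n. norm (a n * of_nat n powr (-2)) * 2 powr (2 - x))"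
      by (intro norm_suminf_le le summable_mult2 sK)
    also have "\<dots> = K * 2 powr (2 - x)" unfolding K_def using sK by (simp add: suminf_mult2)
    finally show ?thesis using sums_unique[OF g] by simp
  qed
  have "((\<lambda>x. K * 2 powr (2 - x)) \<longlongrightarrow> 0) at_top" by real_asymp
  then have "((\<lambda>x. dser a (of_real x) - a 1) \<longlongrightarrow> 0) at_top"
    by (rule Lim_null_comparison[rotated]) (use eventually_mono[OF eventually_ge_at_top[of 2] bound] in simp)
  then show ?thesis by (simp add: LIM_zero_iff)
qed

text \<open>The quotient of the two sides has derivative 0 by \<open>L_deriv\<close> and
  \<open>logL_deriv\<close> and tends to 1 along the real axis. This gives nonvanishing for Re s > 1
  and a logarithm whose real part is read off from its coefficients.\<close>

lemma L_eq_exp_logL: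
  assumes "cmult \<xi>" "Re s > 1"
  shows "dser \<xi> s = exp (logL \<xi> s)"
proof -
  let ?S = "{s. Re s > 1}"
  have "\<exists>c. \<forall>s\<in>?S. dser \<xi> s * exp (- logL \<xi> s) = c"
  proof (rule has_field_derivative_zero_constant)
    show "convex ?S" by (simp add: convex_halfspace_Re_gt)
  next
    fix x assume "x \<in> ?S"
    then have x: "Re x > 1" by simp
    have "((\<lambda>s. dser \<xi> s * exp (- logL \<xi> s)) has_field_derivative 0) (at x)"
      by (rule derivative_eq_intros L_deriv[OF assms(1) x] logL_deriv[OF assms(1) x] refl)+ (simp add: algebra_simps)
    then show "((\<lambda>s. dser \<xi> s * exp (- logL \<xi> s)) has_field_derivative 0) (at x within ?S)"
      by (rule has_field_derivative_at_within)
  qed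
  then obtain c where c: "\<And>s. Re s > 1 \<Longrightarrow> dser \<xi> s * exp (- logL \<xi> s) = c" by auto
  have "((\<lambda>x. dser \<xi> (of_real x) * exp (- logL \<xi> (of_real x))) \<longlongrightarrow> \<xi> 1 * exp (- (of_real (lcoef 1) * \<xi> 1))) at_top"
    unfolding logL_def by (intro tendsto_intros dser_tendsto cmult_subpoly subpoly_lcoef assms)
  moreover have "eventually (\<lambda>x. dser \<xi> (of_real x) * exp (- logL \<xi> (of_real x)) = c) at_top"
    using eventually_gt_at_top[of 1] by eventually_elim (rule c, simp)
  ultimately have "((\<lambda>x::real. c) \<longlongrightarrow> \<xi> 1 * exp (- (of_real (lcoef 1) * \<xi> 1))) at_top"
    using tendsto_cong by fast
  then have "c = \<xi> 1 * exp (- (of_real (lcoef 1) * \<xi> 1))" by (simp add: tendsto_const_iff)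
  then have "c = 1" using cmult_1[OF assms(1)] by (simp add: lcoef_def)
  with c[OF assms(2)] show ?thesis by (simp add: exp_minus field_simps)
qed

section \<open>Continuation to the half-plane \<open>Re s > 0\<close>\<close>

text \<open>The bound q is carried along because all later estimates must be uniform in it; for a
  nonprincipal character it is the modulus.\<close>

definition psb :: "real \<Rightarrow> (nat \<Rightarrow> complex) \<Rightarrow> bool" where
  "psb q \<xi> \<longleftrightarrow> (\<forall>N. norm (\<Sum>n=1..N. \<xi> n) \<le> q)"

text \<open>In the variable x = log u the power is exp (- s x), whose derivative is dominated by
  that of - (norm s / Re s) exp (- Re s x). Keeping a difference on the right lets sums of such
  bounds telescope.\<close>

lemma norm_powr_diff_le:
  assumes s: "Re s > 0" and uv: "0 < u" "u \<le> v"
  shows "norm (of_real u powr (-s) - of_real v powr (-s)) \<le> norm s / Re s * (u powr (- Re s) - v powr (- Re s))"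
proof -
  let ?f = "\<lambda>x. exp (- s * of_real x)" and ?\<phi> = "\<lambda>x. - (norm s / Re s * exp (- Re s * x))"
  have pw: "of_real w powr (-s) = ?f (ln w)" "w powr (- Re s) = exp (- Re s * ln w)" if "w > 0" for w
    using that by (auto simp: powr_def Ln_of_real)
  have "norm (?f (ln v) - ?f (ln u)) \<le> ?\<phi> (ln v) - ?\<phi> (ln u)"
  proof (cases "u = v")
    case False
    then have lt: "ln u < ln v" using uv by simp
    show ?thesis
    proof (rule differentiable_bound_general[OF lt, where f = ?f and \<phi> = ?\<phi> and f' = "\<lambda>x. - s * ?f x" and \<phi>' = "\<lambda>x. norm s * exp (- Re s * x)"])
      fix x :: real
      show "(?f has_vector_derivative - s * ?f x) (at x)"
        by (rule has_vector_derivative_real_field) (auto intro!: derivative_eq_intros)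
      show "(?\<phi> has_vector_derivative norm s * exp (- Re s * x)) (at x)"
        unfolding has_real_derivative_iff_has_vector_derivative[symmetric]
        using s by (auto intro!: derivative_eq_intros)
      show "norm (- s * ?f x) \<le> norm s * exp (- Re s * x)" by (simp add: norm_mult)
    qed (use s in \<open>auto intro!: continuous_intros\<close>)
  qed simp
  then show ?thesis using uv by (simp add: pw norm_minus_commute algebra_simps)
qed

lemma abel_block:
  fixes \<xi> f :: "nat \<Rightarrow> complex"
  assumes "N \<le> M"
  shows "(\<Sum>n\<in>{N<..M}. \<xi> n * f n) = (\<Sum>n=1..M. \<xi> n) * f (Suc M) - (\<Sum>n=1..N. \<xi> n) * f (Suc N)
     + (\<Sum>n\<in>{N<..M}. (\<Sum>m=1..n. \<xi> m) * (f n - f (Suc n)))"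
  using assms
proof (induction M rule: dec_induct)
  case (step M)
  have "{N<..Suc M} = insert (Suc M) {N<..M}" using step.hyps by auto
  then show ?case using step.IH by (simp add: algebra_simps)
qed simp

text \<open>Partial summation: the two boundary terms contribute the 2, and the differences
  telescope to norm s / Re s.\<close>

lemma psb_block:
  assumes q: "psb q \<xi>" and s: "Re s > 0" and NM: "N \<le> M"
  shows "norm (\<Sum>n\<in>{N<..M}. \<xi> n * of_nat n powr (-s)) \<le> q * (2 + norm s / Re s) * real (Suc N) powr (- Re s)"
proof -
  let ?f = "\<lambda>n. of_nat n powr (-s) :: complex" and ?g = "\<lambda>n. real n powr (- Re s)"
  have A: "norm (\<Sum>n=1..K. \<xi> n) \<le> q" for K using q by (simp add: psb_def)
  have q0: "q \<ge> 0" using A[of 0] by simp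
  have d: "norm (?f n - ?f (Suc n)) \<le> norm s / Re s * (?g n - ?g (Suc n))" if "n > 0" for n
    using norm_powr_diff_le[OF s, of "real n" "real (Suc n)"] that by simp
  have tele: "(\<Sum>n\<in>{N<..M}. ?g n - ?g (Suc n)) = ?g (Suc N) - ?g (Suc M)"
    using NM
  proof (induction M rule: dec_induct)
    case (step M)
    have "{N<..Suc M} = insert (Suc M) {N<..M}" using step.hyps by auto
    then show ?case using step.IH by simp
  qed simp
  have mono: "?g (Suc M) \<le> ?g (Suc N)" using NM s by (intro powr_mono2') auto
  have "norm (\<Sum>n\<in>{N<..M}. (\<Sum>m=1..n. \<xi> m) * (?f n - ?f (Suc n))) \<le> (\<Sum>n\<in>{N<..M}. q * (norm s / Re s * (?g n - ?g (Suc n))))"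
    by (rule sum_norm_le) (auto simp only: norm_mult greaterThanAtMost_iff intro!: mult_mono A d q0 norm_ge_zero)
  also have "\<dots> = q * (norm s / Re s) * (?g (Suc N) - ?g (Suc M))"
    unfolding tele[symmetric] by (simp add: sum_distrib_left mult.assoc)
  also have "\<dots> \<le> q * (norm s / Re s) * ?g (Suc N)" using q0 s by (intro mult_left_mono) auto
  finally have 1: "norm (\<Sum>n\<in>{N<..M}. (\<Sum>m=1..n. \<xi> m) * (?f n - ?f (Suc n))) \<le> q * (norm s / Re s) * ?g (Suc N)" .
  have 2: "norm ((\<Sum>n=1..M. \<xi> n) * ?f (Suc M)) \<le> q * ?g (Suc N)"
    unfolding norm_mult norm_npow using mono by (intro mult_mono A q0) auto
  have 3: "norm ((\<Sum>n=1..N. \<xi> n) * ?f (Suc N)) \<le> q * ?g (Suc N)"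
    unfolding norm_mult norm_npow by (intro mult_mono A q0) auto
  have "norm (\<Sum>n\<in>{N<..M}. \<xi> n * ?f n) \<le> q * ?g (Suc N) + q * ?g (Suc N) + q * (norm s / Re s) * ?g (Suc N)"
    unfolding abel_block[OF NM, of \<xi> ?f] using 1 2 3
    by (meson norm_triangle_ineq norm_triangle_ineq4 add_mono order_trans)
  then show ?thesis by (simp add: algebra_simps)
qed

lemma sum_lessThan_npow: "(\<Sum>n<Suc N. a n * of_nat n powr (-s) :: complex) = (\<Sum>n=1..N. a n * of_nat n powr (-s))"
  by (rule sum.mono_neutral_right) (auto simp: not_le)

lemma npow_tendsto_0: assumes "\<sigma> > 0" shows "(\<lambda>N. K * real (Suc N) powr (-\<sigma>)) \<longlonglongrightarrow> 0"
proof -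
  have "(\<lambda>N. real (Suc N) powr (-\<sigma>)) \<longlonglongrightarrow> 0"
    using assms by (intro LIMSEQ_Suc tendsto_neg_powr filterlim_real_sequentially) auto
  then show ?thesis by (rule tendsto_mult_right_zero)
qed

text \<open>The series itself converges for Re s > 0, so \<open>dser \<xi>\<close> is its own
  continuation; the second statement is the cost of truncation at N.\<close>

lemma psb_sums:
  assumes q: "psb q \<xi>" and s: "Re s > 0"
  shows "(\<lambda>n. \<xi> n * of_nat n powr (-s)) sums dser \<xi> s"
    and "norm (dser \<xi> s - (\<Sum>n=1..N. \<xi> n * of_nat n powr (-s))) \<le> q * (2 + norm s / Re s) * real (Suc N) powr (- Re s)"
proof -
  let ?P = "\<lambda>N. \<Sum>n=1..N. \<xi> n * of_nat n powr (-s)"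
  let ?K = "q * (2 + norm s / Re s)"
  have diff: "norm (?P M - ?P N) \<le> ?K * real (Suc N) powr (- Re s)" if "N \<le> M" for N M
  proof -
    have "{1..M} = {1..N} \<union> {N<..M}" using that by auto
    then have "?P M = ?P N + (\<Sum>n\<in>{N<..M}. \<xi> n * of_nat n powr (-s))"
      unfolding \<open>{1..M} = _\<close> by (intro sum.union_disjoint) auto
    then show ?thesis using psb_block[OF q s that] by simp
  qed
  have "Cauchy ?P"
  proof (rule CauchyI')
    fix e :: real assume e: "e > 0"
    have "eventually (\<lambda>N. ?K * real (Suc N) powr (- Re s) < e) sequentially"
      using npow_tendsto_0[OF s, of ?K] e by (auto simp: order_tendsto_iff)
    then obtain N0 where N0: "\<And>N. N \<ge> N0 \<Longrightarrow> ?K * real (Suc N) powr (- Re s) < e"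
      unfolding eventually_sequentially by blast
    show "\<exists>M. \<forall>m\<ge>M. \<forall>n>m. dist (?P m) (?P n) < e"
    proof (intro exI[of _ N0] allI impI)
      fix m n assume "N0 \<le> m" "m < n"
      then show "dist (?P m) (?P n) < e"
        unfolding dist_norm using diff[of m n] N0[of m] norm_minus_commute[of "?P m" "?P n"] by linarith
    qed
  qed
  then obtain l where l: "?P \<longlonglongrightarrow> l" using Cauchy_convergent convergent_def by blast
  then have "(\<lambda>N. \<Sum>n<Suc N. \<xi> n * of_nat n powr (-s)) \<longlonglongrightarrow> l" by (simp add: sum_lessThan_npow del: sum.lessThan_Suc)
  then have S: "(\<lambda>n. \<xi> n * of_nat n powr (-s)) sums l"
    unfolding sums_def by (rule LIMSEQ_imp_Suc)
  then have "l = dser \<xi> s" unfolding dser_def by (rule sums_unique)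
  with S show "(\<lambda>n. \<xi> n * of_nat n powr (-s)) sums dser \<xi> s" by simp
  have "(\<lambda>M. norm (?P M - ?P N)) \<longlonglongrightarrow> norm (dser \<xi> s - ?P N)"
    using l \<open>l = _\<close> by (intro tendsto_intros) simp
  then show "norm (dser \<xi> s - ?P N) \<le> ?K * real (Suc N) powr (- Re s)"
    by (rule Lim_bounded[where M = N]) (use diff in auto)
qed

text \<open>On a disc of radius Re x / 2 about x the real part stays at least Re x / 2 and K is
  bounded by compactness. Only the form of the truncation error enters, so the L-functions and
  \<open>Zf\<close> share the argument.\<close>

lemma uniform_limit_npow:
  assumes bound: "\<And>N s. Re s > 0 \<Longrightarrow> norm (g s - P N s) \<le> K s * real (Suc N) powr (- Re s)"
    and K: "continuous_on {s. Re s > 0} K" and x: "Re x > 0"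
  shows "\<exists>d>0. cball x d \<subseteq> {s. Re s > 0} \<and> uniform_limit (cball x d) P g sequentially"
proof -
  define d where "d = Re x / 2"
  have d: "d > 0" using x by (simp add: d_def)
  have Re: "Re s \<ge> d" if "s \<in> cball x d" for s
    using that abs_Re_le_cmod[of "x - s"] by (auto simp: dist_norm d_def)
  have sub: "cball x d \<subseteq> {s. Re s > 0}" using Re d by (auto intro: less_le_trans)
  have "continuous_on (cball x d) K" using K sub continuous_on_subset by blast
  then have "compact (K ` cball x d)" by (intro compact_continuous_image) auto
  then obtain B where B: "\<And>s. s \<in> cball x d \<Longrightarrow> \<bar>K s\<bar> \<le> B"
    using compact_imp_bounded bounded_real by (metis (no_types, lifting) imageI)
  have "uniform_limit (cball x d) P g sequentially"
  proof (rule uniform_limitI)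
    fix e :: real assume e: "e > 0"
    have "eventually (\<lambda>N. B * real (Suc N) powr (- d) < e) sequentially"
      using npow_tendsto_0[OF d, of B] e by (auto simp: order_tendsto_iff)
    then show "\<forall>\<^sub>F n in sequentially. \<forall>s\<in>cball x d. dist (P n s) (g s) < e"
    proof eventually_elim
      case (elim N)
      show ?case
      proof
        fix s assume s: "s \<in> cball x d"
        have "dist (P N s) (g s) \<le> K s * real (Suc N) powr (- Re s)"
          using bound[of s N] subsetD[OF sub s] by (simp add: dist_norm norm_minus_commute)
        also have "\<dots> \<le> B * real (Suc N) powr (- d)"
          using B[OF s] Re[OF s] by (intro mult_mono powr_mono) auto
        finally show "dist (P N s) (g s) < e" using elim by simp
      qed
    qed
  qed
  with d sub show ?thesis by blast
qed

lemma npow_holomorphic: "(\<lambda>s. of_nat n powr (- s) :: complex) holomorphic_on S"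
proof (cases "n = 0")
  case False
  then show ?thesis unfolding powr_def by (auto intro!: holomorphic_intros)
qed auto

lemma npow_holomorphic': "(\<lambda>s. of_nat n powr (1 - s) :: complex) holomorphic_on S"
proof (cases "n = 0")
  case False
  then show ?thesis unfolding powr_def by (auto intro!: holomorphic_intros)
qed auto

lemma psb_holomorphic: assumes q: "psb q \<xi>" shows "dser \<xi> holomorphic_on {s. Re s > 0}"
proof (rule holomorphic_uniform_sequence[OF open_Re_gt])
  show "(\<lambda>s. \<Sum>n=1..N. \<xi> n * of_nat n powr (-s)) holomorphic_on {s. Re s > 0}" for N
    by (intro holomorphic_intros npow_holomorphic)
next
  fix x assume x: "x \<in> {s. Re s > 0}"
  show "\<exists>d>0. cball x d \<subseteq> {s. Re s > 0} \<and>
      uniform_limit (cball x d) (\<lambda>N s. \<Sum>n=1..N. \<xi> n * of_nat n powr (-s)) (dser \<xi>) sequentially"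
    by (rule uniform_limit_npow[OF psb_sums(2)[OF q]]) (use x in \<open>auto intro!: continuous_intros\<close>)
qed

text \<open>Each term is at most Q^\<rho> / n. The harmonic sum up to Q is at most 1 + ln Q, which
  costs another Q^\<rho> and the factor 1 + 1/\<rho>.\<close>

lemma sum_powr_le:
  assumes "0 < \<rho>" "1 - \<rho> \<le> \<sigma>" "1 \<le> Q" "real N \<le> Q"
  shows "(\<Sum>n=1..N. real n powr (-\<sigma>)) \<le> (1 + 1 / \<rho>) * Q powr (2 * \<rho>)"
proof -
  have harm: "(\<Sum>n=1..N. 1 / real n) \<le> 1 + ln (real N)" if "N > 0"
    using that
  proof (induction N rule: nat_induct_non_zero)
    case (Suc N)
    have "ln (real N / real (Suc N)) \<le> real N / real (Suc N) - 1" using Suc by (intro ln_le_minus_one) auto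
    then have "1 / real (Suc N) \<le> ln (real (Suc N)) - ln (real N)"
      using Suc by (simp add: ln_div field_simps)
    then show ?case using Suc by simp
  qed simp
  have "(\<Sum>n=1..N. real n powr (-\<sigma>)) \<le> (\<Sum>n=1..N. Q powr \<rho> * (1 / real n))"
  proof (rule sum_mono)
    fix n assume n: "n \<in> {1..N}"
    have "real n powr (-\<sigma>) \<le> real n powr (\<rho> - 1)" using n assms by (intro powr_mono) auto
    also have "\<dots> = real n powr \<rho> * (1 / real n)" using n by (simp add: powr_diff)
    also have "\<dots> \<le> Q powr \<rho> * (1 / real n)" using n assms by (intro mult_right_mono powr_mono2) auto
    finally show "real n powr (-\<sigma>) \<le> Q powr \<rho> * (1 / real n)" .
  qed
  also have "\<dots> = Q powr \<rho> * (\<Sum>n=1..N. 1 / real n)" by (simp add: sum_distrib_left)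
  also have "\<dots> \<le> Q powr \<rho> * (1 + ln Q)"
  proof (cases "N = 0")
    case False
    then have "ln (real N) \<le> ln Q" using assms by simp
    then show ?thesis using harm False by (intro mult_left_mono) auto
  qed (use assms in auto)
  also have "\<dots> \<le> Q powr \<rho> * (Q powr \<rho> + Q powr \<rho> / \<rho>)"
    using assms ln_powr_bound[of Q \<rho>] ge_one_powr_ge_zero[of Q \<rho>] by (intro mult_left_mono add_mono) auto
  also have "\<dots> = (1 + 1 / \<rho>) * (Q powr \<rho> * Q powr \<rho>)" by (simp add: field_simps)
  also have "Q powr \<rho> * Q powr \<rho> = Q powr (2 * \<rho>)" by (simp flip: powr_add)
  finally show ?thesis .
qed

lemma norm_le_Im: assumes "0 \<le> Re s" "Re s \<le> 4" shows "norm s \<le> 4 + \<bar>Im s\<bar>"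
  using cmod_le[of s] assms by simp

text \<open>Truncate at Q = q (2 + |Im s|), where the tail becomes comparable with the trivial bound
  for the terms kept. The terms up to Q give 1 + 1/\<rho>, the tail gives 12.\<close>

lemma psb_bound:
  assumes q: "psb q \<xi>" "q \<ge> 1" and \<xi>: "\<And>n. norm (\<xi> n) \<le> 1" and \<rho>: "0 < \<rho>" "\<rho> \<le> 1/2"
    and s: "1 - \<rho> \<le> Re s" "Re s \<le> 4"
  shows "norm (dser \<xi> s) \<le> (13 + 1 / \<rho>) * (q * (2 + \<bar>Im s\<bar>)) powr (2 * \<rho>)"
proof -
  define Q where "Q = q * (2 + \<bar>Im s\<bar>)"
  have Q1: "Q \<ge> 1" using q mult_mono[of 1 q 1 "2 + \<bar>Im s\<bar>"] by (simp add: Q_def)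
  define N where "N = nat \<lfloor>Q\<rfloor>"
  have N: "real N \<le> Q" "Q \<le> real (Suc N)" using Q1 by (simp_all add: N_def) linarith
  have s0: "Re s > 0" "Re s \<ge> 1/2" using \<rho> s by auto
  have "norm (\<Sum>n=1..N. \<xi> n * of_nat n powr (-s)) \<le> (\<Sum>n=1..N. real n powr (- Re s))"
    by (rule sum_norm_le) (use \<xi> in \<open>auto simp: norm_mult norm_npow intro!: mult_left_le_one_le\<close>)
  also have "\<dots> \<le> (1 + 1 / \<rho>) * Q powr (2 * \<rho>)" by (rule sum_powr_le[OF \<rho>(1) s(1) Q1 N(1)])
  finally have 1: "norm (\<Sum>n=1..N. \<xi> n * of_nat n powr (-s)) \<le> (1 + 1 / \<rho>) * Q powr (2 * \<rho>)" .
  have "norm s / Re s \<le> (4 + \<bar>Im s\<bar>) / (1/2)"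
    using s0 norm_le_Im[of s] s by (intro frac_le) auto
  then have "q * (2 + norm s / Re s) \<le> q * (12 * (2 + \<bar>Im s\<bar>))" using q by (intro mult_left_mono) auto
  then have a: "q * (2 + norm s / Re s) \<le> 12 * Q" by (simp add: Q_def algebra_simps)
  have "real (Suc N) powr (- Re s) \<le> Q powr (- Re s)" using N(2) Q1 s0 by (intro powr_mono2') auto
  also have "\<dots> \<le> Q powr (\<rho> - 1)" using s Q1 by (intro powr_mono) auto
  finally have b: "real (Suc N) powr (- Re s) \<le> Q powr (\<rho> - 1)" .
  have "q * (2 + norm s / Re s) * real (Suc N) powr (- Re s) \<le> 12 * Q * Q powr (\<rho> - 1)"
    by (rule mult_mono[OF a b]) (use Q1 in auto)
  also have "12 * Q * Q powr (\<rho> - 1) = 12 * Q powr \<rho>" using Q1 by (simp add: powr_diff)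
  also have "\<dots> \<le> 12 * Q powr (2 * \<rho>)" using Q1 \<rho> by (intro mult_left_mono powr_mono) auto
  finally have "norm (dser \<xi> s - (\<Sum>n=1..N. \<xi> n * of_nat n powr (-s))) \<le> 12 * Q powr (2 * \<rho>)"
    using psb_sums(2)[OF q(1) s0(1), of N] by linarith
  then have "norm (dser \<xi> s) \<le> 12 * Q powr (2 * \<rho>) + (1 + 1 / \<rho>) * Q powr (2 * \<rho>)"
    using 1 norm_triangle_sub[of "dser \<xi> s" "\<Sum>n=1..N. \<xi> n * of_nat n powr (-s)"] by linarith
  then show ?thesis by (simp add: Q_def algebra_simps)
qed

text \<open>For Re s > 1 the last term is s - 1 times the integral of x^(-s) over x >= N + 1, the
  leading part of the remainder of zeta.\<close>

definition zpart :: "nat \<Rightarrow> complex \<Rightarrow> complex" where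
  "zpart N s = (s - 1) * (\<Sum>n=1..N. of_nat n powr (-s)) + of_nat (Suc N) powr (1 - s)"

text \<open>By partial summation the limit exists for \<open>Re s > 0\<close>, where it continues \<open>(s - 1) \<zeta>(s)\<close>.\<close>

definition Zf :: "complex \<Rightarrow> complex" where "Zf s = lim (\<lambda>N. zpart N s)"

text \<open>With m = n + 1 the increment is the integral of (s - 1) (m^(-s) - x^(-s)) over m <= x <=
  m + 1, and the integrand is controlled by \<open>norm_powr_diff_le\<close>.\<close>

lemma zpart_step:
  assumes s: "Re s > 0"
  shows "norm (zpart (Suc n) s - zpart n s) \<le> norm (s - 1) * (norm s / Re s) * (real (Suc n) powr (- Re s) - real (Suc (Suc n)) powr (- Re s))"
proof -
  let ?m = "real (Suc n)"
  let ?B = "norm (s - 1) * (norm s / Re s * (?m powr (- Re s) - (?m + 1) powr (- Re s)))"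
  let ?f = "\<lambda>x. of_real x powr (1 - s) + (s - 1) * of_real ?m powr (-s) * of_real x"
  let ?f' = "\<lambda>x. (s - 1) * (of_real ?m powr (-s) - of_real x powr (-s))"
  have "norm (?f (?m + 1) - ?f ?m) \<le> ?B * (?m + 1) - ?B * ?m"
  proof (rule differentiable_bound_general[where f = ?f and f' = ?f' and \<phi> = "\<lambda>x. ?B * x" and \<phi>' = "\<lambda>_. ?B"])
    have ne: "complex_of_real x \<notin> \<real>\<^sub>\<le>\<^sub>0" if "x \<ge> ?m" for x using that by (auto simp: complex_nonpos_Reals_iff)
    have d: "(?f has_vector_derivative ?f' x) (at x)" if "x \<ge> ?m" for x
      by (rule has_vector_derivative_real_field, (rule derivative_eq_intros refl ne[OF that])+)
         (use that in \<open>simp add: algebra_simps powr_diff\<close>)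
    show "continuous_on {?m..?m + 1} ?f"
      by (rule continuous_at_imp_continuous_on) (use d has_vector_derivative_continuous in force)
    fix x assume x: "?m < x" "x < ?m + 1"
    show "(?f has_vector_derivative ?f' x) (at x)" using d x by simp
    have "norm (of_real ?m powr (-s) - of_real x powr (-s)) \<le> norm s / Re s * (?m powr (- Re s) - x powr (- Re s))"
      using x by (intro norm_powr_diff_le s) auto
    also have "\<dots> \<le> norm s / Re s * (?m powr (- Re s) - (?m + 1) powr (- Re s))"
      using x s by (intro mult_left_mono diff_left_mono powr_mono2') auto
    finally show "norm (?f' x) \<le> ?B" unfolding norm_mult by (intro mult_left_mono) auto
  qed (use s in \<open>auto intro!: derivative_eq_intros continuous_intros simp flip: has_real_derivative_iff_has_vector_derivative\<close>)
  moreover have "?f (?m + 1) - ?f ?m = zpart (Suc n) s - zpart n s"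
  proof -
    have "complex_of_real (?m + 1) = of_nat (Suc (Suc n))" "complex_of_real ?m = of_nat (Suc n)" by simp_all
    then show ?thesis unfolding zpart_def by (simp add: algebra_simps)
  qed
  moreover have "?B * (?m + 1) - ?B * ?m = ?B" by (simp only: distrib_left)
  moreover have "?m + 1 = real (Suc (Suc n))" by simp
  ultimately show ?thesis by (metis mult.assoc)
qed

lemma zpart_diff:
  assumes s: "Re s > 0" and NM: "N \<le> M"
  shows "norm (zpart M s - zpart N s) \<le> norm (s - 1) * (norm s / Re s) * (real (Suc N) powr (- Re s) - real (Suc M) powr (- Re s))"
  using NM
proof (induction M rule: dec_induct)
  case (step M)
  let ?c = "norm (s - 1) * (norm s / Re s)"
  have "norm (zpart (Suc M) s - zpart N s) \<le> norm (zpart (Suc M) s - zpart M s) + norm (zpart M s - zpart N s)"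
    by (metis diff_add_cancel add_diff_eq norm_triangle_ineq)
  also have "\<dots> \<le> ?c * (real (Suc M) powr (- Re s) - real (Suc (Suc M)) powr (- Re s)) + ?c * (real (Suc N) powr (- Re s) - real (Suc M) powr (- Re s))"
    using zpart_step[OF s, of M] step.IH by linarith
  also have "\<dots> = ?c * (real (Suc N) powr (- Re s) - real (Suc (Suc M)) powr (- Re s))" by (simp only: distrib_left[symmetric]) simp
  finally show ?case .
qed simp

lemma Zf_bound:
  assumes s: "Re s > 0"
  shows "(\<lambda>N. zpart N s) \<longlonglongrightarrow> Zf s"
    and "norm (Zf s - zpart N s) \<le> norm (s - 1) * (norm s / Re s) * real (Suc N) powr (- Re s)"
proof -
  let ?K = "norm (s - 1) * (norm s / Re s)"
  have K: "?K \<ge> 0" using s by simp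
  have diff: "norm (zpart M s - zpart N s) \<le> ?K * real (Suc N) powr (- Re s)" if "N \<le> M" for N M
    using zpart_diff[OF s that] mult_left_mono[OF _ K, of "real (Suc N) powr (- Re s) - real (Suc M) powr (- Re s)" "real (Suc N) powr (- Re s)"]
    by auto
  have "Cauchy (\<lambda>N. zpart N s)"
  proof (rule CauchyI')
    fix e :: real assume e: "e > 0"
    have "eventually (\<lambda>N. ?K * real (Suc N) powr (- Re s) < e) sequentially"
      using npow_tendsto_0[OF s, of ?K] e by (auto simp: order_tendsto_iff)
    then obtain N0 where N0: "\<And>N. N \<ge> N0 \<Longrightarrow> ?K * real (Suc N) powr (- Re s) < e"
      unfolding eventually_sequentially by blast
    show "\<exists>M. \<forall>m\<ge>M. \<forall>n>m. dist (zpart m s) (zpart n s) < e"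
    proof (intro exI[of _ N0] allI impI)
      fix m n assume "N0 \<le> m" "m < n"
      then show "dist (zpart m s) (zpart n s) < e"
        unfolding dist_norm using diff[of m n] N0[of m] norm_minus_commute[of "zpart m s" "zpart n s"] by linarith
    qed
  qed
  then show l: "(\<lambda>N. zpart N s) \<longlonglongrightarrow> Zf s"
    unfolding Zf_def using Cauchy_convergent convergent_LIMSEQ_iff by blast
  have "(\<lambda>M. norm (zpart M s - zpart N s)) \<longlonglongrightarrow> norm (Zf s - zpart N s)"
    using l by (intro tendsto_intros) simp
  then show "norm (Zf s - zpart N s) \<le> ?K * real (Suc N) powr (- Re s)"
    by (rule Lim_bounded[where M = N]) (use diff in auto)
qed

lemma Zf_holomorphic: "Zf holomorphic_on {s. Re s > 0}"
proof (rule holomorphic_uniform_sequence[OF open_Re_gt])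
  show "zpart N holomorphic_on {s. Re s > 0}" for N
    unfolding zpart_def by (intro holomorphic_intros npow_holomorphic npow_holomorphic')
next
  fix x assume x: "x \<in> {s. Re s > 0}"
  show "\<exists>d>0. cball x d \<subseteq> {s. Re s > 0} \<and> uniform_limit (cball x d) zpart Zf sequentially"
    by (rule uniform_limit_npow[OF Zf_bound(2)]) (use x in \<open>auto intro!: continuous_intros\<close>)
qed

lemma Zf_1: "Zf 1 = 1"
  using Zf_bound(1)[of 1] by (simp add: zpart_def tendsto_const_iff del: of_nat_Suc)

abbreviation zeta :: "complex \<Rightarrow> complex" where "zeta \<equiv> dser (\<lambda>_. 1)"

lemma Zf_eq: assumes "Re s > 1" shows "Zf s = (s - 1) * zeta s"
proof -
  have "(\<lambda>n. 1 * of_nat n powr (-s)) sums zeta s"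
    by (rule dser_sums[OF cmult_subpoly[OF cmult_one] assms])
  then have "(\<lambda>N. \<Sum>n<Suc N. 1 * of_nat n powr (-s)) \<longlonglongrightarrow> zeta s"
    unfolding sums_def by (rule LIMSEQ_Suc)
  then have *: "(\<lambda>N. \<Sum>n=1..N. of_nat n powr (-s)) \<longlonglongrightarrow> zeta s"
    unfolding sum_lessThan_npow by simp
  have "(\<lambda>N. of_nat (Suc N) powr (1 - s) :: complex) \<longlonglongrightarrow> 0"
  proof (rule tendsto_norm_zero_cancel)
    show "(\<lambda>N. norm (of_nat (Suc N) powr (1 - s) :: complex)) \<longlonglongrightarrow> 0"
      using npow_tendsto_0[of "Re s - 1" 1] assms norm_npow[of _ "s - 1"] by (simp del: of_nat_Suc)
  qed
  with * have "(\<lambda>N. zpart N s) \<longlonglongrightarrow> (s - 1) * zeta s + 0"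
    unfolding zpart_def by (intro tendsto_intros)
  with Zf_bound(1)[of s] show ?thesis using assms LIMSEQ_unique by fastforce
qed

text \<open>As in \<open>psb_bound\<close> with q = 1. The factor 1 + norm (s - 1) reflects the
  multiplication by s - 1, and the correction term of \<open>zpart\<close> contributes a 2.\<close>

lemma Zf_norm_bound:
  assumes \<rho>: "0 < \<rho>" "\<rho> \<le> 1/2" and s: "1 - \<rho> \<le> Re s" "Re s \<le> 4"
  shows "norm (Zf s) \<le> (13 + 1 / \<rho>) * (1 + norm (s - 1)) * (2 + \<bar>Im s\<bar>) powr (2 * \<rho>)"
proof -
  define Q where "Q = 2 + \<bar>Im s\<bar>"
  have Q1: "Q \<ge> 1" by (simp add: Q_def)
  define N where "N = nat \<lfloor>Q\<rfloor>"
  have N: "real N \<le> Q" "Q \<le> real (Suc N)" using Q1 by (simp_all add: N_def) linarith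
  have s0: "Re s > 0" "Re s \<ge> 1/2" using \<rho> s by auto
  have Qp: "Q powr \<rho> \<le> Q powr (2 * \<rho>)" "1 \<le> Q powr (2 * \<rho>)" using Q1 \<rho> by (auto intro!: powr_mono ge_one_powr_ge_zero)
  have "norm (\<Sum>n=1..N. of_nat n powr (-s) :: complex) \<le> (\<Sum>n=1..N. real n powr (- Re s))"
    by (rule sum_norm_le) (auto simp: norm_npow)
  also have "\<dots> \<le> (1 + 1 / \<rho>) * Q powr (2 * \<rho>)" by (rule sum_powr_le[OF \<rho>(1) s(1) Q1 N(1)])
  finally have "norm ((s - 1) * (\<Sum>n=1..N. of_nat n powr (-s))) \<le> norm (s - 1) * ((1 + 1 / \<rho>) * Q powr (2 * \<rho>))"
    unfolding norm_mult by (rule mult_left_mono) simp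
  moreover have "norm (of_nat (Suc N) powr (1 - s) :: complex) \<le> 2 * Q powr (2 * \<rho>)"
  proof -
    have "norm (of_nat (Suc N) powr (1 - s) :: complex) = real (Suc N) powr (1 - Re s)"
      using norm_npow[of "Suc N" "s - 1"] by simp
    also have "\<dots> \<le> real (Suc N) powr \<rho>" using s by (intro powr_mono) auto
    also have "\<dots> \<le> (2 * Q) powr \<rho>" using N(1) Q1 \<rho> by (intro powr_mono2) auto
    also have "\<dots> = 2 powr \<rho> * Q powr \<rho>" using Q1 by (simp add: powr_mult)
    also have "\<dots> \<le> 2 powr 1 * Q powr (2 * \<rho>)" using Qp Q1 \<rho> by (intro mult_mono powr_mono) auto
    finally show ?thesis by simp
  qed
  moreover have "norm (Zf s - zpart N s) \<le> norm (s - 1) * (12 * Q powr (2 * \<rho>))"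
  proof -
    have "norm s / Re s \<le> (4 + \<bar>Im s\<bar>) / (1/2)"
      using s0 norm_le_Im[of s] s by (intro frac_le) auto
    then have a: "norm s / Re s \<le> 12 * Q" by (simp add: Q_def)
    have "real (Suc N) powr (- Re s) \<le> Q powr (- Re s)" using N(2) Q1 s0 by (intro powr_mono2') auto
    also have "\<dots> \<le> Q powr (\<rho> - 1)" using s Q1 by (intro powr_mono) auto
    finally have "norm s / Re s * real (Suc N) powr (- Re s) \<le> 12 * Q * Q powr (\<rho> - 1)"
      using a Q1 by (intro mult_mono) auto
    also have "12 * Q * Q powr (\<rho> - 1) = 12 * Q powr \<rho>" using Q1 by (simp add: powr_diff)
    also have "\<dots> \<le> 12 * Q powr (2 * \<rho>)" using Qp by simp
    finally have "norm (s - 1) * (norm s / Re s * real (Suc N) powr (- Re s)) \<le> norm (s - 1) * (12 * Q powr (2 * \<rho>))"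
      by (rule mult_left_mono) simp
    with Zf_bound(2)[OF s0(1), of N] show ?thesis by (simp add: mult.assoc)
  qed
  ultimately have "norm (Zf s) \<le> norm (s - 1) * ((1 + 1 / \<rho>) * Q powr (2 * \<rho>)) + 2 * Q powr (2 * \<rho>) + norm (s - 1) * (12 * Q powr (2 * \<rho>))"
    using norm_triangle_sub[of "Zf s" "zpart N s"] norm_triangle_ineq[of "(s - 1) * (\<Sum>n=1..N. of_nat n powr (-s))" "of_nat (Suc N) powr (1 - s)"]
    unfolding zpart_def by linarith
  also have "\<dots> = (13 + 1 / \<rho>) * norm (s - 1) * Q powr (2 * \<rho>) + 2 * Q powr (2 * \<rho>)" by (simp add: algebra_simps)
  also have "\<dots> \<le> (13 + 1 / \<rho>) * norm (s - 1) * Q powr (2 * \<rho>) + (13 + 1 / \<rho>) * Q powr (2 * \<rho>)"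
    using \<rho> by (intro add_left_mono mult_right_mono) auto
  finally show ?thesis by (simp add: Q_def algebra_simps)
qed

section \<open>The methods of Estermann and Landau\<close>

lemma nonneg_real_dser:
  assumes "subpoly (\<lambda>n. of_real (c n))" "\<And>n. c n \<ge> 0"
  shows "(\<lambda>n. c n * ln (real n) ^ m * real n powr (-2)) sums Re (dser (\<lambda>n. of_real (c n) * of_real (ln (real n)) ^ m) 2)"
    and "dser (\<lambda>n. of_real (c n) * of_real (ln (real n)) ^ m) 2 = of_real (Re (dser (\<lambda>n. of_real (c n) * of_real (ln (real n)) ^ m) 2))"
    and "Re (dser (\<lambda>n. of_real (c n) * of_real (ln (real n)) ^ m) 2) \<ge> 0"
proof -
  let ?D = "dser (\<lambda>n. of_real (c n) * of_real (ln (real n)) ^ m) 2"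
  have t: "of_real (c n) * of_real (ln (real n)) ^ m * of_nat n powr (-2) = complex_of_real (c n * ln (real n) ^ m * real n powr (-2))" for n
    using powr_of_real[of "real n" "-2"] by simp
  have "(\<lambda>n. of_real (c n) * of_real (ln (real n)) ^ m * of_nat n powr (-2)) sums ?D"
    by (rule dser_sums[OF subpoly_ln_power[OF assms(1)]]) simp
  then have *: "(\<lambda>n. complex_of_real (c n * ln (real n) ^ m * real n powr (-2))) sums ?D" unfolding t .
  from sums_Re[OF *] show 1: "(\<lambda>n. c n * ln (real n) ^ m * real n powr (-2)) sums Re ?D" by simp
  from sums_Im[OF *] have "(\<lambda>n. 0::real) sums Im ?D" by simp
  then have "Im ?D = 0" using sums_unique by fastforce
  then show "?D = of_real (Re ?D)" by (simp add: complex_eq_iff)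
  have nn: "c n * ln (real n) ^ m * real n powr (-2) \<ge> 0" for n
  proof (cases "n = 0")
    case False
    then show ?thesis using assms(2)[of n] by (intro mult_nonneg_nonneg) auto
  qed simp
  show "Re ?D \<ge> 0" by (rule sums_le[OF _ sums_zero 1]) (rule nn)
qed

text \<open>The Taylor coefficients at 2 of a Dirichlet series with nonnegative coefficients alternate in sign,
  and exponentiation preserves this.\<close>

lemma exp_dser_deriv_signs:
  assumes c: "subpoly (\<lambda>n. of_real (c n))" "\<And>n. c n \<ge> 0"
    and F: "\<And>s. Re s > 1 \<Longrightarrow> F s = exp (dser (\<lambda>n. of_real (c n)) s)"
  shows "\<exists>b. (\<forall>m. (-1) ^ m * (deriv ^^ m) F 2 = of_real (b m) \<and> b m \<ge> 0
      \<and> b m \<ge> Re (dser (\<lambda>n. of_real (c n) * of_real (ln (real n)) ^ m) 2)) \<and> b 0 \<ge> 1"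
proof -
  let ?G = "dser (\<lambda>n. of_real (c n))" and ?S = "{s. Re s > 1}"
  define g where "g m = Re (dser (\<lambda>n. of_real (c n) * of_real (ln (real n)) ^ m) 2)" for m
  have g: "(deriv ^^ m) ?G 2 = (-1) ^ m * of_real (g m)" "g m \<ge> 0" for m
    using dser_higher_deriv[OF c(1), of 2 m] nonneg_real_dser(2,3)[OF c, of m] by (simp_all add: g_def)
  have Gh: "?G holomorphic_on ?S" by (rule dser_holomorphic[OF c(1)])
  have "(\<lambda>s. exp (?G s)) holomorphic_on ?S" by (intro holomorphic_intros Gh)
  then have Fh: "F holomorphic_on ?S" by (rule holomorphic_transform) (simp add: F)
  have F2: "F 2 = of_real (exp (g 0))" using F[of 2] g(1)[of 0] by (simp add: exp_of_real)
  have dF: "deriv F s = deriv ?G s * F s" if "Re s > 1" for s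
  proof -
    have ev: "eventually (\<lambda>w. F w = exp (?G w)) (nhds s)"
      using eventually_nhds_in_open[OF open_Re_gt[of 1], of s] that by (auto elim!: eventually_mono simp: F)
    have "(?G has_field_derivative deriv ?G s) (at s)"
      using Gh that open_Re_gt by (intro holomorphic_derivI[of _ ?S]) auto
    then have "((\<lambda>w. exp (?G w)) has_field_derivative exp (?G s) * deriv ?G s) (at s)"
      by (rule DERIV_fun_exp)
    then show ?thesis using deriv_cong_ev[OF ev refl] F[OF that] by (simp add: DERIV_imp_deriv mult_ac)
  qed
  \<comment> \<open>Leibniz' rule for F' = G' F expresses a derivative of F at 2 by derivatives of G
    and lower derivatives of F, all of known sign.\<close>
  have rec: "(deriv ^^ Suc m) F 2 = (\<Sum>i=0..m. of_nat (m choose i) * (deriv ^^ Suc i) ?G 2 * (deriv ^^ (m - i)) F 2)" for m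
  proof -
    have "(deriv ^^ Suc m) F 2 = (deriv ^^ m) (deriv F) 2" by (simp only: funpow_Suc_right o_def)
    also have "\<dots> = (deriv ^^ m) (\<lambda>s. deriv ?G s * F s) 2"
    proof (rule higher_deriv_transform_within_open[of _ ?S])
      show "deriv F holomorphic_on ?S" using Fh open_Re_gt by (rule holomorphic_deriv)
      show "(\<lambda>s. deriv ?G s * F s) holomorphic_on ?S" by (intro holomorphic_intros Gh Fh open_Re_gt)
    qed (use dF open_Re_gt in auto)
    also have "\<dots> = (\<Sum>i=0..m. of_nat (m choose i) * (deriv ^^ i) (deriv ?G) 2 * (deriv ^^ (m - i)) F 2)"
      by (rule higher_deriv_mult[of _ ?S]) (use Gh Fh open_Re_gt in \<open>auto intro: holomorphic_deriv\<close>)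
    finally show ?thesis by (simp only: funpow_Suc_right o_def)
  qed
  have main: "\<exists>r\<ge>0. (-1) ^ m * (deriv ^^ m) F 2 = of_real r \<and> r \<ge> g m" for m
  proof (induction m rule: less_induct)
    case (less m)
    show ?case
    proof (cases m)
      case 0
      have "g 0 \<le> exp (g 0)" using exp_ge_add_one_self[of "g 0"] by linarith
      then show ?thesis using F2 0 by (intro exI[of _ "exp (g 0)"]) auto
    next
      case (Suc k)
      have "\<forall>i\<in>{0..k}. \<exists>r\<ge>0. (-1) ^ (k - i) * (deriv ^^ (k - i)) F 2 = of_real r"
        using less.IH Suc by (metis diff_le_self le_imp_less_Suc)
      then obtain r where r: "\<And>i. i \<le> k \<Longrightarrow> r i \<ge> 0" "\<And>i. i \<le> k \<Longrightarrow> (-1) ^ (k - i) * (deriv ^^ (k - i)) F 2 = complex_of_real (r i)"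
        by (metis atLeastAtMost_iff le0)
      have rk: "r k = exp (g 0)"
      proof -
        have "complex_of_real (r k) = of_real (exp (g 0))" using r(2)[of k] F2 by simp
        then show ?thesis by (simp only: of_real_eq_iff)
      qed
      have "(-1) ^ m * (deriv ^^ m) F 2 = (\<Sum>i=0..k. of_real (real (k choose i) * g (Suc i) * r i))"
        unfolding Suc rec sum_distrib_left
      proof (intro sum.cong refl)
        fix i assume "i \<in> {0..k}"
        then have i: "i \<le> k" by simp
        have s: "(-1::complex) ^ Suc k = (-1) ^ Suc i * (-1) ^ (k - i)" using i by (simp flip: power_add)
        have "(-1) ^ Suc k * (of_nat (k choose i) * (deriv ^^ Suc i) ?G 2 * (deriv ^^ (k - i)) F 2)
            = of_nat (k choose i) * ((-1) ^ Suc i * (deriv ^^ Suc i) ?G 2) * ((-1) ^ (k - i) * (deriv ^^ (k - i)) F 2)"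
          unfolding s by (simp only: mult_ac)
        also have "(-1) ^ Suc i * (deriv ^^ Suc i) ?G 2 = of_real (g (Suc i))"
          unfolding g(1) by (simp flip: mult.assoc power_add)
        finally show "(-1) ^ Suc k * (of_nat (k choose i) * (deriv ^^ Suc i) ?G 2 * (deriv ^^ (k - i)) F 2)
            = of_real (real (k choose i) * g (Suc i) * r i)" using r(2)[OF i] by simp
      qed
      also have "\<dots> = of_real (\<Sum>i=0..k. real (k choose i) * g (Suc i) * r i)" by simp
      finally have eq: "(-1) ^ m * (deriv ^^ m) F 2 = of_real (\<Sum>i=0..k. real (k choose i) * g (Suc i) * r i)" .
      have nn: "real (k choose i) * g (Suc i) * r i \<ge> 0" if "i \<in> {0..k}" for i
        using that r(1) g(2) by (intro mult_nonneg_nonneg) auto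
      \<comment> \<open>The term i = k alone is \<open>g m\<close> times F 2 = exp (g 0) >= 1; the
        other terms are nonnegative.\<close>
      have "g m \<le> real (k choose k) * g (Suc k) * r k"
        using Suc rk g(2)[of m] g(2)[of 0] mult_left_mono[of 1 "exp (g 0)" "g m"] by simp
      also have "\<dots> \<le> (\<Sum>i=0..k. real (k choose i) * g (Suc i) * r i)"
        by (rule member_le_sum) (use nn in auto)
      finally have ge: "g m \<le> (\<Sum>i=0..k. real (k choose i) * g (Suc i) * r i)" .
      show ?thesis using eq ge sum_nonneg[OF nn]
        by (intro exI[of _ "\<Sum>i=0..k. real (k choose i) * g (Suc i) * r i"] conjI) assumption+
    qed
  qed
  then obtain b where b: "\<And>m. b m \<ge> 0" "\<And>m. (-1) ^ m * (deriv ^^ m) F 2 = complex_of_real (b m)" "\<And>m. b m \<ge> g m"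
    by metis
  have "b 0 = exp (g 0)"
  proof -
    have "complex_of_real (b 0) = of_real (exp (g 0))" using b(2)[of 0] F2 by simp
    then show ?thesis by (simp only: of_real_eq_iff)
  qed
  then have "b 0 \<ge> 1" using g(2)[of 0] by simp
  with b show ?thesis unfolding g_def by blast
qed

lemma higher_deriv_pole:
  assumes "Re s > 1"
  shows "(deriv ^^ m) (\<lambda>s. 1 / (s - 1)) s = (-1) ^ m * fact m / (s - 1) ^ Suc m"
  using assms
proof (induction m arbitrary: s)
  case (Suc m)
  have "eventually (\<lambda>w. w \<in> {s. Re s > 1}) (nhds s)"
    by (rule eventually_nhds_in_open) (use Suc.prems open_Re_gt in auto)
  then have "eventually (\<lambda>w. (deriv ^^ m) (\<lambda>s. 1 / (s - 1)) w = (-1) ^ m * fact m / (w - 1) ^ Suc m) (nhds s)"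
    by eventually_elim (use Suc.IH in auto)
  then have "deriv ((deriv ^^ m) (\<lambda>s. 1 / (s - 1))) s = deriv (\<lambda>w. (-1) ^ m * fact m / (w - 1) ^ Suc m) s"
    by (rule deriv_cong_ev) simp
  also have "\<dots> = (-1) ^ Suc m * fact (Suc m) / (s - 1) ^ Suc (Suc m)"
  proof (rule DERIV_imp_deriv)
    have ne: "s - 1 \<noteq> 0" using Suc.prems by auto
    have d: "((\<lambda>w. (w - 1) ^ Suc m) has_field_derivative of_nat (Suc m) * (s - 1) ^ m) (at s)"
    proof -
      have "((\<lambda>w. w - 1) has_field_derivative 1) (at s)" by (auto intro!: derivative_eq_intros)
      from DERIV_power[OF this, of "Suc m"] show ?thesis by (simp only: mult_1 diff_Suc_Suc diff_zero)
    qed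
    have nz: "(s - 1) ^ Suc m \<noteq> 0" using ne by simp
    have alg: "(-1) ^ m * fact m * - (of_nat (Suc m) * z ^ m * inverse ((z ^ Suc m) ^ Suc (Suc 0))) = (-1) ^ Suc m * fact (Suc m) * inverse (z ^ Suc (Suc m))"
      if "z \<noteq> 0" for z :: complex using that by (simp add: field_simps)
    show "((\<lambda>w. (-1) ^ m * fact m / (w - 1) ^ Suc m) has_field_derivative (-1) ^ Suc m * fact (Suc m) / (s - 1) ^ Suc (Suc m)) (at s)"
      unfolding divide_inverse
      by (rule DERIV_cong[OF DERIV_cmult[OF DERIV_inverse_fun[OF d nz]]]) (rule alg[OF ne])
  qed
  finally show ?case by simp
qed simp

text \<open>\<Phi> is W/(s - 1) with the polar part \<kappa>/(s - 1) subtracted, hence holomorphic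
  on the whole half-plane. At 2 the Taylor coefficients of W/(s - 1) alternate in sign, and those of
  the polar part are known exactly.\<close>

lemma estermann_setup:
  assumes W: "W holomorphic_on {s. Re s > 0}"
    and c: "subpoly (\<lambda>n. of_real (c n))" "\<And>n. c n \<ge> 0"
    and eq: "\<And>s. Re s > 1 \<Longrightarrow> W s = (s - 1) * exp (dser (\<lambda>n. of_real (c n)) s)"
    and W1: "W 1 = of_real \<kappa>"
  obtains b \<Phi> where "\<Phi> holomorphic_on {s. Re s > 0}" "\<And>s. s \<noteq> 1 \<Longrightarrow> \<Phi> s = (W s - of_real \<kappa>) / (s - 1)"
    "\<And>m. (deriv ^^ m) \<Phi> 2 = (-1) ^ m * of_real (b m - \<kappa> * fact m)" "b 0 \<ge> 1" "\<And>m. b m \<ge> 0"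
    "\<And>m. b m \<ge> Re (dser (\<lambda>n. of_real (c n) * of_real (ln (real n)) ^ m) 2)"
proof -
  define \<Phi> where "\<Phi> = (\<lambda>z. if z = 1 then deriv W 1 else (W z - W 1) / (z - 1))"
  define F where "F s = W s / (s - 1)" for s
  have "\<Phi> holomorphic_on {s. Re s > 0}"
    unfolding \<Phi>_def by (rule pole_lemma[OF W]) (simp add: interior_open[OF open_Re_gt])
  have Fe: "F s = exp (dser (\<lambda>n. of_real (c n)) s)" if "Re s > 1" for s
  proof -
    have "s \<noteq> 1" using that by auto
    then show ?thesis using eq[OF that] by (simp add: F_def)
  qed
  obtain b where b: "\<And>m. (-1) ^ m * (deriv ^^ m) F 2 = of_real (b m)" "\<And>m. b m \<ge> 0"
      "\<And>m. b m \<ge> Re (dser (\<lambda>n. of_real (c n) * of_real (ln (real n)) ^ m) 2)" "b 0 \<ge> 1"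
    using exp_dser_deriv_signs[OF c Fe] by blast
  let ?S = "{s. Re s > 1}"
  have sub: "?S \<subseteq> {s. Re s > 0}" by auto
  have ne: "s \<noteq> 1" if "s \<in> ?S" for s using that by auto
  have Fh: "F holomorphic_on ?S" unfolding F_def
    using ne by (intro holomorphic_intros holomorphic_on_subset[OF W sub]) auto
  have Ph: "(\<lambda>s. 1 / (s - 1)) holomorphic_on ?S" using ne by (intro holomorphic_intros) auto
  have "(deriv ^^ m) \<Phi> 2 = (-1) ^ m * of_real (b m - \<kappa> * fact m)" for m
  proof -
    have "(deriv ^^ m) \<Phi> 2 = (deriv ^^ m) (\<lambda>s. F s - of_real \<kappa> * (1 / (s - 1))) 2"
    proof (rule higher_deriv_transform_within_open[of _ ?S])
      show "\<Phi> holomorphic_on ?S" using \<open>\<Phi> holomorphic_on _\<close> sub holomorphic_on_subset by blast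
      show "(\<lambda>s. F s - of_real \<kappa> * (1 / (s - 1))) holomorphic_on ?S" by (intro holomorphic_intros Fh Ph)
      fix w assume "w \<in> ?S"
      then show "\<Phi> w = F w - of_real \<kappa> * (1 / (w - 1))" using ne[of w] W1 by (simp add: \<Phi>_def F_def diff_divide_distrib)
    qed (use open_Re_gt in auto)
    also have "\<dots> = (deriv ^^ m) F 2 - of_real \<kappa> * (deriv ^^ m) (\<lambda>s. 1 / (s - 1)) 2"
      by (subst higher_deriv_diff[of _ ?S], (use Fh Ph open_Re_gt in \<open>auto intro!: holomorphic_intros\<close>)[4])
         (subst higher_deriv_cmult[of _ ?S], use Ph open_Re_gt in auto)
    also have "(deriv ^^ m) (\<lambda>s. 1 / (s - 1)) 2 = (-1) ^ m * (fact m :: complex)" using higher_deriv_pole[of 2 m] by simp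
    also have "(deriv ^^ m) F 2 = (-1) ^ m * of_real (b m)" unfolding b(1)[symmetric] by (simp flip: mult.assoc power_add)
    finally show ?thesis by (simp add: algebra_simps)
  qed
  with that[of \<Phi> b] b \<open>\<Phi> holomorphic_on _\<close> W1 show ?thesis by (simp add: \<Phi>_def)
qed

lemma ball_2_subset: "r \<le> 7/4 \<Longrightarrow> cball 2 r \<subseteq> {s. Re s > 0}"
proof
  fix s :: complex assume "r \<le> 7/4" "s \<in> cball 2 r"
  then show "s \<in> {s. Re s > 0}" using abs_Re_le_cmod[of "2 - s"] by (auto simp: dist_norm)
qed

text \<open>Expand \<Phi> at 2 and evaluate at \<beta>. Cauchy's estimate makes the terms from M on
  negligible, the first M terms give at least 1 minus \<kappa> times a geometric sum in y = 2 -
  \<beta>, and the sign of W at \<beta> bounds \<Phi> there by \<kappa>/(1 - \<beta>). Together (1 -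
  \<beta>)/2 <= \<kappa> y^M. As M has the size of log B, y^M is at most a power of B with exponent
  proportional to 1 - \<beta>.\<close>

lemma estermann:
  assumes W: "W holomorphic_on {s. Re s > 0}"
    and c: "subpoly (\<lambda>n. of_real (c n))" "\<And>n. c n \<ge> 0"
    and eq: "\<And>s. Re s > 1 \<Longrightarrow> W s = (s - 1) * exp (dser (\<lambda>n. of_real (c n)) s)"
    and W1: "W 1 = of_real \<kappa>"
    and B: "\<And>s. s \<in> cball 2 (3/2) \<Longrightarrow> norm (W s) \<le> B" "B \<ge> 1"
    and \<beta>: "3/4 \<le> \<beta>" "\<beta> < 1" "Re (W (of_real \<beta>)) \<ge> 0"
  shows "\<kappa> \<ge> (1 - \<beta>) / 6 * (48 * B) powr (- 6 * (1 - \<beta>))"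
proof -
  obtain b \<Phi> where P: "\<Phi> holomorphic_on {s. Re s > 0}" "\<And>s. s \<noteq> 1 \<Longrightarrow> \<Phi> s = (W s - of_real \<kappa>) / (s - 1)"
    "\<And>m. (deriv ^^ m) \<Phi> 2 = (-1) ^ m * of_real (b m - \<kappa> * fact m)" "b 0 \<ge> 1" "\<And>m. b m \<ge> 0"
    "\<And>m. b m \<ge> Re (dser (\<lambda>n. of_real (c n) * of_real (ln (real n)) ^ m) 2)"
    by (rule estermann_setup[OF W c _ W1], erule eq, rule that, assumption+)
  define y where "y = 2 - \<beta>"
  have y: "1 < y" "y \<le> 5/4" using \<beta> by (auto simp: y_def)
  define u where "u m = (b m / fact m - \<kappa>) * y ^ m" for m
  have ball: "ball 2 (7/4) \<subseteq> {s. Re s > 0}" using ball_2_subset[of "7/4"] ball_subset_cball by blast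
  have us: "u sums Re (\<Phi> (of_real \<beta>))"
  proof -
    have "(\<lambda>m. (deriv ^^ m) \<Phi> 2 / fact m * (of_real \<beta> - 2) ^ m) sums \<Phi> (of_real \<beta>)"
      by (rule holomorphic_power_series[where r = "7/4"])
         (use P(1) ball holomorphic_on_subset \<beta> in \<open>auto simp: dist_norm norm_complex_def\<close>)
    moreover have "(deriv ^^ m) \<Phi> 2 / fact m * (of_real \<beta> - 2) ^ m = complex_of_real (u m)" for m
    proof -
      have "(of_real \<beta> - 2 :: complex) ^ m = (-1) ^ m * of_real (y ^ m)"
        unfolding y_def by (simp flip: power_mult_distrib)
      then have "(deriv ^^ m) \<Phi> 2 / fact m * (of_real \<beta> - 2) ^ m = ((-1) ^ m * (-1) ^ m) * (of_real ((b m - \<kappa> * fact m) / fact m * y ^ m))"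
        unfolding P(3) by (simp add: mult_ac)
      also have "(-1) ^ m * (-1) ^ m = (1::complex)" by (simp flip: power_add)
      also have "(b m - \<kappa> * fact m) / fact m = b m / fact m - \<kappa>" by (simp add: field_simps)
      finally show ?thesis by (simp add: u_def)
    qed
    ultimately have "(\<lambda>m. complex_of_real (u m)) sums \<Phi> (of_real \<beta>)" by simp
    from sums_Re[OF this] show ?thesis by simp
  qed
  have \<kappa>B: "\<bar>\<kappa>\<bar> \<le> B" using B(1)[of 1] W1 by (simp add: dist_norm)
  \<comment> \<open>On the circle of radius 3/2 about 2 the numerator W - \<kappa> is at most 2 B
    and norm (x - 1) >= 1/2. With y <= 5/4 the ratio is (5/4)/(3/2) = 5/6.\<close>
  have ub: "\<bar>u m\<bar> \<le> 4 * B * (5/6) ^ m" for m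
  proof -
    have "norm ((deriv ^^ m) \<Phi> 2) \<le> fact m * (4 * B) / (3/2) ^ m"
    proof (rule Cauchy_inequality)
      have "cball 2 (3/2) \<subseteq> {s. Re s > 0}" by (rule ball_2_subset) simp
      then have "\<Phi> holomorphic_on cball 2 (3/2)" using P(1) holomorphic_on_subset by blast
      then show "\<Phi> holomorphic_on ball 2 (3/2)" "continuous_on (cball 2 (3/2)) \<Phi>"
        using holomorphic_on_subset ball_subset_cball holomorphic_on_imp_continuous_on by blast+
      fix x :: complex assume x: "norm (2 - x) = 3/2"
      have x1: "norm (x - 1) \<ge> 1/2" using norm_triangle_ineq2[of "2 - x" 1] x by (simp add: norm_minus_commute)
      then have "x \<noteq> 1" by auto
      have "norm (\<Phi> x) = norm (W x - of_real \<kappa>) / norm (x - 1)" using P(2)[OF \<open>x \<noteq> 1\<close>] by (simp add: norm_divide)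
      also have "\<dots> \<le> (2 * B) / (1/2)"
      proof (rule frac_le)
        have "norm (W x) \<le> B" using x by (intro B) (simp add: dist_norm)
        then show "norm (W x - of_real \<kappa>) \<le> 2 * B"
          using norm_triangle_ineq4[of "W x" "of_real \<kappa>"] \<kappa>B by simp
      qed (use x1 B in auto)
      finally show "norm (\<Phi> x) \<le> 4 * B" by simp
    qed simp
    moreover have "norm ((deriv ^^ m) \<Phi> 2) = \<bar>b m - \<kappa> * fact m\<bar>" unfolding P(3) by (simp only: norm_mult norm_power norm_minus_cancel norm_one power_one mult_1 norm_of_real)
    moreover have "\<bar>b m - \<kappa> * fact m\<bar> = fact m * \<bar>b m / fact m - \<kappa>\<bar>"
    proof -
      have "b m - \<kappa> * fact m = fact m * (b m / fact m - \<kappa>)" by (simp add: right_diff_distrib)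
      then show ?thesis by (simp only: abs_mult abs_of_nonneg[OF fact_ge_zero])
    qed
    ultimately have "fact m * \<bar>b m / fact m - \<kappa>\<bar> \<le> fact m * (4 * B / (3/2) ^ m)"
      by (simp only: times_divide_eq_right)
    then have "\<bar>b m / fact m - \<kappa>\<bar> \<le> 4 * B / (3/2) ^ m"
      using mult_le_cancel_left_pos[OF fact_gt_zero] by blast
    then have "\<bar>u m\<bar> \<le> 4 * B / (3/2) ^ m * (5/4) ^ m"
      unfolding u_def abs_mult using y by (intro mult_mono) (auto simp: power_mono)
    also have "\<dots> = 4 * B * ((5/4) / (3/2)) ^ m" unfolding power_divide by (simp add: mult_ac)
    finally show ?thesis by simp
  qed
  \<comment> \<open>The tail sums to 24 B (5/6)^M. This is at most 1/2 once M >= 6 ln (48 B),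
    because ln (5/6) <= -1/6.\<close>
  define M where "M = nat \<lceil>6 * ln (48 * B)\<rceil>"
  have Mge: "real M \<ge> 6 * ln (48 * B)" unfolding M_def by linarith
  have "ln (48 * B) \<ge> 0" using B by simp
  then have Mle: "real M \<le> 6 * ln (48 * B) + 1" unfolding M_def by linarith
  have "ln (5/6::real) \<le> 5/6 - 1" by (intro ln_le_minus_one) simp
  have tail: "24 * B * (5/6) ^ M \<le> 1/2"
  proof -
    have "(5/6::real) ^ M = exp (real M * ln (5/6))" by (simp add: exp_of_nat_mult)
    also have "\<dots> \<le> exp (- ln (48 * B))"
    proof -
      have "real M * ln (5/6) \<le> real M * (- 1/6)" using \<open>ln (5/6::real) \<le> _\<close> by (intro mult_left_mono) auto
      then show ?thesis using Mge by simp
    qed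
    also have "\<dots> = 1 / (48 * B)" using B by (simp add: exp_minus field_simps)
    finally have "24 * B * (5/6) ^ M \<le> 24 * B * (1 / (48 * B))" using B by (intro mult_left_mono) auto
    then show ?thesis using B by simp
  qed
  have "Re (\<Phi> (of_real \<beta>)) = (\<Sum>m. u (m + M)) + (\<Sum>m<M. u m)"
    using suminf_split_initial_segment[OF sums_summable[OF us], of M] sums_unique[OF us] by simp
  moreover have "\<bar>\<Sum>m. u (m + M)\<bar> \<le> 24 * B * (5/6) ^ M"
  proof -
    have gs: "(\<lambda>m. 4 * B * (5/6) ^ M * (5/6) ^ m) sums (4 * B * (5/6) ^ M * 6)"
      using sums_mult[OF geometric_sums[of "5/6::real"], of "4 * B * (5/6) ^ M"] by simp
    have "norm (\<Sum>m. u (m + M)) \<le> (\<Sum>m. 4 * B * (5/6) ^ M * (5/6) ^ m)"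
    proof (intro norm_suminf_le sums_summable[OF gs])
      fix m show "norm (u (m + M)) \<le> 4 * B * (5/6) ^ M * (5/6) ^ m" using ub[of "m + M"] by (simp add: power_add mult_ac)
    qed
    then show ?thesis using sums_unique[OF gs] by simp
  qed
  moreover have "(\<Sum>m<M. u m) \<ge> 1 - \<kappa> * (y ^ M - 1) / (y - 1)"
  proof -
    have "M > 0"
    proof -
      have "48 * B > 1" using B by simp
      then have "6 * ln (48 * B) > 0" by simp
      then show ?thesis unfolding M_def by linarith
    qed
    have "(\<Sum>m<M. u m) = (\<Sum>m<M. b m / fact m * y ^ m) - \<kappa> * (\<Sum>m<M. y ^ m)"
      by (simp add: u_def left_diff_distrib sum_subtractf sum_distrib_left)
    moreover have "1 \<le> (\<Sum>m<M. b m / fact m * y ^ m)"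
    proof -
      have "b 0 / fact 0 * y ^ 0 \<le> (\<Sum>m<M. b m / fact m * y ^ m)"
        by (rule member_le_sum) (use \<open>M > 0\<close> P(5) y in auto)
      then show ?thesis using P(4) by simp
    qed
    moreover have "(\<Sum>m<M. y ^ m) = (y ^ M - 1) / (y - 1)" using y by (simp add: geometric_sum)
    ultimately show ?thesis by simp
  qed
  ultimately have "Re (\<Phi> (of_real \<beta>)) \<ge> 1/2 - \<kappa> * (y ^ M - 1) / (y - 1)" using tail by linarith
  moreover have "Re (\<Phi> (of_real \<beta>)) \<le> \<kappa> / (y - 1)"
  proof -
    have "complex_of_real \<beta> \<noteq> 1" using \<beta> by auto
    then have "\<Phi> (of_real \<beta>) = (W (of_real \<beta>) - of_real \<kappa>) / of_real (\<beta> - 1)" by (simp add: P(2))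
    then have "Re (\<Phi> (of_real \<beta>)) = (Re (W (of_real \<beta>)) - \<kappa>) / (\<beta> - 1)" by (simp add: Re_divide_of_real)
    also have "\<dots> = (\<kappa> - Re (W (of_real \<beta>))) / (y - 1)" using \<beta> by (simp add: y_def divide_simps) (simp add: algebra_simps)
    also have "\<dots> \<le> \<kappa> / (y - 1)" using \<beta> y by (intro divide_right_mono) auto
    finally show ?thesis .
  qed
  ultimately have "1/2 \<le> \<kappa> * (y ^ M - 1) / (y - 1) + \<kappa> / (y - 1)" by linarith
  also have "\<dots> = \<kappa> * y ^ M / (y - 1)" unfolding add_divide_distrib[symmetric] by (simp add: algebra_simps)
  finally have half: "(1 - \<beta>) / 2 \<le> \<kappa> * y ^ M" using y by (simp add: y_def field_simps)
  have ypos: "y ^ M > 0" using y by simp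
  have "y ^ M \<le> exp (real M * (1 - \<beta>))"
  proof -
    have "y \<le> exp (1 - \<beta>)" using exp_ge_add_one_self[of "1 - \<beta>"] by (simp add: y_def)
    then show ?thesis using y by (simp add: exp_of_nat_mult power_mono)
  qed
  also have "\<dots> \<le> exp (6 * (1 - \<beta>) * ln (48 * B) + 1)"
  proof -
    have "real M * (1 - \<beta>) \<le> (6 * ln (48 * B) + 1) * (1 - \<beta>)" using Mle \<beta> by (intro mult_right_mono) auto
    also have "\<dots> \<le> 6 * (1 - \<beta>) * ln (48 * B) + 1" using \<beta> by (simp add: algebra_simps)
    finally show ?thesis by simp
  qed
  also have "\<dots> = exp 1 * (48 * B) powr (6 * (1 - \<beta>))" using B by (simp add: powr_def exp_add mult_ac)
  \<comment> \<open>Rounding M up costs at most exp 1 <= 3, whence the denominator 6 = 2 * 3 in the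
    statement.\<close>
  also have "\<dots> \<le> 3 * (48 * B) powr (6 * (1 - \<beta>))" using exp_le by (intro mult_right_mono) auto
  finally have yM: "y ^ M \<le> 3 * (48 * B) powr (6 * (1 - \<beta>))" .
  have lpos: "\<kappa> > 0"
  proof (rule ccontr)
    assume "\<not> \<kappa> > 0"
    then have "\<kappa> * y ^ M \<le> 0" using ypos by (simp add: mult_nonpos_nonneg)
    then show False using half \<beta> by simp
  qed
  have "(1 - \<beta>) / 2 \<le> \<kappa> * (3 * (48 * B) powr (6 * (1 - \<beta>)))"
    using half mult_left_mono[OF yM, of \<kappa>] lpos by linarith
  then have "(1 - \<beta>) / 6 / (48 * B) powr (6 * (1 - \<beta>)) \<le> \<kappa>"
    using B by (simp add: field_simps)
  moreover have "(48 * B) powr (- 6 * (1 - \<beta>)) = 1 / (48 * B) powr (6 * (1 - \<beta>))"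
    using powr_minus_divide[of "48 * B" "6 * (1 - \<beta>)"] by simp
  ultimately show ?thesis by simp
qed


section \<open>Nonvanishing at s = 1\<close>

lemma lcoef_square_ge: "lcoef (n * n) \<ge> lcoef n / 2"
proof (cases "primepow n")
  case True
  then obtain p k where p: "prime p" "k > 0" "n = p ^ k" by (auto simp: primepow_def)
  then have nn: "n * n = p ^ (k + k)" by (simp add: power_add)
  have "mangoldt (n * n) = (mangoldt n :: real)" unfolding nn using p by (simp only: mangoldt_primepow')
  moreover have "ln (real (n * n)) = 2 * ln (real n)"
    using p by (simp add: ln_mult prime_gt_0_nat)
  ultimately show ?thesis by (simp add: lcoef_def)
next
  case False
  then show ?thesis using lcoef_nonneg[of "n * n"] by (simp add: lcoef_def mangoldt_def)
qed

text \<open>If W 1 = 0, then W/(s - 1) is holomorphic on Re s > 0 and its Taylor series at 2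
  converges at 1/2. Since the coefficients have known sign, this bounds the Dirichlet series of c at
  1/2. There the squares alone contribute half of the series of log zeta at 1, which would be
  bounded, contrary to \<open>Zf 1 = 1\<close>.\<close>

lemma landau_nonvanishing:
  assumes W: "W holomorphic_on {s. Re s > 0}"
    and c: "subpoly (\<lambda>n. of_real (c n))" "\<And>n. c n \<ge> 0"
    and eq: "\<And>s. Re s > 1 \<Longrightarrow> W s = (s - 1) * exp (dser (\<lambda>n. of_real (c n)) s)"
    and sq: "\<And>n. c (n * n) \<ge> lcoef n / 2"
  shows "W 1 \<noteq> 0"
proof
  assume "W 1 = 0"
  then have W1: "W 1 = of_real 0" by simp
  obtain b \<Phi> where P: "\<Phi> holomorphic_on {s. Re s > 0}" "\<And>s. s \<noteq> 1 \<Longrightarrow> \<Phi> s = (W s - of_real 0) / (s - 1)"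
    "\<And>m. (deriv ^^ m) \<Phi> 2 = (-1) ^ m * of_real (b m - 0 * fact m)" "b 0 \<ge> 1" "\<And>m. b m \<ge> 0"
    "\<And>m. b m \<ge> Re (dser (\<lambda>n. of_real (c n) * of_real (ln (real n)) ^ m) 2)"
    by (rule estermann_setup[OF W c _ W1], erule eq, rule that, assumption+)
  define u where "u m = b m / fact m * (3/2) ^ m" for m
  have ball: "ball 2 (7/4) \<subseteq> {s. Re s > 0}" using ball_2_subset[of "7/4"] ball_subset_cball by blast
  define K where "K = Re (\<Phi> (1/2))"
  have us: "u sums K"
  proof -
    have "(\<lambda>m. (deriv ^^ m) \<Phi> 2 / fact m * (1/2 - 2) ^ m) sums \<Phi> (1/2)"
      by (rule holomorphic_power_series[where r = "7/4"])
         (use P(1) ball holomorphic_on_subset in \<open>auto simp: dist_norm\<close>)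
    moreover have "(deriv ^^ m) \<Phi> 2 / fact m * (1/2 - 2) ^ m = complex_of_real (u m)" for m
    proof -
      have "(1/2 - 2 :: complex) ^ m = (-1) ^ m * of_real ((3/2) ^ m)"
        by (simp flip: power_mult_distrib)
      then have "(deriv ^^ m) \<Phi> 2 / fact m * (1/2 - 2) ^ m = ((-1) ^ m * (-1) ^ m) * (of_real (b m / fact m * (3/2) ^ m))"
        unfolding P(3) by (simp add: mult_ac)
      also have "(-1) ^ m * (-1) ^ m = (1::complex)" by (simp flip: power_add)
      finally show ?thesis by (simp add: u_def)
    qed
    ultimately have "(\<lambda>m. complex_of_real (u m)) sums \<Phi> (1/2)" by simp
    from sums_Re[OF this] show ?thesis by (simp add: K_def)
  qed
  \<comment> \<open>As 3/2 = 2 - 1/2, expanding n^(3/2) in powers of log n turns the sum at 1/2 into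
    logarithmic moments at 2, each of which is dominated by \<open>b m\<close>.\<close>
  have part: "(\<Sum>n=1..N. c n * real n powr (-1/2)) \<le> K" for N
  proof -
    have "(\<lambda>m. \<Sum>n=1..N. c n * real n powr (-2) * (((3/2) * ln (real n)) ^ m /\<^sub>R fact m)) sums
        (\<Sum>n=1..N. c n * real n powr (-2) * exp ((3/2) * ln (real n)))"
      by (intro sums_sum sums_mult exp_converges)
    moreover have "c n * real n powr (-2) * exp ((3/2) * ln (real n)) = c n * real n powr (-1/2)" if "n \<in> {1..N}" for n
    proof -
      have "exp ((3/2) * ln (real n)) = real n powr (3/2)" using that by (simp add: powr_def)
      then show ?thesis by (simp add: mult.assoc flip: powr_add)
    qed
    then have "(\<Sum>n=1..N. c n * real n powr (-2) * exp ((3/2) * ln (real n))) = (\<Sum>n=1..N. c n * real n powr (-1/2))"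
      by (rule sum.cong[OF refl])
    ultimately have S: "(\<lambda>m. \<Sum>n=1..N. c n * real n powr (-2) * (((3/2) * ln (real n)) ^ m /\<^sub>R fact m)) sums
        (\<Sum>n=1..N. c n * real n powr (-1/2))" by (simp only:)
    show ?thesis
    proof (rule sums_le[OF _ S us])
      fix m
      have nn: "c n * ln (real n) ^ m * real n powr (-2) \<ge> 0" for n
      proof (cases "n = 0")
        case False
        then show ?thesis using c(2)[of n] by (intro mult_nonneg_nonneg) auto
      qed simp
      have "(\<Sum>n=1..N. c n * real n powr (-2) * (((3/2) * ln (real n)) ^ m /\<^sub>R fact m))
         = (3/2) ^ m / fact m * (\<Sum>n=1..N. c n * ln (real n) ^ m * real n powr (-2))"
        by (simp add: sum_distrib_left power_mult_distrib field_simps)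
      also have "\<dots> \<le> (3/2) ^ m / fact m * b m"
      proof (rule mult_left_mono)
        have S: "(\<lambda>n. c n * ln (real n) ^ m * real n powr (-2)) sums Re (dser (\<lambda>n. of_real (c n) * of_real (ln (real n)) ^ m) 2)"
          by (rule nonneg_real_dser(1)[OF c])
        have "(\<Sum>n=1..N. c n * ln (real n) ^ m * real n powr (-2)) \<le> (\<Sum>n. c n * ln (real n) ^ m * real n powr (-2))"
          by (rule sum_le_suminf) (use nn sums_summable[OF S] in auto)
        then show "(\<Sum>n=1..N. c n * ln (real n) ^ m * real n powr (-2)) \<le> b m" using sums_unique[OF S] P(6)[of m] by linarith
      qed simp
      also have "\<dots> = u m" by (simp add: u_def)
      finally show "(\<Sum>n=1..N. c n * real n powr (-2) * (((3/2) * ln (real n)) ^ m /\<^sub>R fact m)) \<le> u m" .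
    qed
  qed
  have sqpart: "(\<Sum>n=1..N. lcoef n / real n) \<le> 2 * K" for N
  proof -
    have "(\<Sum>n=1..N. lcoef n / real n) \<le> (\<Sum>n=1..N. 2 * (c (n * n) * real (n * n) powr (-1/2)))"
    proof (rule sum_mono)
      fix n assume n: "n \<in> {1..N}"
      have "real (n * n) powr (-1/2) = 1 / real n"
        using n by (simp add: powr_minus_divide powr_half_sqrt real_sqrt_mult)
      moreover have "lcoef n / real n \<le> 2 * c (n * n) / real n" using sq[of n] by (intro divide_right_mono) auto
      ultimately show "lcoef n / real n \<le> 2 * (c (n * n) * real (n * n) powr (-1/2))" by simp
    qed
    also have "\<dots> = 2 * (\<Sum>k\<in>(\<lambda>n. n * n) ` {1..N}. c k * real k powr (-1/2))"
      by (subst sum.reindex) (auto simp: sum_distrib_left inj_on_def power2_eq_square[symmetric])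
    also have "(\<Sum>k\<in>(\<lambda>n. n * n) ` {1..N}. c k * real k powr (-1/2)) \<le> (\<Sum>k=1..N * N. c k * real k powr (-1/2))"
      by (rule sum_mono2) (use c in \<open>auto intro: mult_le_mono\<close>)
    also have "\<dots> \<le> K" by (rule part)
    finally show ?thesis by simp
  qed
  \<comment> \<open>log zeta stays below 2 K to the right of 1, so \<open>Zf\<close>, which is
    (\<sigma> - 1) zeta there, would tend to 0 at 1.\<close>
  have zb: "norm (Zf (of_real \<sigma>)) \<le> (\<sigma> - 1) * exp (2 * K)" if \<sigma>: "\<sigma> > 1" for \<sigma>
  proof -
    have "logL (\<lambda>_. 1) (of_real \<sigma>) = dser (\<lambda>n. of_real (lcoef n)) (of_real \<sigma>)" by (simp add: logL_def)
    have "(\<lambda>n. of_real (lcoef n) * 1 * of_nat n powr (- complex_of_real \<sigma>)) sums logL (\<lambda>_. 1) (of_real \<sigma>)"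
      unfolding logL_def by (rule dser_sums[OF subpoly_lcoef[OF cmult_one]]) (use \<sigma> in simp)
    moreover have "of_real (lcoef n) * 1 * of_nat n powr (- complex_of_real \<sigma>) = of_real (lcoef n * real n powr (-\<sigma>))" for n
      using powr_of_real[of "real n" "-\<sigma>"] by simp
    ultimately have "(\<lambda>n. complex_of_real (lcoef n * real n powr (-\<sigma>))) sums logL (\<lambda>_. 1) (of_real \<sigma>)" by (simp only:)
    from sums_Re[OF this] have S: "(\<lambda>n. lcoef n * real n powr (-\<sigma>)) sums Re (logL (\<lambda>_. 1) (of_real \<sigma>))" by simp
    have "(\<Sum>n<N. lcoef n * real n powr (-\<sigma>)) \<le> 2 * K" for N
    proof -
      have "(\<Sum>n<N. lcoef n * real n powr (-\<sigma>)) \<le> (\<Sum>n<N. lcoef n / real n)"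
      proof (rule sum_mono)
        fix n
        show "lcoef n * real n powr (-\<sigma>) \<le> lcoef n / real n"
        proof (cases "n = 0")
          case False
          then have "real n powr (-\<sigma>) \<le> real n powr (-1)" using \<sigma> by (intro powr_mono) auto
          then have "lcoef n * real n powr (-\<sigma>) \<le> lcoef n * real n powr (-1)" by (rule mult_left_mono[OF _ lcoef_nonneg])
          then show ?thesis using False by (simp add: powr_minus_divide)
        qed simp
      qed
      also have "\<dots> \<le> (\<Sum>n=1..N. lcoef n / real n)"
        by (rule sum_mono2[THEN order_trans, of "{0..N}"])
           (auto simp: lcoef_nonneg sum.atLeast_Suc_atMost[of 0] intro!: order_refl)
      finally show ?thesis using sqpart[of N] by linarith
    qed
    then have "Re (logL (\<lambda>_. 1) (of_real \<sigma>)) \<le> 2 * K"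
      using S unfolding sums_def by (intro LIMSEQ_le_const2) auto
    then have "norm (zeta (of_real \<sigma>)) \<le> exp (2 * K)"
      using L_eq_exp_logL[OF cmult_one, of "of_real \<sigma>"] \<sigma> by simp
    then have "norm (of_real (\<sigma> - 1) * zeta (of_real \<sigma>)) \<le> (\<sigma> - 1) * exp (2 * K)"
      unfolding norm_mult norm_of_real using \<sigma> by simp
    then show ?thesis using Zf_eq[of "of_real \<sigma>"] \<sigma> by simp
  qed
  have cont: "isCont Zf 1"
    using continuous_on_eq_continuous_at[OF open_Re_gt[of 0], of Zf] holomorphic_on_imp_continuous_on[OF Zf_holomorphic] by simp
  have "((\<lambda>\<sigma>. norm (Zf (of_real \<sigma>))) \<longlongrightarrow> norm (Zf (of_real 1))) (at_right 1)"
    using cont by (intro tendsto_intros isCont_tendsto_compose[of _ Zf]) (auto intro!: tendsto_intros)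
  moreover have "((\<lambda>\<sigma>. (\<sigma> - 1) * exp (2 * K)) \<longlongrightarrow> (1 - 1) * exp (2 * K)) (at_right 1)"
    by (intro tendsto_intros)
  moreover have "eventually (\<lambda>\<sigma>. norm (Zf (of_real \<sigma>)) \<le> (\<sigma> - 1) * exp (2 * K)) (at_right 1)"
    unfolding eventually_at_right_field using zb by (intro exI[of _ 2]) auto
  ultimately have "norm (Zf (of_real 1)) \<le> (1 - 1) * exp (2 * K)"
    by (intro tendsto_le[OF trivial_limit_at_right_real])
  then show False by (simp add: Zf_1)
qed

section \<open>Siegel's theorem\<close>

text \<open>q is any modulus and not the conductor, so characters to different moduli may agree
  outside finitely many primes; this is the case treated in \<open>zero_transfer\<close>.\<close>

definition rchar :: "nat \<Rightarrow> (nat \<Rightarrow> complex) \<Rightarrow> bool" where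
  "rchar q \<xi> \<longleftrightarrow> q > 0 \<and> dchar q \<xi> \<and> nonprincipal q \<xi> \<and> (\<forall>n. Im (\<xi> n) = 0)"

lemma dchar_cmult: assumes "q > 0" "dchar q \<xi>" shows "cmult \<xi>"
  by (rule cmultI) (use assms in \<open>auto simp: dchar_1 dchar_mult dchar_norm\<close>)

lemma dchar_psb: "q > 0 \<Longrightarrow> dchar q \<xi> \<Longrightarrow> nonprincipal q \<xi> \<Longrightarrow> psb (real q) \<xi>"
  using nonprincipal_partial_sums by (simp add: psb_def)

lemma rchar_cmult: "rchar q \<xi> \<Longrightarrow> cmult \<xi>" and rchar_psb: "rchar q \<xi> \<Longrightarrow> psb (real q) \<xi>"
  and rchar_q: "rchar q \<xi> \<Longrightarrow> real q \<ge> 1" and rchar_Im: "rchar q \<xi> \<Longrightarrow> Im (\<xi> n) = 0"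
  by (auto simp: rchar_def intro: dchar_cmult dchar_psb)

lemma rchar_Re: assumes "rchar q \<xi>" shows "\<xi> n = of_real (Re (\<xi> n))" "\<bar>Re (\<xi> n)\<bar> \<le> 1"
  using rchar_Im[OF assms, of n] cmult_norm[OF rchar_cmult[OF assms], of n] abs_Re_le_cmod[of "\<xi> n"]
  by (auto simp: complex_eq_iff)

lemma real_dser_Im:
  assumes "\<And>n. Im (\<xi> n) = 0" "(\<lambda>n. \<xi> n * of_nat n powr (- complex_of_real x)) sums dser \<xi> (of_real x)"
  shows "Im (dser \<xi> (of_real x)) = 0"
proof -
  have "Im (\<xi> n * of_nat n powr (- complex_of_real x)) = 0" for n
    using powr_of_real[of "real n" "-x"] assms(1)[of n] by simp
  with sums_Im[OF assms(2)] have "(\<lambda>n. 0::real) sums Im (dser \<xi> (of_real x))" by simp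
  then show ?thesis using sums_unique by fastforce
qed

lemma rchar_L_real: assumes "rchar q \<xi>" "x > 0" shows "Im (dser \<xi> (of_real x)) = 0"
  by (rule real_dser_Im[OF rchar_Im[OF assms(1)] psb_sums(1)[OF rchar_psb[OF assms(1)]]]) (use assms in simp)

lemma Zf_real: assumes "x > 0" shows "Im (Zf (of_real x)) = 0"
proof -
  have "Im (zpart N (of_real x)) = 0" for N
  proof -
    have "zpart N (of_real x) = of_real ((x - 1) * (\<Sum>n=1..N. real n powr (-x)) + real (Suc N) powr (1 - x))"
      using powr_of_real[of "real _" "-x"] powr_of_real[of "real (Suc N)" "1 - x"] unfolding zpart_def by simp
    then show ?thesis by simp
  qed
  moreover have "(\<lambda>N. Im (zpart N (of_real x))) \<longlonglongrightarrow> Im (Zf (of_real x))"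
    using Zf_bound(1)[of "of_real x"] assms by (intro tendsto_intros) simp
  ultimately show ?thesis by (simp add: LIMSEQ_const_iff)
qed

lemma cball_2_bounds:
  assumes "s \<in> cball 2 (3/2 :: real)"
  shows "1 - 1/2 \<le> Re s" "Re s \<le> 4" "2 + \<bar>Im s\<bar> \<le> 4" "norm (s - 1) \<le> 5/2"
proof -
  have n: "norm (s - 2) \<le> 3/2" using assms by (simp add: dist_norm norm_minus_commute)
  have R: "\<bar>Re s - 2\<bar> \<le> 3/2" "\<bar>Im s\<bar> \<le> 3/2" using abs_Re_le_cmod[of "s - 2"] abs_Im_le_cmod[of "s - 2"] n by auto
  show "1 - 1/2 \<le> Re s" "Re s \<le> 4" "2 + \<bar>Im s\<bar> \<le> 4" using R by linarith+
  show "norm (s - 1) \<le> 5/2" using norm_triangle_ineq[of "s - 2" 1] n by simp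
qed

lemma psb_bound_cball:
  assumes "psb q \<xi>" "q \<ge> 1" "cmult \<xi>" "s \<in> cball 2 (3/2)"
  shows "norm (dser \<xi> s) \<le> 60 * q"
proof -
  note b = cball_2_bounds[OF assms(4)]
  have "norm (dser \<xi> s) \<le> (13 + 1 / (1/2)) * (q * (2 + \<bar>Im s\<bar>)) powr (2 * (1/2))"
    by (rule psb_bound) (use assms b cmult_norm in auto)
  also have "\<dots> = 15 * (q * (2 + \<bar>Im s\<bar>))" using assms(2) by simp
  also have "\<dots> \<le> 15 * (q * 4)" using b assms(2) by (intro mult_left_mono) auto
  finally show ?thesis by simp
qed

lemma Zf_bound_cball: assumes "s \<in> cball 2 (3/2)" shows "norm (Zf s) \<le> 210"
proof -
  note b = cball_2_bounds[OF assms]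
  have "norm (Zf s) \<le> (13 + 1 / (1/2)) * (1 + norm (s - 1)) * (2 + \<bar>Im s\<bar>) powr (2 * (1/2))"
    by (rule Zf_norm_bound) (use b in auto)
  also have "\<dots> = 15 * ((1 + norm (s - 1)) * (2 + \<bar>Im s\<bar>))" by simp
  also have "\<dots> \<le> 15 * ((1 + 5/2) * 4)" using b by (intro mult_left_mono mult_mono) auto
  finally show ?thesis by simp
qed

lemma subpoly_real_bounded: "(\<And>n. \<bar>c n\<bar> \<le> C) \<Longrightarrow> subpoly (\<lambda>n. of_real (c n))"
  by (rule subpoly_bounded[of _ C]) simp

text \<open>The logarithm of zeta times L has the coefficients \<open>lcoef n\<close> times 1 +
  \<xi> n, which are nonnegative; on squares \<xi> is itself nonnegative, which Landau's argument
  uses.\<close>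

lemma one_char_setup:
  assumes \<xi>: "rchar q \<xi>"
  defines "c \<equiv> \<lambda>n. lcoef n * (1 + Re (\<xi> n))"
  shows "(\<lambda>s. Zf s * dser \<xi> s) holomorphic_on {s. Re s > 0}"
    "subpoly (\<lambda>n. of_real (c n))" "\<And>n. c n \<ge> 0"
    "\<And>s. Re s > 1 \<Longrightarrow> Zf s * dser \<xi> s = (s - 1) * exp (dser (\<lambda>n. of_real (c n)) s)"
    "\<And>n. c (n * n) \<ge> lcoef n / 2"
proof -
  note R = rchar_Re[OF \<xi>]
  show "(\<lambda>s. Zf s * dser \<xi> s) holomorphic_on {s. Re s > 0}"
    by (intro holomorphic_intros Zf_holomorphic psb_holomorphic[OF rchar_psb[OF \<xi>]])
  have R1: "0 \<le> 1 + Re (\<xi> n)" "1 + Re (\<xi> n) \<le> 2" for n using R(2)[of n] by auto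
  show c0: "c n \<ge> 0" for n unfolding c_def using lcoef_nonneg R1 by simp
  show sp: "subpoly (\<lambda>n. of_real (c n))"
  proof (rule subpoly_real_bounded)
    fix n
    have "c n \<le> 1 * 2" unfolding c_def using lcoef_nonneg lcoef_le_1 R1 by (intro mult_mono) auto
    then show "\<bar>c n\<bar> \<le> 2" using c0[of n] by simp
  qed
  show "Zf s * dser \<xi> s = (s - 1) * exp (dser (\<lambda>n. of_real (c n)) s)" if s: "Re s > 1" for s
  proof -
    have "dser (\<lambda>n. of_real (c n)) s = dser (\<lambda>n. of_real (lcoef n) * 1 + of_real (lcoef n) * \<xi> n) s"
    proof (rule dser_cong)
      fix n
      obtain r where "\<xi> n = of_real r" using R(1)[of n] by blast
      then show "complex_of_real (c n) = of_real (lcoef n) * 1 + of_real (lcoef n) * \<xi> n" by (simp add: c_def distrib_left)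
    qed
    also have "\<dots> = logL (\<lambda>_. 1) s + logL \<xi> s"
      unfolding logL_def by (intro dser_add subpoly_lcoef cmult_one rchar_cmult[OF \<xi>] s)
    finally show ?thesis using L_eq_exp_logL[OF cmult_one s] L_eq_exp_logL[OF rchar_cmult[OF \<xi>] s] Zf_eq[OF s]
      by (simp add: exp_add)
  qed
  show "c (n * n) \<ge> lcoef n / 2" for n
  proof -
    have "Re (\<xi> (n * n)) = Re (\<xi> n) * Re (\<xi> n)"
      using cmult_mult[OF rchar_cmult[OF \<xi>], of n n] rchar_Im[OF \<xi>, of n] by simp
    then have "Re (\<xi> (n * n)) \<ge> 0" by simp
    then have "lcoef (n * n) * 1 \<le> c (n * n)" unfolding c_def using lcoef_nonneg by (intro mult_left_mono) auto
    then show ?thesis using lcoef_square_ge[of n] by simp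
  qed
qed

lemma rchar_L1_nonzero: assumes "rchar q \<xi>" shows "dser \<xi> 1 \<noteq> 0"
  using landau_nonvanishing[OF one_char_setup[OF assms]] by (simp add: Zf_1)

lemma rchar_L_pos_gt1: assumes \<xi>: "rchar q \<xi>" and x: "x > 1" shows "Re (dser \<xi> (of_real x)) > 0"
proof -
  have s: "Re (of_real x) > 1" using x by simp
  have "Im (logL \<xi> (of_real x)) = 0"
    unfolding logL_def
    by (rule real_dser_Im[OF _ dser_sums[OF subpoly_lcoef[OF rchar_cmult[OF \<xi>]] s]]) (simp add: rchar_Im[OF \<xi>])
  then show ?thesis using L_eq_exp_logL[OF rchar_cmult[OF \<xi>] s] by (simp add: Re_exp)
qed

lemma rchar_L_continuous: assumes "rchar q \<xi>" shows "continuous_on {x. x > 0} (\<lambda>x. Re (dser \<xi> (of_real x)))"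
  by (intro continuous_intros continuous_on_compose2[OF holomorphic_on_imp_continuous_on[OF psb_holomorphic[OF rchar_psb[OF assms]]]]) auto

text \<open>L is real and continuous on the positive axis, nonzero at 1 and positive beyond 1, so
  without a zero in [b, 1) it cannot be nonpositive at b.\<close>

lemma rchar_L_pos:
  assumes \<xi>: "rchar q \<xi>" and b: "0 < b" and nz: "\<And>x. b \<le> x \<Longrightarrow> x < 1 \<Longrightarrow> dser \<xi> (of_real x) \<noteq> 0"
  shows "Re (dser \<xi> (of_real b)) > 0"
proof (rule ccontr)
  assume "\<not> ?thesis"
  then have le: "Re (dser \<xi> (of_real b)) \<le> 0" by simp
  then have "b \<le> 2" using rchar_L_pos_gt1[OF \<xi>, of b] by (cases "b > 1") auto
  have "\<exists>x\<ge>b. x \<le> 2 \<and> Re (dser \<xi> (of_real x)) = 0"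
  proof (rule IVT')
    show "0 \<le> Re (dser \<xi> (of_real 2))" using rchar_L_pos_gt1[OF \<xi>, of 2] by simp
    show "continuous_on {b..2} (\<lambda>x. Re (dser \<xi> (of_real x)))"
      by (rule continuous_on_subset[OF rchar_L_continuous[OF \<xi>]]) (use b in auto)
  qed (use le \<open>b \<le> 2\<close> in auto)
  then obtain x where x: "x \<ge> b" "Re (dser \<xi> (of_real x)) = 0" by blast
  then have z: "dser \<xi> (of_real x) = 0" using rchar_L_real[OF \<xi>, of x] b by (simp add: complex_eq_iff)
  consider "x < 1" | "x = 1" | "x > 1" by linarith
  then show False
  proof cases
    case 1 then show ?thesis using nz x z by simp
  next
    case 2 then show ?thesis using rchar_L1_nonzero[OF \<xi>] z by simp
  next
    case 3 then show ?thesis using rchar_L_pos_gt1[OF \<xi> 3] x by simp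
  qed
qed

lemma rchar_L1_pos: assumes "rchar q \<xi>" shows "Re (dser \<xi> 1) > 0"
  using rchar_L_pos[OF assms, of 1] by simp

lemma rchar_L1_eq: assumes "rchar q \<xi>" shows "dser \<xi> 1 = of_real (Re (dser \<xi> 1))"
  using rchar_L_real[OF assms, of 1] by (simp add: complex_eq_iff)

text \<open>Estermann's bound for zeta times L, whose residue at 1 is L(1). The constant 12600 = 210
  * 60 bounds the two factors on the disc.\<close>

lemma siegel_one:
  assumes \<xi>: "rchar q \<xi>" and \<beta>: "3/4 \<le> \<beta>" "\<beta> < 1" "Re (Zf (of_real \<beta>)) \<ge> 0" "Re (dser \<xi> (of_real \<beta>)) \<ge> 0"
  shows "Re (dser \<xi> 1) \<ge> (1 - \<beta>) / 6 * (48 * (12600 * real q)) powr (- 6 * (1 - \<beta>))"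
proof (rule estermann[OF one_char_setup(1-4)[OF \<xi>]])
  show "Zf 1 * dser \<xi> 1 = of_real (Re (dser \<xi> 1))" using rchar_L1_eq[OF \<xi>] by (simp add: Zf_1)
  show "norm (Zf s * dser \<xi> s) \<le> 12600 * real q" if "s \<in> cball 2 (3/2)" for s
  proof -
    have "norm (Zf s) * norm (dser \<xi> s) \<le> 210 * (60 * real q)"
      using that by (intro mult_mono Zf_bound_cball psb_bound_cball rchar_psb[OF \<xi>] rchar_q[OF \<xi>] rchar_cmult[OF \<xi>]) auto
    then show ?thesis by (simp add: norm_mult)
  qed
  show "1 \<le> 12600 * real q" using rchar_q[OF \<xi>] by simp
  have "Im (Zf (of_real \<beta>)) = 0" using \<beta> by (intro Zf_real) auto
  then show "0 \<le> Re (Zf (of_real \<beta>) * dser \<xi> (of_real \<beta>))" using \<beta> by simp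
qed (use \<beta> in auto)

text \<open>The product of zeta and three L-functions has a logarithm with coefficients
  \<open>lcoef n\<close> times (1 + \<xi> n)(1 + \<psi> n) >= 0. A zero of one factor at \<beta>
  makes the sign condition there automatic, whatever \<psi> is. 45360000 = 210 * 60^3, and the
  moduli enter as q, r and q r.\<close>

lemma siegel_two:
  assumes \<xi>: "rchar q \<xi>" and \<psi>: "rchar r \<psi>" and p: "rchar (q * r) (\<lambda>n. \<xi> n * \<psi> n)"
    and \<beta>: "3/4 \<le> \<beta>" "\<beta> < 1" "dser \<xi> (of_real \<beta>) = 0"
  shows "Re (dser \<xi> 1) * Re (dser \<psi> 1) * Re (dser (\<lambda>n. \<xi> n * \<psi> n) 1)
     \<ge> (1 - \<beta>) / 6 * (48 * (45360000 * (real q * real r) ^ 2)) powr (- 6 * (1 - \<beta>))"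
proof -
  let ?\<theta> = "\<lambda>n. \<xi> n * \<psi> n"
  define c where "c n = lcoef n * ((1 + Re (\<xi> n)) * (1 + Re (\<psi> n)))" for n
  let ?W = "\<lambda>s. Zf s * dser \<xi> s * dser \<psi> s * dser ?\<theta> s"
  note R = rchar_Re[OF \<xi>] and R' = rchar_Re[OF \<psi>]
  have R1: "0 \<le> 1 + Re (\<xi> n)" "1 + Re (\<xi> n) \<le> 2" "0 \<le> 1 + Re (\<psi> n)" "1 + Re (\<psi> n) \<le> 2" for n using R(2)[of n] R'(2)[of n] by auto
  have c0: "c n \<ge> 0" for n unfolding c_def using lcoef_nonneg R1 by simp
  have sp: "subpoly (\<lambda>n. of_real (c n))"
  proof (rule subpoly_real_bounded)
    fix n
    have "c n \<le> 1 * (2 * 2)" unfolding c_def using lcoef_nonneg lcoef_le_1 R1 by (intro mult_mono) auto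
    then show "\<bar>c n\<bar> \<le> 4" using c0[of n] by simp
  qed
  note cm = cmult_one rchar_cmult[OF \<xi>] rchar_cmult[OF \<psi>] rchar_cmult[OF p]
  have eq: "?W s = (s - 1) * exp (dser (\<lambda>n. of_real (c n)) s)" if s: "Re s > 1" for s
  proof -
    have "dser (\<lambda>n. of_real (c n)) s = dser (\<lambda>n. of_real (lcoef n) * 1 + (of_real (lcoef n) * \<xi> n + (of_real (lcoef n) * \<psi> n + of_real (lcoef n) * (\<xi> n * \<psi> n)))) s"
    proof (rule dser_cong)
      fix n
      obtain r t where "\<xi> n = of_real r" "\<psi> n = of_real t" using R(1)[of n] R'(1)[of n] by blast
      then show "complex_of_real (c n) = of_real (lcoef n) * 1 + (of_real (lcoef n) * \<xi> n + (of_real (lcoef n) * \<psi> n + of_real (lcoef n) * (\<xi> n * \<psi> n)))"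
        by (simp add: c_def algebra_simps)
    qed
    also have "\<dots> = logL (\<lambda>_. 1) s + (logL \<xi> s + (logL \<psi> s + logL ?\<theta> s))"
      unfolding logL_def using s cm by (simp only: dser_add subpoly_lcoef subpoly_add)
    finally show ?thesis using cm[THEN L_eq_exp_logL, OF s] Zf_eq[OF s]
      by (simp add: exp_add)
  qed
  have "Re (dser \<xi> 1) * Re (dser \<psi> 1) * Re (dser ?\<theta> 1) \<ge> (1 - \<beta>) / 6 * (48 * (45360000 * (real q * real r) ^ 2)) powr (- 6 * (1 - \<beta>))"
  proof (rule estermann[OF _ sp c0 eq])
    show "?W holomorphic_on {s. Re s > 0}"
      by (intro holomorphic_intros Zf_holomorphic psb_holomorphic[OF rchar_psb[OF \<xi>]] psb_holomorphic[OF rchar_psb[OF \<psi>]] psb_holomorphic[OF rchar_psb[OF p]])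
    have "?W 1 = of_real (Re (dser \<xi> 1)) * of_real (Re (dser \<psi> 1)) * of_real (Re (dser ?\<theta> 1))"
      using rchar_L1_eq[OF \<xi>] rchar_L1_eq[OF \<psi>] rchar_L1_eq[OF p] by (simp only: Zf_1 mult_1)
    then show "?W 1 = of_real (Re (dser \<xi> 1) * Re (dser \<psi> 1) * Re (dser ?\<theta> 1))" by simp
    show "norm (?W s) \<le> 45360000 * (real q * real r) ^ 2" if "s \<in> cball 2 (3/2)" for s
    proof -
      have "norm (Zf s) * norm (dser \<xi> s) * norm (dser \<psi> s) * norm (dser ?\<theta> s) \<le> 210 * (60 * real q) * (60 * real r) * (60 * real (q * r))"
        using that rchar_q[OF \<xi>] rchar_q[OF \<psi>]
        by (intro mult_mono Zf_bound_cball psb_bound_cball rchar_psb[OF \<xi>] rchar_psb[OF \<psi>] rchar_psb[OF p] rchar_q[OF \<xi>] rchar_q[OF \<psi>] rchar_q[OF p] cm mult_nonneg_nonneg) auto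
      then show ?thesis by (simp add: norm_mult power2_eq_square mult_ac)
    qed
    have "1 \<le> real q * real r" using rchar_q[OF p] by simp
    then have "1 \<le> (real q * real r) ^ 2" by (rule one_le_power)
    then show "1 \<le> 45360000 * (real q * real r) ^ 2" by simp
    show "0 \<le> Re (?W (of_real \<beta>))" using \<beta> by simp
  qed (use \<beta> in auto)
  then show ?thesis .
qed

section \<open>Euler factors and zeros common to two characters\<close>

lemma euler_factor_step:
  assumes \<xi>: "cmult \<xi>" and p: "prime p" and s: "Re s > 1"
  shows "dser (\<lambda>n. if p dvd n then 0 else \<xi> n) s = (1 - \<xi> p * of_nat p powr (-s)) * dser \<xi> s"
proof -
  let ?f = "\<lambda>n. \<xi> n * of_nat n powr (-s)"
  have S: "?f sums dser \<xi> s" by (rule dser_sums[OF cmult_subpoly[OF \<xi>] s])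
  have "(\<lambda>n. \<xi> p * of_nat p powr (-s) * ?f n) sums (\<xi> p * of_nat p powr (-s) * dser \<xi> s)"
    by (rule sums_mult[OF S])
  moreover have "\<xi> p * of_nat p powr (-s) * ?f n = ?f (p * n)" for n
    using powr_times_real[of "of_nat p" "of_nat n" "-s"] by (simp add: cmult_mult[OF \<xi>])
  ultimately have "(\<lambda>n. ?f (p * n)) sums (\<xi> p * of_nat p powr (-s) * dser \<xi> s)" by simp
  then have "(\<lambda>n. (if p dvd p * n then ?f (p * n) else 0)) sums (\<xi> p * of_nat p powr (-s) * dser \<xi> s)" by simp
  then have "(\<lambda>n. (if p dvd n then ?f n else 0)) sums (\<xi> p * of_nat p powr (-s) * dser \<xi> s)"
    by (subst (asm) sums_mono_reindex[of "\<lambda>n. p * n" "\<lambda>n. if p dvd n then ?f n else 0"])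
       (use p in \<open>auto simp: strict_mono_def prime_gt_0_nat elim!: dvdE\<close>)
  from sums_diff[OF S this] have "(\<lambda>n. ?f n - (if p dvd n then ?f n else 0)) sums ((1 - \<xi> p * of_nat p powr (-s)) * dser \<xi> s)"
    by (simp add: algebra_simps)
  moreover have "(\<lambda>n. ?f n - (if p dvd n then ?f n else 0)) = (\<lambda>n. (if p dvd n then 0 else \<xi> n) * of_nat n powr (-s))" by auto
  ultimately show ?thesis unfolding dser_def by (metis (no_types, lifting) sums_unique)
qed

lemma cmult_remove_prime: assumes \<xi>: "cmult \<xi>" and p: "prime p" shows "cmult (\<lambda>n. if p dvd n then 0 else \<xi> n)"
proof (rule cmultI)
  show "(if p dvd Suc 0 then 0 else \<xi> (Suc 0)) = 1" using p cmult_1[OF \<xi>] by auto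
qed (use p cmult_norm[OF \<xi>] in \<open>auto simp: prime_dvd_mult_iff cmult_mult[OF \<xi>]\<close>)

text \<open>The coefficients stay completely multiplicative when the multiples of a prime are
  removed, so primes can be removed one at a time.\<close>

lemma euler_factors:
  assumes \<xi>: "cmult \<xi>" and P: "finite P" "\<And>p. p \<in> P \<Longrightarrow> prime p" and s: "Re s > 1"
  shows "cmult (\<lambda>n. if \<exists>p\<in>P. p dvd n then 0 else \<xi> n) \<and>
    dser (\<lambda>n. if \<exists>p\<in>P. p dvd n then 0 else \<xi> n) s = (\<Prod>p\<in>P. 1 - \<xi> p * of_nat p powr (-s)) * dser \<xi> s"
  using P
proof (induction P rule: finite_induct)
  case empty
  then show ?case using \<xi> by simp
next
  case (insert p P)
  let ?g = "\<lambda>n. if \<exists>p\<in>P. p dvd n then 0 else \<xi> n"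
  have IH: "cmult ?g" "dser ?g s = (\<Prod>p\<in>P. 1 - \<xi> p * of_nat p powr (-s)) * dser \<xi> s" using insert by auto
  have p: "prime p" using insert by simp
  have "\<not> (\<exists>r\<in>P. r dvd p)" using insert.hyps insert.prems p by (metis insertCI primes_dvd_imp_eq)
  then have gp: "?g p = \<xi> p" by simp
  have fe: "(\<lambda>n. if p dvd n then 0 else ?g n) = (\<lambda>n. if \<exists>p\<in>insert p P. p dvd n then 0 else \<xi> n)" by auto
  have "dser (\<lambda>n. if p dvd n then 0 else ?g n) s = (1 - \<xi> p * of_nat p powr (-s)) * dser ?g s"
    using euler_factor_step[OF IH(1) p s] unfolding gp .
  then show ?case using IH(2) cmult_remove_prime[OF IH(1) p] insert.hyps unfolding fe by (simp add: mult.assoc)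
qed

text \<open>If the product is principal, \<xi> and \<psi> agree at all n coprime to q r, so their
  L-functions differ only by Euler factors at primes dividing q r. The identity continues from Re s
  > 1 to Re s > 0, and these factors do not vanish on the positive axis.\<close>

lemma zero_transfer:
  assumes \<xi>: "rchar q \<xi>" and \<psi>: "rchar r \<psi>" and np: "\<not> nonprincipal (q * r) (\<lambda>n. \<xi> n * \<psi> n)"
    and \<beta>: "\<beta> > 0" "dser \<xi> (of_real \<beta>) = 0"
  shows "dser \<psi> (of_real \<beta>) = 0"
proof -
  have pos: "q > 0" "r > 0" and d: "dchar q \<xi>" "dchar r \<psi>" using \<xi> \<psi> by (auto simp: rchar_def)
  let ?P = "prime_factors q" and ?P' = "prime_factors r"
  let ?E = "\<lambda>s. \<Prod>p\<in>?P'. 1 - \<xi> p * of_nat p powr (-s)" and ?E' = "\<lambda>s. \<Prod>p\<in>?P. 1 - \<psi> p * of_nat p powr (-s)"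
  have cop: "(\<exists>p\<in>prime_factors m. p dvd n) \<longleftrightarrow> \<not> coprime n m" if m: "m > 0" for m n :: nat
  proof
    assume "\<exists>p\<in>prime_factors m. p dvd n"
    then obtain p where "prime p" "p dvd m" "p dvd n" by (auto simp: in_prime_factors_iff)
    then show "\<not> coprime n m" using coprime_common_divisor[of n m p] not_prime_unit by blast
  next
    assume "\<not> coprime n m"
    then obtain p where "prime p" "p dvd gcd n m" 
      using prime_factor_nat[of "gcd n m"] coprime_iff_gcd_eq_1[of n m] by blast
    then show "\<exists>p\<in>prime_factors m. p dvd n" using m by (auto simp: in_prime_factors_iff)
  qed
  have eqf: "(if \<exists>p\<in>?P'. p dvd n then 0 else \<xi> n) = (if \<exists>p\<in>?P. p dvd n then 0 else \<psi> n)" for n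
  proof -
    have "\<xi> n = \<psi> n" if "coprime n q" "coprime n r"
    proof -
      have "\<xi> n * \<psi> n = 1" using np that by (auto simp: nonprincipal_def)
      moreover have "\<psi> n * \<psi> n = 1"
      proof -
        obtain t where t: "\<psi> n = of_real t" using rchar_Re(1)[OF \<psi>, of n] by blast
        then have "\<bar>t\<bar> = 1" using dchar_norm[OF pos(2) d(2), of n] that by simp
        then have "t * t = 1" by (metis abs_mult_self mult_1)
        then show ?thesis using t by (simp flip: of_real_mult)
      qed
      ultimately show ?thesis by (metis mult.assoc mult.commute mult_1)
    qed
    then show ?thesis unfolding cop[OF pos(1)] cop[OF pos(2)] using dchar_nz[OF d(1), of n] dchar_nz[OF d(2), of n] by auto
  qed
  have ext: "?E s * dser \<xi> s = ?E' s * dser \<psi> s" if "Re s > 1" for s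
    using euler_factors[OF rchar_cmult[OF \<xi>] _ _ that, of ?P'] euler_factors[OF rchar_cmult[OF \<psi>] _ _ that, of ?P] eqf
    by (auto simp: in_prime_factors_iff)
  define h where "h s = ?E s * dser \<xi> s - ?E' s * dser \<psi> s" for s
  have "h (of_real \<beta>) = 0"
  proof (rule analytic_continuation[of h "{s. Re s > 0}" "{s. Re s > 1}" 2])
    show "h holomorphic_on {s. Re s > 0}" unfolding h_def
      by (intro holomorphic_intros npow_holomorphic psb_holomorphic[OF rchar_psb[OF \<xi>]] psb_holomorphic[OF rchar_psb[OF \<psi>]])
    show "connected {s. Re s > 0}" by (intro convex_connected convex_halfspace_Re_gt)
    show "2 islimpt {s. Re s > 1}" by (intro interior_limit_point) (simp add: interior_open open_Re_gt)
    show "h z = 0" if "z \<in> {s. Re s > 1}" for z using ext[of z] that by (simp add: h_def)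
  qed (use open_Re_gt \<beta> in auto)
  then have "?E' (of_real \<beta>) * dser \<psi> (of_real \<beta>) = 0" using \<beta> by (simp add: h_def)
  moreover have "?E' (of_real \<beta>) \<noteq> 0"
  proof -
    have "\<psi> p * of_nat p powr (- complex_of_real \<beta>) \<noteq> 1" if "p \<in> ?P" for p
    proof
      assume "\<psi> p * of_nat p powr (- complex_of_real \<beta>) = 1"
      then have "1 = norm (\<psi> p) * real p powr (-\<beta>)" using norm_npow[of p "of_real \<beta>"] by (metis Re_complex_of_real norm_mult norm_one)
      also have "\<dots> \<le> 1 * real p powr (-\<beta>)" by (intro mult_right_mono cmult_norm[OF rchar_cmult[OF \<psi>]]) simp
      also have "\<dots> < real p powr 0"
        using that prime_gt_1_nat[of p] \<beta> powr_less_mono[of "-\<beta>" 0 "real p"] by (auto simp: in_prime_factors_iff)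
      also have "\<dots> \<le> 1" by simp
      finally show False by simp
    qed
    then show ?thesis by auto
  qed
  ultimately show ?thesis by simp
qed


lemma siegel_product_char:
  assumes "rchar q \<xi>" "rchar r \<psi>" "nonprincipal (q * r) (\<lambda>n. \<xi> n * \<psi> n)"
  shows "rchar (q * r) (\<lambda>n. \<xi> n * \<psi> n)"
proof -
  have d: "q > 0" "r > 0" "dchar q \<xi>" "dchar r \<psi>" using assms by (auto simp: rchar_def)
  have "dchar (q * r) (\<lambda>n. \<xi> n * \<psi> n)"
  proof (rule dcharI)
    fix m n
    show "\<xi> (m * n) * \<psi> (m * n) = \<xi> m * \<psi> m * (\<xi> n * \<psi> n)" using dchar_mult[OF d(3)] dchar_mult[OF d(4)] by simp
    show "\<xi> m * \<psi> m = \<xi> n * \<psi> n" if "[m = n] (mod (q * r))"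
      using dchar_cong[OF d(3)] dchar_cong[OF d(4)] that cong_modulus_mult_nat[of m n q r] cong_modulus_mult_nat[of m n r q]
      by (metis mult.commute)
    show "(\<xi> n * \<psi> n \<noteq> 0) = coprime n (q * r)" using dchar_nz[OF d(3), of n] dchar_nz[OF d(4), of n] by auto
  qed
  moreover have "Im (\<xi> n * \<psi> n) = 0" for n using rchar_Im[OF assms(1)] rchar_Im[OF assms(2)] by simp
  ultimately show ?thesis using assms(3) d by (simp add: rchar_def)
qed

text \<open>Continuity together with \<open>Zf 1 = 1\<close>. It supplies the sign of the zeta
  factor at \<beta> that \<open>siegel_one\<close> asks for.\<close>

lemma Zf_positive_near_1: obtains \<eta> where "0 < \<eta>" "\<eta> \<le> 1/4" "\<And>x. 1 - \<eta> < x \<Longrightarrow> x < 1 \<Longrightarrow> Re (Zf (of_real x)) > 0"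
proof -
  have "isCont Zf 1"
    using continuous_on_eq_continuous_at[OF open_Re_gt[of 0], of Zf] holomorphic_on_imp_continuous_on[OF Zf_holomorphic] by simp
  then obtain d where d: "d > 0" "\<And>z. dist z 1 < d \<Longrightarrow> dist (Zf z) (Zf 1) < 1"
    unfolding continuous_at_eps_delta by (meson zero_less_one)
  show ?thesis
  proof (rule that[of "min d (1/4)"])
    fix x assume x: "1 - min d (1/4) < x" "x < 1"
    have "dist (complex_of_real x) 1 = \<bar>x - 1\<bar>" unfolding dist_norm by (metis norm_of_real of_real_1 of_real_diff)
    then have "norm (Zf (of_real x) - 1) < 1" using d(2)[of "of_real x"] x by (simp add: dist_norm Zf_1)
    then show "Re (Zf (of_real x)) > 0" using abs_Re_le_cmod[of "Zf (of_real x) - 1"] by simp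
  qed (use d in auto)
qed

text \<open>Either no real character has a zero in (1 - \<eta>, 1), and \<open>siegel_one\<close> at
  1 - \<eta>/2 serves for all of them; or one character \<xi>1 with such a zero \<beta> is fixed. In
  the second case \<open>siegel_two\<close> treats every \<xi> for which the product with \<xi>1 is
  nonprincipal; any other \<xi> inherits the zero, and \<open>siegel_one\<close> applies at \<beta>.
  The modulus of \<xi>1 is not controlled, so c is not effective.\<close>

theorem siegel:
  assumes "\<epsilon> > 0"
  shows "\<exists>c>0. \<forall>q \<xi>. rchar q \<xi> \<longrightarrow> Re (dser \<xi> 1) \<ge> c * real q powr (-\<epsilon>)"
proof -
  obtain \<eta>0 where \<eta>0: "0 < \<eta>0" "\<eta>0 \<le> 1/4" "\<And>x. 1 - \<eta>0 < x \<Longrightarrow> x < 1 \<Longrightarrow> Re (Zf (of_real x)) > 0"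
    using Zf_positive_near_1 by metis
  \<comment> \<open>With an exceptional zero, 12 \<eta> is lost because q^2 enters with the exponent
    6 (1 - \<beta>), and a further \<eta> through the upper bound for L(1) of the product character;
    13 \<eta> has to stay below \<epsilon>.\<close>
  define \<eta> where "\<eta> = min \<eta>0 (\<epsilon> / 14)"
  have \<eta>: "0 < \<eta>" "\<eta> \<le> 1/4" "14 * \<eta> \<le> \<epsilon>" using assms \<eta>0 by (auto simp: \<eta>_def)
  have Zpos: "Re (Zf (of_real x)) > 0" if "1 - \<eta> < x" "x < 1" for x using that \<eta>0(3)[of x] by (simp add: \<eta>_def)
  have one: "Re (dser \<xi> 1) \<ge> (1 - \<beta>) / 6 * 604800 powr (-6) * real q powr (-\<epsilon>)"
    if \<xi>: "rchar q \<xi>" and b: "1 - \<eta> < \<beta>" "\<beta> < 1" "Re (dser \<xi> (of_real \<beta>)) \<ge> 0" for q \<xi> \<beta>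
  proof -
    note q = rchar_q[OF \<xi>]
    have "(1 - \<beta>) / 6 * (48 * (12600 * real q)) powr (- 6 * (1 - \<beta>)) \<le> Re (dser \<xi> 1)"
      using b \<eta> Zpos[of \<beta>] by (intro siegel_one[OF \<xi>]) auto
    moreover have "(48 * (12600 * real q)) powr (- 6 * (1 - \<beta>)) = 604800 powr (- 6 * (1 - \<beta>)) * real q powr (- 6 * (1 - \<beta>))"
      using q by (simp add: powr_mult[symmetric])
    moreover have "604800 powr (-6) * real q powr (-\<epsilon>) \<le> 604800 powr (- 6 * (1 - \<beta>)) * real q powr (- 6 * (1 - \<beta>))"
      using b \<eta> q by (intro mult_mono powr_mono) auto
    then have "(1 - \<beta>) / 6 * (604800 powr (-6) * real q powr (-\<epsilon>)) \<le> (1 - \<beta>) / 6 * (604800 powr (- 6 * (1 - \<beta>)) * real q powr (- 6 * (1 - \<beta>)))"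
      using b by (intro mult_left_mono) auto
    ultimately show ?thesis by (simp add: mult.assoc)
  qed
  show ?thesis
  proof (cases "\<exists>q \<xi> \<beta>. rchar q \<xi> \<and> 1 - \<eta> < \<beta> \<and> \<beta> < 1 \<and> dser \<xi> (of_real \<beta>) = 0")
    case False
    show ?thesis
    proof (intro exI[of _ "(\<eta> / 2) / 6 * 604800 powr (-6)"] conjI allI impI)
      fix q \<xi> assume \<xi>: "rchar q \<xi>"
      have "Re (dser \<xi> (of_real (1 - \<eta> / 2))) > 0"
        by (rule rchar_L_pos[OF \<xi>]) (use False \<xi> \<eta> in auto)
      then show "(\<eta> / 2) / 6 * 604800 powr (-6) * real q powr (-\<epsilon>) \<le> Re (dser \<xi> 1)"
        using one[OF \<xi>, of "1 - \<eta> / 2"] \<eta> by simp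
    qed (use \<eta> in simp)
  next
    case True
    then obtain q1 \<xi>1 \<beta> where x1: "rchar q1 \<xi>1" "1 - \<eta> < \<beta>" "\<beta> < 1" "dser \<xi>1 (of_real \<beta>) = 0" by blast
    define l1 where "l1 = Re (dser \<xi>1 1)"
    have l1: "l1 > 0" using rchar_L1_pos[OF x1(1)] by (simp add: l1_def)
    note q1 = rchar_q[OF x1(1)]
    define K where "K = 48 * 45360000 * real q1 ^ 2"
    have K1: "K \<ge> 1" using one_le_power[OF q1, of 2] by (simp add: K_def)
    define D where "D = (13 + 1 / (\<eta> / 2)) * (real q1 * 2) powr \<eta>"
    have D: "D > 0" using \<eta> q1 by (simp add: D_def add_pos_pos)
    define c where "c = min ((1 - \<beta>) / 6 * 604800 powr (-6)) ((1 - \<beta>) / 6 * K powr (-6) / (l1 * D))"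
    have c: "c > 0" using x1 K1 l1 D by (simp add: c_def)
    show ?thesis
    proof (intro exI[of _ c] conjI allI impI c)
      fix q \<xi> assume \<xi>: "rchar q \<xi>"
      note q = rchar_q[OF \<xi>]
      show "c * real q powr (-\<epsilon>) \<le> Re (dser \<xi> 1)"
      proof (cases "nonprincipal (q1 * q) (\<lambda>n. \<xi>1 n * \<xi> n)")
        case False
        then have "dser \<xi> (of_real \<beta>) = 0" using zero_transfer[OF x1(1) \<xi>] x1 \<eta> by auto
        then have "(1 - \<beta>) / 6 * 604800 powr (-6) * real q powr (-\<epsilon>) \<le> Re (dser \<xi> 1)"
          using one[OF \<xi> x1(2,3)] by simp
        moreover have "c * real q powr (-\<epsilon>) \<le> (1 - \<beta>) / 6 * 604800 powr (-6) * real q powr (-\<epsilon>)"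
          by (intro mult_right_mono) (auto simp: c_def)
        ultimately show ?thesis by linarith
      next
        case True
        let ?\<theta> = "\<lambda>n. \<xi>1 n * \<xi> n"
        have p: "rchar (q1 * q) ?\<theta>" by (rule siegel_product_char[OF x1(1) \<xi> True])
        have A: "(1 - \<beta>) / 6 * (48 * (45360000 * (real q1 * real q) ^ 2)) powr (- 6 * (1 - \<beta>)) \<le> l1 * Re (dser \<xi> 1) * Re (dser ?\<theta> 1)"
          unfolding l1_def using x1 \<eta> by (intro siegel_two[OF x1(1) \<xi> p]) auto
        have "Re (dser ?\<theta> 1) \<le> norm (dser ?\<theta> 1)" by (rule complex_Re_le_cmod)
        also have "\<dots> \<le> (13 + 1 / (\<eta> / 2)) * (real (q1 * q) * (2 + \<bar>Im 1\<bar>)) powr (2 * (\<eta> / 2))"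
          by (rule psb_bound[OF rchar_psb[OF p] rchar_q[OF p] cmult_norm[OF rchar_cmult[OF p]]]) (use \<eta> in auto)
        also have "\<dots> = D * real q powr \<eta>" using q q1 by (simp add: D_def powr_mult mult_ac)
        finally have T: "Re (dser ?\<theta> 1) \<le> D * real q powr \<eta>" .
        have "K powr (-6) * real q powr (- 12 * \<eta>) \<le> (48 * (45360000 * (real q1 * real q) ^ 2)) powr (- 6 * (1 - \<beta>))"
        proof -
          have "48 * (45360000 * (real q1 * real q) ^ 2) = K * (real q) ^ 2" by (simp add: K_def power_mult_distrib)
          then have "(48 * (45360000 * (real q1 * real q) ^ 2)) powr (- 6 * (1 - \<beta>)) = K powr (- 6 * (1 - \<beta>)) * real q powr (2 * (- 6 * (1 - \<beta>)))"
          proof -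
            have "(real q) ^ 2 = real q powr 2" using q by (simp add: powr_numeral)
            moreover have "(K * real q powr 2) powr t = K powr t * real q powr (2 * t)" for t
              using K1 q by (simp only: powr_mult powr_powr)
            ultimately show ?thesis using \<open>48 * _ = _\<close> by simp
          qed
          moreover have "K powr (-6) * real q powr (- 12 * \<eta>) \<le> K powr (- 6 * (1 - \<beta>)) * real q powr (2 * (- 6 * (1 - \<beta>)))"
          proof (rule mult_mono)
            show "K powr (-6) \<le> K powr (- 6 * (1 - \<beta>))" using x1 \<eta> by (intro powr_mono K1) auto
            show "real q powr (- 12 * \<eta>) \<le> real q powr (2 * (- 6 * (1 - \<beta>)))" using x1 \<eta> by (intro powr_mono q) auto
          qed auto
          ultimately show ?thesis by simp
        qed
        then have "(1 - \<beta>) / 6 * (K powr (-6) * real q powr (- 12 * \<eta>)) \<le> (1 - \<beta>) / 6 * (48 * (45360000 * (real q1 * real q) ^ 2)) powr (- 6 * (1 - \<beta>))"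
          using x1 by (intro mult_left_mono) auto
        also have "\<dots> \<le> l1 * Re (dser \<xi> 1) * Re (dser ?\<theta> 1)" by (rule A)
        also have "\<dots> \<le> l1 * Re (dser \<xi> 1) * (D * real q powr \<eta>)"
          using l1 rchar_L1_pos[OF \<xi>] T by (intro mult_left_mono) auto
        finally have F: "(1 - \<beta>) / 6 * K powr (-6) * real q powr (- 12 * \<eta>) \<le> (l1 * D) * (Re (dser \<xi> 1) * real q powr \<eta>)"
          by (simp only: mult_ac)
        have "(1 - \<beta>) / 6 * K powr (-6) / (l1 * D) * real q powr (- 13 * \<eta>) \<le> Re (dser \<xi> 1)"
        proof -
          have e: "real q powr (- 13 * \<eta>) * real q powr \<eta> = real q powr (- 12 * \<eta>)" by (simp flip: powr_add)
          have pos: "l1 * D > 0" "real q powr \<eta> > 0" using l1 D q by auto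
          have "((1 - \<beta>) / 6 * K powr (-6) / (l1 * D) * real q powr (- 13 * \<eta>)) * ((l1 * D) * real q powr \<eta>) = (1 - \<beta>) / 6 * K powr (-6) * real q powr (- 12 * \<eta>)"
            unfolding e[symmetric] using pos l1 D by simp
          also have "\<dots> \<le> Re (dser \<xi> 1) * ((l1 * D) * real q powr \<eta>)" using F by (simp only: mult_ac)
          finally have le: "((1 - \<beta>) / 6 * K powr (-6) / (l1 * D) * real q powr (- 13 * \<eta>)) * ((l1 * D) * real q powr \<eta>) \<le> Re (dser \<xi> 1) * ((l1 * D) * real q powr \<eta>)" .
          show ?thesis by (rule mult_right_le_imp_le[OF le]) (use pos in simp)
        qed
        moreover have "c * real q powr (-\<epsilon>) \<le> (1 - \<beta>) / 6 * K powr (-6) / (l1 * D) * real q powr (- 13 * \<eta>)"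
          using x1 K1 l1 D q \<eta> by (intro mult_mono powr_mono) (auto simp: c_def)
        ultimately show ?thesis by linarith
      qed
    qed
  qed
qed

section \<open>Bounds for logarithmic derivatives\<close>

text \<open>f' is at most 2 U/\<rho> on the half disc, so f keeps norm at least m/2 up to the
  distance r = m \<rho>/(4 U). There f'/f is at most 4 U/(\<rho> m) = 1/r, and Cauchy's estimate
  costs another 1/r per derivative. A zero-free disc thus comes from a lower bound at its centre
  alone.\<close>

lemma logderiv_bound:
  assumes f: "f holomorphic_on cball z \<rho>" and \<rho>: "0 < \<rho>" and U: "\<And>w. w \<in> cball z \<rho> \<Longrightarrow> norm (f w) \<le> U"
    and m: "0 < m" "m \<le> norm (f z)"
  shows "norm ((deriv ^^ j) (\<lambda>s. deriv f s / f s) z) \<le> fact j * (4 * U / (\<rho> * m)) ^ Suc j"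
proof -
  have mU: "m \<le> U" using U[of z] m \<rho> by simp
  define r where "r = m * \<rho> / (4 * U)"
  have Upos: "U > 0" using mU m by simp
  have r: "0 < r" "r \<le> \<rho> / 4"
    using m \<rho> mU Upos by (auto simp: r_def field_simps)
  have fb: "f holomorphic_on ball z \<rho>" using f by (rule holomorphic_on_subset) auto
  have d: "norm (deriv f w) \<le> 2 * U / \<rho>" if w: "w \<in> cball z (\<rho>/2)" for w
  proof -
    have sub: "cball w (\<rho>/2) \<subseteq> cball z \<rho>"
    proof
      fix v assume "v \<in> cball w (\<rho>/2)"
      then show "v \<in> cball z \<rho>" using w dist_triangle[of z v w] by auto
    qed
    have fw: "f holomorphic_on cball w (\<rho>/2)" using f sub by (rule holomorphic_on_subset)
    have "norm ((deriv ^^ 1) f w) \<le> fact 1 * U / (\<rho>/2) ^ 1"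
    proof (rule Cauchy_inequality)
      show "f holomorphic_on ball w (\<rho>/2)" using fw by (rule holomorphic_on_subset) auto
      show "continuous_on (cball w (\<rho>/2)) f" using fw by (rule holomorphic_on_imp_continuous_on)
      show "norm (f x) \<le> U" if "norm (w - x) = \<rho>/2" for x
        using that sub by (intro U) (auto simp: dist_norm)
    qed (use \<rho> in simp)
    then show ?thesis by (simp add: field_simps)
  qed
  have low: "norm (f w) \<ge> m / 2" if w: "w \<in> cball z r" for w
  proof -
    have sub: "cball z r \<subseteq> cball z (\<rho>/2)" using r by auto
    have "norm (f w - f z) \<le> 2 * U / \<rho> * norm (w - z)"
    proof (rule field_differentiable_bound[of "cball z r" f "deriv f"])
      fix x assume x: "x \<in> cball z r"
      then have "x \<in> ball z \<rho>" using r \<rho> by auto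
      then show "(f has_field_derivative deriv f x) (at x within cball z r)"
        by (rule has_field_derivative_at_within[OF holomorphic_derivI[OF fb open_ball]])
      show "norm (deriv f x) \<le> 2 * U / \<rho>" using d x sub by blast
    qed (use w r in auto)
    also have "\<dots> \<le> 2 * U / \<rho> * r" using w \<rho> Upos by (intro mult_left_mono) (auto simp: dist_norm norm_minus_commute)
    also have "\<dots> = m / 2" using \<rho> Upos by (simp add: r_def field_simps)
    finally show ?thesis using norm_triangle_ineq2[of "f z" "f w"] m by (simp add: norm_minus_commute)
  qed
  have hol: "(\<lambda>s. deriv f s / f s) holomorphic_on ball z (\<rho>/2) \<inter> {s. f s \<noteq> 0}"
  proof -
    have o: "open (ball z (\<rho>/2) \<inter> {s. f s \<noteq> 0})"
    proof -
      have "continuous_on (ball z (\<rho>/2)) f" using fb \<rho> by (intro holomorphic_on_imp_continuous_on holomorphic_on_subset[OF fb]) auto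
      then have "open (ball z (\<rho>/2) \<inter> f -` (- {0}))" by (intro continuous_open_preimage) auto
      moreover have "ball z (\<rho>/2) \<inter> f -` (- {0}) = ball z (\<rho>/2) \<inter> {s. f s \<noteq> 0}" by auto
      ultimately show ?thesis by simp
    qed
    have fs: "f holomorphic_on ball z (\<rho>/2) \<inter> {s. f s \<noteq> 0}" using \<rho> by (intro holomorphic_on_subset[OF fb]) auto
    show ?thesis by (intro holomorphic_intros fs o) auto
  qed
  have sub: "cball z r \<subseteq> ball z (\<rho>/2) \<inter> {s. f s \<noteq> 0}" using low m r \<rho> by fastforce
  have h: "(\<lambda>s. deriv f s / f s) holomorphic_on cball z r" using hol sub by (rule holomorphic_on_subset)
  have "norm ((deriv ^^ j) (\<lambda>s. deriv f s / f s) z) \<le> fact j * (4 * U / (\<rho> * m)) / r ^ j"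
  proof (rule Cauchy_inequality)
    show "(\<lambda>s. deriv f s / f s) holomorphic_on ball z r" using h by (rule holomorphic_on_subset) auto
    show "continuous_on (cball z r) (\<lambda>s. deriv f s / f s)" using h by (rule holomorphic_on_imp_continuous_on)
    fix x assume "norm (z - x) = r"
    then have x: "x \<in> cball z r" by (simp add: dist_norm)
    have "norm (deriv f x / f x) \<le> (2 * U / \<rho>) / (m / 2)"
      unfolding norm_divide using d[of x] low[OF x] x r m \<rho> Upos by (intro frac_le) auto
    also have "\<dots> = 4 * U / (\<rho> * m)" by simp
    finally show "norm (deriv f x / f x) \<le> 4 * U / (\<rho> * m)" .
  qed (rule r)
  also have "\<dots> = fact j * (4 * U / (\<rho> * m)) ^ Suc j"
  proof -
    have "1 / r ^ j = (4 * U / (\<rho> * m)) ^ j" by (simp add: r_def power_divide mult_ac)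
    moreover have "fact j * (4 * U / (\<rho> * m)) / r ^ j = fact j * (4 * U / (\<rho> * m)) * (1 / r ^ j)" by simp
    ultimately show ?thesis by (simp only: power_Suc mult.assoc)
  qed
  finally show ?thesis .
qed

section \<open>Lower bounds for L-functions to the right of the line Re s = 1\<close>

lemma npow_split: assumes "n > 0" shows "of_nat n powr (- Complex \<sigma> t) = of_real (real n powr (-\<sigma>)) * cis (- t * ln (real n))"
  using assms by (simp add: powr_def Ln_of_nat exp_eq_polar) 

text \<open>For norm z <= 1 the expression is at least 2 (1 + Re z)^2. The disc rather than the
  circle admits the zeros of a character.\<close>

lemma three_four_one_point:
  assumes "norm z \<le> 1" shows "0 \<le> 3 + 4 * Re z + Re (z * z)"
proof -
  have "(norm z)\<^sup>2 \<le> 1" using assms by (simp add: power_le_one)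
  then have "(Re z)\<^sup>2 + (Im z)\<^sup>2 \<le> 1" by (simp add: cmod_power2)
  moreover have "Re (z * z) = (Re z)\<^sup>2 - (Im z)\<^sup>2" by (simp add: power2_eq_square)
  moreover have "0 \<le> 2 * (1 + Re z)\<^sup>2" by simp
  ultimately show ?thesis by (simp add: power2_eq_square algebra_simps)
qed

lemma Re_logL_sums:
  assumes "cmult \<xi>" "\<sigma> > 1"
  shows "(\<lambda>n. lcoef n * (real n powr (-\<sigma>) * Re (\<xi> n * cis (- t * ln (real n))))) sums Re (logL \<xi> (Complex \<sigma> t))"
proof -
  have S: "(\<lambda>n. of_real (lcoef n) * \<xi> n * of_nat n powr (- Complex \<sigma> t)) sums logL \<xi> (Complex \<sigma> t)"
    unfolding logL_def by (rule dser_sums[OF subpoly_lcoef[OF assms(1)]]) (use assms in simp)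
  have "Re (of_real (lcoef n) * \<xi> n * of_nat n powr (- Complex \<sigma> t)) = lcoef n * (real n powr (-\<sigma>) * Re (\<xi> n * cis (- t * ln (real n))))" for n
  proof (cases "n = 0")
    case False
    have "of_real (lcoef n) * \<xi> n * of_nat n powr (- Complex \<sigma> t) = of_real (lcoef n * real n powr (-\<sigma>)) * (\<xi> n * cis (- t * ln (real n)))"
      using False by (simp only: npow_split neq0_conv of_real_mult mult_ac)
    moreover have "Re (of_real a * z) = a * Re z" for a z by simp
    ultimately show ?thesis by (simp only: mult.assoc)
  qed simp
  then show ?thesis using sums_Re[OF S] by (simp only:)
qed

lemma zeta_le: assumes "1 < \<sigma>" "\<sigma> \<le> 2" shows "norm (zeta (of_real \<sigma>)) \<le> 210 / (\<sigma> - 1)"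
proof -
  have "norm (Zf (of_real \<sigma>)) \<le> 210"
    by (rule Zf_bound_cball) (use assms in \<open>auto simp: dist_norm norm_complex_def abs_if\<close>)
  moreover have "norm (Zf (of_real \<sigma>)) = (\<sigma> - 1) * norm (zeta (of_real \<sigma>))"
  proof -
    have "Zf (of_real \<sigma>) = of_real (\<sigma> - 1) * zeta (of_real \<sigma>)" using Zf_eq[of "of_real \<sigma>"] assms by simp
    then show ?thesis unfolding norm_mult norm_of_real using assms by (simp only: norm_mult norm_of_real abs_of_pos diff_gt_0_iff_gt)
  qed
  ultimately show ?thesis using assms by (simp add: field_simps)
qed

text \<open>The norm of L is at least 1/zeta(\<sigma>). This is of use where \<sigma> - 1 is bounded
  below.\<close>

lemma trivial_lower:
  assumes \<xi>: "cmult \<xi>" and \<sigma>: "1 < \<sigma>" "\<sigma> \<le> 2"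
  shows "norm (dser \<xi> (Complex \<sigma> t)) \<ge> (\<sigma> - 1) / 210"
proof -
  have 1: "norm (dser \<xi> (Complex \<sigma> t)) = exp (Re (logL \<xi> (Complex \<sigma> t)))" using L_eq_exp_logL[OF \<xi>, of "Complex \<sigma> t"] \<sigma> by simp
  have 2: "norm (zeta (of_real \<sigma>)) = exp (Re (logL (\<lambda>_. 1) (Complex \<sigma> 0)))"
    using L_eq_exp_logL[OF cmult_one, of "of_real \<sigma>"] \<sigma> by (simp add: complex_of_real_def)
  have "0 \<le> Re (logL \<xi> (Complex \<sigma> t)) + Re (logL (\<lambda>_. 1) (Complex \<sigma> 0))"
  proof (rule sums_le[OF _ sums_zero sums_add[OF Re_logL_sums[OF \<xi> \<sigma>(1), of t] Re_logL_sums[OF cmult_one \<sigma>(1), of 0]]])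
    fix n
    have "\<bar>Re (\<xi> n * cis (- t * ln (real n)))\<bar> \<le> norm (\<xi> n * cis (- t * ln (real n)))" by (rule abs_Re_le_cmod)
    also have "\<dots> \<le> 1" using cmult_norm[OF \<xi>, of n] by (simp add: norm_mult)
    finally have "0 \<le> Re (\<xi> n * cis (- t * ln (real n))) + 1" by linarith
    then have "0 \<le> lcoef n * (real n powr (-\<sigma>) * (Re (\<xi> n * cis (- t * ln (real n))) + 1))"
      by (intro mult_nonneg_nonneg lcoef_nonneg) auto
    then show "0 \<le> lcoef n * (real n powr (-\<sigma>) * Re (\<xi> n * cis (- t * ln (real n)))) + lcoef n * (real n powr (-\<sigma>) * Re (1 * cis (- 0 * ln (real n))))"
      by (simp add: algebra_simps)
  qed
  then have "1 \<le> norm (dser \<xi> (Complex \<sigma> t)) * norm (zeta (of_real \<sigma>))" unfolding 1 2 by (simp flip: exp_add)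
  also have "\<dots> \<le> norm (dser \<xi> (Complex \<sigma> t)) * (210 / (\<sigma> - 1))" using zeta_le[OF \<sigma>] by (intro mult_left_mono) auto
  finally show ?thesis using \<sigma> by (simp add: field_simps)
qed

text \<open>The product of the third power of zeta, the fourth power of |L(\<xi>)| and |L(\<psi>)|
  is at least 1. \<psi> has to agree with the square of \<xi> only where \<xi> is nonzero, so that
  \<psi> = 1 can serve for real \<xi>; at the other n the sum is at least 3 - 1. The constant is
  210^3.\<close>

lemma three_four_one:
  assumes \<xi>: "cmult \<xi>" and \<psi>: "cmult \<psi>" and rel: "\<And>n. \<psi> n = \<xi> n * \<xi> n \<or> \<xi> n = 0"
    and \<sigma>: "1 < \<sigma>" "\<sigma> \<le> 2" and M: "norm (dser \<psi> (Complex \<sigma> (2 * t))) \<le> M"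
  shows "(\<sigma> - 1) ^ 3 / (9261000 * M) \<le> norm (dser \<xi> (Complex \<sigma> t)) ^ 4"
proof -
  define l where "l = norm (dser \<xi> (Complex \<sigma> t))"
  define z where "z = norm (zeta (of_real \<sigma>))"
  define p where "p = norm (dser \<psi> (Complex \<sigma> (2 * t)))"
  have 1: "l = exp (Re (logL \<xi> (Complex \<sigma> t)))" using L_eq_exp_logL[OF \<xi>, of "Complex \<sigma> t"] \<sigma> by (simp add: l_def)
  have 2: "z = exp (Re (logL (\<lambda>_. 1) (Complex \<sigma> 0)))"
    using L_eq_exp_logL[OF cmult_one, of "of_real \<sigma>"] \<sigma> by (simp add: z_def complex_of_real_def)
  have 3: "p = exp (Re (logL \<psi> (Complex \<sigma> (2 * t))))" using L_eq_exp_logL[OF \<psi>, of "Complex \<sigma> (2 * t)"] \<sigma> by (simp add: p_def)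
  have "0 \<le> 3 * Re (logL (\<lambda>_. 1) (Complex \<sigma> 0)) + 4 * Re (logL \<xi> (Complex \<sigma> t)) + Re (logL \<psi> (Complex \<sigma> (2 * t)))"
  proof (rule sums_le[OF _ sums_zero sums_add[OF sums_add[OF sums_mult[OF Re_logL_sums[OF cmult_one \<sigma>(1), of 0], of 3] sums_mult[OF Re_logL_sums[OF \<xi> \<sigma>(1), of t], of 4]] Re_logL_sums[OF \<psi> \<sigma>(1), of "2 * t"]]])
    fix n
    let ?w = "cis (- t * ln (real n))"
    have w2: "cis (- (2 * t) * ln (real n)) = ?w * ?w" by (simp add: cis_mult mult.assoc)
    have "0 \<le> 3 + 4 * Re (\<xi> n * ?w) + Re (\<psi> n * (?w * ?w))"
    proof (cases "\<psi> n = \<xi> n * \<xi> n")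
      case True
      have "norm (\<xi> n * ?w) \<le> 1" using cmult_norm[OF \<xi>, of n] by (simp add: norm_mult)
      from three_four_one_point[OF this] show ?thesis using True by (simp only: mult_ac)
    next
      case False
      then have "\<xi> n = 0" using rel by blast
      moreover have "\<bar>Re (\<psi> n * (?w * ?w))\<bar> \<le> norm (\<psi> n * (?w * ?w))" by (rule abs_Re_le_cmod)
      moreover have "norm (\<psi> n * (?w * ?w)) \<le> 1" using cmult_norm[OF \<psi>, of n] by (simp add: norm_mult)
      ultimately show ?thesis by (simp only: mult_zero_left zero_complex.sel)
    qed
    then have "0 \<le> lcoef n * (real n powr (-\<sigma>) * (3 + 4 * Re (\<xi> n * ?w) + Re (\<psi> n * (?w * ?w))))"
      by (intro mult_nonneg_nonneg lcoef_nonneg) auto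
    moreover have "Re (1 * cis (- 0 * ln (real n))) = 1" by simp
    ultimately show "0 \<le> 3 * (lcoef n * (real n powr (-\<sigma>) * Re (1 * cis (- 0 * ln (real n))))) + 4 * (lcoef n * (real n powr (-\<sigma>) * Re (\<xi> n * ?w))) + lcoef n * (real n powr (-\<sigma>) * Re (\<psi> n * cis (- (2 * t) * ln (real n))))"
      unfolding w2 by (simp only: distrib_left mult_ac)
  qed
  then have "1 \<le> z ^ 3 * l ^ 4 * p"
    unfolding 1 2 3 by (simp flip: exp_of_nat_mult exp_add)
  also have "\<dots> \<le> (210 / (\<sigma> - 1)) ^ 3 * l ^ 4 * M"
    using zeta_le[OF \<sigma>] M \<sigma> unfolding z_def p_def l_def by (intro mult_mono power_mono mult_nonneg_nonneg zero_le_power) auto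
  finally have ge: "1 \<le> (210 / (\<sigma> - 1)) ^ 3 * l ^ 4 * M" .
  have "M \<ge> 0" using M norm_ge_zero order_trans by blast
  then have "M > 0" using ge by (cases "M = 0") auto
  have "(\<sigma> - 1) ^ 3 \<le> (\<sigma> - 1) ^ 3 * ((210 / (\<sigma> - 1)) ^ 3 * l ^ 4 * M)"
    using mult_left_mono[OF ge, of "(\<sigma> - 1) ^ 3"] \<sigma> by simp
  also have "\<dots> = l ^ 4 * (9261000 * M)" using \<sigma> by (simp add: power_divide)
  finally show ?thesis using \<open>M > 0\<close> unfolding l_def[symmetric] by (simp add: pos_divide_le_eq)
qed

text \<open>From 1 + k on the hypothesis gives A/(8 b^3). The choice k = A/(16 b^4) makes the loss b
  k on the way from 1 + k towards 1 exactly half of this, so the bound becomes uniform up to the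
  line.\<close>

lemma lower_from_341:
  fixes f :: "real \<Rightarrow> complex"
  assumes A: "0 < A" "A \<le> 1" and b: "1 \<le> b"
    and low: "\<And>x. 1 < x \<Longrightarrow> x \<le> 2 \<Longrightarrow> A * (x - 1) ^ 3 \<le> norm (f x) ^ 4"
    and lip: "\<And>x y. 1 < x \<Longrightarrow> x \<le> y \<Longrightarrow> y \<le> 2 \<Longrightarrow> norm (f y - f x) \<le> b * (y - x)"
    and x: "1 < x" "x \<le> 2"
  shows "A / (16 * b ^ 3) \<le> norm (f x)"
proof -
  define k where "k = A / (16 * b ^ 4)"
  have b4: "1 \<le> b ^ 4" "1 \<le> b ^ 3" using b by (auto intro: one_le_power)
  have k: "0 < k" "k \<le> 1" 
  proof -
    have "A \<le> 16 * b ^ 4" using A b4 by linarith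
    then show "0 < k" "k \<le> 1" using A b by (auto simp: k_def field_simps)
  qed
  have big: "A / (8 * b ^ 3) \<le> norm (f y)" if y: "1 + k \<le> y" "y \<le> 2" for y
  proof (rule power_le_imp_le_base[of _ 3])
    have "(A / (8 * b ^ 3)) ^ Suc 3 = A * k ^ 3" using b by (simp add: k_def power_divide power_mult_distrib eval_nat_numeral)
    also have "\<dots> \<le> A * (y - 1) ^ 3" using A y k by (intro mult_left_mono power_mono) auto
    also have "\<dots> \<le> norm (f y) ^ Suc 3" using low[of y] y k by (simp del: power_Suc)
    finally show "(A / (8 * b ^ 3)) ^ Suc 3 \<le> norm (f y) ^ Suc 3" .
  qed simp
  have half: "A / (16 * b ^ 3) = A / (8 * b ^ 3) - b * k" using b by (simp add: k_def field_simps eval_nat_numeral)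
  show ?thesis
  proof (cases "1 + k \<le> x")
    case True
    have "0 \<le> b * k" using b k by simp
    then show ?thesis using big[OF True x(2)] half by linarith
  next
    case False
    have "norm (f (1 + k) - f x) \<le> b * (1 + k - x)" using False x k by (intro lip) auto
    also have "\<dots> \<le> b * k" using b x by (intro mult_left_mono) auto
    finally have "norm (f (1 + k)) - norm (f x) \<le> b * k" using norm_triangle_ineq2[of "f (1 + k)" "f x"] by linarith
    then show ?thesis using big[of "1 + k"] half k by linarith
  qed
qed

lemma vertical_lipschitz:
  assumes \<rho>: "0 < \<rho>" and f: "\<And>x. 1 < x \<Longrightarrow> x \<le> 2 \<Longrightarrow> f holomorphic_on cball (Complex x t) \<rho>"
    and U: "\<And>x w. 1 < x \<Longrightarrow> x \<le> 2 \<Longrightarrow> w \<in> cball (Complex x t) \<rho> \<Longrightarrow> norm (f w) \<le> U"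
    and xy: "1 < x" "x \<le> y" "y \<le> 2"
  shows "norm (f (Complex y t) - f (Complex x t)) \<le> U / \<rho> * (y - x)"
proof -
  define S where "S = closed_segment (Complex x t) (Complex y t)"
  have S: "\<exists>v. w = Complex v t \<and> x \<le> v \<and> v \<le> y" if wS: "w \<in> S" for w
  proof -
    obtain u where u: "0 \<le> u" "u \<le> 1" "w = (1 - u) *\<^sub>R Complex x t + u *\<^sub>R Complex y t" 
      using wS unfolding S_def in_segment by blast
    then have "w = Complex (x + u * (y - x)) t" by (simp add: complex_eq_iff algebra_simps)
    moreover have "0 \<le> u * (y - x)" "u * (y - x) \<le> y - x" using u xy by (auto intro: mult_left_le_one_le)
    ultimately show ?thesis by (intro exI[of _ "x + u * (y - x)"]) auto
  qed
  have "norm (f (Complex y t) - f (Complex x t)) \<le> U / \<rho> * norm (Complex y t - Complex x t)"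
  proof (rule field_differentiable_bound[of S f "deriv f"])
    show "convex S" by (simp add: S_def)
    show "Complex y t \<in> S" "Complex x t \<in> S" by (auto simp: S_def)
    fix w assume "w \<in> S"
    from S[OF this] obtain v where "w = Complex v t" "x \<le> v" "v \<le> y" by blast
    then have v: "w = Complex v t" "1 < v" "v \<le> 2" using xy by auto
    have fw: "f holomorphic_on cball w \<rho>" unfolding v(1) by (rule f[OF v(2,3)])
    have fb: "f holomorphic_on ball w \<rho>" using fw by (rule holomorphic_on_subset) auto
    show "(f has_field_derivative deriv f w) (at w within S)"
      by (rule has_field_derivative_at_within[OF holomorphic_derivI[OF fb open_ball]]) (use \<rho> in simp)
    have "norm ((deriv ^^ 1) f w) \<le> fact 1 * U / \<rho> ^ 1"
    proof (rule Cauchy_inequality[OF fb])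
      show "continuous_on (cball w \<rho>) f" using fw by (rule holomorphic_on_imp_continuous_on)
      show "norm (f u) \<le> U" if "norm (w - u) = \<rho>" for u
        by (rule U[OF v(2,3)]) (use that v(1) in \<open>simp add: dist_norm\<close>)
    qed (rule \<rho>)
    then show "norm (deriv f w) \<le> U / \<rho>" by simp
  qed
  moreover have "norm (Complex y t - Complex x t) = y - x" using xy by (simp add: cmod_def)
  ultimately show ?thesis by simp
qed

text \<open>f continues the L-function beyond Re s = 1, so that discs of fixed radius \<rho> fit
  around points arbitrarily close to the line; this gives the Lipschitz constant U/\<rho>. The
  numerical constant is 16 * 210^3.\<close>

lemma lower_bound_core:
  assumes \<xi>: "cmult \<xi>" and \<psi>: "cmult \<psi>" and rel: "\<And>n. \<psi> n = \<xi> n * \<xi> n \<or> \<xi> n = 0"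
    and \<rho>: "0 < \<rho>" "\<rho> \<le> 1"
    and f: "\<And>x. 1 < x \<Longrightarrow> x \<le> 2 \<Longrightarrow> f holomorphic_on cball (Complex x t) \<rho>"
    and fe: "\<And>s. Re s > 1 \<Longrightarrow> f s = dser \<xi> s"
    and U: "\<And>x w. 1 < x \<Longrightarrow> x \<le> 2 \<Longrightarrow> w \<in> cball (Complex x t) \<rho> \<Longrightarrow> norm (f w) \<le> U" "1 \<le> U"
    and M: "\<And>x. 1 < x \<Longrightarrow> x \<le> 2 \<Longrightarrow> norm (dser \<psi> (Complex x (2 * t))) \<le> M" "1 \<le> M"
    and x: "1 < x" "x \<le> 2"
  shows "\<rho> ^ 3 / (148176000 * M * U ^ 3) \<le> norm (dser \<xi> (Complex x t))"
proof -
  have "1 / (9261000 * M) / (16 * (U / \<rho>) ^ 3) \<le> norm (dser \<xi> (Complex x t))"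
  proof (rule lower_from_341[where f = "\<lambda>x. dser \<xi> (Complex x t)"])
    show "1 / (9261000 * M) * (y - 1) ^ 3 \<le> norm (dser \<xi> (Complex y t)) ^ 4" if "1 < y" "y \<le> 2" for y
      using three_four_one[OF \<xi> \<psi> rel that M(1)[OF that]] by simp
    show "norm (dser \<xi> (Complex z t) - dser \<xi> (Complex y t)) \<le> U / \<rho> * (z - y)" if "1 < y" "y \<le> z" "z \<le> 2" for y z
      using vertical_lipschitz[OF \<rho>(1) f U(1) that] that by (simp add: fe)
    show "1 \<le> U / \<rho>" using U(2) \<rho> by (simp add: field_simps)
  qed (use M x in auto)
  moreover have "1 / (9261000 * M) / (16 * (U / \<rho>) ^ 3) = \<rho> ^ 3 / (148176000 * M * U ^ 3)"
    using \<rho> U(2) M(2) by (simp add: power_divide)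
  ultimately show ?thesis by simp
qed

text \<open>The range of Im s covers both the discs at height t and the point at height 2 t of the
  3-4-1 inequality; the factor 2 pays for it.\<close>

lemma psb_U:
  assumes q: "psb q \<xi>" "q \<ge> 1" and \<xi>: "cmult \<xi>" and \<rho>: "0 < \<rho>" "\<rho> \<le> 1/2"
    and s: "1 - \<rho> \<le> Re s" "Re s \<le> 4" "\<bar>Im s\<bar> \<le> 2 + 2 * \<bar>t\<bar>"
  shows "norm (dser \<xi> s) \<le> 2 * (13 + 1 / \<rho>) * (q * (2 + \<bar>t\<bar>)) powr (2 * \<rho>)"
proof -
  have "norm (dser \<xi> s) \<le> (13 + 1 / \<rho>) * (q * (2 + \<bar>Im s\<bar>)) powr (2 * \<rho>)"
    by (rule psb_bound[OF q cmult_norm[OF \<xi>] \<rho> s(1,2)])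
  also have "\<dots> \<le> (13 + 1 / \<rho>) * (2 * (q * (2 + \<bar>t\<bar>)) powr (2 * \<rho>))"
  proof (rule mult_left_mono)
    have "q * (2 + \<bar>Im s\<bar>) \<le> q * (2 * (2 + \<bar>t\<bar>))" using q s by (intro mult_left_mono) auto
    then have "q * (2 + \<bar>Im s\<bar>) \<le> 2 * (q * (2 + \<bar>t\<bar>))" by (simp only: mult_ac)
    then have "(q * (2 + \<bar>Im s\<bar>)) powr (2 * \<rho>) \<le> (2 * (q * (2 + \<bar>t\<bar>))) powr (2 * \<rho>)" using q \<rho> by (intro powr_mono2) auto
    also have "\<dots> = 2 powr (2 * \<rho>) * (q * (2 + \<bar>t\<bar>)) powr (2 * \<rho>)" using q by (simp only: powr_mult)
    also have "\<dots> \<le> 2 powr 1 * (q * (2 + \<bar>t\<bar>)) powr (2 * \<rho>)" using \<rho> by (intro mult_right_mono powr_mono) auto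
    finally show "(q * (2 + \<bar>Im s\<bar>)) powr (2 * \<rho>) \<le> 2 * (q * (2 + \<bar>t\<bar>)) powr (2 * \<rho>)" by simp
  qed (use \<rho> in auto)
  finally show ?thesis by (simp only: mult_ac)
qed

definition zext :: "complex \<Rightarrow> complex" where "zext s = Zf s / (s - 1)"

lemma zext_eq: "Re s > 1 \<Longrightarrow> zext s = zeta s"
  using Zf_eq[of s] by (auto simp: zext_def)

lemma zext_holomorphic: "zext holomorphic_on {s. Re s > 0} - {1}"
  unfolding zext_def by (intro holomorphic_intros holomorphic_on_subset[OF Zf_holomorphic]) auto

lemma zext_U:
  assumes \<rho>: "0 < \<rho>" "\<rho> \<le> 1/2" and \<tau>: "0 < \<tau>" "\<tau> \<le> norm (s - 1)"
    and s: "1 - \<rho> \<le> Re s" "Re s \<le> 4" "\<bar>Im s\<bar> \<le> 2 + 2 * \<bar>t\<bar>"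
  shows "norm (zext s) \<le> (1 + 1 / \<tau>) * (2 * (13 + 1 / \<rho>) * (2 + \<bar>t\<bar>) powr (2 * \<rho>))"
proof -
  have s1: "norm (s - 1) > 0" using \<tau> by linarith
  have "norm (Zf s) \<le> (13 + 1 / \<rho>) * (1 + norm (s - 1)) * (2 + \<bar>Im s\<bar>) powr (2 * \<rho>)"
    by (rule Zf_norm_bound[OF \<rho> s(1,2)])
  also have "(2 + \<bar>Im s\<bar>) powr (2 * \<rho>) \<le> (2 * (2 + \<bar>t\<bar>)) powr (2 * \<rho>)"
    using s \<rho> by (intro powr_mono2) auto
  also have "\<dots> = 2 powr (2 * \<rho>) * (2 + \<bar>t\<bar>) powr (2 * \<rho>)" by (simp only: powr_mult)
  also have "\<dots> \<le> 2 powr 1 * (2 + \<bar>t\<bar>) powr (2 * \<rho>)" using \<rho> by (intro mult_right_mono powr_mono) auto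
  finally have "norm (Zf s) \<le> (13 + 1 / \<rho>) * (1 + norm (s - 1)) * (2 powr 1 * (2 + \<bar>t\<bar>) powr (2 * \<rho>))"
    using \<rho> s1 by (simp add: mult_left_mono)
  then have "norm (Zf s) / norm (s - 1) \<le> (13 + 1 / \<rho>) * (1 + norm (s - 1)) * (2 powr 1 * (2 + \<bar>t\<bar>) powr (2 * \<rho>)) / norm (s - 1)"
    using s1 by (intro divide_right_mono) auto
  also have "\<dots> = (1 + 1 / norm (s - 1)) * (2 * (13 + 1 / \<rho>) * (2 + \<bar>t\<bar>) powr (2 * \<rho>))"
    using s1 by (simp add: field_simps)
  also have "\<dots> \<le> (1 + 1 / \<tau>) * (2 * (13 + 1 / \<rho>) * (2 + \<bar>t\<bar>) powr (2 * \<rho>))"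
    using \<tau> \<rho> s1 by (intro mult_right_mono add_left_mono divide_left_mono mult_pos_pos) auto
  finally show ?thesis by (simp add: zext_def norm_divide)
qed

lemma cball_vertical:
  assumes "w \<in> cball (Complex x t) \<rho>" "1 < x" "x \<le> 2" "\<rho> \<le> 1/2"
  shows "1 - \<rho> \<le> Re w" "Re w \<le> 4" "\<bar>Im w\<bar> \<le> 2 + 2 * \<bar>t\<bar>" "\<bar>Im w - t\<bar> \<le> \<rho>" "Re w > 0"
proof -
  have "norm (w - Complex x t) \<le> \<rho>" using assms by (simp add: dist_norm norm_minus_commute)
  then have "\<bar>Re w - x\<bar> \<le> \<rho>" "\<bar>Im w - t\<bar> \<le> \<rho>" using abs_Re_le_cmod[of "w - Complex x t"] abs_Im_le_cmod[of "w - Complex x t"] by auto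
  then show "1 - \<rho> \<le> Re w" "Re w \<le> 4" "\<bar>Im w\<bar> \<le> 2 + 2 * \<bar>t\<bar>" "\<bar>Im w - t\<bar> \<le> \<rho>" "Re w > 0" using assms by linarith+
qed


lemma C0_ge_1: assumes "0 < \<rho>" shows "(1::real) \<le> 2 * (13 + 1 / \<rho>)"
proof -
  have "2 * 13 \<le> 2 * (13 + 1 / \<rho>)" using assms by (intro mult_left_mono) auto
  then show ?thesis by linarith
qed

lemma U_ge_1:
  assumes "q \<ge> 1" "0 < \<rho>" shows "1 \<le> 2 * (13 + 1 / \<rho>) * (q * (2 + \<bar>t::real\<bar>)) powr (2 * \<rho>)"
proof -
  have "1 * 1 \<le> (2 * (13 + 1 / \<rho>)) * (q * (2 + \<bar>t\<bar>)) powr (2 * \<rho>)"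
  proof (rule mult_mono)
    have "1 \<le> q * (2 + \<bar>t\<bar>)" using mult_mono[of 1 q 1 "2 + \<bar>t\<bar>"] assms by simp
    then show "1 \<le> (q * (2 + \<bar>t\<bar>)) powr (2 * \<rho>)" using assms by (intro ge_one_powr_ge_zero) auto
    show "1 \<le> 2 * (13 + 1 / \<rho>)" by (rule C0_ge_1[OF assms(2)])
    then show "0 \<le> 2 * (13 + 1 / \<rho>)" by linarith
  qed simp
  then show ?thesis by simp
qed

text \<open>The square of \<xi> has bounded partial sums too, so U also bounds its L-function at
  height 2 t; hence U^4.\<close>

lemma L_lower_complex:
  assumes \<xi>: "cmult \<xi>" and q: "psb q \<xi>" "q \<ge> 1" "psb q (\<lambda>n. \<xi> n * \<xi> n)" and \<rho>: "0 < \<rho>" "\<rho> \<le> 1/2" and x: "1 < x" "x \<le> 2"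
    and U: "U = 2 * (13 + 1 / \<rho>) * (q * (2 + \<bar>t\<bar>)) powr (2 * \<rho>)"
  shows "\<rho> ^ 3 / (148176000 * U ^ 4) \<le> norm (dser \<xi> (Complex x t))"
proof -
  have "\<rho> ^ 3 / (148176000 * U * U ^ 3) \<le> norm (dser \<xi> (Complex x t))"
  proof (rule lower_bound_core[OF \<xi> cmult_times[OF \<xi> \<xi>], where f = "dser \<xi>" and \<rho> = \<rho>])
    show "dser \<xi> holomorphic_on cball (Complex y t) \<rho>" if "1 < y" "y \<le> 2" for y
      by (rule holomorphic_on_subset[OF psb_holomorphic[OF q(1)]]) (use cball_vertical(5)[OF _ that \<rho>(2)] in auto)
    show "norm (dser \<xi> w) \<le> U" if "1 < y" "y \<le> 2" "w \<in> cball (Complex y t) \<rho>" for y w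
      unfolding U using cball_vertical[OF that(3,1,2) \<rho>(2)] by (intro psb_U q \<xi> \<rho>)
    show "norm (dser (\<lambda>n. \<xi> n * \<xi> n) (Complex y (2 * t))) \<le> U" if "1 < y" "y \<le> 2" for y
      unfolding U using that \<rho> by (intro psb_U q cmult_times \<xi> \<rho>) auto
    show "1 \<le> U" "1 \<le> U" unfolding U by (rule U_ge_1[OF q(2) \<rho>(1)])+
  qed (use x \<rho> in auto)
  then show ?thesis by (simp add: eval_nat_numeral mult_ac)
qed

lemma disc_lipschitz:
  assumes f: "f holomorphic_on cball z \<rho>" and \<rho>: "0 < \<rho>" and U: "\<And>w. w \<in> cball z \<rho> \<Longrightarrow> norm (f w) \<le> U"
    and w: "norm (w - z) \<le> \<rho> / 2"
  shows "norm (f w - f z) \<le> 2 * U / \<rho> * norm (w - z)"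
proof (rule field_differentiable_bound[of "cball z (\<rho>/2)" f "deriv f"])
  have fb: "f holomorphic_on ball z \<rho>" using f by (rule holomorphic_on_subset) auto
  fix x assume x: "x \<in> cball z (\<rho>/2)"
  then have "x \<in> ball z \<rho>" using \<rho> by auto
  then show "(f has_field_derivative deriv f x) (at x within cball z (\<rho>/2))"
    by (rule has_field_derivative_at_within[OF holomorphic_derivI[OF fb open_ball]])
  have sub: "cball x (\<rho>/2) \<subseteq> cball z \<rho>"
  proof
    fix v assume "v \<in> cball x (\<rho>/2)"
    then show "v \<in> cball z \<rho>" using x dist_triangle[of z v x] by auto
  qed
  have fw: "f holomorphic_on cball x (\<rho>/2)" using f sub by (rule holomorphic_on_subset)
  have "norm ((deriv ^^ 1) f x) \<le> fact 1 * U / (\<rho>/2) ^ 1"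
  proof (rule Cauchy_inequality)
    show "f holomorphic_on ball x (\<rho>/2)" using fw by (rule holomorphic_on_subset) auto
    show "continuous_on (cball x (\<rho>/2)) f" using fw by (rule holomorphic_on_imp_continuous_on)
    show "norm (f y) \<le> U" if "norm (x - y) = \<rho>/2" for y
      using that sub by (intro U) (auto simp: dist_norm)
  qed (use \<rho> in simp)
  then show "norm (deriv f x) \<le> 2 * U / \<rho>" by (simp add: field_simps)
qed (use w \<rho> in \<open>auto simp: dist_norm norm_minus_commute\<close>)

text \<open>Allows \<psi> = 1 in \<open>three_four_one\<close>.\<close>

lemma rchar_square: assumes "rchar q \<xi>" shows "(1::complex) = \<xi> n * \<xi> n \<or> \<xi> n = 0"
proof -
  have d: "q > 0" "dchar q \<xi>" using assms by (auto simp: rchar_def)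
  obtain r where r: "\<xi> n = of_real r" using rchar_Re(1)[OF assms, of n] by blast
  then have "\<bar>r\<bar> = 1 \<or> \<bar>r\<bar> = 0" using dchar_norm[OF d, of n] by (simp split: if_splits)
  then have "r * r = 1 \<or> r = 0" by (metis abs_eq_0 abs_mult_self mult_1)
  then show ?thesis using r by (auto simp flip: of_real_mult)
qed

text \<open>Now \<psi> = 1, and the pole of zeta makes the 3-4-1 inequality useless near s = 1.
  Within \<tau> of 1 the value L(1) and a Lipschitz bound are used; for |t| >= \<tau>/2 the point at
  height 2 t has distance at least \<tau> from the pole; for \<sigma> - 1 >= \<tau>/2 the trivial
  bound is enough.\<close>

lemma L_lower_real:
  assumes \<xi>: "rchar q \<xi>" and \<rho>: "0 < \<rho>" "\<rho> \<le> 1/2" and x: "1 < x" "x \<le> 2"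
    and l: "0 < l" "l \<le> 1" "l \<le> Re (dser \<xi> 1)"
    and U: "U = 2 * (13 + 1 / \<rho>) * (real q * (2 + \<bar>t\<bar>)) powr (2 * \<rho>)"
  shows "l * \<rho> ^ 4 / (1185408000 * U ^ 5) \<le> norm (dser \<xi> (Complex x t))"
proof -
  note q = rchar_psb[OF \<xi>] rchar_q[OF \<xi>] and cm = rchar_cmult[OF \<xi>]
  have U1: "1 \<le> U" unfolding U by (rule U_ge_1[OF q(2) \<rho>(1)])
  \<comment> \<open>Chosen so that \<tau> times the Lipschitz constant 2 U/\<rho> is l/2.\<close>
  define \<tau> where "\<tau> = l * \<rho> / (4 * U)"
  have l\<rho>: "l * \<rho> \<le> \<rho>" using mult_right_mono[OF l(2), of \<rho>] \<rho> by simp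
  have \<tau>: "0 < \<tau>" "\<tau> \<le> \<rho> / 2" "\<tau> \<le> 1" 
  proof -
    show "0 < \<tau>" using l \<rho> U1 by (simp add: \<tau>_def)
    have "\<tau> \<le> l * \<rho> / (4 * 1)" unfolding \<tau>_def using l \<rho> U1 by (intro divide_left_mono) auto
    then have "4 * \<tau> \<le> \<rho>" using l\<rho> by simp
    then show "\<tau> \<le> \<rho> / 2" "\<tau> \<le> 1" using \<rho> by linarith+
  qed
  have U4: "1 \<le> U ^ 4" "1 \<le> U ^ 5" "U \<le> U ^ 5" using U1 power_increasing[of 1 5 U] by (auto intro: one_le_power)
  have \<rho>4: "\<rho> ^ 4 \<le> 1" "\<rho> ^ 4 \<le> \<rho>" using \<rho> power_decreasing[of 1 4 \<rho>] by (auto intro: power_le_one)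
  have goal1: "l * \<rho> ^ 4 / (1185408000 * U ^ 5) \<le> l / 2"
  proof -
    have "l * \<rho> ^ 4 / (1185408000 * U ^ 5) \<le> l * 1 / 2" using l \<rho>4 U4 \<rho> by (intro frac_le mult_mono) auto
    then show ?thesis by simp
  qed
  have goal2: "l * \<rho> ^ 4 / (1185408000 * U ^ 5) \<le> \<tau> / 420"
  proof -
    have "l * \<rho> ^ 4 / (1185408000 * U ^ 5) \<le> l * \<rho> / (1680 * U)"
      using l \<rho>4 U4 \<rho> U1 by (intro frac_le mult_mono) auto
    then show ?thesis by (simp add: \<tau>_def)
  qed
  consider "norm (Complex x t - 1) \<le> \<tau>" | "\<bar>t\<bar> \<ge> \<tau> / 2" | "x - 1 \<ge> \<tau> / 2"
  proof (cases "norm (Complex x t - 1) \<le> \<tau>")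
    case False
    moreover have "norm (Complex x t - 1) \<le> \<bar>x - 1\<bar> + \<bar>t\<bar>" using cmod_le[of "Complex x t - 1"] by simp
    ultimately show ?thesis using that x by linarith
  qed (use that in blast)
  then show ?thesis
  proof cases
    case 1
    have "norm (dser \<xi> (Complex x t) - dser \<xi> 1) \<le> 2 * U / \<rho> * norm (Complex x t - 1)"
    proof (rule disc_lipschitz)
      have B: "1 - \<rho> \<le> Re w \<and> Re w \<le> 4 \<and> \<bar>Im w\<bar> \<le> 2 + 2 * \<bar>t\<bar> \<and> Re w > 0" if "w \<in> cball 1 \<rho>" for w
      proof -
        have "norm (w - 1) \<le> \<rho>" using that by (simp add: dist_norm norm_minus_commute)
        then have "\<bar>Re w - 1\<bar> \<le> \<rho>" "\<bar>Im w\<bar> \<le> \<rho>" using abs_Re_le_cmod[of "w - 1"] abs_Im_le_cmod[of "w - 1"] by auto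
        then show ?thesis using \<rho> by linarith
      qed
      show "dser \<xi> holomorphic_on cball 1 \<rho>" by (rule holomorphic_on_subset[OF psb_holomorphic[OF q(1)]]) (use B in auto)
      show "norm (dser \<xi> w) \<le> U" if "w \<in> cball 1 \<rho>" for w unfolding U using B[OF that] by (intro psb_U q cm \<rho>) auto
    qed (use 1 \<tau> \<rho> in auto)
    also have "\<dots> \<le> 2 * U / \<rho> * \<tau>" using 1 \<rho> U1 by (intro mult_left_mono) auto
    also have "\<dots> = l / 2" using \<rho> U1 by (simp add: \<tau>_def)
    finally have "norm (dser \<xi> (Complex x t) - dser \<xi> 1) \<le> l / 2" .
    moreover have "l \<le> norm (dser \<xi> 1)" using l(3) complex_Re_le_cmod order_trans by blast
    ultimately have "l / 2 \<le> norm (dser \<xi> (Complex x t))"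
      using norm_triangle_ineq2[of "dser \<xi> 1" "dser \<xi> (Complex x t)"] by (simp add: norm_minus_commute)
    then show ?thesis using goal1 by linarith
  next
    case 2
    have "\<rho> ^ 3 / (148176000 * (2 / \<tau> * U) * U ^ 3) \<le> norm (dser \<xi> (Complex x t))"
    proof (rule lower_bound_core[OF cm cmult_one rchar_square[OF \<xi>], where f = "dser \<xi>" and \<rho> = \<rho>])
      show "dser \<xi> holomorphic_on cball (Complex y t) \<rho>" if "1 < y" "y \<le> 2" for y
        by (rule holomorphic_on_subset[OF psb_holomorphic[OF q(1)]]) (use cball_vertical(5)[OF _ that \<rho>(2)] in auto)
      show "norm (dser \<xi> w) \<le> U" if "1 < y" "y \<le> 2" "w \<in> cball (Complex y t) \<rho>" for y w
        unfolding U using cball_vertical[OF that(3,1,2) \<rho>(2)] by (intro psb_U q cm \<rho>)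
      show "norm (zeta (Complex y (2 * t))) \<le> 2 / \<tau> * U" if y: "1 < y" "y \<le> 2" for y
      proof -
        have "norm (zext (Complex y (2 * t))) \<le> (1 + 1 / \<tau>) * (2 * (13 + 1 / \<rho>) * (2 + \<bar>t\<bar>) powr (2 * \<rho>))"
        proof (rule zext_U[OF \<rho> \<tau>(1)])
          show "\<tau> \<le> norm (Complex y (2 * t) - 1)" using 2 abs_Im_le_cmod[of "Complex y (2 * t) - 1"] by simp
        qed (use y \<rho> in auto)
        also have "\<dots> \<le> (2 / \<tau>) * U"
        proof (rule mult_mono)
          show "1 + 1 / \<tau> \<le> 2 / \<tau>" using \<tau> by (simp add: field_simps)
          have "2 + \<bar>t\<bar> \<le> real q * (2 + \<bar>t\<bar>)" using q(2) by (simp add: mult_le_cancel_right1)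
          then show "2 * (13 + 1 / \<rho>) * (2 + \<bar>t\<bar>) powr (2 * \<rho>) \<le> U" unfolding U using \<rho> by (intro mult_left_mono powr_mono2) auto
        qed (use \<tau> \<rho> in auto)
        finally show ?thesis using zext_eq[of "Complex y (2 * t)"] y by simp
      qed
      have "1 * 1 \<le> 2 / \<tau> * U" using \<tau> U1 by (intro mult_mono) (auto simp: field_simps)
      then show "1 \<le> 2 / \<tau> * U" by simp
    qed (use x \<rho> U1 in auto)
    \<comment> \<open>2/\<tau> = 8 U/(l \<rho>) is the source of the constant 8 * 148176000 and of
      the powers l, \<rho>^4 and U^5.\<close>
    moreover have "\<rho> ^ 3 / (148176000 * (2 / \<tau> * U) * U ^ 3) = l * \<rho> ^ 4 / (1185408000 * U ^ 5)"
      using l \<rho> U1 by (simp add: \<tau>_def field_simps eval_nat_numeral)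
    ultimately show ?thesis by simp
  next
    case 3
    have "\<tau> / 420 \<le> (x - 1) / 210" using 3 by simp
    then show ?thesis using trivial_lower[OF cm x, of t] goal2 by linarith
  qed
qed

text \<open>U has the size Q^(2 \<rho>), so U^5 together with Siegel's bound for the exponent \<rho>
  gives 11 \<rho>. The complex case, with U^4, stays within 8 \<rho>. The split is by whether the
  square of \<xi> is principal, which forces \<xi> to be real.\<close>

lemma L_lower:
  assumes \<rho>: "0 < \<rho>" "\<rho> \<le> 1/2"
  shows "\<exists>c>0. \<forall>q \<xi> s. q > 0 \<longrightarrow> dchar q \<xi> \<longrightarrow> nonprincipal q \<xi> \<longrightarrow> 1 < Re s \<longrightarrow> Re s \<le> 2
     \<longrightarrow> c * (real q * (2 + \<bar>Im s\<bar>)) powr (- 11 * \<rho>) \<le> norm (dser \<xi> s)"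
proof -
  obtain c0 where c0: "c0 > 0" "\<And>q \<xi>. rchar q \<xi> \<Longrightarrow> Re (dser \<xi> 1) \<ge> c0 * real q powr (-\<rho>)"
    using siegel[OF \<rho>(1)] by blast
  define C0 where "C0 = 2 * (13 + 1 / \<rho>)"
  have C0: "C0 \<ge> 1" unfolding C0_def by (rule C0_ge_1[OF \<rho>(1)])
  define c where "c = min (\<rho> ^ 3 / (148176000 * C0 ^ 4)) (min c0 1 * \<rho> ^ 4 / (1185408000 * C0 ^ 5))"
  have cpos: "c > 0" using \<rho> C0 c0 by (simp add: c_def)
  show ?thesis
  proof (intro exI[of _ c] conjI allI impI cpos)
    fix q \<xi> s assume q: "q > 0" and d: "dchar q \<xi>" and np: "nonprincipal q \<xi>" and s: "1 < Re s" "Re s \<le> 2"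
    define Q where "Q = real q * (2 + \<bar>Im s\<bar>)"
    have q1: "real q \<ge> 1" using q by simp
    have Qq: "real q \<le> Q" "1 \<le> Q" using q1 mult_mono[of 1 "real q" 1 "2 + \<bar>Im s\<bar>"] by (auto simp: Q_def mult_le_cancel_left1)
    define U where "U = 2 * (13 + 1 / \<rho>) * (real q * (2 + \<bar>Im s\<bar>)) powr (2 * \<rho>)"
    have UQ: "U = C0 * Q powr (2 * \<rho>)" by (simp add: U_def C0_def Q_def)
    have Upow: "U ^ k = C0 ^ k * Q powr (real k * (2 * \<rho>))" for k
      using Qq by (simp add: UQ power_mult_distrib powr_power mult_ac)
    have s': "s = Complex (Re s) (Im s)" by simp
    have pm: "Q powr (-a) = 1 / Q powr a" for a by (rule powr_minus_divide)
    show "c * (real q * (2 + \<bar>Im s\<bar>)) powr (- 11 * \<rho>) \<le> norm (dser \<xi> s)"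
    proof (cases "nonprincipal q (\<lambda>n. \<xi> n * \<xi> n)")
      case True
      have "\<rho> ^ 3 / (148176000 * U ^ 4) \<le> norm (dser \<xi> (Complex (Re s) (Im s)))"
        by (rule L_lower_complex[OF dchar_cmult[OF q d] dchar_psb[OF q d np] q1 dchar_psb[OF q dchar_mult_dchar[OF d d] True] \<rho> s U_def])
      moreover have "c * Q powr (- 11 * \<rho>) \<le> \<rho> ^ 3 / (148176000 * U ^ 4)"
      proof -
        have "c * Q powr (- 11 * \<rho>) \<le> \<rho> ^ 3 / (148176000 * C0 ^ 4) * Q powr (- (8 * \<rho>))"
          using \<rho> Qq C0 cpos by (intro mult_mono powr_mono) (auto simp: c_def)
        then show ?thesis unfolding Upow pm by simp
      qed
      ultimately show ?thesis by (simp add: Q_def)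
    next
      case False
      have "Im (\<xi> n) = 0" for n
      proof (cases "coprime n q")
        case True
        then have "\<xi> n * \<xi> n = 1" using False by (auto simp: nonprincipal_def)
        then have "(\<xi> n - 1) * (\<xi> n + 1) = 0" by (simp add: algebra_simps)
        then have "\<xi> n = 1 \<or> \<xi> n = -1" by (auto simp: add_eq_0_iff2)
        then show ?thesis by auto
      next
        case False
        then show ?thesis using dchar_nz[OF d, of n] by simp
      qed
      then have r: "rchar q \<xi>" using q d np by (simp add: rchar_def)
      define l where "l = min c0 1 * Q powr (-\<rho>)"
      have Ql: "Q powr (-\<rho>) \<le> 1" "Q powr (-\<rho>) \<le> real q powr (-\<rho>)"
        using Qq q1 \<rho> powr_mono[of "-\<rho>" 0 Q] by (auto intro!: powr_mono2')
      have l: "0 < l" "l \<le> 1" "l \<le> Re (dser \<xi> 1)"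
      proof -
        show "0 < l" using c0 Qq by (simp add: l_def)
        show "l \<le> 1" unfolding l_def using c0 Ql by (intro mult_le_one) auto
        have "l \<le> c0 * real q powr (-\<rho>)" unfolding l_def using c0 Ql by (intro mult_mono) auto
        then show "l \<le> Re (dser \<xi> 1)" using c0(2)[OF r] by linarith
      qed
      have "l * \<rho> ^ 4 / (1185408000 * U ^ 5) \<le> norm (dser \<xi> (Complex (Re s) (Im s)))"
        by (rule L_lower_real[OF r \<rho> s l U_def])
      moreover have "c * Q powr (- 11 * \<rho>) \<le> l * \<rho> ^ 4 / (1185408000 * U ^ 5)"
      proof -
        have "c * Q powr (- 11 * \<rho>) \<le> (min c0 1 * \<rho> ^ 4 / (1185408000 * C0 ^ 5)) * Q powr (- 11 * \<rho>)"
          by (intro mult_right_mono) (auto simp: c_def)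
        moreover have "Q powr (- 11 * \<rho>) = Q powr (-\<rho>) * Q powr (- (10 * \<rho>))" by (simp flip: powr_add)
        moreover have "(min c0 1 * \<rho> ^ 4 / (1185408000 * C0 ^ 5)) * (Q powr (-\<rho>) * Q powr (- (10 * \<rho>))) = l * \<rho> ^ 4 / (1185408000 * U ^ 5)"
          unfolding Upow l_def pm[of "10 * \<rho>"] by (simp add: mult_ac)
        ultimately show ?thesis by simp
      qed
      ultimately show ?thesis by (simp add: Q_def)
    qed
  qed
qed

text \<open>The ratio of the upper to the lower bound for L is of size Q^(13 \<rho>), with 2 \<rho>
  from above and 11 \<rho> from below. The j-th derivative of L'/L raises it to the power j + 1,
  which dictates \<rho>.\<close>

theorem dser_mangoldt_char_bound:
  assumes "\<epsilon> > 0"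
  shows "\<exists>C>0. \<forall>q \<xi> s. q > 0 \<longrightarrow> dchar q \<xi> \<longrightarrow> nonprincipal q \<xi> \<longrightarrow> 1 < Re s \<longrightarrow> Re s \<le> 2
     \<longrightarrow> norm (dser (\<lambda>n. mangoldt n * \<xi> n * of_real (ln (real n)) ^ j) s) \<le> C * (real q * (2 + \<bar>Im s\<bar>)) powr \<epsilon>"
proof -
  define \<rho> where "\<rho> = min (1/2) (\<epsilon> / (13 * real (Suc j)))"
  have \<rho>: "0 < \<rho>" "\<rho> \<le> 1/2" using assms unfolding \<rho>_def by (simp, linarith)
  have "\<rho> \<le> \<epsilon> / (13 * real (Suc j))" by (simp add: \<rho>_def)
  then have \<rho>\<epsilon>: "real (Suc j) * (13 * \<rho>) \<le> \<epsilon>" by (simp add: field_simps)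
  obtain c where c: "c > 0" "\<And>q \<xi> s. q > 0 \<Longrightarrow> dchar q \<xi> \<Longrightarrow> nonprincipal q \<xi> \<Longrightarrow> 1 < Re s \<Longrightarrow> Re s \<le> 2
     \<Longrightarrow> c * (real q * (2 + \<bar>Im s\<bar>)) powr (- 11 * \<rho>) \<le> norm (dser \<xi> s)"
    using L_lower[OF \<rho>] by blast
  define C0 where "C0 = 2 * (13 + 1 / \<rho>)"
  have C0: "C0 \<ge> 1" unfolding C0_def by (rule C0_ge_1[OF \<rho>(1)])
  define C where "C = fact j * (4 * C0 / (\<rho> * c)) ^ Suc j"
  have C: "C > 0" using C0 \<rho> c by (simp add: C_def)
  show ?thesis
  proof (intro exI[of _ C] conjI allI impI C)
    fix q \<xi> s assume q: "q > 0" and d: "dchar q \<xi>" and np: "nonprincipal q \<xi>" and s: "1 < Re s" "Re s \<le> 2"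
    note cm = dchar_cmult[OF q d] and ps = dchar_psb[OF q d np]
    define Q where "Q = real q * (2 + \<bar>Im s\<bar>)"
    have q1: "real q \<ge> 1" using q by simp
    have Q1: "1 \<le> Q" using q1 mult_mono[of 1 "real q" 1 "2 + \<bar>Im s\<bar>"] by (auto simp: Q_def)
    define U where "U = C0 * Q powr (2 * \<rho>)"
    define m where "m = c * Q powr (- 11 * \<rho>)"
    have ball: "1 - \<rho> \<le> Re w" "Re w \<le> 4" "\<bar>Im w\<bar> \<le> 2 + 2 * \<bar>Im s\<bar>" "Re w > 0" if "w \<in> cball s \<rho>" for w
      using cball_vertical[of w "Re s" "Im s" \<rho>] that s \<rho> by simp_all
    have B: "norm ((deriv ^^ j) (\<lambda>s. deriv (dser \<xi>) s / dser \<xi> s) s) \<le> fact j * (4 * U / (\<rho> * m)) ^ Suc j"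
    proof (rule logderiv_bound[OF _ \<rho>(1)])
      show "dser \<xi> holomorphic_on cball s \<rho>"
        by (rule holomorphic_on_subset[OF psb_holomorphic[OF ps]]) (use ball in auto)
      show "norm (dser \<xi> w) \<le> U" if "w \<in> cball s \<rho>" for w
        unfolding U_def C0_def Q_def using ball[OF that] by (intro psb_U ps q1 cm \<rho>)
      show "0 < m" using c Q1 by (simp add: m_def)
      show "m \<le> norm (dser \<xi> s)" unfolding m_def Q_def by (rule c(2)[OF q d np s])
    qed
    have "4 * U / (\<rho> * m) = 4 * C0 / (\<rho> * c) * Q powr (13 * \<rho>)"
    proof -
      have "Q powr (- 11 * \<rho>) = 1 / Q powr (11 * \<rho>)" using powr_minus_divide[of Q "11 * \<rho>"] by simp
      moreover have "Q powr (13 * \<rho>) = Q powr (2 * \<rho>) * Q powr (11 * \<rho>)" by (simp flip: powr_add)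
      ultimately show ?thesis by (simp add: U_def m_def)
    qed
    then have "fact j * (4 * U / (\<rho> * m)) ^ Suc j = C * (Q powr (13 * \<rho>)) ^ Suc j"
      by (simp only: C_def power_mult_distrib mult.assoc)
    also have "(Q powr (13 * \<rho>)) ^ Suc j = Q powr (real (Suc j) * (13 * \<rho>))"
      using Q1 by (simp add: powr_power mult_ac del: power_Suc)
    also have "C * Q powr (real (Suc j) * (13 * \<rho>)) \<le> C * Q powr \<epsilon>" using C Q1 \<rho>\<epsilon> by (intro mult_left_mono powr_mono) auto
    finally have "norm ((deriv ^^ j) (\<lambda>s. deriv (dser \<xi>) s / dser \<xi> s) s) \<le> C * Q powr \<epsilon>" using B by linarith
    moreover have "(deriv ^^ j) (\<lambda>s. deriv (dser \<xi>) s / dser \<xi> s) s = (deriv ^^ j) (\<lambda>s. - dser (\<lambda>n. mangoldt n * \<xi> n) s) s"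
    proof (rule higher_deriv_cong_ev)
      have "eventually (\<lambda>w. w \<in> {s. Re s > 1}) (nhds s)"
        by (rule eventually_nhds_in_open[OF open_Re_gt]) (use s in simp)
      then show "eventually (\<lambda>w. deriv (dser \<xi>) w / dser \<xi> w = - dser (\<lambda>n. mangoldt n * \<xi> n) w) (nhds s)"
      proof eventually_elim
        case (elim w)
        then have w: "Re w > 1" using s by simp
        have "dser \<xi> w \<noteq> 0" using L_eq_exp_logL[OF cm w] by simp
        then show ?case using DERIV_imp_deriv[OF L_deriv[OF cm w]] by simp
      qed
    qed simp
    moreover have "(deriv ^^ j) (\<lambda>s. - dser (\<lambda>n. mangoldt n * \<xi> n) s) s = - (deriv ^^ j) (dser (\<lambda>n. mangoldt n * \<xi> n)) s"
      by (rule higher_deriv_uminus[OF dser_holomorphic[OF subpoly_mangoldt[OF cm]] open_Re_gt]) (use s in simp)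
    moreover have "(deriv ^^ j) (dser (\<lambda>n. mangoldt n * \<xi> n)) s = (-1) ^ j * dser (\<lambda>n. mangoldt n * \<xi> n * of_real (ln (real n)) ^ j) s"
      by (rule dser_higher_deriv[OF subpoly_mangoldt[OF cm] s(1)])
    ultimately show "norm (dser (\<lambda>n. mangoldt n * \<xi> n * of_real (ln (real n)) ^ j) s) \<le> C * (real q * (2 + \<bar>Im s\<bar>)) powr \<epsilon>"
      by (simp add: Q_def norm_mult norm_power)
  qed
qed

section \<open>The principal case: zeta with the pole removed\<close>

lemma mangoldt_minus_one_subpoly: "subpoly (\<lambda>n. mangoldt n - 1)"
proof -
  have "subpoly (\<lambda>n. mangoldt n * 1 + - (1::complex))"
    by (intro subpoly_add subpoly_mangoldt[OF cmult_one] subpoly_uminus cmult_subpoly[OF cmult_one])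
  then show ?thesis by simp
qed

lemma dser_mangoldt_minus_one:
  assumes s: "Re s > 1"
  shows "dser (\<lambda>n. mangoldt n - 1) s = - (deriv zeta s / zeta s) - zeta s"
proof -
  have "dser (\<lambda>n. mangoldt n * 1 + - (1::complex)) s = dser (\<lambda>n. mangoldt n * 1) s + dser (\<lambda>n. - 1) s"
    by (intro dser_add subpoly_mangoldt[OF cmult_one] subpoly_uminus cmult_subpoly[OF cmult_one] s)
  also have "dser (\<lambda>n. - 1) s = - zeta s" by (rule dser_uminus[OF cmult_subpoly[OF cmult_one] s])
  also have "dser (\<lambda>n. mangoldt n * 1) s = - (deriv zeta s / zeta s)"
  proof -
    have "zeta s \<noteq> 0" using L_eq_exp_logL[OF cmult_one s] by simp
    then show ?thesis using DERIV_imp_deriv[OF L_deriv[OF cmult_one s]] by simp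
  qed
  finally show ?thesis by simp
qed

lemma nhds_Re_gt: "Re s > c \<Longrightarrow> eventually (\<lambda>w. Re w > c) (nhds s)"
  using eventually_nhds_in_open[OF open_Re_gt[of c], of s] by simp

text \<open>Subtracting 1 from \<open>mangoldt\<close> cancels the pole: - zeta'/zeta - zeta equals
  - Zf'/Zf - (Zf - 1)/(s - 1), which is holomorphic near 1 because \<open>Zf 1 = 1\<close>.
  Compactness then bounds each derivative.\<close>

lemma zeta_near_1:
  assumes \<tau>: "0 < \<tau>" "\<tau> \<le> 1/2" and Z: "\<And>w. w \<in> cball 1 \<tau> \<Longrightarrow> Zf w \<noteq> 0"
  shows "\<exists>C. \<forall>s. 1 < Re s \<longrightarrow> norm (s - 1) \<le> \<tau> / 2 \<longrightarrow> norm ((deriv ^^ j) (dser (\<lambda>n. mangoldt n - 1)) s) \<le> C"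
proof -
  define \<Phi> where "\<Phi> = (\<lambda>z. if z = 1 then deriv Zf 1 else (Zf z - Zf 1) / (z - 1))"
  define h where "h s = - (deriv Zf s / Zf s) - \<Phi> s" for s
  have sub: "ball 1 \<tau> \<subseteq> {s. Re s > 0}"
  proof
    fix s :: complex assume "s \<in> ball 1 \<tau>"
    then show "s \<in> {s. Re s > 0}" using abs_Re_le_cmod[of "1 - s"] \<tau> by (auto simp: dist_norm)
  qed
  have "\<Phi> holomorphic_on {s. Re s > 0}"
    unfolding \<Phi>_def by (rule pole_lemma[OF Zf_holomorphic]) (simp add: interior_open[OF open_Re_gt])
  then have Ph: "\<Phi> holomorphic_on ball 1 \<tau>" using sub by (rule holomorphic_on_subset)
  have Zh: "Zf holomorphic_on ball 1 \<tau>" using Zf_holomorphic sub by (rule holomorphic_on_subset)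
  have "h holomorphic_on ball 1 \<tau>" unfolding h_def
    by (intro holomorphic_intros Ph Zh holomorphic_deriv[OF Zh]) (use Z in auto)
  then have "(deriv ^^ j) h holomorphic_on ball 1 \<tau>" by (rule holomorphic_higher_deriv) simp
  then have "continuous_on (cball 1 (\<tau>/2)) ((deriv ^^ j) h)"
    by (intro holomorphic_on_imp_continuous_on) (erule holomorphic_on_subset, use \<tau> in auto)
  then have "bounded ((deriv ^^ j) h ` cball 1 (\<tau>/2))"
    by (intro compact_imp_bounded compact_continuous_image) auto
  then obtain C where C: "\<And>w. w \<in> cball 1 (\<tau>/2) \<Longrightarrow> norm ((deriv ^^ j) h w) \<le> C"
    unfolding bounded_iff by blast
  have "norm ((deriv ^^ j) (dser (\<lambda>n. mangoldt n - 1)) s) \<le> C" if s: "1 < Re s" "norm (s - 1) \<le> \<tau>/2" for s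
  proof -
    have sb: "s \<in> cball 1 (\<tau>/2)" using s by (simp add: dist_norm norm_minus_commute)
    have "(deriv ^^ j) (dser (\<lambda>n. mangoldt n - 1)) s = (deriv ^^ j) h s"
    proof (rule higher_deriv_cong_ev)
      have "eventually (\<lambda>w. w \<in> ball 1 \<tau>) (nhds s)" using sb \<tau> by (intro eventually_nhds_in_open) auto
      then show "eventually (\<lambda>w. dser (\<lambda>n. mangoldt n - 1) w = h w) (nhds s)"
        using nhds_Re_gt[OF s(1)]
      proof eventually_elim
        case (elim w)
        have w1: "w \<noteq> 1" using elim by auto
        have Zw: "Zf w \<noteq> 0" using Z elim by auto
        have ev: "eventually (\<lambda>v. zeta v = Zf v / (v - 1)) (nhds w)"
          using nhds_Re_gt[OF elim(2)] by eventually_elim (auto simp: Zf_eq)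
        have dZ: "(Zf has_field_derivative deriv Zf w) (at w)" by (rule holomorphic_derivI[OF Zh open_ball elim(1)])
        have "((\<lambda>v. Zf v / (v - 1)) has_field_derivative (deriv Zf w * (w - 1) - Zf w * 1) / ((w - 1) * (w - 1))) (at w)"
          by (rule DERIV_divide[OF dZ]) (use w1 in \<open>auto intro!: derivative_eq_intros\<close>)
        then have dz: "deriv zeta w = (deriv Zf w * (w - 1) - Zf w * 1) / ((w - 1) * (w - 1))"
          using deriv_cong_ev[OF ev refl] by (simp add: DERIV_imp_deriv)
        have z: "zeta w = Zf w / (w - 1)" using Zf_eq[OF elim(2)] w1 by simp
        show ?case unfolding dser_mangoldt_minus_one[OF elim(2)] dz z h_def \<Phi>_def using w1 Zw
          by (simp add: Zf_1 divide_simps) (simp add: algebra_simps)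
      qed
    qed simp
    then show ?thesis using C[OF sb] by simp
  qed
  then show ?thesis by blast
qed

text \<open>The 3-4-1 inequality with \<xi> = \<psi> = 1. For |t| >= \<tau>/2 the discs of radius at
  most \<tau>/4 and the point at height 2 t keep the distance \<tau>/4 from the pole; otherwise
  \<sigma> - 1 >= \<tau>/2.\<close>

lemma zeta_far_lower:
  assumes \<tau>: "0 < \<tau>" "\<tau> \<le> 1/2" and \<rho>: "0 < \<rho>" "\<rho> \<le> 1/2" and x: "1 < x" "x \<le> 2"
    and far: "\<tau> \<le> norm (Complex x t - 1)"
    and U: "U = (1 + 4 / \<tau>) * (2 * (13 + 1 / \<rho>) * (2 + \<bar>t\<bar>) powr (2 * \<rho>))" and r: "r = min \<rho> (\<tau> / 4)"
  shows "min (\<tau> / 420) (r ^ 3 / (148176000 * U ^ 4)) \<le> norm (zeta (Complex x t))"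
proof -
  have U1: "1 \<le> U"
  proof -
    have "1 * 1 \<le> U" unfolding U using U_ge_1[of 1 \<rho> t] \<rho> \<tau> by (intro mult_mono) auto
    then show ?thesis by simp
  qed
  have r': "0 < r" "r \<le> \<rho>" "r \<le> \<tau> / 4" using \<rho> \<tau> by (auto simp: r)
  consider "\<bar>t\<bar> \<ge> \<tau> / 2" | "x - 1 \<ge> \<tau> / 2"
    using cmod_le[of "Complex x t - 1"] far x by fastforce
  then show ?thesis
  proof cases
    case 1
    have ball: "\<tau> / 4 \<le> norm (w - 1)" "1 - \<rho> \<le> Re w" "Re w \<le> 4" "\<bar>Im w\<bar> \<le> 2 + 2 * \<bar>t\<bar>" "Re w > 0"
      if "1 < y" "y \<le> 2" "w \<in> cball (Complex y t) r" for y w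
    proof -
      have "r \<le> 1/2" using r' \<rho> by linarith
      note b = cball_vertical[OF that(3,1,2) this]
      show "1 - \<rho> \<le> Re w" "Re w \<le> 4" "\<bar>Im w\<bar> \<le> 2 + 2 * \<bar>t\<bar>" "Re w > 0" using b r' by linarith+
      have "\<tau> / 4 \<le> \<bar>Im w\<bar>" using b(4) r' 1 by linarith
      then show "\<tau> / 4 \<le> norm (w - 1)" using abs_Im_le_cmod[of "w - 1"] by simp
    qed
    have "r ^ 3 / (148176000 * U * U ^ 3) \<le> norm (zeta (Complex x t))"
    proof (rule lower_bound_core[OF cmult_one cmult_one, where f = zext and \<rho> = r])
      show "zext holomorphic_on cball (Complex y t) r" if "1 < y" "y \<le> 2" for y
        by (rule holomorphic_on_subset[OF zext_holomorphic]) (use ball[OF that] \<tau> in force)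
      show "norm (zext w) \<le> U" if "1 < y" "y \<le> 2" "w \<in> cball (Complex y t) r" for y w
        using zext_U[OF \<rho> _ ball(1)[OF that] ball(2-4)[OF that]] \<tau> by (simp add: U)
      show "norm (zeta (Complex y (2 * t))) \<le> U" if y: "1 < y" "y \<le> 2" for y
      proof -
        have "norm (zext (Complex y (2 * t))) \<le> (1 + 1 / (\<tau>/4)) * (2 * (13 + 1 / \<rho>) * (2 + \<bar>t\<bar>) powr (2 * \<rho>))"
        proof (rule zext_U[OF \<rho>])
          show "\<tau> / 4 \<le> norm (Complex y (2 * t) - 1)" using 1 \<tau> abs_Im_le_cmod[of "Complex y (2 * t) - 1"] by simp
        qed (use y \<rho> \<tau> in auto)
        then show ?thesis using zext_eq[of "Complex y (2 * t)"] y by (simp add: U)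
      qed
    qed (use x r' \<rho> U1 in \<open>auto simp: zext_eq\<close>)
    then have "r ^ 3 / (148176000 * U ^ 4) \<le> norm (zeta (Complex x t))" by (simp add: eval_nat_numeral mult_ac)
    then show ?thesis by linarith
  next
    case 2
    then have "\<tau> / 420 \<le> (x - 1) / 210" by simp
    then show ?thesis using trivial_lower[OF cmult_one x, of t] by linarith
  qed
qed

theorem dser_mangoldt_zeta_bound:
  assumes "\<epsilon> > 0"
  shows "\<exists>C>0. \<forall>s. 1 < Re s \<longrightarrow> Re s \<le> 2
     \<longrightarrow> norm (dser (\<lambda>n. (mangoldt n - 1) * of_real (ln (real n)) ^ j) s) \<le> C * (2 + \<bar>Im s\<bar>) powr \<epsilon>"
proof -
  \<comment> \<open>10 \<rho> = 2 \<rho> + 8 \<rho>, from U in the upper and U^4 in the lower bound;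
    again the power j + 1 is taken.\<close>
  define \<rho> where "\<rho> = min (1/2) (\<epsilon> / (10 * real (Suc j)))"
  have \<rho>: "0 < \<rho>" "\<rho> \<le> 1/2" using assms unfolding \<rho>_def by (simp, linarith)
  have "\<rho> \<le> \<epsilon> / (10 * real (Suc j))" by (simp add: \<rho>_def)
  then have \<rho>\<epsilon>: "real (Suc j) * (10 * \<rho>) \<le> \<epsilon>" by (simp add: field_simps)
  have "1 * (10 * \<rho>) \<le> real (Suc j) * (10 * \<rho>)" using \<rho> by (intro mult_right_mono) auto
  then have \<rho>\<epsilon>': "2 * \<rho> \<le> \<epsilon>" using \<rho>\<epsilon> \<rho> by linarith
  have "isCont Zf 1"
    using continuous_on_eq_continuous_at[OF open_Re_gt[of 0], of Zf] holomorphic_on_imp_continuous_on[OF Zf_holomorphic] by simp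
  then obtain d where d: "d > 0" "\<And>z. dist z 1 < d \<Longrightarrow> dist (Zf z) (Zf 1) < 1"
    unfolding continuous_at_eps_delta by (meson zero_less_one)
  define \<tau>0 where "\<tau>0 = min (d/2) (1/2)"
  have \<tau>0: "0 < \<tau>0" "\<tau>0 \<le> 1/2" using d unfolding \<tau>0_def by (simp, linarith)
  have "\<tau>0 < d" using d unfolding \<tau>0_def by linarith
  have Znz: "Zf w \<noteq> 0" if "w \<in> cball 1 \<tau>0" for w
  proof
    assume "Zf w = 0"
    then show False using d(2)[of w] that \<open>\<tau>0 < d\<close> by (auto simp: Zf_1 dist_commute)
  qed
  define \<tau> where "\<tau> = \<tau>0 / 2"
  have \<tau>: "0 < \<tau>" "\<tau> \<le> 1/2" using \<tau>0 by (auto simp: \<tau>_def)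
  obtain Cn where Cn: "\<And>s. 1 < Re s \<Longrightarrow> norm (s - 1) \<le> \<tau> \<Longrightarrow> norm ((deriv ^^ j) (dser (\<lambda>n. mangoldt n - 1)) s) \<le> Cn"
    using zeta_near_1[OF \<tau>0 Znz, of j] unfolding \<tau>_def by blast
  define r where "r = min \<rho> (\<tau> / 4)"
  have r: "0 < r" "r \<le> \<rho>" "r \<le> \<tau> / 4" "r \<le> 1/2" using \<rho> \<tau> unfolding r_def by (simp, linarith+)
  define C1 where "C1 = (1 + 4 / \<tau>) * (2 * (13 + 1 / \<rho>))"
  have C1: "1 \<le> C1"
  proof -
    have "1 * 1 \<le> C1" unfolding C1_def using C0_ge_1[OF \<rho>(1)] \<tau> by (intro mult_mono) auto
    then show ?thesis by simp
  qed
  define \<kappa> where "\<kappa> = min (\<tau> / 420) (r ^ 3 / (148176000 * C1 ^ 4))"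
  have \<kappa>: "\<kappa> > 0" using \<tau> r C1 by (simp add: \<kappa>_def)
  define Cf where "Cf = fact j * (4 * C1 / (r * \<kappa>)) ^ Suc j + fact j * C1 / r ^ j"
  have Cf: "Cf > 0" using C1 r \<kappa> by (simp add: Cf_def add_pos_pos)
  define C where "C = max Cn Cf"
  have C: "C > 0" "Cn \<le> C" "Cf \<le> C" using Cf unfolding C_def by auto
  have main: "norm ((deriv ^^ j) (dser (\<lambda>n. mangoldt n - 1)) s) \<le> C * (2 + \<bar>Im s\<bar>) powr \<epsilon>" if s: "1 < Re s" "Re s \<le> 2" for s
  proof -
    define Q where "Q = 2 + \<bar>Im s\<bar>"
    have Q1: "1 \<le> Q" by (simp add: Q_def)
    have Q\<epsilon>: "1 \<le> Q powr \<epsilon>" using Q1 assms by (intro ge_one_powr_ge_zero) auto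
    show ?thesis
    proof (cases "norm (s - 1) \<le> \<tau>")
      case True
      then have "norm ((deriv ^^ j) (dser (\<lambda>n. mangoldt n - 1)) s) \<le> C * 1" using Cn[OF s(1)] C by fastforce
      also have "\<dots> \<le> C * Q powr \<epsilon>" using C Q\<epsilon> by (intro mult_left_mono) auto
      finally show ?thesis by (simp add: Q_def)
    next
      case False
      define U where "U = C1 * Q powr (2 * \<rho>)"
      have U': "U = (1 + 4 / \<tau>) * (2 * (13 + 1 / \<rho>) * (2 + \<bar>Im s\<bar>) powr (2 * \<rho>))" by (simp add: U_def C1_def Q_def)
      define m where "m = \<kappa> * Q powr (- 8 * \<rho>)"
      have ball: "\<tau> / 4 \<le> norm (w - 1)" "1 - \<rho> \<le> Re w" "Re w \<le> 4" "\<bar>Im w\<bar> \<le> 2 + 2 * \<bar>Im s\<bar>" "Re w > 0"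
        if w: "w \<in> cball s r" for w
      proof -
        have "w \<in> cball (Complex (Re s) (Im s)) r" using w by simp
        note b = cball_vertical[OF this s r(4)]
        show "1 - \<rho> \<le> Re w" "Re w \<le> 4" "\<bar>Im w\<bar> \<le> 2 + 2 * \<bar>Im s\<bar>" "Re w > 0" using b r by linarith+
        have "norm (s - w) \<le> r" using w by (simp add: dist_norm)
        then show "\<tau> / 4 \<le> norm (w - 1)" using norm_triangle_ineq[of "s - w" "w - 1"] False r \<tau> by simp
      qed
      have zh: "zext holomorphic_on cball s r"
        by (rule holomorphic_on_subset[OF zext_holomorphic]) (use ball \<tau> in force)
      have zU: "norm (zext w) \<le> U" if "w \<in> cball s r" for w
        using zext_U[OF \<rho> _ ball(1)[OF that] ball(2-4)[OF that]] \<tau> by (simp add: U')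
      have Upow: "U ^ 4 = C1 ^ 4 * Q powr (8 * \<rho>)"
      proof -
        have "(Q powr (2 * \<rho>)) ^ 4 = Q powr (8 * \<rho>)" using Q1 by (simp add: powr_power)
        then show ?thesis by (simp add: U_def power_mult_distrib)
      qed
      have Qm: "Q powr (- 8 * \<rho>) \<le> 1" using Q1 \<rho> powr_mono[of "- 8 * \<rho>" 0 Q] by simp
      have pm: "Q powr (- 8 * \<rho>) = 1 / Q powr (8 * \<rho>)" using powr_minus_divide[of Q "8 * \<rho>"] by simp
      have "m \<le> min (\<tau> / 420) (r ^ 3 / (148176000 * U ^ 4))"
      proof (rule min.boundedI)
        have "m \<le> \<kappa> * 1" unfolding m_def using \<kappa> Qm by (intro mult_left_mono) auto
        then show "m \<le> \<tau> / 420" by (simp add: \<kappa>_def)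
        have "m \<le> r ^ 3 / (148176000 * C1 ^ 4) * Q powr (- 8 * \<rho>)" unfolding m_def by (intro mult_right_mono) (auto simp: \<kappa>_def)
        then show "m \<le> r ^ 3 / (148176000 * U ^ 4)" unfolding Upow pm by (simp add: mult_ac)
      qed
      moreover have "min (\<tau> / 420) (r ^ 3 / (148176000 * U ^ 4)) \<le> norm (zeta (Complex (Re s) (Im s)))"
        by (rule zeta_far_lower[OF \<tau> \<rho> s _ U' r_def]) (use False in simp)
      ultimately have "m \<le> norm (zeta (Complex (Re s) (Im s)))" by (rule order_trans)
      then have mz: "m \<le> norm (zext s)" using zext_eq[OF s(1)] by simp
      have m0: "0 < m" using \<kappa> Q1 by (simp add: m_def)
      have B1: "norm ((deriv ^^ j) (\<lambda>s. deriv zext s / zext s) s) \<le> fact j * (4 * U / (r * m)) ^ Suc j"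
        by (rule logderiv_bound[OF zh r(1) zU m0 mz])
      have B2: "norm ((deriv ^^ j) zext s) \<le> fact j * U / r ^ j"
      proof (rule Cauchy_inequality[OF _ _ r(1)])
        show "zext holomorphic_on ball s r" using zh by (rule holomorphic_on_subset) auto
        show "continuous_on (cball s r) zext" using zh by (rule holomorphic_on_imp_continuous_on)
        show "norm (zext x) \<le> U" if "norm (s - x) = r" for x using that by (intro zU) (simp add: dist_norm)
      qed
      have e1: "4 * U / (r * m) = 4 * C1 / (r * \<kappa>) * Q powr (10 * \<rho>)"
      proof -
        have "Q powr (10 * \<rho>) = Q powr (2 * \<rho>) * Q powr (8 * \<rho>)" by (simp flip: powr_add)
        then show ?thesis unfolding U_def m_def pm by simp
      qed
      have "(Q powr (10 * \<rho>)) ^ Suc j = Q powr (real (Suc j) * (10 * \<rho>))"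
        using Q1 by (simp add: powr_power mult_ac del: power_Suc)
      also have "\<dots> \<le> Q powr \<epsilon>" using Q1 \<rho>\<epsilon> by (intro powr_mono) auto
      finally have e2: "(Q powr (10 * \<rho>)) ^ Suc j \<le> Q powr \<epsilon>" .
      have b1: "fact j * (4 * U / (r * m)) ^ Suc j \<le> fact j * (4 * C1 / (r * \<kappa>)) ^ Suc j * Q powr \<epsilon>"
        unfolding e1 power_mult_distrib mult.assoc[symmetric] using C1 r \<kappa> by (intro mult_left_mono e2) auto
      have b2: "fact j * U / r ^ j \<le> fact j * C1 / r ^ j * Q powr \<epsilon>"
      proof -
        have "fact j * U / r ^ j = fact j * C1 / r ^ j * Q powr (2 * \<rho>)" by (simp add: U_def)
        also have "\<dots> \<le> fact j * C1 / r ^ j * Q powr \<epsilon>" using C1 r Q1 \<rho>\<epsilon>' by (intro mult_left_mono powr_mono) auto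
        finally show ?thesis .
      qed
      let ?S = "{s. Re s > 1}"
      have zS: "zext holomorphic_on ?S" by (rule holomorphic_on_subset[OF zext_holomorphic]) auto
      have nz: "zext w \<noteq> 0" if "w \<in> ?S" for w using that zext_eq[of w] L_eq_exp_logL[OF cmult_one, of w] by simp
      have lS: "(\<lambda>s. deriv zext s / zext s) holomorphic_on ?S"
        by (intro holomorphic_intros holomorphic_deriv[OF zS open_Re_gt] zS nz)
      have "(deriv ^^ j) (dser (\<lambda>n. mangoldt n - 1)) s = (deriv ^^ j) (\<lambda>s. - (deriv zext s / zext s) - zext s) s"
      proof (rule higher_deriv_cong_ev)
        show "eventually (\<lambda>w. dser (\<lambda>n. mangoldt n - 1) w = - (deriv zext w / zext w) - zext w) (nhds s)"
          using nhds_Re_gt[OF s(1)]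
        proof eventually_elim
          case (elim w)
          have "eventually (\<lambda>v. zext v = zeta v) (nhds w)" using nhds_Re_gt[OF elim] by eventually_elim (rule zext_eq)
          then have "deriv zext w = deriv zeta w" by (rule deriv_cong_ev) simp
          then show ?case using dser_mangoldt_minus_one[OF elim] zext_eq[OF elim] by simp
        qed
      qed simp
      also have "\<dots> = (deriv ^^ j) (\<lambda>s. - (deriv zext s / zext s)) s - (deriv ^^ j) zext s"
        by (rule higher_deriv_diff[of _ ?S]) (use s open_Re_gt zS lS in \<open>auto intro!: holomorphic_intros\<close>)
      also have "(deriv ^^ j) (\<lambda>s. - (deriv zext s / zext s)) s = - (deriv ^^ j) (\<lambda>s. deriv zext s / zext s) s"
        by (rule higher_deriv_uminus[of _ ?S]) (use s open_Re_gt lS in auto)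
      finally have "norm ((deriv ^^ j) (dser (\<lambda>n. mangoldt n - 1)) s) \<le> norm ((deriv ^^ j) (\<lambda>s. deriv zext s / zext s) s) + norm ((deriv ^^ j) zext s)"
        using norm_triangle_ineq4[of "- (deriv ^^ j) (\<lambda>s. deriv zext s / zext s) s" "(deriv ^^ j) zext s"] by simp
      also have "\<dots> \<le> Cf * Q powr \<epsilon>" using B1 B2 b1 b2 unfolding Cf_def distrib_right by linarith
      also have "\<dots> \<le> C * Q powr \<epsilon>" using C by (intro mult_right_mono) auto
      finally show ?thesis by (simp add: Q_def)
    qed
  qed
  show ?thesis
  proof (intro exI[of _ C] conjI allI impI C)
    fix s assume s: "1 < Re s" "Re s \<le> 2"
    show "norm (dser (\<lambda>n. (mangoldt n - 1) * of_real (ln (real n)) ^ j) s) \<le> C * (2 + \<bar>Im s\<bar>) powr \<epsilon>"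
      using main[OF s] dser_higher_deriv[OF mangoldt_minus_one_subpoly s(1), of j] by (simp add: norm_mult norm_power)
  qed
qed

section \<open>A Tauberian theorem\<close>

text \<open>Up to scaling the Fejer kernel: its cosine transform is a tent, and its decay 1/t^2
  beats a growth |t|^(1/2) of the Dirichlet series.\<close>

definition fker :: "real \<Rightarrow> real \<Rightarrow> real" where "fker a t = (1 - cos (a * t)) / t\<^sup>2"

lemma fker_nonneg: "0 \<le> fker a t" by (simp add: fker_def)

lemma one_minus_cos_le: "1 - cos x \<le> x\<^sup>2 / (2::real)"
proof -
  have "\<bar>sin (x/2)\<bar> \<le> \<bar>x/2\<bar>" by (rule abs_sin_x_le_abs_x)
  then have "(sin (x/2))\<^sup>2 \<le> (x/2)\<^sup>2" by (simp only: abs_le_square_iff)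
  moreover have "1 - cos x = 2 * (sin (x/2))\<^sup>2" using cos_double_sin[of "x/2"] by simp
  ultimately show ?thesis by (simp add: power2_eq_square)
qed

lemma einterval_0_inf: "einterval 0 \<infinity> = {0<..}"
  by (auto simp: einterval_def)

text \<open>\<open>?F\<close> is the antiderivative found by integrating by parts; the sine integral
  supplies the limit at infinity.\<close>

lemma fker_integral:
  assumes "a > 0"
  shows "set_integrable lborel {0<..} (fker a)" "(LBINT t:{0<..}. fker a t) = pi / 2 * a"
proof -
  let ?F = "\<lambda>t. a * Si (a * t) - (1 - cos (a * t)) / t"
  have D: "DERIV ?F x :> fker a x" if "0 < x" for x
  proof -
    have "(?F has_real_derivative a * (sinc (a * x) * a) - ((sin (a * x) * a) * x - (1 - cos (a * x)) * 1) / (x * x)) (at x)"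
      using that by (auto intro!: derivative_eq_intros DERIV_chain2[OF DERIV_Si])
    moreover have "a * (sinc (a * x) * a) - ((sin (a * x) * a) * x - (1 - cos (a * x)) * 1) / (x * x) = fker a x"
      using that assms by (simp add: fker_def field_simps power2_eq_square)
    ultimately show ?thesis by simp
  qed
  have A: "(?F \<longlongrightarrow> 0) (at_right 0)"
  proof -
    have "isCont (\<lambda>t. a * Si (a * t)) 0" by (intro continuous_intros isCont_o2[OF _ isCont_Si])
    then have "((\<lambda>t. a * Si (a * t)) \<longlongrightarrow> a * Si (a * 0)) (at_right 0)"
      unfolding isCont_def by (rule filterlim_mono[OF _ order_refl at_le]) simp
    moreover have "Si 0 = 0" by (simp add: Si_def interval_integral_endpoints_same zero_ereal_def[symmetric])
    moreover have "((\<lambda>t. (1 - cos (a * t)) / t) \<longlongrightarrow> 0) (at_right 0)" by real_asymp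
    ultimately show ?thesis using tendsto_diff by fastforce
  qed
  have B: "(?F \<longlongrightarrow> pi / 2 * a) at_top"
  proof -
    have "((\<lambda>t. Si (a * t)) \<longlongrightarrow> pi / 2) at_top"
      by (rule filterlim_compose[OF Si_at_top]) (use assms in real_asymp)
    then have "((\<lambda>t. a * Si (a * t)) \<longlongrightarrow> a * (pi / 2)) at_top" by (intro tendsto_intros)
    moreover have "((\<lambda>t. (1 - cos (a * t)) / t) \<longlongrightarrow> 0) at_top"
    proof (rule Lim_null_comparison)
      show "eventually (\<lambda>t. norm ((1 - cos (a * t)) / t) \<le> 2 / t) at_top"
        using eventually_gt_at_top[of 0]
      proof eventually_elim
        case (elim t)
        have "1 - cos (a * t) \<le> 2" using cos_ge_minus_one[of "a * t"] by linarith
        then show ?case using elim by (simp add: divide_right_mono)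
      qed
    qed real_asymp
    ultimately have "((\<lambda>t. a * Si (a * t) - (1 - cos (a * t)) / t) \<longlongrightarrow> a * (pi / 2) - 0) at_top" by (rule tendsto_diff)
    then show ?thesis by (simp add: mult.commute)
  qed
  have A': "((?F \<circ> real_of_ereal) \<longlongrightarrow> 0) (at_right 0)" using A by (simp add: ereal_tendsto_simps zero_ereal_def)
  have B': "((?F \<circ> real_of_ereal) \<longlongrightarrow> pi / 2 * a) (at_left \<infinity>)" using B by (simp add: ereal_tendsto_simps)
  have D': "DERIV ?F x :> fker a x" if "0 < ereal x" "ereal x < \<infinity>" for x using D that by simp
  have c': "isCont (fker a) x" if "0 < ereal x" "ereal x < \<infinity>" for x
    using that unfolding fker_def by (intro continuous_intros) auto
  have n': "AE x in lborel. 0 < ereal x \<longrightarrow> ereal x < \<infinity> \<longrightarrow> 0 \<le> fker a x" by (simp add: fker_nonneg)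
  note FTC = interval_integral_FTC_nonneg[OF _ D' c' n' A' B', simplified]
  show "set_integrable lborel {0<..} (fker a)" using FTC(1) by (simp add: einterval_0_inf)
  show "(LBINT t:{0<..}. fker a t) = pi / 2 * a" using FTC(2) by (simp add: interval_lebesgue_integral_def einterval_0_inf)
qed

lemma fker_integral_abs:
  shows "set_integrable lborel {0<..} (fker a)" "(LBINT t:{0<..}. fker a t) = pi / 2 * \<bar>a\<bar>"
proof -
  have m: "fker a = fker \<bar>a\<bar>" by (rule ext) (simp add: fker_def abs_if)
  have "set_integrable lborel {0<..} (fker a) \<and> (LBINT t:{0<..}. fker a t) = pi / 2 * \<bar>a\<bar>"
  proof (cases "a = 0")
    case True
    then have "fker a = (\<lambda>_. 0)" by (auto simp: fker_def)
    then show ?thesis using True by (auto simp: set_integrable_def set_lebesgue_integral_def)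
  next
    case False
    then show ?thesis using fker_integral[of "\<bar>a\<bar>"] by (simp flip: m)
  qed
  then show "set_integrable lborel {0<..} (fker a)" "(LBINT t:{0<..}. fker a t) = pi / 2 * \<bar>a\<bar>" by blast+
qed

definition tent :: "real \<Rightarrow> real \<Rightarrow> real" where "tent \<delta> u = max 0 (1 - \<bar>u\<bar> / \<delta>)"

text \<open>By the product formula for cosines the integrand is a second difference of
  \<open>fker\<close> in its parameter. Its integral is the same second difference of pi/2 |u|, a
  tent.\<close>

lemma tent_integral:
  assumes \<delta>: "\<delta> > 0"
  shows "set_integrable lborel {0<..} (\<lambda>t. fker \<delta> t * cos (u * t))"
    "(LBINT t:{0<..}. fker \<delta> t * cos (u * t)) = pi / 2 * \<delta> * tent \<delta> u"
proof -
  have e: "fker \<delta> t * cos (u * t) = (1/2) * fker (u + \<delta>) t + (1/2) * fker (u - \<delta>) t - fker u t" for t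
  proof -
    have c: "cos (u * t) * cos (\<delta> * t) = (cos (u * t + \<delta> * t) + cos (u * t - \<delta> * t)) / 2" by (simp add: cos_add cos_diff)
    have "(1 - cos (\<delta> * t)) * cos (u * t) = cos (u * t) - cos (u * t) * cos (\<delta> * t)" by (simp add: algebra_simps)
    also have "\<dots> = (1/2) * (1 - cos ((u + \<delta>) * t)) + (1/2) * (1 - cos ((u - \<delta>) * t)) - (1 - cos (u * t))"
      unfolding c by (simp add: algebra_simps)
    finally show ?thesis
      unfolding fker_def times_divide_eq_left times_divide_eq_right add_divide_distrib[symmetric] diff_divide_distrib[symmetric] by (rule arg_cong)
  qed
  note I = fker_integral_abs(1)
  have i: "set_integrable lborel {0<..} (\<lambda>t. (1/2) * fker (u + \<delta>) t)" "set_integrable lborel {0<..} (\<lambda>t. (1/2) * fker (u - \<delta>) t)"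
    using I by (auto intro!: set_integrable_mult_right)
  show "set_integrable lborel {0<..} (\<lambda>t. fker \<delta> t * cos (u * t))"
    unfolding e by (intro set_integral_diff(1) set_integral_add(1) i I)
  have "(LBINT t:{0<..}. fker \<delta> t * cos (u * t)) = (1/2) * (pi / 2 * \<bar>u + \<delta>\<bar>) + (1/2) * (pi / 2 * \<bar>u - \<delta>\<bar>) - pi / 2 * \<bar>u\<bar>"
    unfolding e using i I by (simp add: set_integral_diff set_integral_add fker_integral_abs(2))
  also have "\<dots> = pi / 2 * ((\<bar>u + \<delta>\<bar> + \<bar>u - \<delta>\<bar>) / 2 - \<bar>u\<bar>)" by (simp add: field_simps)
  also have "(\<bar>u + \<delta>\<bar> + \<bar>u - \<delta>\<bar>) / 2 - \<bar>u\<bar> = max 0 (\<delta> - \<bar>u\<bar>)" using \<delta> by (auto simp: max_def abs_if)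
  also have "max 0 (\<delta> - \<bar>u\<bar>) = \<delta> * tent \<delta> u" using \<delta> by (simp add: tent_def max_def field_simps)
  finally show "(LBINT t:{0<..}. fker \<delta> t * cos (u * t)) = pi / 2 * \<delta> * tent \<delta> u" by simp
qed

text \<open>Twice this function majorises \<open>fker \<delta> t\<close> times (2 + t)^(1/2) for all
  \<delta> <= 1 at once, and it is integrable.\<close>

definition kmaj :: "real \<Rightarrow> real" where
  "kmaj t = (if t \<le> 1 then 1 else 4 * t powr (-3/2))"

lemma kmaj_integrable: "set_integrable lborel {0<..} kmaj"
proof -
  have "set_integrable lborel (einterval 1 \<infinity>) (\<lambda>t::real. 4 * t powr (-3/2))"
  proof (rule interval_integral_FTC_nonneg(1)[where F = "\<lambda>t. - 8 * t powr (-1/2)" and A = "-8" and B = 0])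
    show "DERIV (\<lambda>t. - 8 * t powr (-1/2)) x :> 4 * x powr (-3/2)" if "1 < ereal x" for x
      using that by (auto intro!: derivative_eq_intros)
    have "((\<lambda>t::real. - 8 * t powr (-1/2)) \<longlongrightarrow> - 8 * 1 powr (-1/2)) (at_right 1)" by (intro tendsto_intros) auto
    then show "(((\<lambda>t. - 8 * t powr (-1/2)) \<circ> real_of_ereal) \<longlongrightarrow> -8) (at_right 1)" by (simp add: ereal_tendsto_simps one_ereal_def)
    have "((\<lambda>t::real. - 8 * t powr (-1/2)) \<longlongrightarrow> 0) at_top" by real_asymp
    then show "(((\<lambda>t. - 8 * t powr (-1/2)) \<circ> real_of_ereal) \<longlongrightarrow> 0) (at_left \<infinity>)" by (simp add: ereal_tendsto_simps)
    show "isCont (\<lambda>t. 4 * t powr (-3/2)) x" if "1 < ereal x" for x using that by (intro continuous_intros) auto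
  qed auto
  moreover have "einterval 1 \<infinity> = {1<..}" by (auto simp: einterval_def)
  ultimately have 1: "set_integrable lborel {1<..} (\<lambda>t::real. 4 * t powr (-3/2))" by (simp only:)
  have "set_integrable lborel {1<..} kmaj"
  proof -
    have "set_integrable lborel {1<..} kmaj \<longleftrightarrow> set_integrable lborel {1<..} (\<lambda>t::real. 4 * t powr (-3/2))"
      by (rule set_integrable_cong) (auto simp: kmaj_def)
    then show ?thesis using 1 by blast
  qed
  moreover have "set_integrable lborel {0<..1} kmaj"
  proof -
    have "set_integrable lborel {0<..1::real} (\<lambda>_. 1::real)" by (simp add: set_integrable_def)
    moreover have "set_integrable lborel {0<..1} kmaj \<longleftrightarrow> set_integrable lborel {0<..1::real} (\<lambda>_. 1::real)"
      by (rule set_integrable_cong) (auto simp: kmaj_def)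
    ultimately show ?thesis by blast
  qed
  moreover have "{0::real<..} = {0<..1} \<union> {1<..}" by auto
  ultimately show ?thesis by (simp add: set_integrable_Un)
qed

lemma fker_le_kmaj:
  assumes "0 < \<delta>" "\<delta> \<le> 1" "0 < t" shows "fker \<delta> t * (2 + t) powr (1/2) \<le> 2 * kmaj t"
proof (cases "t \<le> 1")
  case True
  have "1 - cos (\<delta> * t) \<le> (\<delta> * t)\<^sup>2 / 2" by (rule one_minus_cos_le)
  also have "\<dots> \<le> t\<^sup>2 / 2" using assms by (simp add: power_mult_distrib mult_left_le_one_le power_le_one)
  finally have "fker \<delta> t \<le> (t\<^sup>2 / 2) / t\<^sup>2" unfolding fker_def by (intro divide_right_mono) auto
  then have "fker \<delta> t \<le> 1/2" using assms by simp
  moreover have "(2 + t) powr (1/2) \<le> 4 powr (1/2)" using True assms by (intro powr_mono2) auto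
  then have "(2 + t) powr (1/2) \<le> 2" by (simp add: powr_half_sqrt)
  ultimately have "fker \<delta> t * (2 + t) powr (1/2) \<le> 1/2 * 2" using fker_nonneg by (intro mult_mono) auto
  then show ?thesis using True by (simp add: kmaj_def)
next
  case False
  have "1 - cos (\<delta> * t) \<le> 2" using cos_ge_minus_one[of "\<delta> * t"] by linarith
  then have "fker \<delta> t \<le> 2 / t\<^sup>2" unfolding fker_def by (intro divide_right_mono) auto
  moreover have "(2 + t) powr (1/2) \<le> (4 * t) powr (1/2)" using False by (intro powr_mono2) auto
  then have "(2 + t) powr (1/2) \<le> 2 * t powr (1/2)" using False by (simp add: powr_mult powr_half_sqrt)
  ultimately have "fker \<delta> t * (2 + t) powr (1/2) \<le> 2 / t\<^sup>2 * (2 * t powr (1/2))" using fker_nonneg by (intro mult_mono) auto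
  also have "\<dots> = 4 * t powr (-3/2)"
  proof -
    have "t\<^sup>2 = t powr 2" using False by (simp add: powr_numeral)
    moreover have "t powr (1/2) / t powr 2 = t powr (-3/2)" by (simp flip: powr_diff)
    ultimately show ?thesis by simp
  qed
  also have "\<dots> \<le> 2 * kmaj t" using False by (simp add: kmaj_def)
  finally show ?thesis .
qed

lemma tent_nonneg: "0 \<le> tent \<delta> u" and tent_le_1: "\<delta> > 0 \<Longrightarrow> tent \<delta> u \<le> 1"
  by (auto simp: tent_def)

lemma npow_cis: assumes "n > 0"
  shows "of_nat n powr (- Complex \<sigma> t) = of_real (real n powr (-\<sigma>)) * cis (- (t * ln (real n)))"
  using npow_split[OF assms, of \<sigma> t] unfolding mult_minus_left .

text \<open>The tent in log n is a cosine integral against \<open>fker\<close>. After exchanging sum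
  and integral, the inner sum combines the values of \<open>dser b\<close> at \<sigma> + i t and
  \<sigma> - i t, and only their size enters. The factor 1/\<delta> normalises the kernel.\<close>

lemma tent_sum_bound:
  obtains C where "C > 0"
    "\<And>b M \<sigma> \<delta> V. subpoly b \<Longrightarrow> (\<And>t. norm (dser b (Complex \<sigma> t)) \<le> M * (2 + \<bar>t\<bar>) powr (1/2)) \<Longrightarrow> 1 < \<sigma> \<Longrightarrow> 0 < \<delta> \<Longrightarrow> \<delta> \<le> 1
      \<Longrightarrow> norm (\<Sum>n. b n * of_real (real n powr (-\<sigma>) * tent \<delta> (V - ln (real n)))) \<le> C * M / \<delta>"
proof -
  define I where "I = (LBINT t:{0<..}. kmaj t)"
  have kn: "0 \<le> kmaj t" for t by (simp add: kmaj_def)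
  have I0: "0 \<le> I" unfolding I_def set_lebesgue_integral_def by (intro integral_nonneg_AE) (auto simp: kn)
  define C where "C = 4 / pi * I + 1"
  have "0 \<le> 4 / pi * I" using I0 by simp
  then have C: "C > 0" unfolding C_def by linarith
  show ?thesis
  proof (rule that[OF C])
    fix b M \<sigma> \<delta> V assume b: "subpoly b" and M: "\<And>t. norm (dser b (Complex \<sigma> t)) \<le> M * (2 + \<bar>t\<bar>) powr (1/2)"
      and \<sigma>: "1 < \<sigma>" and \<delta>: "0 < \<delta>" "\<delta> \<le> (1::real)"
    have "0 \<le> M * (2 + \<bar>0\<bar>) powr (1/2)" by (rule order_trans[OF norm_ge_zero M])
    then have M0: "0 \<le> M" by (simp add: zero_le_mult_iff)
    define \<mu> where "\<mu> n = b n * of_real (real n powr (-\<sigma>))" for n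
    have S\<mu>: "summable (\<lambda>n. norm (\<mu> n))"
      using subpoly_summable[OF b, of "of_real \<sigma>"] \<sigma> by (simp add: \<mu>_def norm_mult norm_npow)
    define u where "u n = V - ln (real n)" for n :: nat
    define g where "g n t = indicator {0<..} t *\<^sub>R (of_real (fker \<delta> t * cos (u n * t)) * \<mu> n)" for n t
    have gi0: "set_integrable lborel {0<..} (\<lambda>t. of_real (fker \<delta> t * cos (u n * t)) * \<mu> n)" for n
      using tent_integral(1)[OF \<delta>(1), of "u n"]
      by (intro set_integrable_mult_left) (simp add: set_integrable_def scaleR_conv_of_real flip: of_real_mult)
    then have gi: "integrable lborel (g n)" for n unfolding g_def set_integrable_def by simp
    have gint: "integral\<^sup>L lborel (g n) = of_real (pi / 2 * \<delta> * tent \<delta> (u n)) * \<mu> n" for n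
    proof -
      have "integral\<^sup>L lborel (g n) = (LBINT t. of_real (indicator {0<..} t * (fker \<delta> t * cos (u n * t))) * \<mu> n)"
        unfolding g_def by (simp add: scaleR_conv_of_real mult.assoc)
      also have "\<dots> = of_real (LBINT t. indicator {0<..} t * (fker \<delta> t * cos (u n * t))) * \<mu> n"
        by (simp only: integral_mult_left_zero integral_complex_of_real)
      also have "(LBINT t. indicator {0<..} t * (fker \<delta> t * cos (u n * t))) = pi / 2 * \<delta> * tent \<delta> (u n)"
        using tent_integral(2)[OF \<delta>(1), of "u n"] by (simp add: set_lebesgue_integral_def)
      finally show ?thesis .
    qed
    have gn: "norm (g n t) \<le> norm (\<mu> n) * (indicator {0<..} t * fker \<delta> t)" for n t
    proof -
      have "fker \<delta> t * \<bar>cos (u n * t)\<bar> \<le> fker \<delta> t * 1" using fker_nonneg by (intro mult_left_mono) auto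
      then have "norm (\<mu> n) * (fker \<delta> t * \<bar>cos (u n * t)\<bar>) \<le> norm (\<mu> n) * (fker \<delta> t * 1)" by (rule mult_left_mono) simp
      then show ?thesis by (auto simp: g_def norm_mult abs_mult fker_nonneg indicator_def mult_ac)
    qed
    have ki: "integrable lborel (\<lambda>t. indicator {0<..} t * fker \<delta> t)"
      using fker_integral(1)[OF \<delta>(1)] by (simp add: set_integrable_def)
    have sm: "summable (\<lambda>n. norm (g n t))" for t
      by (rule summable_comparison_test'[OF summable_mult2[OF S\<mu>, of "indicator {0<..} t * fker \<delta> t"]]) (use gn in simp)
    have sI: "summable (\<lambda>n. LBINT t. norm (g n t))"
    proof (rule summable_comparison_test'[OF summable_mult2[OF S\<mu>, of "LBINT t. indicator {0<..} t * fker \<delta> t"]])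
      fix n :: nat
      have "(LBINT t. norm (g n t)) \<le> (LBINT t. norm (\<mu> n) * (indicator {0<..} t * fker \<delta> t))"
        using gn ki gi by (intro integral_mono integrable_norm integrable_mult_right) auto
      then show "norm (LBINT t. norm (g n t)) \<le> norm (\<mu> n) * (LBINT t. indicator {0<..} t * fker \<delta> t)" by simp
    qed
    have sums: "(\<lambda>n. integral\<^sup>L lborel (g n)) sums (LBINT t. \<Sum>n. g n t)"
      by (rule sums_integral[OF gi _ sI]) (use sm in auto)
    have "(\<lambda>n. of_real (pi / 2 * \<delta>) * (b n * of_real (real n powr (-\<sigma>) * tent \<delta> (V - ln (real n))))) sums (LBINT t. \<Sum>n. g n t)"
      using sums unfolding gint \<mu>_def u_def by (simp add: mult_ac)
    then have "(LBINT t. \<Sum>n. g n t) = of_real (pi / 2 * \<delta>) * (\<Sum>n. b n * of_real (real n powr (-\<sigma>) * tent \<delta> (V - ln (real n))))"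
    proof -
      assume S: "(\<lambda>n. of_real (pi / 2 * \<delta>) * (b n * of_real (real n powr (-\<sigma>) * tent \<delta> (V - ln (real n))))) sums (LBINT t. \<Sum>n. g n t)"
      have "summable (\<lambda>n. b n * of_real (real n powr (-\<sigma>) * tent \<delta> (V - ln (real n))))"
        using sums_summable[OF S] \<delta> by (subst (asm) summable_cmult_iff) auto
      from suminf_mult[OF this, of "of_real (pi / 2 * \<delta>)"] show ?thesis using sums_unique[OF S] by (simp only:)
    qed
    moreover have "norm (LBINT t. \<Sum>n. g n t) \<le> (LBINT t. indicator {0<..} t * (2 * M * kmaj t))"
    proof (rule order_trans[OF integral_norm_bound integral_mono])
      show "integrable lborel (\<lambda>t. norm (\<Sum>n. g n t))" by (rule integrable_norm, rule integrable_suminf[OF gi _ sI]) (use sm in auto)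
      have "set_integrable lborel {0<..} (\<lambda>t. 2 * M * kmaj t)" by (intro set_integrable_mult_right kmaj_integrable)
      then show "integrable lborel (\<lambda>t. indicator {0<..} t * (2 * M * kmaj t))" by (simp add: set_integrable_def)
      fix t :: real
      show "norm (\<Sum>n. g n t) \<le> indicator {0<..} t * (2 * M * kmaj t)"
      proof (cases "t > 0")
        case False
        then have "(\<lambda>n. g n t) = (\<lambda>_. 0)" by (auto simp: g_def)
        then show ?thesis using False by simp
      next
        case True
        have ds: "(\<lambda>n. b n * of_nat n powr (- Complex \<sigma> \<tau>)) sums dser b (Complex \<sigma> \<tau>)" for \<tau>
          by (rule dser_sums[OF b]) (use \<sigma> in simp)
        \<comment> \<open>Writing the cosine of t (V - log n) by exponentials splits off n^(-it) and
          n^(it).\<close>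
        have t1: "of_real (cos (u n * t)) * \<mu> n = (cis (t * V) / 2) * (b n * of_nat n powr (- Complex \<sigma> t)) + (cis (- (t * V)) / 2) * (b n * of_nat n powr (- Complex \<sigma> (-t)))" for n
        proof (cases "n = 0")
          case False
          have e: "of_real (cos x) = (cis x + cis (-x)) / 2" for x by (simp add: complex_eq_iff)
          have C: "of_real (cos (u n * t)) = (cis (t * V) * cis (- (t * ln (real n))) + cis (- (t * V)) * cis (t * ln (real n))) / 2"
            unfolding e by (simp add: cis_mult u_def algebra_simps)
          have p1: "of_nat n powr (- Complex \<sigma> t) = of_real (real n powr (-\<sigma>)) * cis (- (t * ln (real n)))" using False by (intro npow_cis) simp
          have p2: "of_nat n powr (- Complex \<sigma> (-t)) = of_real (real n powr (-\<sigma>)) * cis (t * ln (real n))"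
            using False npow_cis[of n \<sigma> "-t"] by (simp only: mult_minus_left minus_minus neq0_conv)
          show ?thesis unfolding C p1 p2 \<mu>_def by (simp add: field_simps)
        qed (simp add: \<mu>_def)
        have "(\<lambda>n. of_real (cos (u n * t)) * \<mu> n) sums ((cis (t * V) / 2) * dser b (Complex \<sigma> t) + (cis (- (t * V)) / 2) * dser b (Complex \<sigma> (-t)))" (is "_ sums ?D")
          unfolding t1 by (intro sums_add sums_mult ds)
        from sums_mult[OF this, of "of_real (fker \<delta> t)"] have "(\<lambda>n. g n t) sums (of_real (fker \<delta> t) * ?D)"
          using True by (simp add: g_def mult.assoc)
        then have "norm (\<Sum>n. g n t) = fker \<delta> t * norm ?D" using sums_unique by (metis abs_of_nonneg fker_nonneg norm_mult norm_of_real)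
        also have "norm ?D \<le> 1/2 * norm (dser b (Complex \<sigma> t)) + 1/2 * norm (dser b (Complex \<sigma> (-t)))"
          by (rule order_trans[OF norm_triangle_ineq]) (simp add: norm_mult norm_divide)
        also have "\<dots> \<le> M * (2 + t) powr (1/2)" using M[of t] M[of "-t"] True by simp
        finally have "norm (\<Sum>n. g n t) \<le> fker \<delta> t * (M * (2 + t) powr (1/2))" using fker_nonneg by (simp add: mult_left_mono)
        also have "\<dots> = M * (fker \<delta> t * (2 + t) powr (1/2))" by simp
        also have "\<dots> \<le> M * (2 * kmaj t)"
          by (rule mult_left_mono[OF fker_le_kmaj[OF \<delta> True] M0])
        finally show ?thesis using True by (simp add: mult_ac)
      qed
    qed
    moreover have "(LBINT t. indicator {0<..} t * (2 * M * kmaj t)) = 2 * M * I"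
    proof -
      have "(LBINT t:{0<..}. 2 * M * kmaj t) = 2 * M * I" unfolding I_def by (rule set_integral_mult_right)
      then show ?thesis by (simp only: set_lebesgue_integral_def real_scaleR_def)
    qed
    ultimately have "norm (of_real (pi / 2 * \<delta>) * (\<Sum>n. b n * of_real (real n powr (-\<sigma>) * tent \<delta> (V - ln (real n))))) \<le> 2 * M * I"
      by (simp only:)
    moreover have "\<bar>pi / 2 * \<delta>\<bar> = pi / 2 * \<delta>" using \<delta> by simp
    ultimately have "pi / 2 * \<delta> * norm (\<Sum>n. b n * of_real (real n powr (-\<sigma>) * tent \<delta> (V - ln (real n)))) \<le> 2 * M * I"
      by (simp only: norm_mult norm_of_real)
    then have "norm (\<Sum>n. b n * of_real (real n powr (-\<sigma>) * tent \<delta> (V - ln (real n)))) \<le> (4 / pi * I) * M / \<delta>"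
      using \<delta> by (simp add: field_simps)
    also have "\<dots> \<le> C * M / \<delta>"
      using \<delta> M0 by (intro divide_right_mono mult_right_mono) (auto simp: C_def)
    finally show "norm (\<Sum>n. b n * of_real (real n powr (-\<sigma>) * tent \<delta> (V - ln (real n)))) \<le> C * M / \<delta>" .
  qed
qed

text \<open>At a given u only the two neighbouring grid points have nonzero tents, and these
  interpolate linearly, hence add up to 1; beyond the ends of the grid one or both may be
  missing.\<close>

lemma tent_partition:
  fixes u \<delta> :: real
  assumes \<delta>: "\<delta> > 0" and u: "u \<ge> 0"
  shows "(\<Sum>k=k0..K. tent \<delta> (\<delta> * real k - u)) \<le> 1"
    "\<delta> * real k0 \<le> u \<Longrightarrow> u \<le> \<delta> * real K \<Longrightarrow> (\<Sum>k=k0..K. tent \<delta> (\<delta> * real k - u)) = 1"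
proof -
  define m where "m = nat \<lfloor>u / \<delta>\<rfloor>"
  have m: "\<delta> * real m \<le> u" "u < \<delta> * (real m + 1)"
  proof -
    have r: "real m = of_int \<lfloor>u / \<delta>\<rfloor>" using u \<delta> by (simp add: m_def)
    have "real m \<le> u / \<delta>" "u / \<delta> < real m + 1" unfolding r by linarith+
    then show "\<delta> * real m \<le> u" "u < \<delta> * (real m + 1)" using \<delta> by (simp_all add: field_simps)
  qed
  let ?g = "\<lambda>k. tent \<delta> (\<delta> * real k - u)"
  have zero: "?g k = 0" if "k \<noteq> m" "k \<noteq> Suc m" for k
  proof -
    have "k + 1 \<le> m \<or> m + 2 \<le> k" using that by linarith
    then have "\<delta> \<le> \<bar>\<delta> * real k - u\<bar>"
    proof
      assume "k + 1 \<le> m"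
      then have "\<delta> * (real k + 1) \<le> \<delta> * real m" using \<delta> by (intro mult_left_mono) auto
      then show ?thesis using m by (simp add: algebra_simps)
    next
      assume "m + 2 \<le> k"
      then have "\<delta> * (real m + 2) \<le> \<delta> * real k" using \<delta> by (intro mult_left_mono) auto
      then show ?thesis using m by (simp add: algebra_simps)
    qed
    then show ?thesis using \<delta> by (simp add: tent_def)
  qed
  have gm: "?g m = 1 - (u - \<delta> * real m) / \<delta>" "?g (Suc m) = (u - \<delta> * real m) / \<delta>"
    using m \<delta> by (simp_all add: tent_def abs_if field_simps max_def)
  have two: "(\<Sum>k\<in>{m, Suc m}. ?g k) = 1" using gm by simp
  have "(\<Sum>k=k0..K. ?g k) = (\<Sum>k\<in>{k0..K} \<inter> {m, Suc m}. ?g k)"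
    by (rule sum.mono_neutral_right) (use zero in auto)
  also have "\<dots> \<le> (\<Sum>k\<in>{m, Suc m}. ?g k)" by (rule sum_mono2) (auto simp: tent_nonneg)
  finally show "(\<Sum>k=k0..K. ?g k) \<le> 1" using two by simp
  assume k: "\<delta> * real k0 \<le> u" "u \<le> \<delta> * real K"
  have "\<delta> * real k0 < \<delta> * (real m + 1)" using k m by linarith
  then have k0m: "k0 \<le> m" using \<delta> by simp
  have "\<delta> * real m \<le> \<delta> * real K" using k m by linarith
  then have mK: "m \<le> K" using \<delta> by simp
  have "(\<Sum>k\<in>{m, Suc m}. ?g k) = (\<Sum>k\<in>{k0..K} \<inter> {m, Suc m}. ?g k)"
  proof (rule sum.mono_neutral_right)
    show "\<forall>i\<in>{m, Suc m} - {k0..K} \<inter> {m, Suc m}. ?g i = 0"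
    proof
      fix i assume "i \<in> {m, Suc m} - {k0..K} \<inter> {m, Suc m}"
      then have "i = Suc m" "m = K" using k0m mK by auto
      then show "?g i = 0" using gm(2) k m \<delta> by simp
    qed
  qed auto
  also have "\<dots> = (\<Sum>k=k0..K. ?g k)" by (rule sum.mono_neutral_left) (use zero in auto)
  finally show "(\<Sum>k=k0..K. ?g k) = 1" using two by simp
qed

lemma tent_zero: "\<delta> > 0 \<Longrightarrow> \<delta> \<le> \<bar>u\<bar> \<Longrightarrow> tent \<delta> u = 0"
  by (simp add: tent_def)

text \<open>The weight exp (\<sigma> v)/v^j undoes n^(-\<sigma>) log^j n at log n = v. Moving u =
  log n by less than \<delta> changes the exponential by at most exp (2 \<delta>) and, as u and v
  exceed j, the j-th power by at most exp \<delta>; finally exp (3 \<delta>) <= 1 + 6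
  \<delta>.\<close>

lemma ratio_bound:
  fixes u v \<delta> \<sigma> :: real
  assumes uv: "\<bar>v - u\<bar> < \<delta>" "real j + 1 \<le> u" "real j + 1 \<le> v" and \<sigma>: "0 \<le> \<sigma>" "\<sigma> \<le> 2" and \<delta>: "3 * \<delta> \<le> 1"
  shows "\<bar>exp (\<sigma> * v) / v ^ j * (u ^ j * exp (-\<sigma> * u)) - 1\<bar> \<le> 6 * \<delta>"
proof -
  have pos: "u > 0" "v > 0" "\<delta> > 0" using uv by auto
  define r where "r = exp (\<sigma> * v) / v ^ j * (u ^ j * exp (-\<sigma> * u))"
  have r: "r = exp (\<sigma> * (v - u)) * (u / v) ^ j" by (simp add: r_def power_divide exp_diff exp_minus field_simps)
  have p: "(x / y) ^ j \<le> exp \<delta>" if "\<bar>x - y\<bar> < \<delta>" "real j + 1 \<le> y" "x > 0" for x y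
  proof -
    have y: "y > 0" using that by linarith
    have "x / y \<le> 1 + \<delta> / y" using that y by (simp add: field_simps)
    also have "\<dots> \<le> exp (\<delta> / y)" by (rule exp_ge_add_one_self)
    finally have "(x / y) ^ j \<le> exp (\<delta> / y) ^ j" using that y by (intro power_mono) auto
    also have "\<dots> = exp (real j * (\<delta> / y))" by (simp only: exp_of_nat_mult)
    also have "\<dots> \<le> exp \<delta>"
    proof -
      have "real j * \<delta> \<le> y * \<delta>" using that pos by (intro mult_right_mono) auto
      then show ?thesis using y by (simp add: field_simps)
    qed
    finally show ?thesis .
  qed
  have up: "r \<le> exp (3 * \<delta>)"
  proof -
    have "\<sigma> * (v - u) \<le> 2 * \<delta>"
    proof -
      have "\<sigma> * (v - u) \<le> \<sigma> * \<delta>" using uv \<sigma> by (intro mult_left_mono) auto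
      also have "\<dots> \<le> 2 * \<delta>" using \<sigma> pos by (intro mult_right_mono) auto
      finally show ?thesis .
    qed
    then have "r \<le> exp (2 * \<delta>) * exp \<delta>" unfolding r using p[of u v] uv pos by (intro mult_mono) (auto simp: abs_minus_commute)
    then show ?thesis by (simp flip: exp_add)
  qed
  have lo: "1 / r \<le> exp (3 * \<delta>)"
  proof -
    have "1 / r = exp (\<sigma> * (u - v)) * (v / u) ^ j" unfolding r using pos by (simp add: power_divide exp_minus[symmetric] field_simps flip: exp_add)
    moreover have "\<sigma> * (u - v) \<le> 2 * \<delta>"
    proof -
      have "\<sigma> * (u - v) \<le> \<sigma> * \<delta>" using uv \<sigma> by (intro mult_left_mono) auto
      also have "\<dots> \<le> 2 * \<delta>" using \<sigma> pos by (intro mult_right_mono) auto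
      finally show ?thesis .
    qed
    then have "exp (\<sigma> * (u - v)) * (v / u) ^ j \<le> exp (2 * \<delta>) * exp \<delta>" using p[of v u] uv pos by (intro mult_mono) auto
    ultimately show ?thesis by (simp flip: exp_add)
  qed
  have rpos: "r > 0" using pos by (simp add: r)
  have "exp (3 * \<delta>) \<le> 1 + 3 * \<delta> + (3 * \<delta>)\<^sup>2" using \<delta> pos by (intro exp_bound) auto
  also have "(3 * \<delta>)\<^sup>2 \<le> 3 * \<delta>" using \<delta> pos by (simp add: power2_eq_square mult_left_le)
  finally have e: "exp (3 * \<delta>) \<le> 1 + 6 * \<delta>" by simp
  have "r \<ge> exp (- (3 * \<delta>))" using lo rpos by (simp add: exp_minus field_simps)
  moreover have "exp (- (3 * \<delta>)) \<ge> 1 + - (3 * \<delta>)" by (rule exp_ge_add_one_self)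
  ultimately have "\<bar>r - 1\<bar> \<le> 6 * \<delta>" using up e pos by linarith
  then show ?thesis by (simp add: r_def)
qed

lemma card_nat_interval_le:
  assumes "0 \<le> A" "A \<le> B" shows "finite {n::nat. A \<le> real n \<and> real n \<le> B}" "real (card {n::nat. A \<le> real n \<and> real n \<le> B}) \<le> B - A + 1"
proof -
  have sub: "{n::nat. A \<le> real n \<and> real n \<le> B} = {nat \<lceil>A\<rceil>..nat \<lfloor>B\<rfloor>}"
    using assms by (auto simp: nat_le_iff le_nat_iff ceiling_le_iff le_floor_iff)
  show "finite {n::nat. A \<le> real n \<and> real n \<le> B}" unfolding sub by simp
  have "real (card {nat \<lceil>A\<rceil>..nat \<lfloor>B\<rfloor>}) \<le> B - A + 1"
  proof (cases "nat \<lceil>A\<rceil> \<le> nat \<lfloor>B\<rfloor>")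
    case True
    then have "real (card {nat \<lceil>A\<rceil>..nat \<lfloor>B\<rfloor>}) = real (nat \<lfloor>B\<rfloor>) + 1 - real (nat \<lceil>A\<rceil>)" by simp
    moreover have "real (nat \<lfloor>B\<rfloor>) \<le> B" using assms by simp
    moreover have "real (nat \<lceil>A\<rceil>) \<ge> A" by linarith
    ultimately show ?thesis by linarith
  qed (use assms in auto)
  then show "real (card {n::nat. A \<le> real n \<and> real n \<le> B}) \<le> B - A + 1" unfolding sub .
qed

lemma subpoly_of_ln_bound: assumes "\<And>n. n > 0 \<Longrightarrow> norm (a n) \<le> 1 + ln (real n)" shows "subpoly a"
proof -
  have "subpoly (\<lambda>n. 1 + 1 * of_real (ln (real n)))"
    by (intro subpoly_add subpoly_ln cmult_subpoly[OF cmult_one])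
  then show ?thesis
  proof (rule subpoly_dominated)
    fix n :: nat assume n: "n > 0"
    have "norm (1 + 1 * complex_of_real (ln (real n))) = \<bar>1 + ln (real n)\<bar>" by (metis mult_1 norm_of_real of_real_1 of_real_add)
    then show "norm (a n) \<le> norm (1 + 1 * complex_of_real (ln (real n)))" using assms[OF n] by linarith
  qed
qed

text \<open>Let X = ln x. Tents of width \<delta> centred at the points \<delta> k, weighted so as
  to cancel n^(-\<sigma>) log^j n, add up to nearly the indicator of [sqrt x, x]. There are at most
  X/\<delta> of them, each contributing C0 M/\<delta> times a weight of size x/X^j; with \<delta> =
  X^(-h) this is the first term. The second is the total deviation of the weights from the indicator
  of [1, x], O(\<delta> x), times the bound O(X) for the coefficients.\<close>

theorem tauberian:
  fixes j h :: nat
  assumes h: "h \<ge> 1"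
  shows "\<exists>C>0. \<exists>x0>1. \<forall>a M x. (\<forall>n>0. norm (a n :: complex) \<le> 1 + ln (real n)) \<longrightarrow>
     (\<forall>\<sigma> t. 1 < \<sigma> \<longrightarrow> \<sigma> \<le> 2 \<longrightarrow> norm (dser (\<lambda>n. a n * of_real (ln (real n)) ^ j) (Complex \<sigma> t)) \<le> M * (2 + \<bar>t\<bar>) powr (1/2))
     \<longrightarrow> x \<ge> x0 \<longrightarrow> norm (\<Sum>n=1..nat \<lfloor>x\<rfloor>. a n) \<le> C * (M * x * ln x ^ (1 + 2 * h) / ln x ^ j + x * ln x / ln x ^ h)"
proof -
  obtain C0 where C0: "C0 > 0"
    "\<And>b M \<sigma> \<delta> V. subpoly b \<Longrightarrow> (\<And>t. norm (dser b (Complex \<sigma> t)) \<le> M * (2 + \<bar>t\<bar>) powr (1/2)) \<Longrightarrow> 1 < \<sigma> \<Longrightarrow> 0 < \<delta> \<Longrightarrow> \<delta> \<le> 1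
      \<Longrightarrow> norm (\<Sum>n. b n * of_real (real n powr (-\<sigma>) * tent \<delta> (V - ln (real n)))) \<le> C0 * M / \<delta>"
    by (rule tent_sum_bound) blast
  have "eventually (\<lambda>X::real. X ^ h \<le> exp (X / 2)) at_top" by real_asymp
  then obtain X1 where X1: "\<And>X::real. X \<ge> X1 \<Longrightarrow> X ^ h \<le> exp (X / 2)" by (auto simp: eventually_at_top_linorder)
  define X0 where "X0 = max X1 (2 * real j + 6)"
  define C where "C = max (C0 * exp 1 * 2 ^ j) 48"
  show ?thesis
  proof (rule exI[of _ C], intro conjI exI[of _ "exp X0"] allI impI)
    show "C > 0" by (simp add: C_def)
    show "exp X0 > 1" by (simp add: X0_def)
    fix a :: "nat \<Rightarrow> complex" and M x :: real
    assume a: "\<forall>n>0. norm (a n) \<le> 1 + ln (real n)"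
      and MM: "\<forall>\<sigma> t. 1 < \<sigma> \<longrightarrow> \<sigma> \<le> 2 \<longrightarrow> norm (dser (\<lambda>n. a n * of_real (ln (real n)) ^ j) (Complex \<sigma> t)) \<le> M * (2 + \<bar>t\<bar>) powr (1/2)"
      and xx: "exp X0 \<le> x"
    define X where "X = ln x"
    have x0: "x > 0" using xx exp_gt_zero[of X0] by linarith
    then have xX: "x = exp X" by (simp add: X_def)
    have "X0 \<le> X" using xx by (simp add: xX)
    then have X: "X \<ge> 2 * real j + 6" "X \<ge> 6" "X ^ h \<le> exp (X / 2)" using X1[of X] by (auto simp: X0_def)
    define \<delta> where "\<delta> = 1 / X ^ h"
    have "X ^ 1 \<le> X ^ h" using X h by (intro power_increasing) auto
    then have \<delta>: "0 < \<delta>" "3 * \<delta> \<le> 1" "\<delta> \<le> 1" using X by (auto simp: \<delta>_def field_simps)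
    \<comment> \<open>Then exp (\<sigma> X) = exp 1 * x: the weights keep the size of x while Re s
      exceeds 1 as the hypothesis demands.\<close>
    define \<sigma> where "\<sigma> = 1 + 1 / X"
    have \<sigma>: "1 < \<sigma>" "\<sigma> \<le> 2" "\<sigma> * X = X + 1" using X by (auto simp: \<sigma>_def field_simps)
    \<comment> \<open>Starting the tents at X/2 keeps every centre v above X/2, so that 1/v^j costs
      only 2^j/X^j; the n below about sqrt x are few enough to be dropped.\<close>
    define k0 where "k0 = nat \<lceil>X / (2 * \<delta>)\<rceil>"
    define K where "K = nat \<lfloor>X / \<delta>\<rfloor>"
    have k0: "X / 2 \<le> \<delta> * real k0" "\<delta> * real k0 \<le> X / 2 + \<delta>" "k0 \<ge> 1"
    proof -
      have p: "X / (2 * \<delta>) > 0" using X \<delta> by simp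
      then have "X / (2 * \<delta>) \<le> real k0" "real k0 \<le> X / (2 * \<delta>) + 1" unfolding k0_def by linarith+
      then show "X / 2 \<le> \<delta> * real k0" "\<delta> * real k0 \<le> X / 2 + \<delta>" using \<delta> by (simp_all add: field_simps)
      show "k0 \<ge> 1" using p unfolding k0_def by linarith
    qed
    have K: "\<delta> * real K \<le> X" "X < \<delta> * (real K + 1)"
    proof -
      have p: "X / \<delta> > 0" using X \<delta> by simp
      then have "real K \<le> X / \<delta>" "X / \<delta> < real K + 1" unfolding K_def by linarith+
      then show "\<delta> * real K \<le> X" "X < \<delta> * (real K + 1)" using \<delta> by (simp_all add: field_simps)
    qed
    define b where "b n = a n * of_real (ln (real n)) ^ j" for n
    have bs: "subpoly b" unfolding b_def by (intro subpoly_ln_power subpoly_of_ln_bound) (use a in auto)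
    define c where "c k = exp (\<sigma> * (\<delta> * real k)) / (\<delta> * real k) ^ j" for k :: nat
    have c0: "0 \<le> c k" for k using \<delta> by (simp add: c_def)
    define g where "g k n = b n * of_real (real n powr (-\<sigma>) * tent \<delta> (\<delta> * real k - ln (real n)))" for k n :: nat
    have Sk: "norm (\<Sum>n. g k n) \<le> C0 * M / \<delta>" for k
    proof -
      have "b = (\<lambda>n. a n * of_real (ln (real n)) ^ j)" by (rule ext) (simp add: b_def)
      then have "norm (dser b (Complex \<sigma> t)) \<le> M * (2 + \<bar>t\<bar>) powr (1/2)" for t using MM \<sigma> by blast
      then show ?thesis unfolding g_def by (rule C0(2)[OF bs _ \<sigma>(1) \<delta>(1,3)])
    qed
    have M0: "0 \<le> M"
    proof -
      have "0 \<le> M * (2 + \<bar>0\<bar>) powr (1/2)" using MM \<sigma> norm_ge_zero order_trans by blast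
      then show ?thesis by (simp add: zero_le_mult_iff)
    qed
    have gs: "summable (g k)" for k
    proof (rule summable_norm_cancel, rule summable_comparison_test')
      show "summable (\<lambda>n. norm (b n * of_nat n powr (- complex_of_real \<sigma>)))" by (rule subpoly_summable[OF bs]) (use \<sigma> in simp)
      fix n :: nat
      have "real n powr (-\<sigma>) * tent \<delta> (\<delta> * real k - ln (real n)) \<le> real n powr (-\<sigma>) * 1"
        using tent_le_1[OF \<delta>(1)] by (intro mult_left_mono) auto
      then show "norm (norm (g k n)) \<le> norm (b n * of_nat n powr (- complex_of_real \<sigma>))"
        by (simp add: g_def norm_mult norm_npow tent_nonneg mult_left_mono)
    qed
    define w where "w n = (\<Sum>k=k0..K. tent \<delta> (\<delta> * real k - ln (real n)) * (c k * (ln (real n) ^ j * exp (-\<sigma> * ln (real n)))))" for n :: nat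
    have gw: "(\<Sum>k=k0..K. of_real (c k) * g k n) = a n * of_real (w n)" if "n > 0" for n
    proof -
      have p: "real n powr (-\<sigma>) = exp (-\<sigma> * ln (real n))" using that by (simp add: powr_def)
      have "of_real (c k) * g k n = a n * of_real (tent \<delta> (\<delta> * real k - ln (real n)) * (c k * (ln (real n) ^ j * exp (-\<sigma> * ln (real n)))))" for k
        by (simp add: g_def b_def p mult_ac)
      then show ?thesis by (simp only: w_def of_real_sum sum_distrib_left)
    qed
    \<comment> \<open>\<open>w n\<close> is the weight actually produced, \<open>P n\<close> the
      partition of unity that it approximates.\<close>
    define P where "P n = (\<Sum>k=k0..K. tent \<delta> (\<delta> * real k - ln (real n)))" for n :: nat
    have wP: "\<bar>w n - P n\<bar> \<le> 6 * \<delta> * P n" if "n > 0" for n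
    proof -
      have wP_eq: "w n - P n = (\<Sum>k=k0..K. tent \<delta> (\<delta> * real k - ln (real n)) * (c k * (ln (real n) ^ j * exp (-\<sigma> * ln (real n))) - 1))"
        by (simp add: w_def P_def right_diff_distrib sum_subtractf)
      have "\<bar>w n - P n\<bar> \<le> (\<Sum>k=k0..K. \<bar>tent \<delta> (\<delta> * real k - ln (real n)) * (c k * (ln (real n) ^ j * exp (-\<sigma> * ln (real n))) - 1)\<bar>)"
        unfolding wP_eq by (rule sum_abs)
      also have "\<dots> \<le> (\<Sum>k=k0..K. tent \<delta> (\<delta> * real k - ln (real n)) * (6 * \<delta>))"
      proof (rule sum_mono)
        fix k assume k: "k \<in> {k0..K}"
        show "\<bar>tent \<delta> (\<delta> * real k - ln (real n)) * (c k * (ln (real n) ^ j * exp (-\<sigma> * ln (real n))) - 1)\<bar> \<le> tent \<delta> (\<delta> * real k - ln (real n)) * (6 * \<delta>)"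
        proof (cases "\<bar>\<delta> * real k - ln (real n)\<bar> < \<delta>")
          case False
          then have "tent \<delta> (\<delta> * real k - ln (real n)) = 0" by (intro tent_zero \<delta>) simp
          then show ?thesis by simp
        next
          case True
          have "\<delta> * real k0 \<le> \<delta> * real k" using k \<delta> by (intro mult_left_mono) auto
          then have v: "real j + 2 \<le> \<delta> * real k" using k0 X by linarith
          then have u: "real j + 1 \<le> ln (real n)" using True \<delta> by linarith
          have "\<bar>c k * (ln (real n) ^ j * exp (-\<sigma> * ln (real n))) - 1\<bar> \<le> 6 * \<delta>"
            unfolding c_def by (rule ratio_bound[OF True u _ _ \<sigma>(2) \<delta>(2)]) (use v \<sigma> in auto)
          then show ?thesis unfolding abs_mult by (simp add: tent_nonneg mult_left_mono)
        qed
      qed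
      also have "\<dots> = 6 * \<delta> * P n" unfolding P_def sum_distrib_right[symmetric] by (rule mult.commute)
      finally show ?thesis .
    qed
    have P01: "0 \<le> P n" "P n \<le> 1" if "n > 0" for n
      using tent_partition(1)[OF \<delta>(1), of "ln (real n)" k0 K] that by (auto simp: P_def intro!: sum_nonneg tent_nonneg)
    have P1: "P n = 1" if "n > 0" "\<delta> * real k0 \<le> ln (real n)" "ln (real n) \<le> \<delta> * real K" for n
      using tent_partition(2)[OF \<delta>(1) _ that(2,3)] that by (simp add: P_def)
    have w0: "w n = 0" if "n > 0" "\<delta> * (real K + 1) \<le> ln (real n)" for n
      unfolding w_def
    proof (rule sum.neutral, rule)
      fix k assume k: "k \<in> {k0..K}"
      have "\<delta> * real k \<le> \<delta> * real K" using k \<delta> by (intro mult_left_mono) auto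
      then have "\<delta> \<le> \<bar>\<delta> * real k - ln (real n)\<bar>" using that(2) by (simp add: distrib_left)
      then have "tent \<delta> (\<delta> * real k - ln (real n)) = 0" by (intro tent_zero \<delta>)
      then show "tent \<delta> (\<delta> * real k - ln (real n)) * (c k * (ln (real n) ^ j * exp (-\<sigma> * ln (real n)))) = 0" by simp
    qed
    define e where "e n = (if real n \<le> x then 1 else 0) - w n" for n
    have wb: "\<bar>w n - P n\<bar> \<le> 6 * \<delta>" if "n > 0" for n
    proof -
      have "6 * \<delta> * P n \<le> 6 * \<delta> * 1" using P01[OF that] \<delta> by (intro mult_left_mono) auto
      then show ?thesis using wP[OF that] by linarith
    qed
    have e3: "\<bar>e n\<bar> \<le> 3" if "n > 0" for n
      using wb[OF that] P01[OF that] \<delta> unfolding e_def by (auto simp: abs_if split: if_splits)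
    have lnx: "ln (real n) \<le> X \<longleftrightarrow> real n \<le> x" if "n > 0" for n using that x0 by (simp add: X_def)
    have emid: "\<bar>e n\<bar> \<le> 6 * \<delta>" if "n > 0" "\<delta> * real k0 \<le> ln (real n)" "ln (real n) \<le> \<delta> * real K" for n
    proof -
      have "ln (real n) \<le> X" using that K by linarith
      then have "e n = 1 - w n" using lnx[OF that(1)] by (simp add: e_def)
      then show ?thesis using wb[OF that(1)] P1[OF that] by linarith
    qed
    have eout: "e n = 0" if "n > 0" "\<delta> * (real K + 1) \<le> ln (real n)" for n
    proof -
      have "\<not> real n \<le> x" using that K lnx[OF that(1)] by linarith
      then show ?thesis using w0[OF that] by (simp add: e_def)
    qed
    define N1 where "N1 = nat \<lfloor>x\<rfloor>"
    \<comment> \<open>Beyond 2 x all weights vanish: the last tent ends at most at X + 1/3, which is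
      below ln (2 x).\<close>
    define N2 where "N2 = nat \<lfloor>2 * x\<rfloor>"
    have N12: "N1 \<le> N2" unfolding N1_def N2_def using x0 by (intro nat_mono floor_mono) simp
    have big: "\<delta> * (real K + 1) \<le> ln (real n)" if "n > N2" for n
    proof -
      have "2 * x < real n" using that x0 unfolding N2_def by linarith
      then have "ln (2 * x) \<le> ln (real n)" using x0 by simp
      moreover have "ln (2 * x) = ln 2 + X" using x0 by (simp add: ln_mult X_def)
      moreover have "\<delta> * (real K + 1) \<le> X + 1/3" using K(1) \<delta>(2) unfolding distrib_left by linarith
      moreover have "ln 2 \<ge> (1/3::real)" using ln2_ge_two_thirds by linarith
      ultimately show ?thesis by linarith
    qed
    have "(\<lambda>n. \<Sum>k=k0..K. of_real (c k) * g k n) sums (\<Sum>n\<in>{..N2}. \<Sum>k=k0..K. of_real (c k) * g k n)"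
    proof (rule sums_finite)
      fix n assume "n \<notin> {..N2}"
      then have n: "n > N2" "n > 0" by auto
      then show "(\<Sum>k=k0..K. of_real (c k) * g k n) = 0" using gw[OF n(2)] w0[OF n(2) big[OF n(1)]] by simp
    qed simp
    moreover have "(\<lambda>n. \<Sum>k=k0..K. of_real (c k) * g k n) sums (\<Sum>k=k0..K. of_real (c k) * (\<Sum>n. g k n))"
      by (intro sums_sum sums_mult summable_sums gs)
    ultimately have "(\<Sum>n\<in>{..N2}. \<Sum>k=k0..K. of_real (c k) * g k n) = (\<Sum>k=k0..K. of_real (c k) * (\<Sum>n. g k n))"
      by (rule sums_unique2)
    moreover have "(\<Sum>n\<in>{..N2}. \<Sum>k=k0..K. of_real (c k) * g k n) = (\<Sum>n=1..N2. a n * of_real (w n))"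
    proof -
      have "(\<Sum>n\<in>{..N2}. \<Sum>k=k0..K. of_real (c k) * g k n) = (\<Sum>n=1..N2. \<Sum>k=k0..K. of_real (c k) * g k n)"
        by (rule sum.mono_neutral_right) (auto simp: g_def not_less_eq_eq)
      also have "\<dots> = (\<Sum>n=1..N2. a n * of_real (w n))" by (intro sum.cong refl gw) auto
      finally show ?thesis .
    qed
    ultimately have main_eq: "(\<Sum>n=1..N2. a n * of_real (w n)) = (\<Sum>k=k0..K. of_real (c k) * (\<Sum>n. g k n))" by simp
    have cmax: "c k \<le> exp 1 * x * 2 ^ j / X ^ j" if "k \<in> {k0..K}" for k
    proof -
      have "\<delta> * real k0 \<le> \<delta> * real k" "\<delta> * real k \<le> \<delta> * real K" using that \<delta> by (auto intro!: mult_left_mono)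
      then have v: "X / 2 \<le> \<delta> * real k" "\<delta> * real k \<le> X" using k0 K by linarith+
      have "\<sigma> * (\<delta> * real k) \<le> \<sigma> * X" using v \<sigma> by (intro mult_left_mono) auto
      then have "exp (\<sigma> * (\<delta> * real k)) \<le> exp (X + 1)" using \<sigma> by simp
      moreover have "(X / 2) ^ j \<le> (\<delta> * real k) ^ j" using v X by (intro power_mono) auto
      ultimately have "c k \<le> exp (X + 1) / (X / 2) ^ j" unfolding c_def using X by (intro frac_le) auto
      also have "\<dots> = exp 1 * x * 2 ^ j / X ^ j" by (simp add: xX exp_add power_divide mult_ac)
      finally show ?thesis .
    qed
    have "norm (\<Sum>n=1..N2. a n * of_real (w n)) \<le> (\<Sum>k=k0..K. (exp 1 * x * 2 ^ j / X ^ j) * (C0 * M / \<delta>))"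
      unfolding main_eq
    proof (rule sum_norm_le)
      fix k assume k: "k \<in> {k0..K}"
      show "norm (of_real (c k) * (\<Sum>n. g k n)) \<le> (exp 1 * x * 2 ^ j / X ^ j) * (C0 * M / \<delta>)"
        unfolding norm_mult using cmax[OF k] c0[of k] Sk[of k] x0 X by (intro mult_mono) auto
    qed
    also have "\<dots> = real (card {k0..K}) * ((exp 1 * x * 2 ^ j / X ^ j) * (C0 * M / \<delta>))" by simp
    also have "\<dots> \<le> (X / \<delta>) * ((exp 1 * x * 2 ^ j / X ^ j) * (C0 * M / \<delta>))"
    proof (rule mult_right_mono)
      have "real (card {k0..K}) \<le> real K" using k0(3) by simp
      also have "\<dots> \<le> X / \<delta>" using K(1) \<delta> by (simp add: field_simps)
      finally show "real (card {k0..K}) \<le> X / \<delta>" .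
      show "0 \<le> (exp 1 * x * 2 ^ j / X ^ j) * (C0 * M / \<delta>)" using x0 X M0 C0(1) \<delta> by (intro mult_nonneg_nonneg divide_nonneg_nonneg) auto
    qed
    also have "\<dots> = (C0 * exp 1 * 2 ^ j) * (M * x * X ^ (1 + 2 * h) / X ^ j)"
    proof -
      have "1 / \<delta> = X ^ h" by (simp add: \<delta>_def)
      have "(X / \<delta>) * ((exp 1 * x * 2 ^ j / X ^ j) * (C0 * M / \<delta>)) = (C0 * exp 1 * 2 ^ j) * (M * x * (X * ((1 / \<delta>) * (1 / \<delta>))) / X ^ j)"
        by (simp only: times_divide_eq_right times_divide_eq_left mult_1 mult_ac divide_divide_eq_left)
      moreover have "X * ((1 / \<delta>) * (1 / \<delta>)) = X ^ (1 + 2 * h)" unfolding \<open>1 / \<delta> = _\<close> by (simp add: mult_2 power_add)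
      ultimately show ?thesis by (simp only:)
    qed
    also have "\<dots> \<le> C * (M * x * X ^ (1 + 2 * h) / X ^ j)"
      using M0 x0 X by (intro mult_right_mono) (auto simp: C_def)
    finally have main: "norm (\<Sum>n=1..N2. a n * of_real (w n)) \<le> C * (M * x * X ^ (1 + 2 * h) / X ^ j)" .
    have diff: "(\<Sum>n=1..N1. a n) - (\<Sum>n=1..N2. a n * of_real (w n)) = (\<Sum>n=1..N2. a n * of_real (e n))"
    proof -
      have "(\<Sum>n=1..N1. a n) = (\<Sum>n=1..N2. a n * of_real (if real n \<le> x then 1 else 0))"
      proof -
        have "(\<Sum>n=1..N2. a n * of_real (if real n \<le> x then 1 else 0)) = (\<Sum>n=1..N1. a n * of_real (if real n \<le> x then 1 else 0))"
        proof (rule sum.mono_neutral_right)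
          show "\<forall>i\<in>{1..N2} - {1..N1}. a i * of_real (if real i \<le> x then 1 else 0) = 0"
            using x0 unfolding N1_def by (auto simp: nat_less_iff floor_less_iff not_le)
        qed (use N12 in auto)
        also have "\<dots> = (\<Sum>n=1..N1. a n)"
        proof (intro sum.cong refl)
          fix n assume n: "n \<in> {1..N1}"
          have "real n \<le> x" using n x0 unfolding N1_def by (simp add: le_nat_iff le_floor_iff)
          then show "a n * of_real (if real n \<le> x then 1 else 0) = a n" by simp
        qed
        finally show ?thesis by simp
      qed
      then show ?thesis by (simp add: e_def sum_subtractf right_diff_distrib)
    qed
    have an: "norm (a n) \<le> X + 2" if "n \<in> {1..N2}" for n
    proof -
      have "real n \<le> 2 * x" using that x0 unfolding N2_def by (simp add: le_nat_iff le_floor_iff)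
      then have "ln (real n) \<le> ln (2 * x)" using that by simp
      moreover have "ln (2 * x) = ln 2 + X" using x0 by (simp add: ln_mult X_def)
      moreover have "ln 2 \<le> (1::real)" using ln2_le_25_over_36 by linarith
      moreover have "norm (a n) \<le> 1 + ln (real n)" using a that by simp
      ultimately show ?thesis by linarith
    qed
    define A where "A = exp (\<delta> * real K)"
    define B where "B = exp (\<delta> * (real K + 1))"
    define E where "E = exp (\<delta> * real k0)"
    let ?S1 = "{n::nat. 0 \<le> real n \<and> real n \<le> x}"
    let ?S2 = "{n::nat. 0 \<le> real n \<and> real n \<le> E}"
    let ?S3 = "{n::nat. A \<le> real n \<and> real n \<le> B}"
    \<comment> \<open>Inside the grid the partition of unity gives O(\<delta>). The exceptions are n
      <= E, with E of order sqrt x, and the last incomplete window [A, B] around x, where only the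
      trivial bound 3 is available.\<close>
    have eb: "\<bar>e n\<bar> \<le> 6 * \<delta> * indicator {n::nat. 0 < n \<and> real n \<le> x} n + 3 * indicator {n::nat. 0 < n \<and> real n \<le> E} n + 3 * indicator ?S3 n" if n: "n > 0" for n
    proof -
      have ex: "real n = exp (ln (real n))" using n by simp
      consider "ln (real n) \<le> \<delta> * real k0" | "\<delta> * real k0 \<le> ln (real n)" "ln (real n) \<le> \<delta> * real K"
        | "\<delta> * real K \<le> ln (real n)" "ln (real n) \<le> \<delta> * (real K + 1)" | "\<delta> * (real K + 1) \<le> ln (real n)" by linarith
      then show ?thesis
      proof cases
        case 1
        then have "real n \<le> E" unfolding E_def by (subst ex) simp
        then show ?thesis using e3[OF n] n \<delta> by (auto simp: indicator_def)
      next
        case 2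
        then have "ln (real n) \<le> X" using K by linarith
        then have "real n \<le> x" using lnx[OF n] by simp
        then show ?thesis using emid[OF n 2] n \<delta> by (auto simp: indicator_def)
      next
        case 3
        then have "A \<le> real n \<and> real n \<le> B" unfolding A_def B_def by (subst (1 2) ex) simp
        then show ?thesis using e3[OF n] n \<delta> by (auto simp: indicator_def)
      next
        case 4
        then show ?thesis using eout[OF n 4] \<delta> by simp
      qed
    qed
    have AB: "0 \<le> A" "A \<le> B" "A \<le> x" using \<delta> K by (auto simp: A_def B_def xX)
    have sq: "exp (X / 2) \<le> \<delta> * x" "1 \<le> \<delta> * x"
    proof -
      have "exp (X / 2) * X ^ h \<le> exp (X / 2) * exp (X / 2)" using X by (intro mult_left_mono) auto
      also have "\<dots> = x" by (simp add: xX flip: exp_add)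
      finally show "exp (X / 2) \<le> \<delta> * x" using X by (simp add: \<delta>_def field_simps)
      moreover have "1 \<le> exp (X / 2)" using X by simp
      ultimately show "1 \<le> \<delta> * x" by linarith
    qed
    have cS1: "real (card {n::nat. 0 < n \<and> real n \<le> x}) \<le> x"
    proof -
      have "{n::nat. 0 < n \<and> real n \<le> x} = {1..N1}" unfolding N1_def using x0 by (auto simp: le_nat_iff le_floor_iff)
      then show ?thesis using x0 by (simp add: N1_def)
    qed
    have cS2: "real (card {n::nat. 0 < n \<and> real n \<le> E}) \<le> 3 * (\<delta> * x)"
    proof -
      have E0: "E > 0" by (simp add: E_def)
      have "{n::nat. 0 < n \<and> real n \<le> E} = {1..nat \<lfloor>E\<rfloor>}" using E0 by (auto simp: le_nat_iff le_floor_iff)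
      then have "real (card {n::nat. 0 < n \<and> real n \<le> E}) \<le> E" using E0 by simp
      also have "E \<le> exp (X / 2 + 1)" unfolding E_def using k0 \<delta> by simp
      also have "\<dots> = exp 1 * exp (X / 2)" by (simp add: exp_add)
      also have "\<dots> \<le> 3 * (\<delta> * x)" using sq exp_le by (intro mult_mono) auto
      finally show ?thesis .
    qed
    have cS3: "real (card ?S3) \<le> 3 * (\<delta> * x)"
    proof -
      have "B = A * exp \<delta>" by (simp add: A_def B_def distrib_left exp_add)
      moreover have "exp \<delta> \<le> 1 + \<delta> + \<delta>\<^sup>2" using \<delta> by (intro exp_bound) auto
      moreover have "\<delta>\<^sup>2 \<le> \<delta>" using \<delta> by (simp add: power2_eq_square mult_left_le)
      ultimately have "B \<le> A * (1 + 2 * \<delta>)" using AB by (simp add: mult_left_mono)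
      then have "B - A \<le> A * (2 * \<delta>)" by (simp add: algebra_simps)
      also have "\<dots> \<le> x * (2 * \<delta>)" using AB \<delta> by (intro mult_right_mono) auto
      finally show ?thesis using card_nat_interval_le(2)[OF AB(1,2)] sq(2) by (simp add: mult_ac)
    qed
    have fin: "finite {n::nat. 0 < n \<and> real n \<le> r}" for r
      by (rule finite_subset[of _ "{..nat \<lfloor>\<bar>r\<bar>\<rfloor>}"]) (auto simp: le_nat_iff le_floor_iff)
    have ind: "(\<Sum>n=1..N2. indicator T n :: real) \<le> real (card T)" if "finite T" for T
    proof -
      have "(\<Sum>n=1..N2. indicator T n :: real) = real (card ({1..N2} \<inter> T))" by (simp add: indicator_def sum.If_cases)
      also have "\<dots> \<le> real (card T)" using that by (simp add: card_mono)
      finally show ?thesis .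
    qed
    have "(\<Sum>n=1..N2. \<bar>e n\<bar>) \<le> (\<Sum>n=1..N2. 6 * \<delta> * indicator {n::nat. 0 < n \<and> real n \<le> x} n + 3 * indicator {n::nat. 0 < n \<and> real n \<le> E} n + 3 * indicator ?S3 n)"
      by (intro sum_mono eb) auto
    also have "\<dots> = 6 * \<delta> * (\<Sum>n=1..N2. indicator {n::nat. 0 < n \<and> real n \<le> x} n) + 3 * (\<Sum>n=1..N2. indicator {n::nat. 0 < n \<and> real n \<le> E} n) + 3 * (\<Sum>n=1..N2. indicator ?S3 n)"
      by (simp add: sum.distrib sum_distrib_left)
    also have "\<dots> \<le> 6 * \<delta> * x + 3 * (3 * (\<delta> * x)) + 3 * (3 * (\<delta> * x))"
      using order_trans[OF ind[OF fin] cS1] order_trans[OF ind[OF fin] cS2] order_trans[OF ind[OF card_nat_interval_le(1)[OF AB(1,2)]] cS3] \<delta>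
      by (intro add_mono mult_left_mono) auto
    \<comment> \<open>24 = 6 + 9 + 9. Since the coefficients are at most X + 2 <= 2 X, this is the
      source of the 48 in \<open>C\<close>.\<close>
    finally have esum: "(\<Sum>n=1..N2. \<bar>e n\<bar>) \<le> 24 * (\<delta> * x)" by simp
    have "norm (\<Sum>n=1..N2. a n * of_real (e n)) \<le> (\<Sum>n=1..N2. (X + 2) * \<bar>e n\<bar>)"
      by (rule sum_norm_le) (use an X in \<open>auto simp: norm_mult intro!: mult_right_mono\<close>)
    also have "\<dots> = (X + 2) * (\<Sum>n=1..N2. \<bar>e n\<bar>)" by (simp add: sum_distrib_left)
    also have "\<dots> \<le> (2 * X) * (24 * (\<delta> * x))" using esum X by (intro mult_mono sum_nonneg) auto
    also have "\<dots> = 48 * (x * X / X ^ h)" by (simp add: \<delta>_def)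
    also have "\<dots> \<le> C * (x * X / X ^ h)" using x0 X by (intro mult_right_mono) (auto simp: C_def)
    finally have err: "norm (\<Sum>n=1..N2. a n * of_real (e n)) \<le> C * (x * X / X ^ h)" .
    have "norm (\<Sum>n=1..N1. a n) \<le> norm (\<Sum>n=1..N2. a n * of_real (w n)) + norm (\<Sum>n=1..N2. a n * of_real (e n))"
      using norm_triangle_ineq[of "\<Sum>n=1..N2. a n * of_real (w n)" "\<Sum>n=1..N2. a n * of_real (e n)"] unfolding diff[symmetric] by simp
    also have "\<dots> \<le> C * (M * x * X ^ (1 + 2 * h) / X ^ j) + C * (x * X / X ^ h)" using main err by linarith
    finally show "norm (\<Sum>n=1..nat \<lfloor>x\<rfloor>. a n) \<le> C * (M * x * ln x ^ (1 + 2 * h) / ln x ^ j + x * ln x / ln x ^ h)"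
      unfolding N1_def X_def by (simp only: distrib_left)
  qed
qed

section \<open>Primes in the residue class 1\<close>

lemma norm_mangoldt_char: assumes "cmult \<xi>" "n > 0" shows "norm (mangoldt n * \<xi> n) \<le> 1 + ln (real n)"
proof -
  have "mangoldt n * norm (\<xi> n) \<le> ln n * 1"
    using assms by (intro mult_mono mangoldt_le cmult_norm) (auto simp: mangoldt_nonneg)
  then show ?thesis by (simp add: norm_mult)
qed

text \<open>h = H + 1 turns the second Tauberian term into x/ln^H x. In the first, j pays for ln^(1
  + 2 h), for the saving ln^H and for one more logarithm, which bounds q^\<epsilon> when q <= ln^B x
  and B \<epsilon> <= 1.\<close>

lemma char_sum_bound:
  fixes B H :: nat
  shows "\<exists>C>0. \<exists>x0>1. \<forall>x\<ge>x0. \<forall>q \<xi>. q > 0 \<longrightarrow> dchar q \<xi> \<longrightarrow> nonprincipal q \<xi> \<longrightarrow> real q \<le> ln x ^ B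
     \<longrightarrow> norm (\<Sum>n=1..nat \<lfloor>x\<rfloor>. mangoldt n * \<xi> n) \<le> C * (x / ln x ^ H)"
proof -
  define h where "h = H + 1"
  define j where "j = 2 + 2 * h + H"
  define \<epsilon> where "\<epsilon> = 1 / (2 * (real B + 1))"
  have \<epsilon>: "\<epsilon> > 0" "\<epsilon> \<le> 1/2" "real B * \<epsilon> \<le> 1" by (auto simp: \<epsilon>_def field_simps)
  obtain C1 where C1: "C1 > 0" "\<And>q \<xi> s. q > 0 \<Longrightarrow> dchar q \<xi> \<Longrightarrow> nonprincipal q \<xi> \<Longrightarrow> 1 < Re s \<Longrightarrow> Re s \<le> 2
     \<Longrightarrow> norm (dser (\<lambda>n. mangoldt n * \<xi> n * of_real (ln (real n)) ^ j) s) \<le> C1 * (real q * (2 + \<bar>Im s\<bar>)) powr \<epsilon>"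
    using dser_mangoldt_char_bound[OF \<epsilon>(1), of j] by blast
  obtain C2 x2 where C2: "C2 > 0" "x2 > 1" "\<And>a M x. (\<forall>n>0. norm (a n :: complex) \<le> 1 + ln (real n)) \<Longrightarrow>
     (\<forall>\<sigma> t. 1 < \<sigma> \<longrightarrow> \<sigma> \<le> 2 \<longrightarrow> norm (dser (\<lambda>n. a n * of_real (ln (real n)) ^ j) (Complex \<sigma> t)) \<le> M * (2 + \<bar>t\<bar>) powr (1/2))
     \<Longrightarrow> x \<ge> x2 \<Longrightarrow> norm (\<Sum>n=1..nat \<lfloor>x\<rfloor>. a n) \<le> C2 * (M * x * ln x ^ (1 + 2 * h) / ln x ^ j + x * ln x / ln x ^ h)"
    using tauberian[of h j] unfolding h_def by auto
  define C where "C = C2 * (C1 + 1)"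
  show ?thesis
  proof (rule exI[of _ C], intro conjI exI[of _ "max x2 (exp 1)"] allI impI)
    show "C > 0" using C1 C2 by (simp add: C_def)
    show "max x2 (exp 1) > 1" using C2 by simp
    fix x q \<xi> assume x: "max x2 (exp 1) \<le> x" and q: "q > 0" "dchar q \<xi>" "nonprincipal q \<xi>" "real q \<le> ln x ^ B"
    define X where "X = ln x"
    have x0: "x > 0" using x exp_gt_zero[of 1] by linarith
    have "ln (exp 1) \<le> X" unfolding X_def using x x0 by (subst ln_le_cancel_iff) auto
    then have X1: "1 \<le> X" by simp
    define M where "M = C1 * X"
    have "norm (\<Sum>n=1..nat \<lfloor>x\<rfloor>. mangoldt n * \<xi> n) \<le> C2 * (M * x * ln x ^ (1 + 2 * h) / ln x ^ j + x * ln x / ln x ^ h)"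
    proof (rule C2(3))
      show "\<forall>n>0. norm (mangoldt n * \<xi> n) \<le> 1 + ln (real n)" using norm_mangoldt_char[OF dchar_cmult[OF q(1,2)]] by blast
      show "x2 \<le> x" using x by simp
      show "\<forall>\<sigma> t. 1 < \<sigma> \<longrightarrow> \<sigma> \<le> 2 \<longrightarrow> norm (dser (\<lambda>n. mangoldt n * \<xi> n * of_real (ln (real n)) ^ j) (Complex \<sigma> t)) \<le> M * (2 + \<bar>t\<bar>) powr (1/2)"
      proof (intro allI impI)
        fix \<sigma> t :: real assume \<sigma>: "1 < \<sigma>" "\<sigma> \<le> 2"
        have "norm (dser (\<lambda>n. mangoldt n * \<xi> n * of_real (ln (real n)) ^ j) (Complex \<sigma> t)) \<le> C1 * (real q * (2 + \<bar>t\<bar>)) powr \<epsilon>"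
          using C1(2)[OF q(1-3), of "Complex \<sigma> t"] \<sigma> by simp
        also have "(real q * (2 + \<bar>t\<bar>)) powr \<epsilon> = real q powr \<epsilon> * (2 + \<bar>t\<bar>) powr \<epsilon>" by (simp add: powr_mult)
        also have "C1 * (real q powr \<epsilon> * (2 + \<bar>t\<bar>) powr \<epsilon>) \<le> C1 * (X * (2 + \<bar>t\<bar>) powr (1/2))"
        proof (intro mult_left_mono mult_mono)
          have "real q powr \<epsilon> \<le> (X ^ B) powr \<epsilon>" using q \<epsilon> by (intro powr_mono2) (auto simp: X_def)
          also have "\<dots> = X powr (real B * \<epsilon>)" using X1 by (simp add: powr_realpow[symmetric] powr_powr)
          also have "\<dots> \<le> X powr 1" using X1 \<epsilon> by (intro powr_mono) auto
          finally show "real q powr \<epsilon> \<le> X" using X1 by simp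
          show "(2 + \<bar>t\<bar>) powr \<epsilon> \<le> (2 + \<bar>t\<bar>) powr (1/2)" using \<epsilon> by (intro powr_mono) auto
        qed (use C1 X1 in auto)
        finally show "norm (dser (\<lambda>n. mangoldt n * \<xi> n * of_real (ln (real n)) ^ j) (Complex \<sigma> t)) \<le> M * (2 + \<bar>t\<bar>) powr (1/2)"
          by (simp add: M_def mult.assoc)
      qed
    qed
    also have "M * x * ln x ^ (1 + 2 * h) / ln x ^ j = C1 * (x / X ^ H)"
      unfolding M_def X_def[symmetric] j_def using X1 by (simp add: power_add field_simps power2_eq_square)
    also have "x * ln x / ln x ^ h = x / X ^ H" unfolding X_def[symmetric] h_def using X1 by simp
    finally show "norm (\<Sum>n=1..nat \<lfloor>x\<rfloor>. mangoldt n * \<xi> n) \<le> C * (x / ln x ^ H)"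
      by (simp only: C_def X_def distrib_left distrib_right mult.assoc mult_1)
  qed
qed

lemma mangoldt_minus_one_sum_bound:
  fixes H :: nat
  shows "\<exists>C>0. \<exists>x0>1. \<forall>x\<ge>x0. norm (\<Sum>n=1..nat \<lfloor>x\<rfloor>. mangoldt n - 1 :: complex) \<le> C * (x / ln x ^ H)"
proof -
  define h where "h = H + 1"
  define j where "j = 1 + 2 * h + H"
  obtain C1 where C1: "C1 > 0" "\<And>s. 1 < Re s \<Longrightarrow> Re s \<le> 2
     \<Longrightarrow> norm (dser (\<lambda>n. (mangoldt n - 1) * of_real (ln (real n)) ^ j) s) \<le> C1 * (2 + \<bar>Im s\<bar>) powr (1/2)"
    using dser_mangoldt_zeta_bound[of "1/2" j] by auto
  obtain C2 x2 where C2: "C2 > 0" "x2 > 1" "\<And>a M x. (\<forall>n>0. norm (a n :: complex) \<le> 1 + ln (real n)) \<Longrightarrow>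
     (\<forall>\<sigma> t. 1 < \<sigma> \<longrightarrow> \<sigma> \<le> 2 \<longrightarrow> norm (dser (\<lambda>n. a n * of_real (ln (real n)) ^ j) (Complex \<sigma> t)) \<le> M * (2 + \<bar>t\<bar>) powr (1/2))
     \<Longrightarrow> x \<ge> x2 \<Longrightarrow> norm (\<Sum>n=1..nat \<lfloor>x\<rfloor>. a n) \<le> C2 * (M * x * ln x ^ (1 + 2 * h) / ln x ^ j + x * ln x / ln x ^ h)"
    using tauberian[of h j] unfolding h_def by auto
  define C where "C = C2 * (C1 + 1)"
  show ?thesis
  proof (rule exI[of _ C], intro conjI exI[of _ "max x2 (exp 1)"] allI impI)
    show "C > 0" using C1 C2 by (simp add: C_def)
    show "max x2 (exp 1) > 1" using C2 by simp
    fix x assume x: "max x2 (exp 1) \<le> x"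
    define X where "X = ln x"
    have x0: "x > 0" using x exp_gt_zero[of 1] by linarith
    have "ln (exp 1) \<le> X" unfolding X_def using x x0 by (subst ln_le_cancel_iff) auto
    then have X1: "1 \<le> X" by simp
    have "norm (\<Sum>n=1..nat \<lfloor>x\<rfloor>. mangoldt n - 1 :: complex) \<le> C2 * (C1 * x * ln x ^ (1 + 2 * h) / ln x ^ j + x * ln x / ln x ^ h)"
    proof (rule C2(3))
      show "\<forall>n>0. norm (mangoldt n - 1 :: complex) \<le> 1 + ln (real n)"
      proof (intro allI impI)
        fix n :: nat assume n: "n > 0"
        have "norm (mangoldt n - 1 :: complex) \<le> norm (mangoldt n :: complex) + 1" using norm_triangle_ineq4[of "mangoldt n :: complex" 1] by simp
        also have "\<dots> \<le> 1 + ln (real n)" using mangoldt_le[OF n] by simp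
        finally show "norm (mangoldt n - 1 :: complex) \<le> 1 + ln (real n)" .
      qed
      show "x2 \<le> x" using x by simp
      show "\<forall>\<sigma> t. 1 < \<sigma> \<longrightarrow> \<sigma> \<le> 2 \<longrightarrow> norm (dser (\<lambda>n. (mangoldt n - 1) * of_real (ln (real n)) ^ j) (Complex \<sigma> t)) \<le> C1 * (2 + \<bar>t\<bar>) powr (1/2)"
        using C1(2)[of "Complex _ _"] by simp
    qed
    also have "C1 * x * ln x ^ (1 + 2 * h) / ln x ^ j = C1 * (x / X ^ H)"
      unfolding X_def[symmetric] j_def using X1 by (simp add: power_add field_simps)
    also have "x * ln x / ln x ^ h = x / X ^ H" unfolding X_def[symmetric] h_def using X1 by simp
    finally show "norm (\<Sum>n=1..nat \<lfloor>x\<rfloor>. mangoldt n - 1 :: complex) \<le> C * (x / ln x ^ H)"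
      by (simp only: C_def X_def distrib_left distrib_right mult.assoc mult_1)
  qed
qed

lemma primepow_exponent_le:
  assumes "prime p" "p ^ k \<le> N" shows "real k \<le> 2 * ln (real N)"
proof -
  have p2: "real p \<ge> 2" using prime_ge_2_nat[OF assms(1)] by simp
  have "real k * ln 2 \<le> real k * ln (real p)" using p2 by (intro mult_left_mono) auto
  also have "\<dots> = ln (real (p ^ k))" using p2 by (simp add: ln_realpow)
  also have "\<dots> \<le> ln (real N)"
  proof -
    have "0 < p ^ k" using p2 by simp
    then have "0 < real (p ^ k)" "real (p ^ k) \<le> real N" using assms(2) by linarith+
    then show ?thesis by (subst ln_le_cancel_iff) linarith+
  qed
  finally have "real k * ln 2 \<le> ln (real N)" .
  moreover have "real k * (1/2) \<le> real k * ln 2" using ln2_ge_two_thirds by (intro mult_left_mono) auto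
  ultimately show ?thesis by linarith
qed

text \<open>Only powers of primes dividing q occur, with exponents at most 2 ln N: at most 2 q ln N
  terms, each at most ln N.\<close>

lemma noncoprime_mangoldt_sum:
  assumes q: "q > 0" and N: "N \<ge> 1"
  shows "(\<Sum>n=1..N. if coprime n q then 0 else mangoldt n) \<le> 2 * real q * ln (real N) ^ 2"
proof -
  define S where "S = {n\<in>{1..N}. \<not> coprime n q \<and> primepow n}"
  define L where "L = nat \<lfloor>2 * ln (real N)\<rfloor>"
  have lnN: "0 \<le> ln (real N)" using N by simp
  have "S \<subseteq> (\<lambda>(p, k). p ^ k) ` ({1..q} \<times> {1..L})"
  proof
    fix n assume n: "n \<in> S"
    then obtain p k where pk: "prime p" "k > 0" "n = p ^ k" by (auto simp: S_def primepow_def)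
    have "\<not> coprime p q" using n pk by (auto simp: S_def)
    then have "p dvd q" using prime_imp_coprime[OF pk(1)] by blast
    then have "p \<in> {1..q}" using q dvd_imp_le prime_gt_0_nat[OF pk(1)] by (simp add: Suc_leI)
    moreover have "real k \<le> 2 * ln (real N)" by (rule primepow_exponent_le[OF pk(1)]) (use n pk in \<open>auto simp: S_def\<close>)
    then have "k \<in> {1..L}" using pk lnN by (simp add: L_def le_nat_iff le_floor_iff)
    ultimately show "n \<in> (\<lambda>(p, k). p ^ k) ` ({1..q} \<times> {1..L})" using pk(3) by (intro image_eqI[of _ _ "(p, k)"]) auto
  qed
  then have "card S \<le> card ({1..q} \<times> {1..L})" by (rule surj_card_le[rotated]) simp
  then have "real (card S) \<le> real (q * L)" by (simp del: of_nat_mult)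
  also have "\<dots> \<le> real q * (2 * ln (real N))" using lnN by (simp add: L_def mult_left_mono)
  finally have cS: "real (card S) \<le> real q * (2 * ln (real N))" .
  have "(\<Sum>n=1..N. if coprime n q then 0 else mangoldt n) = (\<Sum>n\<in>S. mangoldt n)"
    unfolding S_def by (rule sum.mono_neutral_cong_right) (auto simp: mangoldt_def)
  also have "\<dots> \<le> (\<Sum>n\<in>S. ln (real N))"
  proof (rule sum_mono)
    fix n assume "n \<in> S"
    then have "0 < n" "n \<le> N" by (auto simp: S_def)
    then show "mangoldt n \<le> ln (real N)" using mangoldt_le[of n] by (meson ln_mono of_nat_0_less_iff of_nat_le_iff order_trans)
  qed
  also have "\<dots> = real (card S) * ln (real N)" by simp
  also have "\<dots> \<le> (real q * (2 * ln (real N))) * ln (real N)" using cS lnN by (intro mult_right_mono)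
  finally show ?thesis by (simp add: power2_eq_square mult_ac)
qed

text \<open>Orthogonality, with the principal character written as 1 minus the indicator of the n
  not coprime to q, so that its main part becomes a sum of \<open>mangoldt n - 1\<close>.\<close>

lemma progression_identity:
  assumes q: "q > 0"
  shows "of_nat (totient q) * (\<Sum>n=1..N. (if [n = 1] (mod q) then mangoldt n else 0) - 1 / of_nat (totient q))
    = (\<Sum>\<xi> | dchar q \<xi> \<and> nonprincipal q \<xi>. \<Sum>n=1..N. mangoldt n * \<xi> n) + (\<Sum>n=1..N. mangoldt n - 1)
      - (of_real (\<Sum>n=1..N. if coprime n q then 0 else mangoldt n) :: complex)"
proof -
  have t0: "totient q > 0" using q by simp
  define \<xi>0 :: "nat \<Rightarrow> complex" where "\<xi>0 n = (if coprime n q then 1 else 0)" for n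
  have \<xi>0: "dchar q \<xi>0"
    by (rule dcharI) (auto simp: \<xi>0_def dest: cong_imp_coprime cong_sym[THEN cong_imp_coprime])
  have set: "{\<xi>. dchar q \<xi>} = insert \<xi>0 {\<xi>. dchar q \<xi> \<and> nonprincipal q \<xi>}"
  proof (intro Set.set_eqI iffI)
    fix \<xi> assume "\<xi> \<in> {\<xi>. dchar q \<xi>}"
    then have d: "dchar q \<xi>" by simp
    show "\<xi> \<in> insert \<xi>0 {\<xi>. dchar q \<xi> \<and> nonprincipal q \<xi>}"
    proof (cases "nonprincipal q \<xi>")
      case False
      have "\<xi> n = \<xi>0 n" for n using False dchar_nz[OF d, of n] by (cases "coprime n q") (auto simp: nonprincipal_def \<xi>0_def)
      then show ?thesis by blast
    qed (use d in simp)
  qed (use \<xi>0 in auto)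
  have nin: "\<xi>0 \<notin> {\<xi>. dchar q \<xi> \<and> nonprincipal q \<xi>}" by (auto simp: nonprincipal_def \<xi>0_def)
  have fin: "finite {\<xi>. dchar q \<xi> \<and> nonprincipal q \<xi>}" by (rule finite_subset[OF _ finite_dchars[OF q]]) auto
  have "(\<Sum>\<xi> | dchar q \<xi>. \<Sum>n=1..N. mangoldt n * \<xi> n) = (\<Sum>n=1..N. mangoldt n * (\<Sum>\<xi> | dchar q \<xi>. \<xi> n))"
    by (subst sum.swap) (simp add: sum_distrib_left)
  also have "\<dots> = (\<Sum>n=1..N. of_nat (totient q) * (if [n = 1] (mod q) then mangoldt n else 0))"
    by (intro sum.cong refl) (simp add: dchar_orthogonality[OF q])
  finally have 1: "(\<Sum>\<xi> | dchar q \<xi>. \<Sum>n=1..N. mangoldt n * \<xi> n) = of_nat (totient q) * (\<Sum>n=1..N. if [n = 1] (mod q) then mangoldt n else 0)"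
    by (simp add: sum_distrib_left)
  have e1: "(\<Sum>\<xi> | dchar q \<xi>. \<Sum>n=1..N. mangoldt n * \<xi> n) = (\<Sum>n=1..N. mangoldt n * \<xi>0 n) + (\<Sum>\<xi> | dchar q \<xi> \<and> nonprincipal q \<xi>. \<Sum>n=1..N. mangoldt n * \<xi> n)"
    unfolding set by (rule sum.insert[OF fin nin])
  have e2: "(\<Sum>n=1..N. mangoldt n * \<xi>0 n) = (\<Sum>n=1..N. mangoldt n) - of_real (\<Sum>n=1..N. if coprime n q then 0 else mangoldt n)"
    unfolding of_real_sum sum_subtractf[symmetric] by (intro sum.cong refl) (auto simp: \<xi>0_def)
  have e3: "of_nat (totient q) * (\<Sum>n=1..N. (if [n = 1] (mod q) then mangoldt n else 0) - 1 / of_nat (totient q))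
     = of_nat (totient q) * (\<Sum>n=1..N. if [n = 1] (mod q) then mangoldt n else 0) - (of_nat N :: complex)"
    using t0 by (simp add: sum_subtractf right_diff_distrib)
  have e4: "(\<Sum>n=1..N. mangoldt n - 1) = (\<Sum>n=1..N. mangoldt n) - (of_nat N :: complex)" by (simp add: sum_subtractf)
  show ?thesis unfolding e3 e4 1[symmetric] e1 e2 by simp
qed

text \<open>There are at most totient q characters and the identity carries the factor totient q, so
  the bound for a single character survives without loss in q.\<close>

lemma progression_bound:
  fixes B H :: nat
  shows "\<exists>C>0. \<exists>x0>1. \<forall>x\<ge>x0. \<forall>q. q > 0 \<longrightarrow> real q \<le> ln x ^ B
     \<longrightarrow> \<bar>\<Sum>n=1..nat \<lfloor>x\<rfloor>. (if [n = 1] (mod q) then mangoldt n else 0) - 1 / real (totient q)\<bar> \<le> C * (x / ln x ^ H)"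
proof -
  obtain C1 x1 where 1: "C1 > 0" "x1 > 1" "\<And>x q \<xi>. x \<ge> x1 \<Longrightarrow> q > 0 \<Longrightarrow> dchar q \<xi> \<Longrightarrow> nonprincipal q \<xi> \<Longrightarrow> real q \<le> ln x ^ B
     \<Longrightarrow> norm (\<Sum>n=1..nat \<lfloor>x\<rfloor>. mangoldt n * \<xi> n) \<le> C1 * (x / ln x ^ H)"
    using char_sum_bound[of B H] by blast
  obtain C2 x2 where 2: "C2 > 0" "x2 > 1" "\<And>x. x \<ge> x2 \<Longrightarrow> norm (\<Sum>n=1..nat \<lfloor>x\<rfloor>. mangoldt n - 1 :: complex) \<le> C2 * (x / ln x ^ H)"
    using mangoldt_minus_one_sum_bound[of H] by blast
  have "eventually (\<lambda>x::real. 2 * ln x ^ B * ln x ^ 2 \<le> x / ln x ^ H) at_top" by real_asymp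
  then obtain x3 where 3: "\<And>x::real. x \<ge> x3 \<Longrightarrow> 2 * ln x ^ B * ln x ^ 2 \<le> x / ln x ^ H" by (auto simp: eventually_at_top_linorder)
  define x0 where "x0 = max (max x1 x2) x3"
  define C where "C = C1 + C2 + 1"
  show ?thesis
  proof (rule exI[of _ C], intro conjI exI[of _ x0] allI impI)
    show "C > 0" "x0 > 1" using 1 2 by (auto simp: C_def x0_def)
    fix x q assume x: "x0 \<le> x" and q: "q > 0" "real q \<le> ln x ^ B"
    have xx: "x \<ge> x1" "x \<ge> x2" "x \<ge> x3" "x > 1" using x 1 by (auto simp: x0_def)
    define N where "N = nat \<lfloor>x\<rfloor>"
    have N: "N \<ge> 1" "real N \<le> x" using xx by (auto simp: N_def le_nat_iff)
    define E where "E = x / ln x ^ H"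
    have E0: "E \<ge> 0" using xx by (simp add: E_def)
    let ?\<phi> = "real (totient q)"
    have \<phi>: "?\<phi> \<ge> 1" using q by (simp add: Suc_le_eq)
    let ?np = "{\<xi>. dchar q \<xi> \<and> nonprincipal q \<xi>}"
    define T where "T = (\<Sum>n=1..N. (if [n = 1] (mod q) then mangoldt n else 0) - 1 / real (totient q))"
    have cnp: "real (card ?np) \<le> ?\<phi>"
    proof -
      have "(\<Sum>\<xi> | dchar q \<xi>. \<xi> 1) = of_nat (totient q)" using dchar_orthogonality[OF q(1), of 1] by simp
      moreover have "(\<Sum>\<xi> | dchar q \<xi>. \<xi> 1) = (\<Sum>\<xi> | dchar q \<xi>. 1)" by (intro sum.cong refl) (simp add: dchar_1)
      ultimately have "of_nat (card {\<xi>. dchar q \<xi>}) = (of_nat (totient q) :: complex)" by simp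
      then have "card {\<xi>. dchar q \<xi>} = totient q" by (simp only: of_nat_eq_iff)
      moreover have "card ?np \<le> card {\<xi>. dchar q \<xi>}" by (rule card_mono[OF finite_dchars[OF q(1)]]) auto
      ultimately show ?thesis by simp
    qed
    have cast: "of_real T = (\<Sum>n=1..N. (if [n = 1] (mod q) then mangoldt n else 0) - 1 / of_nat (totient q) :: complex)"
      unfolding T_def of_real_sum by (intro sum.cong refl) auto
    have n1: "norm (\<Sum>\<xi>\<in>?np. \<Sum>n=1..N. mangoldt n * \<xi> n) \<le> ?\<phi> * (C1 * E)"
    proof -
      have "norm (\<Sum>\<xi>\<in>?np. \<Sum>n=1..N. mangoldt n * \<xi> n) \<le> (\<Sum>\<xi>\<in>?np. C1 * E)"
        by (rule sum_norm_le) (use 1(3)[OF xx(1) q(1) _ _ q(2)] in \<open>simp add: N_def E_def\<close>)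
      also have "\<dots> = real (card ?np) * (C1 * E)" by simp
      also have "\<dots> \<le> ?\<phi> * (C1 * E)" using cnp 1 E0 by (intro mult_right_mono) auto
      finally show ?thesis .
    qed
    have n2: "norm (\<Sum>n=1..N. mangoldt n - 1 :: complex) \<le> C2 * E" using 2(3)[OF xx(2)] by (simp add: N_def E_def)
    have n3: "norm (of_real (\<Sum>n=1..N. if coprime n q then 0 else mangoldt n) :: complex) \<le> E"
    proof -
      have "(\<Sum>n=1..N. if coprime n q then 0 else mangoldt n) \<le> 2 * real q * ln (real N) ^ 2" by (rule noncoprime_mangoldt_sum[OF q(1) N(1)])
      also have "\<dots> \<le> 2 * ln x ^ B * ln x ^ 2"
      proof (intro mult_mono)
        have "ln (real N) \<le> ln x" using N by simp
        then show "ln (real N) ^ 2 \<le> ln x ^ 2" using N by (intro power_mono) auto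
      qed (use q xx in auto)
      also have "\<dots> \<le> E" using 3[OF xx(3)] by (simp add: E_def)
      finally have "(\<Sum>n=1..N. if coprime n q then 0 else mangoldt n) \<le> E" .
      moreover have "0 \<le> (\<Sum>n=1..N. if coprime n q then 0 else mangoldt n :: real)" by (intro sum_nonneg) (auto simp: mangoldt_nonneg)
      ultimately show ?thesis by (simp only: norm_of_real abs_of_nonneg)
    qed
    have "?\<phi> * \<bar>T\<bar> = norm (of_nat (totient q) * of_real T :: complex)" by (simp add: norm_mult)
    also have "\<dots> \<le> ?\<phi> * (C1 * E) + C2 * E + E"
      unfolding cast progression_identity[OF q(1)] using n1 n2 n3
      by (meson add_mono norm_triangle_ineq norm_triangle_ineq4 order_trans)
    also have "\<dots> \<le> ?\<phi> * (C1 * E) + ?\<phi> * (C2 * E) + ?\<phi> * E"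
    proof -
      have "1 * (C2 * E) \<le> ?\<phi> * (C2 * E)" "1 * E \<le> ?\<phi> * E" using 2(1) E0 by (intro mult_right_mono[OF \<phi>]; simp)+
      then show ?thesis by linarith
    qed
    also have "\<dots> = ?\<phi> * (C * E)" by (simp add: C_def algebra_simps)
    finally have le: "?\<phi> * \<bar>T\<bar> \<le> ?\<phi> * (C * E)" .
    have "\<bar>T\<bar> \<le> C * E" by (rule mult_left_le_imp_le[OF le]) (use \<phi> in linarith)
    then show "\<bar>\<Sum>n=1..nat \<lfloor>x\<rfloor>. (if [n = 1] (mod q) then mangoldt n else 0) - 1 / real (totient q)\<bar> \<le> C * (x / ln x ^ H)"
      by (simp add: T_def N_def E_def)
  qed
qed

section \<open>The logarithmic integral and partial summation\<close>

lemma inv_ln_antimono: assumes "2 \<le> (s::real)" "s \<le> t" shows "1 / ln t \<le> 1 / ln s" "0 < 1 / ln t" "1 / ln t \<le> 2"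
proof -
  have l: "0 < ln s" "ln s \<le> ln t" using assms by auto
  then show "1 / ln t \<le> 1 / ln s" "0 < 1 / ln t" by (auto intro!: divide_left_mono mult_pos_pos)
  have "ln 2 \<le> ln t" using assms by simp
  then have "1/2 \<le> ln t" using ln2_ge_two_thirds by linarith
  then have "1 / ln t \<le> 1 / (1/2)" by (intro divide_left_mono) auto
  then show "1 / ln t \<le> 2" by simp
qed

lemma Li_integrable: assumes "2 \<le> a" shows "(\<lambda>t::real. 1 / ln t) integrable_on {a..b}"
  by (intro integrable_continuous_real continuous_intros) (use assms in auto)

lemma Li_step:
  assumes "2 \<le> a" "a \<le> (b::real)"
  shows "Li b - Li a = integral {a..b} (\<lambda>t. 1 / ln t)" "(b - a) * (1 / ln b) \<le> Li b - Li a" "Li b - Li a \<le> (b - a) * (1 / ln a)"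
proof -
  have "Li b = Li a + integral {a..b} (\<lambda>t. 1 / ln t)"
    unfolding Li_def using Henstock_Kurzweil_Integration.integral_combine[OF assms Li_integrable[of 2]] by simp
  then show e: "Li b - Li a = integral {a..b} (\<lambda>t. 1 / ln t)" by simp
  have "integral {a..b} (\<lambda>t. 1 / ln b) \<le> integral {a..b} (\<lambda>t. 1 / ln t)"
    by (intro integral_le Li_integrable assms(1)) (use assms inv_ln_antimono(1) in auto)
  then show "(b - a) * (1 / ln b) \<le> Li b - Li a" unfolding e using assms by simp
  have "integral {a..b} (\<lambda>t. 1 / ln t) \<le> integral {a..b} (\<lambda>t. 1 / ln a)"
    by (intro integral_le Li_integrable assms(1)) (use assms inv_ln_antimono(1) in auto)
  then show "Li b - Li a \<le> (b - a) * (1 / ln a)" unfolding e using assms by simp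
qed

lemma Li_2: "Li 2 = 0" by (simp add: Li_def)

lemma Li_nonneg: "2 \<le> x \<Longrightarrow> 0 \<le> Li x"
proof -
  assume x: "2 \<le> x"
  have "0 \<le> (x - 2) * (1 / ln x)" using x inv_ln_antimono(2)[of 2 x] by simp
  then show ?thesis using Li_step(2)[of 2 x] x Li_2 by linarith
qed

lemma Li_le: "2 \<le> x \<Longrightarrow> Li x \<le> 2 * x"
proof -
  assume x: "2 \<le> x"
  have "(x - 2) * (1 / ln 2) \<le> (x - 2) * 2" using x inv_ln_antimono(3)[of 2 2] by (intro mult_left_mono) auto
  then have "Li x - Li 2 \<le> (x - 2) * 2" using Li_step(3)[OF order_refl x] by (rule order_trans[rotated])
  then show ?thesis using Li_2 x by simp
qed

lemma Li_sum:
  assumes "x \<ge> 2"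
  shows "\<bar>(\<Sum>n=2..nat \<lfloor>x\<rfloor>. 1 / ln (real n)) - Li x\<bar> \<le> 4"
proof -
  define N where "N = nat \<lfloor>x\<rfloor>"
  have N: "N \<ge> 2" "real N \<le> x" "x \<le> real N + 1" using assms by (auto simp: N_def le_nat_iff le_floor_iff)
  have "1 / ln (real M) \<le> (\<Sum>n=2..M. 1 / ln (real n)) - Li (real M) \<and> (\<Sum>n=2..M. 1 / ln (real n)) - Li (real M) \<le> 1 / ln 2" if "M \<ge> 2" for M
    using that
  proof (induction M rule: dec_induct)
    case base
    then show ?case using Li_2 by simp
  next
    case (step M)
    have "{2..Suc M} = insert (Suc M) {2..M}" using step.hyps by auto
    then have S: "(\<Sum>n=2..Suc M. 1 / ln (real n)) = 1 / ln (real (Suc M)) + (\<Sum>n=2..M. 1 / ln (real n))" by simp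
    have "(real (Suc M) - real M) * (1 / ln (real (Suc M))) \<le> Li (real (Suc M)) - Li (real M)"
      "Li (real (Suc M)) - Li (real M) \<le> (real (Suc M) - real M) * (1 / ln (real M))"
      using step.hyps by (intro Li_step; simp)+
    then have "1 / ln (real (Suc M)) \<le> Li (real (Suc M)) - Li (real M)" "Li (real (Suc M)) - Li (real M) \<le> 1 / ln (real M)" by simp_all
    then show ?case unfolding S using step.IH by linarith
  qed
  from this[OF N(1)] have a: "1 / ln (real N) \<le> (\<Sum>n=2..N. 1 / ln (real n)) - Li (real N)" "(\<Sum>n=2..N. 1 / ln (real n)) - Li (real N) \<le> 1 / ln 2" by auto
  have N2: "2 \<le> real N" using N by simp
  have b: "0 \<le> Li x - Li (real N)" "Li x - Li (real N) \<le> 2"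
  proof -
    have "0 \<le> (x - real N) * (1 / ln x)" using N N2 inv_ln_antimono(2)[of 2 x] by (intro mult_nonneg_nonneg) auto
    then show "0 \<le> Li x - Li (real N)" using Li_step(2)[OF N2 N(2)] by linarith
    have "(x - real N) * (1 / ln (real N)) \<le> 1 * 2" using N N2 inv_ln_antimono(2,3)[of 2 "real N"] by (intro mult_mono) auto
    then show "Li x - Li (real N) \<le> 2" using Li_step(3)[OF N2 N(2)] by linarith
  qed
  have "1 / ln (2::real) \<le> 2" "0 < 1 / ln (real N)" using inv_ln_antimono(3)[of 2 2] inv_ln_antimono(2)[of 2 "real N"] N2 by auto
  then show ?thesis unfolding N_def[symmetric] using a b by linarith
qed

definition pi1 :: "real \<Rightarrow> nat \<Rightarrow> nat" where
  "pi1 x d = card {p. prime p \<and> real p \<le> x \<and> d dvd p - 1}"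

lemma finite_primes_le: "finite {p::nat. prime p \<and> real p \<le> x \<and> P p}"
  by (rule finite_subset[of _ "{..nat \<lfloor>\<bar>x\<bar>\<rfloor>}"]) (auto simp: le_nat_iff le_floor_iff)

lemma cong_1_iff: "n > 0 \<Longrightarrow> [n = 1] (mod d) \<longleftrightarrow> (d::nat) dvd n - 1"
  by (simp add: cong_altdef_nat Suc_le_eq)

text \<open>The difference comes from proper prime powers up to x, with bases at most sqrt x and
  exponents at most 2 ln x.\<close>

lemma pi1_vs_mangoldt:
  assumes x: "x \<ge> 4"
  shows "\<bar>real (pi1 x d) - (\<Sum>n=2..nat \<lfloor>x\<rfloor>. (if [n = 1] (mod d) then mangoldt n else 0) / ln (real n))\<bar> \<le> 2 * sqrt x * ln x"
proof -
  define N where "N = nat \<lfloor>x\<rfloor>"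
  have N: "real N \<le> x" "N \<ge> 1" using x by (auto simp: N_def le_nat_iff le_floor_iff)
  define A where "A = {p. prime p \<and> real p \<le> x \<and> d dvd p - 1}"
  have fA: "finite A" unfolding A_def by (rule finite_primes_le)
  have AN: "A \<subseteq> {2..N}" unfolding A_def N_def using x by (auto simp: prime_ge_2_nat le_nat_iff le_floor_iff)
  define S where "S = {n\<in>{2..N}. primepow n \<and> \<not> prime n}"
  let ?f = "\<lambda>n. (if [n = 1] (mod d) then mangoldt n else 0) / ln (real n)"
  have f0: "0 \<le> ?f n" "?f n \<le> 1" if "n \<in> {2..N}" for n
  proof -
    have l: "0 < ln (real n)" using that by simp
    then show "0 \<le> ?f n" by (simp add: mangoldt_nonneg)
    have "mangoldt n \<le> ln (real n)" using that by (intro mangoldt_le) auto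
    then show "?f n \<le> 1" using l by (simp add: divide_le_eq_1)
  qed
  have fA1: "?f p = 1" if "p \<in> A" for p
  proof -
    have p: "prime p" "d dvd p - 1" using that by (auto simp: A_def)
    then have "[p = 1] (mod d)" using cong_1_iff[of p d] prime_gt_0_nat by blast
    moreover have "ln (real p) > 0" using prime_gt_1_nat[OF p(1)] by simp
    ultimately show ?thesis using p by simp
  qed
  have "(\<Sum>n=2..N. ?f n) = (\<Sum>n\<in>A. ?f n) + (\<Sum>n\<in>{2..N} - A. ?f n)"
    using sum.subset_diff[OF AN, of ?f] by simp
  moreover have "(\<Sum>n\<in>A. ?f n) = (\<Sum>n\<in>A. 1)" by (rule sum.cong[OF refl fA1])
  then have "(\<Sum>n\<in>A. ?f n) = real (card A)" by simp
  moreover have "(\<Sum>n\<in>{2..N} - A. ?f n) \<le> real (card S)"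
  proof -
    have "(\<Sum>n\<in>{2..N} - A. ?f n) \<le> (\<Sum>n\<in>{2..N} - A. if n \<in> S then 1 else 0)"
    proof (rule sum_mono)
      fix n assume n: "n \<in> {2..N} - A"
      show "?f n \<le> (if n \<in> S then 1 else 0)"
      proof (cases "n \<in> S")
        case True
        then show ?thesis using f0[of n] n by simp
      next
        case False
        have "?f n = 0"
        proof (cases "prime n")
          case True
          have "real n \<le> x" using n N by auto
          then have "\<not> d dvd n - 1" using n True by (auto simp: A_def)
          then show ?thesis using cong_1_iff[of n d] n by auto
        next
          case npr: False
          then have "\<not> primepow n" using False n by (auto simp: S_def)
          then show ?thesis by (simp add: mangoldt_def)
        qed
        then show ?thesis using False by (simp only: if_False order_refl)
      qed
    qed
    also have "\<dots> \<le> (\<Sum>n\<in>{2..N}. if n \<in> S then 1 else 0)" by (rule sum_mono2) auto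
    also have "\<dots> = real (card S)" by (simp add: sum.If_cases S_def Int_def)
    finally show ?thesis .
  qed
  moreover have "0 \<le> (\<Sum>n\<in>{2..N} - A. ?f n)" using f0 by (intro sum_nonneg) auto
  moreover have "real (card S) \<le> 2 * sqrt x * ln x"
  proof -
    define R where "R = nat \<lfloor>sqrt x\<rfloor>"
    define L where "L = nat \<lfloor>2 * ln x\<rfloor>"
    have lx: "ln x \<ge> 0" "ln (real N) \<le> ln x" using x N by auto
    have "S \<subseteq> (\<lambda>(p, k). p ^ k) ` ({1..R} \<times> {1..L})"
    proof
      fix n assume n: "n \<in> S"
      then obtain p k where pk: "prime p" "k > 0" "n = p ^ k" by (auto simp: S_def primepow_def)
      have "k \<noteq> 1" using n pk by (auto simp: S_def)
      then have "p ^ 2 \<le> p ^ k" using pk prime_gt_0_nat[OF pk(1)] by (intro power_increasing) auto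
      then have "p ^ 2 \<le> N" using n pk by (auto simp: S_def)
      then have "real (p ^ 2) \<le> x" using N by (meson of_nat_le_iff order_trans)
      then have "real p \<le> sqrt x" by (intro real_le_rsqrt) simp
      then have "p \<in> {1..R}" using prime_gt_0_nat[OF pk(1)] x by (simp add: R_def le_nat_iff le_floor_iff Suc_le_eq)
      moreover have "real k \<le> 2 * ln (real N)" by (rule primepow_exponent_le[OF pk(1)]) (use n pk in \<open>auto simp: S_def\<close>)
      then have "k \<in> {1..L}" using pk lx by (simp add: L_def le_nat_iff le_floor_iff)
      ultimately show "n \<in> (\<lambda>(p, k). p ^ k) ` ({1..R} \<times> {1..L})" using pk(3) by (intro image_eqI[of _ _ "(p, k)"]) auto
    qed
    then have "card S \<le> card ({1..R} \<times> {1..L})" by (rule surj_card_le[rotated]) simp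
    then have "real (card S) \<le> real R * real L" by (simp flip: of_nat_mult)
    also have "\<dots> \<le> sqrt x * (2 * ln x)" using x lx by (intro mult_mono) (auto simp: R_def L_def)
    finally show ?thesis by simp
  qed
  ultimately show ?thesis unfolding pi1_def A_def[symmetric] N_def[symmetric] by linarith
qed

text \<open>1/ln n is decreasing and at most 2 from n = 2 on. The two boundary terms and the total
  variation cost 2 K each.\<close>

lemma abel_inverse_ln:
  fixes a :: "nat \<Rightarrow> real"
  assumes N: "N \<ge> 1" and T: "\<And>n. 1 \<le> n \<Longrightarrow> n \<le> N \<Longrightarrow> \<bar>\<Sum>m=1..n. a m\<bar> \<le> K"
  shows "\<bar>\<Sum>n=2..N. a n / ln (real n)\<bar> \<le> 6 * K"
proof -
  let ?f = "\<lambda>n. 1 / ln (real n)" and ?T = "\<lambda>n. \<Sum>m=1..n. a m"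
  have K: "0 \<le> K" using T[of 1] N by linarith
  have S: "(\<Sum>n=2..M. a n * ?f n) = ?T M * ?f (Suc M) - ?T 1 * ?f 2 + (\<Sum>n=2..M. ?T n * (?f n - ?f (Suc n)))" if "M \<ge> 1" for M
    using that
  proof (induction M rule: dec_induct)
    case base
    then show ?case by (simp add: numeral_2_eq_2)
  next
    case (step M)
    have s2: "{2..Suc M} = insert (Suc M) {2..M}" using step.hyps by auto
    have T': "?T (Suc M) = ?T M + a (Suc M)" by simp
    have u: "(\<Sum>n=2..Suc M. g n) = g (Suc M) + (\<Sum>n=2..M. g n)" for g :: "nat \<Rightarrow> real"
      unfolding s2 by (subst sum.insert) auto
    have alg: "A * f1 + (P * f1 - t + s) = (P + A) * f2 - t + ((P + A) * (f1 - f2) + s)" for A f1 f2 P t s :: real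
      by (simp add: algebra_simps)
    show ?case unfolding u step.IH T' by (rule alg)
  qed
  have f: "0 \<le> ?f (Suc n)" "?f (Suc n) \<le> 2" if "n \<ge> 1" for n
    using inv_ln_antimono(2,3)[of 2 "real (Suc n)"] that by auto
  have t1: "\<bar>?T N * ?f (Suc N)\<bar> \<le> K * 2" unfolding abs_mult using T[of N] N f[OF N] by (intro mult_mono) auto
  have t2: "\<bar>?T 1 * ?f 2\<bar> \<le> K * 2" unfolding abs_mult using T[of 1] N f[of 1] K by (intro mult_mono) (auto simp: numeral_2_eq_2)
  have t3: "\<bar>\<Sum>n=2..N. ?T n * (?f n - ?f (Suc n))\<bar> \<le> K * 2"
  proof -
    have d: "0 \<le> ?f n - ?f (Suc n)" if "n \<ge> 2" for n using inv_ln_antimono(1)[of "real n" "real (Suc n)"] that by simp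
    have "\<bar>\<Sum>n=2..N. ?T n * (?f n - ?f (Suc n))\<bar> \<le> (\<Sum>n=2..N. \<bar>?T n * (?f n - ?f (Suc n))\<bar>)" by (rule sum_abs)
    also have "\<dots> \<le> (\<Sum>n=2..N. K * (?f n - ?f (Suc n)))"
    proof (rule sum_mono)
      fix n assume n: "n \<in> {2..N}"
      show "\<bar>?T n * (?f n - ?f (Suc n))\<bar> \<le> K * (?f n - ?f (Suc n))"
        unfolding abs_mult using d[of n] n T[of n] by (intro mult_mono) auto
    qed
    also have "\<dots> = K * (\<Sum>n=2..N. ?f n - ?f (Suc n))" by (simp add: sum_distrib_left)
    also have "\<dots> \<le> K * 2"
    proof (rule mult_left_mono[OF _ K])
      have "(\<Sum>n=2..M. ?f n - ?f (Suc n)) = ?f 2 - ?f (Suc M)" if "M \<ge> 1" for M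
        using that
      proof (induction M rule: dec_induct)
        case base
        then show ?case by (simp add: numeral_2_eq_2)
      next
        case (step M)
        have "{2..Suc M} = insert (Suc M) {2..M}" using step.hyps by auto
        then show ?case using step.IH by simp
      qed
      note tel = this[OF N]
      have f2: "?f 2 \<le> 2" using f(2)[of 1] by simp
      have "u - w \<le> 2" if "0 \<le> w" "u \<le> 2" for u w :: real using that by linarith
      from this[OF f(1)[OF N] f2] show "(\<Sum>n=2..N. ?f n - ?f (Suc n)) \<le> 2" unfolding tel .
    qed
    finally show ?thesis .
  qed
  have "\<bar>t - u + w\<bar> \<le> 6 * K" if "\<bar>t\<bar> \<le> K * 2" "\<bar>u\<bar> \<le> K * 2" "\<bar>w\<bar> \<le> K * 2" for t u w
    using that by linarith
  from this[OF t1 t2 t3] have "\<bar>\<Sum>n=2..N. a n * ?f n\<bar> \<le> 6 * K" unfolding S[OF N] .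
  then show ?thesis by simp
qed

text \<open>Partial summation asks for all partial sums up to x. Those up to sqrt x are trivially
  small; beyond, \<open>progression_bound\<close> applies at n because ln n >= ln x/2. The exponent
  B + 1 is taken there since one extra logarithm absorbs the factor 2^B lost on passing from ln x to
  ln n.\<close>

theorem primes_1_mod:
  fixes B H :: nat
  shows "\<exists>C>0. \<exists>x0\<ge>2. \<forall>x\<ge>x0. \<forall>d. d > 0 \<longrightarrow> real d \<le> ln x ^ B
     \<longrightarrow> \<bar>real (pi1 x d) - Li x / real (totient d)\<bar> \<le> C * (x / ln x ^ H)"
proof -
  obtain C1 x1 where 1: "C1 > 0" "x1 > 1" "\<And>x q. x \<ge> x1 \<Longrightarrow> q > 0 \<Longrightarrow> real q \<le> ln x ^ (B + 1)
     \<Longrightarrow> \<bar>\<Sum>n=1..nat \<lfloor>x\<rfloor>. (if [n = 1] (mod q) then mangoldt n else 0) - 1 / real (totient q)\<bar> \<le> C1 * (x / ln x ^ H)"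
    using progression_bound[of "B + 1" H] by blast
  have "eventually (\<lambda>x::real. sqrt x * (ln x + 1) \<le> x / ln x ^ H \<and> 2 * sqrt x * ln x \<le> x / ln x ^ H \<and> 4 \<le> x / ln x ^ H
      \<and> x1 \<le> sqrt x \<and> 2 ^ B \<le> ln x / 2 \<and> 4 \<le> x) at_top"
    by (intro eventually_conj) real_asymp+
  then obtain x2 where 2: "\<And>x::real. x \<ge> x2 \<Longrightarrow> sqrt x * (ln x + 1) \<le> x / ln x ^ H \<and> 2 * sqrt x * ln x \<le> x / ln x ^ H \<and> 4 \<le> x / ln x ^ H
      \<and> x1 \<le> sqrt x \<and> 2 ^ B \<le> ln x / 2 \<and> 4 \<le> x"
    by (auto simp: eventually_at_top_linorder)
  define C where "C = 6 * (1 + C1 * 2 ^ H) + 2"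
  show ?thesis
  proof (rule exI[of _ C], intro conjI exI[of _ "max 2 x2"] allI impI)
    have "0 \<le> C1 * 2 ^ H" using 1 by simp
    then have "0 < 6 * (1 + C1 * 2 ^ H)" by (intro mult_pos_pos) (auto simp: add_pos_nonneg)
    then show "C > 0" unfolding C_def by (rule add_pos_pos) simp
    show "2 \<le> max 2 x2" by simp
    fix x d assume x: "max 2 x2 \<le> x" and d: "d > 0" "real d \<le> ln x ^ B"
    define E where "E = x / ln x ^ H"
    have xx: "sqrt x * (ln x + 1) \<le> E" "2 * sqrt x * ln x \<le> E" "4 \<le> E" "x1 \<le> sqrt x" "2 ^ B \<le> ln x / 2" "4 \<le> x"
      using 2[of x] x by (auto simp: E_def)
    define N where "N = nat \<lfloor>x\<rfloor>"
    have N: "real N \<le> x" "N \<ge> 1" using xx by (auto simp: N_def le_nat_iff le_floor_iff)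
    let ?\<phi> = "real (totient d)"
    have \<phi>: "?\<phi> \<ge> 1" using d by (simp add: Suc_le_eq)
    have i\<phi>: "0 \<le> 1 / ?\<phi>" "1 / ?\<phi> \<le> 1"
      using frac_le[OF zero_le_one order_refl zero_less_one \<phi>] by simp_all
    define a where "a n = (if [n = 1] (mod d) then mangoldt n else 0) - 1 / ?\<phi>" for n :: nat
    have lx: "ln x > 0" using xx by simp
    have "\<bar>\<Sum>n=2..N. a n / ln (real n)\<bar> \<le> 6 * ((1 + C1 * 2 ^ H) * E)"
    proof (rule abel_inverse_ln[OF N(2)])
      fix n assume n: "1 \<le> n" "n \<le> N"
      have E0: "0 \<le> E" using xx by linarith
      show "\<bar>\<Sum>m=1..n. a m\<bar> \<le> (1 + C1 * 2 ^ H) * E"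
      proof (cases "real n \<le> sqrt x")
        case True
        have nx: "real n \<le> x" using n N by linarith
        have "\<bar>\<Sum>m=1..n. a m\<bar> \<le> (\<Sum>m=1..n. \<bar>a m\<bar>)" by (rule sum_abs)
        also have "\<dots> \<le> (\<Sum>m=1..n. ln x + 1)"
        proof (rule sum_mono)
          fix m assume m: "m \<in> {1..n}"
          have "mangoldt m \<le> ln (real m)" using m by (intro mangoldt_le) auto
          moreover have "ln (real m) \<le> ln x" using m nx by simp
          ultimately have "0 \<le> (if [m = 1] (mod d) then mangoldt m else (0::real))" "(if [m = 1] (mod d) then mangoldt m else 0) \<le> ln x"
            using lx mangoldt_nonneg[of m] by auto
          moreover have "\<bar>u - i\<bar> \<le> w + 1" if "0 \<le> u" "u \<le> w" "0 \<le> i" "i \<le> 1" for u w i :: real using that by linarith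
          ultimately show "\<bar>a m\<bar> \<le> ln x + 1" using i\<phi> unfolding a_def by blast
        qed
        also have "\<dots> = real n * (ln x + 1)" by simp
        also have "\<dots> \<le> sqrt x * (ln x + 1)" using True lx by (intro mult_right_mono) auto
        also have "\<dots> \<le> E" by (rule xx)
        also have "\<dots> \<le> (1 + C1 * 2 ^ H) * E" using mult_right_mono[of 1 "1 + C1 * 2 ^ H" E] E0 1 by simp
        finally show ?thesis .
      next
        case False
        have n1: "real n \<ge> x1" using False xx by linarith
        have "sqrt x \<le> real n" "0 < sqrt x" using False xx by auto
        then have "ln (sqrt x) \<le> ln (real n)" by (subst ln_le_cancel_iff) linarith+
        moreover have "ln (sqrt x) = ln x / 2" using xx by (simp add: ln_sqrt)
        ultimately have ln: "ln x / 2 \<le> ln (real n)" by simp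
        have nx: "real n \<le> x" using n N by linarith
        have dn: "real d \<le> ln (real n) ^ (B + 1)"
        proof -
          have "ln x ^ B = 2 ^ B * (ln x / 2) ^ B" by (simp add: power_divide)
          also have "\<dots> \<le> ln (real n) * ln (real n) ^ B" using xx(5) ln lx by (intro mult_mono power_mono zero_le_power) linarith+
          finally show ?thesis using d by simp
        qed
        have "\<bar>\<Sum>m=1..nat \<lfloor>real n\<rfloor>. a m\<bar> \<le> C1 * (real n / ln (real n) ^ H)"
          unfolding a_def by (rule 1(3)[OF n1 d(1) dn])
        then have "\<bar>\<Sum>m=1..n. a m\<bar> \<le> C1 * (real n / ln (real n) ^ H)" by simp
        also have "\<dots> \<le> C1 * (x / (ln x / 2) ^ H)"
          using 1 nx ln lx by (intro mult_left_mono frac_le power_mono) auto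
        also have "\<dots> = C1 * 2 ^ H * E" by (simp add: E_def power_divide)
        also have "\<dots> \<le> (1 + C1 * 2 ^ H) * E" using E0 by (simp add: distrib_right)
        finally show ?thesis .
      qed
    qed
    moreover have "(\<Sum>n=2..N. a n / ln (real n)) = (\<Sum>n=2..N. (if [n = 1] (mod d) then mangoldt n else 0) / ln (real n)) - 1 / ?\<phi> * (\<Sum>n=2..N. 1 / ln (real n))"
      unfolding sum_distrib_left sum_subtractf[symmetric] by (intro sum.cong refl) (simp add: a_def diff_divide_distrib)
    moreover have "\<bar>real (pi1 x d) - (\<Sum>n=2..N. (if [n = 1] (mod d) then mangoldt n else 0) / ln (real n))\<bar> \<le> E"
      using pi1_vs_mangoldt[OF xx(6), of d] xx(2) unfolding N_def by linarith
    moreover have "\<bar>1 / ?\<phi> * (\<Sum>n=2..N. 1 / ln (real n)) - Li x / ?\<phi>\<bar> \<le> E"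
    proof -
      have "\<bar>(\<Sum>n=2..N. 1 / ln (real n)) - Li x\<bar> \<le> 4" unfolding N_def using xx by (intro Li_sum) simp
      then have "1 / ?\<phi> * \<bar>(\<Sum>n=2..N. 1 / ln (real n)) - Li x\<bar> \<le> 1 * 4" using i\<phi> by (intro mult_mono) auto
      moreover have "1 / ?\<phi> * \<bar>(\<Sum>n=2..N. 1 / ln (real n)) - Li x\<bar> = \<bar>1 / ?\<phi> * ((\<Sum>n=2..N. 1 / ln (real n)) - Li x)\<bar>"
        using i\<phi>(1) by (simp only: abs_mult abs_of_nonneg)
      moreover have "1 / ?\<phi> * ((\<Sum>n=2..N. 1 / ln (real n)) - Li x) = 1 / ?\<phi> * (\<Sum>n=2..N. 1 / ln (real n)) - Li x / ?\<phi>" by (simp add: right_diff_distrib)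
      ultimately show ?thesis using xx(3) by linarith
    qed
    ultimately have "\<bar>real (pi1 x d) - Li x / ?\<phi>\<bar> \<le> 6 * ((1 + C1 * 2 ^ H) * E) + E + E" by linarith
    then show "\<bar>real (pi1 x d) - Li x / real (totient d)\<bar> \<le> C * (x / ln x ^ H)"
      unfolding C_def E_def by (simp add: algebra_simps)
  qed
qed

section \<open>Ramanujan sums\<close>

text \<open>Expansion of the product of the factors -1 + 1 over Q.\<close>

lemma alternating_sum_Pow:
  assumes "finite Q"
  shows "(\<Sum>T\<in>Pow Q. (- 1) ^ card T) = (of_bool (Q = {}) :: 'a :: comm_ring_1)"
proof -
  have "(\<Prod>q\<in>Q. - 1 + 1) = (\<Sum>T\<in>Pow Q. (\<Prod>q\<in>T. - 1) * (\<Prod>q\<in>Q - T. 1 :: 'a))"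
    by (rule prod_add[OF assms])
  then show ?thesis using assms by (cases "Q = {}") (auto simp: power_0_left)
qed

lemma prime_power_coprime_prod:
  fixes q :: nat
  assumes "prime q" "\<And>r. r \<in> A \<Longrightarrow> prime r" "q \<notin> A"
  shows "coprime (q ^ i) (\<Prod>r\<in>A. r ^ f r)"
proof (rule prod_coprime_right)
  fix r assume "r \<in> A"
  then have "coprime q r" using assms by (intro primes_coprime) auto
  then show "coprime (q ^ i) (r ^ f r)" by simp
qed

lemma prod_prime_powers_dvd_iff:
  fixes n :: nat
  assumes "finite A" "\<And>q. q \<in> A \<Longrightarrow> prime q"
  shows "(\<Prod>q\<in>A. q ^ f q) dvd n \<longleftrightarrow> (\<forall>q\<in>A. q ^ f q dvd n)"
  using assms
proof (induction A rule: finite_induct)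
  case empty
  then show ?case by simp
next
  case (insert q A)
  have c: "coprime (q ^ f q) (\<Prod>r\<in>A. r ^ f r)" using insert by (intro prime_power_coprime_prod) auto
  have "q ^ f q * (\<Prod>r\<in>A. r ^ f r) dvd n \<longleftrightarrow> q ^ f q dvd n \<and> (\<Prod>r\<in>A. r ^ f r) dvd n"
    using divides_mult[OF _ _ c, of n] dvd_mult_left dvd_mult_right by blast
  then show ?case using insert by simp
qed

lemma prod_primes_dvd_iff:
  fixes n :: nat
  assumes "finite A" "\<And>q. q \<in> A \<Longrightarrow> prime q"
  shows "\<Prod>A dvd n \<longleftrightarrow> (\<forall>q\<in>A. q dvd n)"
proof -
  have "(\<Prod>q\<in>A. q ^ 1) dvd n \<longleftrightarrow> (\<forall>q\<in>A. q ^ 1 dvd n)" by (rule prod_prime_powers_dvd_iff[OF assms])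
  then show ?thesis unfolding power_one_right .
qed

lemma totient_prod_prime_powers:
  assumes "finite A" "\<And>q. q \<in> A \<Longrightarrow> prime q"
  shows "totient (\<Prod>q\<in>A. q ^ f q) = (\<Prod>q\<in>A. totient (q ^ f q))"
  using assms
proof (induction A rule: finite_induct)
  case (insert q A)
  have c: "coprime (q ^ f q) (\<Prod>r\<in>A. r ^ f r)" using insert by (intro prime_power_coprime_prod) auto
  show ?case using insert totient_mult_coprime[OF c] by simp
qed simp

lemma prod_primes_inj:
  "inj_on (\<lambda>T. \<Prod>T) {T. finite T \<and> (\<forall>q\<in>T. prime (q::nat))}"
proof (rule inj_onI)
  have *: "T = {q. prime q \<and> q dvd \<Prod>T}" if "finite T" "\<forall>q\<in>T. prime q" for T :: "nat set"
  proof (rule Set.set_eqI)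
    fix q
    have "q dvd \<Prod>T \<longleftrightarrow> q \<in> T" if pq: "prime q"
    proof
      assume "q dvd \<Prod>T"
      then obtain r where r: "r \<in> T" "q dvd r" using prime_dvd_prod_iff[OF \<open>finite T\<close> pq, of "\<lambda>x. x"] by auto
      then show "q \<in> T" using primes_dvd_imp_eq[of q r] \<open>prime q\<close> \<open>\<forall>q\<in>T. prime q\<close> by auto
    next
      assume "q \<in> T"
      then show "q dvd \<Prod>T" using dvd_prodI[OF \<open>finite T\<close>, of q "\<lambda>x. x"] by simp
    qed
    then show "q \<in> T \<longleftrightarrow> q \<in> {q. prime q \<and> q dvd \<Prod>T}" using that by auto
  qed
  fix T U :: "nat set"
  assume a: "T \<in> {T. finite T \<and> (\<forall>q\<in>T. prime q)}" "U \<in> {T. finite T \<and> (\<forall>q\<in>T. prime q)}" "\<Prod>T = \<Prod>U"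
  have "T = {q. prime q \<and> q dvd \<Prod>T}" using a by (intro *) auto
  also have "\<dots> = U" unfolding a(3) using a by (intro *[symmetric]) auto
  finally show "T = U" .
qed

text \<open>The sum of the k-th powers of all m-th roots of unity, by
  \<open>root_of_unity_sum\<close>.\<close>

definition dvd_weight :: "nat \<Rightarrow> nat \<Rightarrow> int" where
  "dvd_weight k m = (if m dvd k then int m else 0)"

lemma root_of_unity_sum:
  assumes "m > 0"
  shows "(\<Sum>i=1..m. exp (2 * complex_of_real pi * \<i> * of_nat i * of_nat k / of_nat m)) = of_int (dvd_weight k m)"
proof -
  define z where "z = exp (2 * complex_of_real pi * \<i> * of_nat k / of_nat m)"
  have "(\<Sum>i=1..m. exp (2 * complex_of_real pi * \<i> * of_nat i * of_nat k / of_nat m)) = (\<Sum>i=1..m. z ^ i)"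
    unfolding z_def exp_of_nat_mult[symmetric] by (intro sum.cong refl arg_cong[of _ _ exp]) simp
  also have "\<dots> = z * (\<Sum>i<m. z ^ i)"
    unfolding sum_distrib_left by (rule sum.reindex_bij_witness[of _ Suc "\<lambda>i. i - 1"]) (auto simp: power_eq_if)
  also have "\<dots> = of_int (dvd_weight k m)"
  proof (cases "m dvd k")
    case True
    then have "z = 1" unfolding z_def using complex_root_unity_eq_1[of m k] assms by simp
    then show ?thesis using True by (simp add: dvd_weight_def)
  next
    case False
    then have "z \<noteq> 1" unfolding z_def using complex_root_unity_eq_1[of m k] assms by simp
    moreover have "z ^ m = 1"
    proof -
      have "z ^ m = exp (2 * complex_of_real pi * \<i> * of_nat k)"
        unfolding z_def exp_of_nat_mult[symmetric] using assms by (intro arg_cong[of _ _ exp]) simp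
      also have "\<dots> = 1" using exp_integer_2pi[of "of_nat k"] by (simp add: mult.commute mult.left_commute)
      finally show ?thesis .
    qed
    moreover have "(z - 1) * (\<Sum>i<m. z ^ i) = z ^ m - 1" by (rule power_diff_1_eq[symmetric])
    ultimately show ?thesis using False by (simp add: dvd_weight_def)
  qed
  finally show ?thesis .
qed

lemma dvd_weight_prod:
  assumes "finite A" "\<And>q. q \<in> A \<Longrightarrow> prime q"
  shows "dvd_weight k (\<Prod>q\<in>A. q ^ f q) = (\<Prod>q\<in>A. dvd_weight k (q ^ f q))"
proof (cases "\<forall>q\<in>A. q ^ f q dvd k")
  case True
  then show ?thesis using prod_prime_powers_dvd_iff[OF assms, of f k] by (simp add: dvd_weight_def)
next
  case False
  then have "\<exists>q\<in>A. dvd_weight k (q ^ f q) = 0" by (auto simp: dvd_weight_def)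
  then have "(\<Prod>q\<in>A. dvd_weight k (q ^ f q)) = 0" using assms(1) by (simp add: prod_zero_iff)
  moreover have "\<not> (\<Prod>q\<in>A. q ^ f q) dvd k" using False prod_prime_powers_dvd_iff[OF assms, of f k] by blast
  then have "dvd_weight k (\<Prod>q\<in>A. q ^ f q) = 0" unfolding dvd_weight_def by (rule if_not_P)
  ultimately show ?thesis by simp
qed

text \<open>Inclusion-exclusion over sets T of primes dividing n removes the coprimality condition.
  Each T leaves a complete sum over the roots of unity of order n divided by
  \<open>\<Prod>T\<close>, and by multiplicativity of \<open>dvd_weight k\<close> the signed sum
  over T factors.\<close>

lemma ramanujan_sum_prod:
  assumes n: "n > 0"
  shows "ramanujan_sum n k =
    of_int (\<Prod>q\<in>prime_factors n. dvd_weight k (q ^ multiplicity q n) - dvd_weight k (q ^ (multiplicity q n - 1)))"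
proof -
  define P where "P = prime_factors n"
  have fP: "finite P" and pP: "\<And>q. q \<in> P \<Longrightarrow> prime q" unfolding P_def by auto
  define \<omega> where "\<omega> j = exp (2 * complex_of_real pi * \<i> * of_nat j * of_nat k / of_nat n)" for j :: nat
  have ind: "of_bool (coprime j n) = (\<Sum>T\<in>Pow P. (- 1) ^ card T * of_bool (\<Prod>T dvd j) :: complex)" if j: "j > 0" for j
  proof -
    define Q where "Q = {q\<in>P. q dvd j}"
    have fQ: "finite Q" unfolding Q_def using fP by simp
    have "(\<Sum>T\<in>Pow P. (- 1) ^ card T * of_bool (\<Prod>T dvd j) :: complex) = (\<Sum>T\<in>Pow Q. (- 1) ^ card T)"
    proof (rule sum.mono_neutral_cong_right)
      show "finite (Pow P)" using fP by simp
      show "Pow Q \<subseteq> Pow P" unfolding Q_def by auto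
      have dv: "\<Prod>T dvd j \<longleftrightarrow> T \<subseteq> Q" if "T \<subseteq> P" for T
        using prod_primes_dvd_iff[of T j] that finite_subset[OF that fP] pP unfolding Q_def by auto
      then show "\<forall>T\<in>Pow P - Pow Q. (- 1) ^ card T * of_bool (\<Prod>T dvd j) = (0::complex)" by auto
      show "(- 1) ^ card T * of_bool (\<Prod>T dvd j) = ((- 1) ^ card T :: complex)" if "T \<in> Pow Q" for T
        using dv[of T] that Q_def by auto
    qed
    also have "\<dots> = of_bool (Q = {})" by (rule alternating_sum_Pow[OF fQ])
    also have "Q = {} \<longleftrightarrow> coprime j n"
    proof
      assume Q: "Q = {}"
      show "coprime j n"
      proof (rule ccontr)
        assume "\<not> coprime j n"
        then have "gcd j n \<noteq> 1" by (simp only: coprime_iff_gcd_eq_1 not_False_eq_True)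
        then obtain q where q: "prime q" "q dvd gcd j n" using prime_factor_nat by blast
        then have "q dvd j" "q dvd n" by auto
        then have "q \<in> Q" using n q(1) unfolding Q_def P_def by (auto simp: prime_factors_dvd)
        then show False using Q by simp
      qed
    next
      assume c: "coprime j n"
      show "Q = {}"
      proof (rule ccontr)
        assume "Q \<noteq> {}"
        then obtain q where "prime q" "q dvd j" "q dvd n" unfolding Q_def P_def by (auto simp: prime_factors_dvd)
        then show False using c by (meson coprime_common_divisor not_prime_unit)
      qed
    qed
    finally show ?thesis by simp
  qed
  have inner: "(\<Sum>j=1..n. of_bool (\<Prod>T dvd j) * \<omega> j) =
      of_int ((\<Prod>q\<in>T. dvd_weight k (q ^ (multiplicity q n - 1))) * (\<Prod>q\<in>P - T. dvd_weight k (q ^ multiplicity q n)))" if T: "T \<subseteq> P" for T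
  proof -
    have fT: "finite T" using T fP finite_subset by blast
    define d where "d = \<Prod>T"
    \<comment> \<open>This is n divided by \<open>\<Prod>T\<close>, written through prime powers so
      that \<open>dvd_weight_prod\<close> applies.\<close>
    define m where "m = (\<Prod>q\<in>P. q ^ (if q \<in> T then multiplicity q n - 1 else multiplicity q n))"
    have d0: "d > 0" unfolding d_def using T pP by (intro prod_pos) (auto simp: prime_gt_0_nat)
    have "d = (\<Prod>q\<in>P. if q \<in> T then q else 1)"
      unfolding d_def using T by (intro prod.mono_neutral_cong_left fP) auto
    then have "d * m = (\<Prod>q\<in>P. (if q \<in> T then q else 1) * q ^ (if q \<in> T then multiplicity q n - 1 else multiplicity q n))"
      unfolding m_def by (simp add: prod.distrib)
    also have "\<dots> = (\<Prod>q\<in>P. q ^ multiplicity q n)"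
    proof (rule prod.cong[OF refl])
      fix q assume "q \<in> P"
      then have "multiplicity q n > 0" unfolding P_def by (auto simp: prime_factors_multiplicity)
      then show "(if q \<in> T then q else 1) * q ^ (if q \<in> T then multiplicity q n - 1 else multiplicity q n) = q ^ multiplicity q n"
        by (cases "multiplicity q n") auto
    qed
    also have "\<dots> = n" unfolding P_def using prime_factorization_nat[OF n] by simp
    finally have dm: "d * m = n" .
    then have m0: "m > 0" using n by (cases m) auto
    have "(\<Sum>j=1..n. of_bool (d dvd j) * \<omega> j) = (\<Sum>j\<in>{j\<in>{1..n}. d dvd j}. \<omega> j)"
      by (intro sum.mono_neutral_cong_right) auto
    also have "\<dots> = (\<Sum>i=1..m. \<omega> (d * i))"
    proof -
      have "{j\<in>{1..n}. d dvd j} = (\<lambda>i. d * i) ` {1..m}"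
      proof (rule Set.set_eqI)
        fix j
        show "j \<in> {j\<in>{1..n}. d dvd j} \<longleftrightarrow> j \<in> (\<lambda>i. d * i) ` {1..m}"
        proof
          assume j: "j \<in> {j\<in>{1..n}. d dvd j}"
          then obtain i where i: "j = d * i" by auto
          then have "d * i \<le> d * m" "i \<noteq> 0" using j dm by auto
          then have "i \<in> {1..m}" using d0 by simp
          then show "j \<in> (\<lambda>i. d * i) ` {1..m}" using i by blast
        next
          assume "j \<in> (\<lambda>i. d * i) ` {1..m}"
          then obtain i where i: "j = d * i" "i \<in> {1..m}" by blast
          then have "d * i \<le> d * m" "1 \<le> d * i" using d0 by (auto simp: Suc_le_eq)
          then show "j \<in> {j\<in>{1..n}. d dvd j}" using i(1) dm by simp
        qed
      qed
      moreover have "inj_on (\<lambda>i. d * i) {1..m}" using d0 by (intro inj_onI) simp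
      ultimately show ?thesis by (simp add: sum.reindex)
    qed
    also have "\<dots> = (\<Sum>i=1..m. exp (2 * complex_of_real pi * \<i> * of_nat i * of_nat k / of_nat m))"
    proof (intro sum.cong refl)
      fix i
      have "of_nat n = (of_nat d * of_nat m :: complex)" unfolding dm[symmetric] by simp
      then show "\<omega> (d * i) = exp (2 * complex_of_real pi * \<i> * of_nat i * of_nat k / of_nat m)"
        unfolding \<omega>_def using d0 m0 by (intro arg_cong[of _ _ exp]) (simp add: field_simps)
    qed
    also have "\<dots> = of_int (dvd_weight k m)" by (rule root_of_unity_sum[OF m0])
    also have "dvd_weight k m = (\<Prod>q\<in>P. dvd_weight k (q ^ (if q \<in> T then multiplicity q n - 1 else multiplicity q n)))"
      unfolding m_def by (rule dvd_weight_prod[OF fP pP])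
    also have "\<dots> = (\<Prod>q\<in>T. dvd_weight k (q ^ (multiplicity q n - 1))) * (\<Prod>q\<in>P - T. dvd_weight k (q ^ multiplicity q n))"
    proof -
      have "(\<Prod>q\<in>P. dvd_weight k (q ^ (if q \<in> T then multiplicity q n - 1 else multiplicity q n)))
        = (\<Prod>q\<in>T. dvd_weight k (q ^ (if q \<in> T then multiplicity q n - 1 else multiplicity q n)))
        * (\<Prod>q\<in>P - T. dvd_weight k (q ^ (if q \<in> T then multiplicity q n - 1 else multiplicity q n)))"
        by (subst prod.subset_diff[OF T fP]) (rule mult.commute)
      then show ?thesis by simp
    qed
    finally show ?thesis unfolding d_def .
  qed
  have "ramanujan_sum n k = (\<Sum>j=1..n. of_bool (coprime j n) * \<omega> j)"
    unfolding ramanujan_sum_def \<omega>_def by (intro sum.mono_neutral_cong_left) auto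
  also have "\<dots> = (\<Sum>j=1..n. \<Sum>T\<in>Pow P. (- 1) ^ card T * (of_bool (\<Prod>T dvd j) * \<omega> j))"
  proof (rule sum.cong[OF refl])
    fix j assume "j \<in> {1..n}"
    then have "j > 0" by simp
    show "of_bool (coprime j n) * \<omega> j = (\<Sum>T\<in>Pow P. (- 1) ^ card T * (of_bool (\<Prod>T dvd j) * \<omega> j))"
      unfolding ind[OF \<open>j > 0\<close>] sum_distrib_right by (simp only: mult.assoc)
  qed
  also have "\<dots> = (\<Sum>T\<in>Pow P. (- 1) ^ card T * (\<Sum>j=1..n. of_bool (\<Prod>T dvd j) * \<omega> j))"
    unfolding sum_distrib_left by (rule sum.swap)
  also have "\<dots> = (\<Sum>T\<in>Pow P. of_int ((\<Prod>q\<in>T. - dvd_weight k (q ^ (multiplicity q n - 1))) * (\<Prod>q\<in>P - T. dvd_weight k (q ^ multiplicity q n))))"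
  proof (rule sum.cong[OF refl])
    fix T assume T: "T \<in> Pow P"
    have "(\<Prod>q\<in>T. - dvd_weight k (q ^ (multiplicity q n - 1))) = (- 1) ^ card T * (\<Prod>q\<in>T. dvd_weight k (q ^ (multiplicity q n - 1)))"
      by (simp add: prod_uminus)
    then show "(- 1) ^ card T * (\<Sum>j=1..n. of_bool (\<Prod>T dvd j) * \<omega> j) = of_int ((\<Prod>q\<in>T. - dvd_weight k (q ^ (multiplicity q n - 1))) * (\<Prod>q\<in>P - T. dvd_weight k (q ^ multiplicity q n)))"
      using inner[of T] T by simp
  qed
  also have "\<dots> = of_int (\<Prod>q\<in>P. - dvd_weight k (q ^ (multiplicity q n - 1)) + dvd_weight k (q ^ multiplicity q n))"
    unfolding prod_add[OF fP] by simp
  finally show ?thesis unfolding P_def by (simp add: add.commute)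
qed

text \<open>The Ramanujan sum c_n(k) at n = q^a. The case a = 0 is separate because
  \<open>a - 1\<close> truncates.\<close>

definition local_value :: "nat \<Rightarrow> nat \<Rightarrow> nat \<Rightarrow> int" where
  "local_value k q a = (if a = 0 then 1 else dvd_weight k (q ^ a) - dvd_weight k (q ^ (a - 1)))"

text \<open>Since i < q^i, no power of q with exponent above k divides k. This leaves finitely many
  relevant tuples of exponents.\<close>

lemma local_value_eq_0:
  assumes "k > 0" "prime q" "a > k + 1"
  shows "local_value k q a = 0"
proof -
  have "\<not> q ^ i dvd k" if "i > k" for i
  proof
    assume "q ^ i dvd k"
    then have "q ^ i \<le> k" using assms(1) by (rule dvd_imp_le)
    moreover have "i < q ^ i" using prime_gt_1_nat[OF assms(2)] by (intro power_gt_expt) simp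
    ultimately show False using that by linarith
  qed
  then show ?thesis using assms(3) by (simp add: local_value_def dvd_weight_def)
qed

text \<open>At primes not dividing k the local value is 1, -1 and 0 for a = 0, a = 1 and a >= 2,
  which are the factors of \<open>mu_S\<close>.\<close>

lemma ramanujan_sum_eq_mu_S:
  assumes k: "k > 0" and n: "n > 0"
  defines "S \<equiv> prime_factors k"
  shows "ramanujan_sum n k = of_int (mu_S S n * (\<Prod>q\<in>S. local_value k q (multiplicity q n)))"
proof -
  define P where "P = prime_factors n"
  let ?f = "\<lambda>q. local_value k q (multiplicity q n)"
  have fP: "finite P" and fS: "finite S" unfolding P_def S_def by auto
  have mP: "multiplicity q n > 0" if "q \<in> P" for q using that unfolding P_def by (auto simp: prime_factors_multiplicity)
  have "(\<Prod>q\<in>P. dvd_weight k (q ^ multiplicity q n) - dvd_weight k (q ^ (multiplicity q n - 1))) = (\<Prod>q\<in>P. ?f q)"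
    by (intro prod.cong refl) (use mP in \<open>auto simp: local_value_def\<close>)
  also have "\<dots> = (\<Prod>q\<in>P - S. ?f q) * (\<Prod>q\<in>P \<inter> S. ?f q)"
    using prod.union_disjoint[of "P - S" "P \<inter> S" ?f] fP by (simp add: Un_Diff_Int Diff_disjoint Int_commute disjoint_iff)
  also have "(\<Prod>q\<in>P \<inter> S. ?f q) = (\<Prod>q\<in>S. ?f q)"
  proof (rule prod.mono_neutral_left[OF fS])
    show "\<forall>q\<in>S - P \<inter> S. ?f q = 1"
    proof
      fix q assume q: "q \<in> S - P \<inter> S"
      then have "\<not> q dvd n" using n unfolding P_def S_def by (auto simp: prime_factors_dvd)
      then show "?f q = 1" by (simp add: local_value_def not_dvd_imp_multiplicity_0)
    qed
  qed simp
  also have "(\<Prod>q\<in>P - S. ?f q) = mu_S S n"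
  proof -
    have PS: "P - S = {q. prime q \<and> q dvd n \<and> q \<notin> S}" unfolding P_def using n by (auto simp: prime_factors_dvd)
    have nd: "\<not> q ^ i dvd k" if "q \<in> P - S" "i > 0" for q i
    proof
      assume "q ^ i dvd k"
      then have "q dvd k" using dvd_power[of i q] that(2) dvd_trans by blast
      then show False using that(1) k unfolding S_def P_def by (auto simp: prime_factors_dvd)
    qed
    have lv: "?f q = (if multiplicity q n = 1 then - 1 else 0)" if q: "q \<in> P - S" for q
      using mP[of q] q nd[OF q] by (auto simp: local_value_def dvd_weight_def)
    have sq: "q ^ 2 dvd n \<longleftrightarrow> multiplicity q n \<noteq> 1" if q: "q \<in> P" for q
    proof -
      have "prime q" using q unfolding P_def by auto
      then have "q ^ 2 dvd n \<longleftrightarrow> 2 \<le> multiplicity q n" using n by (subst power_dvd_iff_le_multiplicity) auto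
      then show ?thesis using mP[OF q] by auto
    qed
    show ?thesis
    proof (cases "S_squarefree S n")
      case True
      then have "multiplicity q n = 1" if "q \<in> P - S" for q
        using sq[of q] that unfolding S_squarefree_def P_def by auto
      then have "(\<Prod>q\<in>P - S. ?f q) = (\<Prod>q\<in>P - S. - 1)" using lv by (intro prod.cong) auto
      then show ?thesis using True PS by (simp add: mu_S_def)
    next
      case False
      then obtain q where q: "prime q" "q \<notin> S" "q ^ 2 dvd n" unfolding S_squarefree_def by auto
      then have "q dvd n" using dvd_trans[of q "q ^ 2" n] by simp
      then have "q \<in> P - S" unfolding PS using q by simp
      then have "?f q = 0" using lv[of q] sq[of q] q by simp
      then have "(\<Prod>q\<in>P - S. ?f q) = 0" using \<open>q \<in> P - S\<close> fP by (auto simp: prod_zero_iff)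
      then show ?thesis using False by (simp add: mu_S_def)
    qed
  qed
  finally show ?thesis using ramanujan_sum_prod[OF n, of k] unfolding P_def by simp
qed

section \<open>The sieve for a prescribed tuple of valuations\<close>

definition valuation_good :: "nat set \<Rightarrow> (nat \<Rightarrow> nat) \<Rightarrow> nat \<Rightarrow> bool" where
  "valuation_good S e n \<longleftrightarrow> S_squarefree S n \<and> (\<forall>q\<in>S. multiplicity q n = e q)"

text \<open>The exponent of the forbidden power of q: one more than prescribed inside S, a square
  outside.\<close>

definition sieve_exp :: "nat set \<Rightarrow> (nat \<Rightarrow> nat) \<Rightarrow> nat \<Rightarrow> nat" where
  "sieve_exp S e q = (if q \<in> S then Suc (e q) else 2)"

text \<open>The modulus attached to T in the inclusion-exclusion: the prescribed power at the primes
  of S outside T, the forbidden power at the primes of T.\<close>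

definition sieve_mod :: "nat set \<Rightarrow> (nat \<Rightarrow> nat) \<Rightarrow> nat set \<Rightarrow> nat" where
  "sieve_mod S e T = (\<Prod>q\<in>S \<union> T. q ^ (if q \<in> T then sieve_exp S e q else e q))"

text \<open>Inclusion-exclusion over the primes whose forbidden power divides n; U only has to
  contain all prime factors of n.\<close>

lemma valuation_good_sum:
  assumes S: "finite S" "\<And>q. q \<in> S \<Longrightarrow> prime q" and U: "finite U" "\<And>q. q \<in> U \<Longrightarrow> prime q"
    and n: "n > 0" "\<And>q. prime q \<Longrightarrow> q dvd n \<Longrightarrow> q \<in> U"
  shows "of_bool (valuation_good S e n) = (\<Sum>T\<in>Pow U. (- 1) ^ card T * of_bool (sieve_mod S e T dvd n) :: real)"
proof -
  define Q where "Q = {q\<in>U. q ^ sieve_exp S e q dvd n}"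
  define base where "base \<longleftrightarrow> (\<forall>q\<in>S. q ^ e q dvd n)"
  have fQ: "finite Q" unfolding Q_def using U by simp
  have dv: "sieve_mod S e T dvd n \<longleftrightarrow> base \<and> T \<subseteq> Q" if T: "T \<subseteq> U" for T
  proof -
    have "sieve_mod S e T dvd n \<longleftrightarrow> (\<forall>q\<in>S \<union> T. q ^ (if q \<in> T then sieve_exp S e q else e q) dvd n)"
      unfolding sieve_mod_def using S U T finite_subset[OF T U(1)] by (intro prod_prime_powers_dvd_iff) auto
    moreover have "q ^ e q dvd n" if "q \<in> S" "q ^ sieve_exp S e q dvd n" for q
      using that dvd_mult_right[of q "q ^ e q" n] by (simp add: sieve_exp_def)
    ultimately show ?thesis unfolding base_def Q_def using T by auto
  qed
  have "(\<Sum>T\<in>Pow U. (- 1) ^ card T * of_bool (sieve_mod S e T dvd n) :: real) = of_bool base * (\<Sum>T\<in>Pow Q. (- 1) ^ card T)"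
  proof -
    have "(\<Sum>T\<in>Pow U. (- 1) ^ card T * of_bool (sieve_mod S e T dvd n) :: real) = (\<Sum>T\<in>Pow Q. of_bool base * (- 1) ^ card T)"
    proof (rule sum.mono_neutral_cong_right)
      show "finite (Pow U)" using U by simp
      show "Pow Q \<subseteq> Pow U" unfolding Q_def by auto
      show "\<forall>T\<in>Pow U - Pow Q. (- 1) ^ card T * of_bool (sieve_mod S e T dvd n) = (0::real)" using dv by auto
      show "(- 1) ^ card T * of_bool (sieve_mod S e T dvd n) = (of_bool base * (- 1) ^ card T :: real)" if "T \<in> Pow Q" for T
        using dv[of T] that Q_def by auto
    qed
    then show ?thesis by (simp add: sum_distrib_left)
  qed
  also have "\<dots> = of_bool (base \<and> Q = {})" unfolding alternating_sum_Pow[OF fQ] by simp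
  also have "base \<and> Q = {} \<longleftrightarrow> valuation_good S e n"
  proof -
    have pw: "q ^ i dvd n \<longleftrightarrow> i \<le> multiplicity q n" if "prime q" for q i
      using that n by (intro power_dvd_iff_le_multiplicity) auto
    have b: "base \<longleftrightarrow> (\<forall>q\<in>S. e q \<le> multiplicity q n)" unfolding base_def using pw S by auto
    have "Q = {} \<longleftrightarrow> (\<forall>q. prime q \<longrightarrow> \<not> q ^ sieve_exp S e q dvd n)"
    proof
      assume Q: "Q = {}"
      show "\<forall>q. prime q \<longrightarrow> \<not> q ^ sieve_exp S e q dvd n"
      proof (intro allI impI notI)
        fix q assume q: "prime q" "q ^ sieve_exp S e q dvd n"
        have "sieve_exp S e q > 0" by (simp add: sieve_exp_def)
        then have "q dvd n" using q(2) dvd_power dvd_trans by blast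
        then show False using Q q n(2) unfolding Q_def by auto
      qed
    qed (use U in \<open>auto simp: Q_def\<close>)
    also have "\<dots> \<longleftrightarrow> S_squarefree S n \<and> (\<forall>q\<in>S. \<not> Suc (e q) \<le> multiplicity q n)"
      unfolding S_squarefree_def sieve_exp_def using pw S(2) by (auto split: if_splits)
    finally show ?thesis unfolding valuation_good_def b by (auto simp: le_antisym not_less_eq_eq)
  qed
  finally show ?thesis by simp
qed

lemma prod_restrict_Un:
  assumes "finite S" "finite T"
  shows "(\<Prod>q\<in>S \<union> T. if q \<in> S then g q else 1) = (\<Prod>q\<in>S. g q :: nat)"
    "(\<Prod>q\<in>S \<union> T. if q \<in> T then g q else 1) = (\<Prod>q\<in>T. g q :: nat)"
proof -
  show "(\<Prod>q\<in>S \<union> T. if q \<in> S then g q else 1) = (\<Prod>q\<in>S. g q)"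
    by (rule prod.mono_neutral_cong_right) (use assms in simp_all)
  show "(\<Prod>q\<in>S \<union> T. if q \<in> T then g q else 1) = (\<Prod>q\<in>T. g q)"
    by (rule prod.mono_neutral_cong_right) (use assms in simp_all)
qed

text \<open>Up to the constant K, which depends on S and e only, the modulus is the square of the
  squarefree number \<open>\<Prod>T\<close>; all later estimates are in terms of the latter.\<close>

lemma sieve_mod_bounds:
  fixes e :: "nat \<Rightarrow> nat"
  assumes S: "finite S" "\<And>q. q \<in> S \<Longrightarrow> prime q" and T: "finite T" "\<And>q. q \<in> T \<Longrightarrow> prime q"
  defines "K \<equiv> \<Prod>q\<in>S. q ^ (e q + 2)"
  shows "sieve_mod S e T \<le> K * (\<Prod>T) ^ 2" "(\<Prod>T) ^ 2 \<le> K * sieve_mod S e T" "sieve_mod S e T > 0" "K > 0" "\<Prod>T > 0"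
proof -
  let ?f = "\<lambda>q. q ^ (if q \<in> T then sieve_exp S e q else e q)"
  have p: "q \<ge> 1" if "q \<in> S \<union> T" for q using that S T prime_ge_1_nat by auto
  have K: "K = (\<Prod>q\<in>S \<union> T. if q \<in> S then q ^ (e q + 2) else 1)" unfolding K_def by (rule prod_restrict_Un(1)[OF S(1) T(1), symmetric])
  have T2: "(\<Prod>T) ^ 2 = (\<Prod>q\<in>S \<union> T. if q \<in> T then q ^ 2 else 1)" unfolding prod_restrict_Un(2)[OF S(1) T(1)] by (simp add: prod_power_distrib)
  show "sieve_mod S e T \<le> K * (\<Prod>T) ^ 2"
    unfolding sieve_mod_def K T2 prod.distrib[symmetric]
  proof (rule prod_mono)
    fix q assume q: "q \<in> S \<union> T"
    have "q ^ Suc (e q) \<le> q ^ (e q + 2)" "q ^ e q \<le> q ^ (e q + 2)" "1 \<le> q ^ 2" "1 \<le> q ^ (e q + 2)"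
      using p[OF q] by (auto intro!: power_increasing)
    moreover have "q ^ (e q + 2) \<le> q ^ (e q + 2) * q ^ 2" using \<open>1 \<le> q ^ 2\<close> by simp
    ultimately show "0 \<le> ?f q \<and> ?f q \<le> (if q \<in> S then q ^ (e q + 2) else 1) * (if q \<in> T then q ^ 2 else 1)"
      using q unfolding sieve_exp_def by (auto simp del: power_Suc intro: order_trans)
  qed
  show "(\<Prod>T) ^ 2 \<le> K * sieve_mod S e T"
    unfolding sieve_mod_def K T2 prod.distrib[symmetric]
  proof (rule prod_mono)
    fix q assume q: "q \<in> S \<union> T"
    have "q ^ 2 \<le> q ^ (e q + 2)" using p[OF q] by (intro power_increasing) auto
    moreover have "1 \<le> ?f q" using p[OF q] by simp
    ultimately have a: "q ^ 2 * 1 \<le> q ^ (e q + 2) * ?f q" by (intro mult_mono) auto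
    have b: "1 \<le> q ^ (e q + 2) * ?f q" using p[OF q] by simp
    show "0 \<le> (if q \<in> T then q ^ 2 else 1) \<and> (if q \<in> T then q ^ 2 else 1) \<le> (if q \<in> S then q ^ (e q + 2) else 1) * ?f q"
    proof (cases "q \<in> S")
      case True
      then show ?thesis using a b by (simp only: if_True) auto
    next
      case False
      then show ?thesis using q by (auto simp: sieve_exp_def)
    qed
  qed
  show "sieve_mod S e T > 0" unfolding sieve_mod_def using p by (intro prod_pos) (auto simp: Suc_le_eq)
  show "K > 0" unfolding K_def using p by (intro prod_pos) (auto simp: Suc_le_eq)
  show "\<Prod>T > 0" using p by (intro prod_pos) (auto simp: Suc_le_eq)
qed

text \<open>Rational-valued, so that the rationality of the constants in the theorem is ensured by
  their type.\<close>

definition artin_factor :: "nat \<Rightarrow> rat" where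
  "artin_factor q = 1 - 1 / (of_nat q * (of_nat q - 1))"

text \<open>The bracket is the density of the primes p for which q divides p - 1 exactly a times.
  Dividing by the Artin factor exchanges the factor at q in Artin's product.\<close>

definition local_ratio :: "nat \<Rightarrow> nat \<Rightarrow> rat" where
  "local_ratio q a = (1 / of_nat (totient (q ^ a)) - 1 / of_nat (totient (q ^ Suc a))) / artin_factor q"

lemma artin_factor_pos: "prime q \<Longrightarrow> artin_factor q > 0"
proof -
  assume "prime q"
  then have "of_nat q \<ge> (2::rat)" using prime_ge_2_nat[of q] by (metis of_nat_le_iff of_nat_numeral)
  then have "of_nat q * (of_nat q - 1) \<ge> 2 * (1::rat)" by (intro mult_mono) auto
  then show ?thesis unfolding artin_factor_def by (simp add: divide_less_eq_1)
qed

text \<open>totient is multiplicative over the prime powers in \<open>sieve_mod\<close>, so the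
  signed sum over T factors. A prime outside S yields its Artin factor, a prime of S the density of
  its prescribed exponent.\<close>

lemma sieve_euler_product:
  assumes S: "finite S" and P: "finite P" "\<And>q. q \<in> P \<Longrightarrow> prime q" "S \<subseteq> P"
  shows "(\<Sum>T\<in>Pow P. (- 1) ^ card T / real (totient (sieve_mod S e T)))
    = real_of_rat (\<Prod>q\<in>S. local_ratio q (e q)) * (\<Prod>q\<in>P. real_of_rat (artin_factor q))"
proof -
  let ?a = "\<lambda>q. if q \<in> S then e q else 0"
  have summand: "(- 1) ^ card T / real (totient (sieve_mod S e T))
      = (\<Prod>q\<in>T. - (1 / real (totient (q ^ sieve_exp S e q)))) * (\<Prod>q\<in>P - T. 1 / real (totient (q ^ ?a q)))" if T: "T \<in> Pow P" for T
  proof -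
    have TP: "T \<subseteq> P" "finite T" using T P finite_subset by auto
    have "sieve_mod S e T = (\<Prod>q\<in>P. q ^ (if q \<in> T then sieve_exp S e q else ?a q))"
      unfolding sieve_mod_def using TP P by (intro prod.mono_neutral_cong_left) auto
    then have "totient (sieve_mod S e T) = (\<Prod>q\<in>P. totient (q ^ (if q \<in> T then sieve_exp S e q else ?a q)))"
      using totient_prod_prime_powers[OF P(1,2)] by simp
    also have "\<dots> = (\<Prod>q\<in>T. totient (q ^ (if q \<in> T then sieve_exp S e q else ?a q))) * (\<Prod>q\<in>P - T. totient (q ^ (if q \<in> T then sieve_exp S e q else ?a q)))"
      by (subst prod.subset_diff[OF TP(1) P(1)]) (rule mult.commute)
    also have "\<dots> = (\<Prod>q\<in>T. totient (q ^ sieve_exp S e q)) * (\<Prod>q\<in>P - T. totient (q ^ ?a q))"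
      by (intro arg_cong2[of _ _ _ _ "(*)"] prod.cong) auto
    finally have "real (totient (sieve_mod S e T)) = (\<Prod>q\<in>T. real (totient (q ^ sieve_exp S e q))) * (\<Prod>q\<in>P - T. real (totient (q ^ ?a q)))"
      by simp
    then show ?thesis by (simp add: prod_uminus prod_dividef del: if_image_distrib)
  qed
  have "(\<Sum>T\<in>Pow P. (- 1) ^ card T / real (totient (sieve_mod S e T)))
     = (\<Sum>T\<in>Pow P. (\<Prod>q\<in>T. - (1 / real (totient (q ^ sieve_exp S e q)))) * (\<Prod>q\<in>P - T. 1 / real (totient (q ^ ?a q))))"
    by (rule sum.cong[OF refl summand])
  also have "\<dots> = (\<Prod>q\<in>P. - (1 / real (totient (q ^ sieve_exp S e q))) + 1 / real (totient (q ^ ?a q)))"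
    by (rule prod_add[OF P(1), symmetric])
  also have "\<dots> = (\<Prod>q\<in>P. (if q \<in> S then real_of_rat (local_ratio q (e q)) else 1) * real_of_rat (artin_factor q))"
  proof (rule prod.cong[OF refl])
    fix q assume q: "q \<in> P"
    show "- (1 / real (totient (q ^ sieve_exp S e q))) + 1 / real (totient (q ^ ?a q))
        = (if q \<in> S then real_of_rat (local_ratio q (e q)) else 1) * real_of_rat (artin_factor q)"
    proof (cases "q \<in> S")
      case True
      have "local_ratio q (e q) * artin_factor q = 1 / of_nat (totient (q ^ e q)) - 1 / of_nat (totient (q ^ Suc (e q)))"
        unfolding local_ratio_def using artin_factor_pos[OF P(2)[OF q]] by simp
      then have "real_of_rat (local_ratio q (e q)) * real_of_rat (artin_factor q) = real_of_rat (1 / of_nat (totient (q ^ e q)) - 1 / of_nat (totient (q ^ Suc (e q))))"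
        unfolding of_rat_mult[symmetric] by simp
      also have "\<dots> = 1 / real (totient (q ^ e q)) - 1 / real (totient (q ^ Suc (e q)))" by (simp only: of_rat_diff of_rat_divide of_rat_1 of_rat_of_nat_eq)
      finally show ?thesis using True by (simp only: if_True sieve_exp_def)
    next
      case False
      have "totient (q ^ 2) = q * (q - 1)" using P(2)[OF q] by (simp add: totient_power totient_prime)
      moreover have "real (q - 1) = real q - 1" using prime_ge_1_nat[OF P(2)[OF q]] by simp
      ultimately have "real (totient (q ^ 2)) = real q * (real q - 1)" by simp
      then show ?thesis using False by (simp add: sieve_exp_def artin_factor_def of_rat_diff of_rat_divide of_rat_mult)
    qed
  qed
  also have "\<dots> = (\<Prod>q\<in>P. if q \<in> S then real_of_rat (local_ratio q (e q)) else 1) * (\<Prod>q\<in>P. real_of_rat (artin_factor q))"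
    by (rule prod.distrib)
  also have "(\<Prod>q\<in>P. if q \<in> S then real_of_rat (local_ratio q (e q)) else 1) = (\<Prod>q\<in>S. real_of_rat (local_ratio q (e q)))"
    using P by (intro prod.mono_neutral_cong_right) auto
  also have "\<dots> = real_of_rat (\<Prod>q\<in>S. local_ratio q (e q))" by (simp add: of_rat_prod)
  finally show ?thesis .
qed

section \<open>Truncation of the sieve and the singular series\<close>

lemma pi1_le:
  assumes "x \<ge> 0" "D > 0"
  shows "real (pi1 x D) \<le> x / real D"
proof -
  let ?A = "{p. prime p \<and> real p \<le> x \<and> D dvd p - 1}"
  have p: "0 < (p - 1) div D \<and> real ((p - 1) div D) \<le> x / real D \<and> p = (p - 1) div D * D + 1" if "p \<in> ?A" for p
  proof -
    have p1: "p > 1" "real p \<le> x" "D dvd p - 1" using that prime_gt_1_nat by auto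
    then obtain m where m: "p - 1 = D * m" by auto
    then have "(p - 1) div D = m" using assms by simp
    moreover have "m > 0" using m p1 by (cases m) auto
    moreover have "real m * real D \<le> x"
    proof -
      have "m * D \<le> p" using m by (simp add: mult.commute)
      then have "real (m * D) \<le> real p" by (rule of_nat_mono)
      then show ?thesis using p1 by simp
    qed
    then have "real m \<le> x / real D" using assms by (simp add: pos_le_divide_eq)
    moreover have "p = m * D + 1" using m p1 by (simp add: mult.commute)
    ultimately show ?thesis by simp
  qed
  have "inj_on (\<lambda>p. (p - 1) div D) ?A" by (rule inj_onI) (use p in metis)
  then have "card ?A = card ((\<lambda>p. (p - 1) div D) ` ?A)" by (rule card_image[symmetric])
  also have "\<dots> \<le> card {1..nat \<lfloor>x / real D\<rfloor>}"
  proof (rule card_mono)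
    show "(\<lambda>p. (p - 1) div D) ` ?A \<subseteq> {1..nat \<lfloor>x / real D\<rfloor>}"
    proof
      fix m assume "m \<in> (\<lambda>p. (p - 1) div D) ` ?A"
      then obtain r where "r \<in> ?A" "m = (r - 1) div D" by blast
      then have "0 < m" "real m \<le> x / real D" using p[of r] by auto
      then show "m \<in> {1..nat \<lfloor>x / real D\<rfloor>}" by (simp add: le_nat_iff le_floor_iff Suc_le_eq)
    qed
  qed simp
  finally have "real (card ?A) \<le> real (nat \<lfloor>x / real D\<rfloor>)" by simp
  also have "\<dots> \<le> x / real D" using assms by simp
  finally show ?thesis unfolding pi1_def .
qed

lemma Li_lower: "4 \<le> x \<Longrightarrow> x / (2 * ln x) \<le> Li x"
proof -
  assume x: "4 \<le> x"
  have "x / 2 * (1 / ln x) \<le> (x - 2) * (1 / ln x)" using x inv_ln_antimono(2)[of 2 x] by (intro mult_right_mono) auto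
  also have "\<dots> \<le> Li x" using Li_step(2)[of 2 x] x Li_2 by simp
  finally show ?thesis by simp
qed

text \<open>Comparing the prime number theorem modulo \<open>D\<close> at \<open>x = exp (D powr (1/4))\<close> with the trivial bound
  \<open>x / D\<close> for the number of these primes forces \<open>totient D\<close> to be large.\<close>

lemma totient_lower_bound:
  "\<exists>C>0. \<forall>D>0. 1 / real (totient D) \<le> C / (sqrt (real D) * sqrt (sqrt (real D)))"
proof -
  obtain C x0 where C: "C > 0" "\<And>x d. x \<ge> x0 \<Longrightarrow> d > 0 \<Longrightarrow> real d \<le> ln x ^ 4 \<Longrightarrow>
      \<bar>real (pi1 x d) - Li x / real (totient d)\<bar> \<le> C * (x / ln x ^ 4)" using primes_1_mod[of 4 4] by blast
  define t0 where "t0 = max 2 (ln (max x0 4))"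
  define C' where "C' = 2 * (1 + C) + t0 ^ 3"
  show ?thesis
  proof (rule exI[of _ C'], intro conjI allI impI)
    have t0: "t0 \<ge> 2" unfolding t0_def by simp
    then show "C' > 0" unfolding C'_def using C by (intro add_pos_nonneg) auto
    fix D :: nat assume D: "D > 0"
    define t where "t = sqrt (sqrt (real D))"
    have t: "t > 0" unfolding t_def using D by simp
    have t2: "t ^ 2 = sqrt (real D)" unfolding t_def by simp
    have t4: "t ^ 4 = real D"
    proof -
      have "t ^ 4 = (t ^ 2) ^ 2" by (simp flip: power_mult)
      then show ?thesis unfolding t2 by simp
    qed
    have den: "sqrt (real D) * sqrt (sqrt (real D)) = t ^ 3"
    proof -
      have "sqrt (real D) * sqrt (sqrt (real D)) = t ^ 2 * t" unfolding t2 unfolding t_def ..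
      then show ?thesis by (simp add: power2_eq_square power3_eq_cube)
    qed
    have \<phi>: "real (totient D) \<ge> 1" using D by (simp add: Suc_le_eq)
    have "1 / real (totient D) \<le> C' / t ^ 3"
    proof (cases "t \<ge> t0")
      case True
      \<comment> \<open>With ln x = t = D^(1/4) the modulus D equals ln x ^ 4, the end of the
        admissible range. The trivial bound and the error term are both O(x/t^4), while Li x >= x/(2
        t); so totient D is at least of order t^3.\<close>
      define x where "x = exp t"
      have lx: "ln x = t" unfolding x_def by simp
      have "exp (ln (max x0 4)) \<le> exp t" using True unfolding t0_def by (intro exp_le_cancel_iff[THEN iffD2]) simp
      then have x: "x \<ge> x0" "x \<ge> 4" unfolding x_def by auto
      have "Li x / real (totient D) \<le> real (pi1 x D) + C * (x / t ^ 4)"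
        using C(2)[OF x(1) D] unfolding lx t4 by (simp add: abs_le_iff)
      also have "real (pi1 x D) \<le> x / t ^ 4" unfolding t4 using x D by (intro pi1_le) auto
      finally have up: "Li x / real (totient D) \<le> (1 + C) * (x / t ^ 4)" by (simp only: distrib_right mult_1)
      have "x / (2 * t) * (1 / real (totient D)) \<le> Li x * (1 / real (totient D))"
        using Li_lower[OF x(2)] unfolding lx by (intro mult_right_mono) auto
      also have "\<dots> \<le> (1 + C) * (x / t ^ 4)" using up by simp
      also have "\<dots> = x / (2 * t) * (2 * (1 + C) / t ^ 3)" using t by (simp add: field_simps power_eq_if)
      finally have "1 / real (totient D) \<le> 2 * (1 + C) / t ^ 3"
        by (rule mult_left_le_imp_le) (use x t in simp)
      also have "\<dots> \<le> C' / t ^ 3" unfolding C'_def using t t0 by (intro divide_right_mono) auto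
      finally show ?thesis .
    next
      case False
      have "1 / real (totient D) \<le> 1 / 1" using \<phi> by (intro frac_le) auto
      also have "\<dots> = t ^ 3 / t ^ 3" using t by simp
      also have "\<dots> \<le> C' / t ^ 3"
      proof (rule divide_right_mono)
        have "t ^ 3 \<le> t0 ^ 3" using False t by (intro power_mono) auto
        then show "t ^ 3 \<le> C'" unfolding C'_def using C(1) by simp
      qed (use t in simp)
      finally show ?thesis .
    qed
    then show "1 / real (totient D) \<le> C' / (sqrt (real D) * sqrt (sqrt (real D)))" unfolding den .
  qed
qed

text \<open>The term at n + 1 is at most the drop of 2/sqrt n from n to n + 1, and these drops
  telescope.\<close>

lemma inverse_three_halves_tail:
  assumes Y: "Y \<ge> 1" and F: "finite F" "\<And>d. d \<in> F \<Longrightarrow> d > Y"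
  shows "(\<Sum>d\<in>F. 1 / (real d * sqrt (real d))) \<le> 2 / sqrt (real Y)"
proof -
  have step: "1 / (real (Suc n) * sqrt (real (Suc n))) \<le> 2 / sqrt (real n) - 2 / sqrt (real (Suc n))" if n: "n \<ge> 1" for n
  proof -
    define a b where "a = sqrt (real n)" and "b = sqrt (real (Suc n))"
    have ab: "0 < a" "a \<le> b" "b ^ 2 = a ^ 2 + 1" "real (Suc n) = b ^ 2" using n unfolding a_def b_def by auto
    have "(b - a) * (b + a) = 1" using ab(3) by (simp add: algebra_simps power2_eq_square)
    moreover have "(b - a) * (b + a) \<le> (b - a) * (2 * b)" using ab by (intro mult_left_mono) auto
    ultimately have h: "1 \<le> 2 * b * (b - a)" by (simp add: mult_ac)
    have "a * 1 \<le> b * (2 * b * (b - a))" using ab h by (intro mult_mono) auto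
    then have "a / (a * (b ^ 2 * b)) \<le> b * (2 * b * (b - a)) / (a * (b ^ 2 * b))" using ab by (intro divide_right_mono) auto
    moreover have b0: "0 < b" using ab by linarith
    have "a / (a * (b ^ 2 * b)) = 1 / (b ^ 2 * b)" "b * (2 * b * (b - a)) / (a * (b ^ 2 * b)) = 2 / a - 2 / b"
      using ab(1) b0 by (simp_all add: field_simps power2_eq_square)
    ultimately have "1 / (b ^ 2 * b) \<le> 2 / a - 2 / b" by simp
    then show ?thesis unfolding ab(4)[symmetric] a_def[symmetric] b_def[symmetric] .
  qed
  have tel: "(\<Sum>d=Suc Y..M. 1 / (real d * sqrt (real d))) \<le> 2 / sqrt (real Y) - 2 / sqrt (real M)" if "M \<ge> Y" for M
    using that
  proof (induction M rule: dec_induct)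
    case (step M)
    have "(\<Sum>d=Suc Y..Suc M. 1 / (real d * sqrt (real d))) = (\<Sum>d=Suc Y..M. 1 / (real d * sqrt (real d))) + 1 / (real (Suc M) * sqrt (real (Suc M)))"
      using step.hyps by (intro sum.cl_ivl_Suc[THEN trans]) auto
    moreover have "1 / (real (Suc M) * sqrt (real (Suc M))) \<le> 2 / sqrt (real M) - 2 / sqrt (real (Suc M))" using step.hyps Y by (intro \<open>\<And>n. n \<ge> 1 \<Longrightarrow> _ n \<le> _ n\<close>) auto
    ultimately show ?case using step.IH by simp
  qed simp
  define M where "M = Max (insert Y F)"
  have M: "M \<ge> Y" "F \<subseteq> {Suc Y..M}" unfolding M_def using F by (auto simp: Suc_le_eq)
  have "(\<Sum>d\<in>F. 1 / (real d * sqrt (real d))) \<le> (\<Sum>d=Suc Y..M. 1 / (real d * sqrt (real d)))"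
    using M by (intro sum_mono2) auto
  also have "\<dots> \<le> 2 / sqrt (real Y) - 2 / sqrt (real M)" by (rule tel[OF M(1)])
  also have "\<dots> \<le> 2 / sqrt (real Y)" by simp
  finally show ?thesis .
qed

text \<open>Sets of primes stand for squarefree numbers through the injective map T ->
  \<open>\<Prod>T\<close>; the sign \<open>(- 1) ^ card T\<close> is then the Moebius
  function.\<close>

definition prime_sets :: "nat set set" where
  "prime_sets = {T. finite T \<and> (\<forall>q\<in>T. prime q)}"

definition small_prime_sets :: "nat \<Rightarrow> nat set set" where
  "small_prime_sets Y = {T \<in> prime_sets. \<Prod>T \<le> Y}"

lemma prime_sets_elem_le_prod: "T \<in> prime_sets \<Longrightarrow> q \<in> T \<Longrightarrow> q \<le> \<Prod>T"
proof -
  assume T: "T \<in> prime_sets" "q \<in> T"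
  then have "\<Prod>T > 0" unfolding prime_sets_def by (intro prod_pos) (auto simp: prime_gt_0_nat)
  moreover have "q dvd \<Prod>T" using dvd_prodI[of T q "\<lambda>x. x"] T unfolding prime_sets_def by simp
  ultimately show ?thesis by (simp add: dvd_imp_le)
qed

lemma small_prime_sets_card: "finite (small_prime_sets Y)" "card (small_prime_sets Y) \<le> Y"
proof -
  have i: "inj_on (\<lambda>T. \<Prod>T) (small_prime_sets Y)"
    by (rule inj_on_subset[OF prod_primes_inj]) (auto simp: small_prime_sets_def prime_sets_def)
  have sub: "(\<lambda>T. \<Prod>T) ` small_prime_sets Y \<subseteq> {1..Y}"
  proof
    fix d assume "d \<in> (\<lambda>T. \<Prod>T) ` small_prime_sets Y"
    then obtain T where T: "T \<in> prime_sets" "\<Prod>T \<le> Y" "d = \<Prod>T" unfolding small_prime_sets_def by auto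
    then have "\<Prod>T > 0" unfolding prime_sets_def by (intro prod_pos) (auto simp: prime_gt_0_nat)
    then show "d \<in> {1..Y}" using T by simp
  qed
  show "finite (small_prime_sets Y)" using finite_imageD[OF _ i] finite_subset[OF sub] by simp
  show "card (small_prime_sets Y) \<le> Y" using card_inj_on_le[OF i sub] by simp
qed

lemma prime_sets_tail:
  assumes "Y \<ge> 1" "finite W" "W \<subseteq> prime_sets" "W \<inter> small_prime_sets Y = {}"
  shows "(\<Sum>T\<in>W. 1 / (real (\<Prod>T) * sqrt (real (\<Prod>T)))) \<le> 2 / sqrt (real Y)"
proof -
  have i: "inj_on (\<lambda>T. \<Prod>T) W"
    by (rule inj_on_subset[OF prod_primes_inj]) (use assms in \<open>auto simp: prime_sets_def\<close>)
  have "(\<Sum>T\<in>W. 1 / (real (\<Prod>T) * sqrt (real (\<Prod>T)))) = (\<Sum>d\<in>(\<lambda>T. \<Prod>T) ` W. 1 / (real d * sqrt (real d)))"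
    unfolding sum.reindex[OF i] by simp
  also have "\<dots> \<le> 2 / sqrt (real Y)"
  proof (rule inverse_three_halves_tail[OF assms(1)])
    show "finite ((\<lambda>T. \<Prod>T) ` W)" using assms by simp
    fix d assume "d \<in> (\<lambda>T. \<Prod>T) ` W"
    then obtain T where "T \<in> W" "d = \<Prod>T" by auto
    moreover from \<open>T \<in> W\<close> have "T \<in> prime_sets" "T \<notin> small_prime_sets Y" using assms by auto
    ultimately show "d > Y" by (simp add: small_prime_sets_def)
  qed
  finally show ?thesis .
qed

text \<open>Comparison with 2/n^2 gives absolute convergence, so the infinite product is the limit
  of the products over primes up to z.\<close>

lemma artin_constant_LIMSEQ:
  "(\<lambda>z. \<Prod>q | prime q \<and> q \<le> z. real_of_rat (artin_factor q)) \<longlonglongrightarrow> artin_constant"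
proof -
  let ?f = "\<lambda>p. if prime p then 1 - 1 / (real p * (real p - 1)) else 1"
  have "summable (\<lambda>p. norm (?f p - 1))"
  proof (rule summable_comparison_test)
    show "\<exists>N. \<forall>n\<ge>N. norm (norm (?f n - 1)) \<le> 2 * (1 / real n ^ 2)"
    proof (intro exI[of _ 2] allI impI)
      fix n :: nat assume n: "n \<ge> 2"
      have "real n ^ 2 \<le> 2 * (real n * (real n - 1))"
      proof -
        have "real n * 1 \<le> real n * (real n - 1)" using n by (intro mult_left_mono) auto
        then show ?thesis by (simp add: algebra_simps power2_eq_square)
      qed
      then have "1 / (real n * (real n - 1)) \<le> 2 * (1 / real n ^ 2)"
        using n by (simp add: field_simps)
      moreover have "0 \<le> 1 / (real n * (real n - 1))" using n by simp
      ultimately show "norm (norm (?f n - 1)) \<le> 2 * (1 / real n ^ 2)" by simp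
    qed
    show "summable (\<lambda>n. 2 * (1 / real n ^ 2))"
      using inverse_power_summable[of 2, where 'a = real] by (intro summable_mult) (simp add: inverse_eq_divide)
  qed
  then have "abs_convergent_prod ?f" by (rule summable_imp_abs_convergent_prod)
  then have "convergent_prod ?f" by (rule abs_convergent_prod_imp_convergent_prod)
  then have "(\<lambda>z. \<Prod>q\<le>z. ?f q) \<longlonglongrightarrow> artin_constant" unfolding artin_constant_def by (rule convergent_prod_LIMSEQ)
  moreover have "(\<Prod>q\<le>z. ?f q) = (\<Prod>q | prime q \<and> q \<le> z. real_of_rat (artin_factor q))" for z
    by (rule prod.mono_neutral_cong_right) (auto simp: artin_factor_def of_rat_diff of_rat_divide of_rat_mult)
  ultimately show ?thesis by simp
qed

text \<open>Writing d = \<open>\<Prod>T\<close>, the modulus D is at least d^2/K, so the bound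
  D^(-3/4) becomes d^(-3/2), which is summable over d.\<close>

lemma inverse_totient_sieve_mod:
  assumes S: "finite S" "\<And>q. q \<in> S \<Longrightarrow> prime q"
  shows "\<exists>C>0. \<forall>T\<in>prime_sets. 1 / real (totient (sieve_mod S e T)) \<le> C * (1 / (real (\<Prod>T) * sqrt (real (\<Prod>T))))"
proof -
  obtain C where C: "C > 0" "\<And>D. D > 0 \<Longrightarrow> 1 / real (totient D) \<le> C / (sqrt (real D) * sqrt (sqrt (real D)))"
    using totient_lower_bound by blast
  define K where "K = (\<Prod>q\<in>S. q ^ (e q + 2))"
  have K0: "K > 0" using sieve_mod_bounds(4)[OF S, of "{}" e] unfolding K_def by simp
  define L where "L = sqrt (real K) * sqrt (sqrt (real K))"
  have L: "L > 0" unfolding L_def using K0 by simp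
  show ?thesis
  proof (rule exI[of _ "C * L"], intro conjI ballI)
    show "C * L > 0" using C L by simp
    fix T assume "T \<in> prime_sets"
    then have T: "finite T" "\<And>q. q \<in> T \<Longrightarrow> prime q" unfolding prime_sets_def by auto
    define d where "d = real (\<Prod>T)"
    define m where "m = real (sieve_mod S e T)"
    have m0: "m > 0" unfolding m_def of_nat_0_less_iff by (rule sieve_mod_bounds(3)[OF S T])
    have d0: "d > 0" unfolding d_def of_nat_0_less_iff by (rule sieve_mod_bounds(5)[OF S T])
    have "real ((\<Prod>T) ^ 2) \<le> real (K * sieve_mod S e T)" unfolding of_nat_le_iff K_def by (rule sieve_mod_bounds(2)[OF S T])
    then have "d ^ 2 \<le> real K * m" unfolding d_def m_def by simp
    then have s: "d \<le> sqrt (real K * m)" by (intro real_le_rsqrt)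
    then have "sqrt d \<le> sqrt (sqrt (real K * m))" by simp
    with s have "d * sqrt d \<le> sqrt (real K * m) * sqrt (sqrt (real K * m))" using d0 m0 by (intro mult_mono) auto
    also have "\<dots> = L * (sqrt m * sqrt (sqrt m))" unfolding L_def by (simp add: real_sqrt_mult)
    finally have le: "d * sqrt d \<le> L * (sqrt m * sqrt (sqrt m))" .
    have "1 / real (totient (sieve_mod S e T)) \<le> C / (sqrt m * sqrt (sqrt m))"
      unfolding m_def by (rule C(2)) (rule sieve_mod_bounds(3)[OF S T])
    also have "\<dots> = C * L / (L * (sqrt m * sqrt (sqrt m)))" using L by simp
    also have "\<dots> \<le> C * L / (d * sqrt d)" using le d0 C L by (intro divide_left_mono mult_pos_pos) (auto simp: m0)
    finally show "1 / real (totient (sieve_mod S e T)) \<le> C * L * (1 / (real (\<Prod>T) * sqrt (real (\<Prod>T))))"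
      unfolding d_def by simp
  qed
qed

text \<open>For large z the sum over all sets of primes up to z is a finite Euler product and
  contains the truncated sum. The difference is a tail bounded independently of z, and z tends to
  infinity.\<close>

lemma singular_series:
  assumes S: "finite S" "\<And>q. q \<in> S \<Longrightarrow> prime q"
  shows "\<exists>C>0. \<forall>Y\<ge>1. \<bar>(\<Sum>T\<in>small_prime_sets Y. (- 1) ^ card T / real (totient (sieve_mod S e T)))
     - real_of_rat (\<Prod>q\<in>S. local_ratio q (e q)) * artin_constant\<bar> \<le> C / sqrt (real Y)"
proof -
  obtain C where C: "C > 0" "\<And>T. T \<in> prime_sets \<Longrightarrow> 1 / real (totient (sieve_mod S e T)) \<le> C * (1 / (real (\<Prod>T) * sqrt (real (\<Prod>T))))"
    using inverse_totient_sieve_mod[OF S] by blast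
  let ?w = "\<lambda>T. (- 1) ^ card T / real (totient (sieve_mod S e T))"
  let ?r = "real_of_rat (\<Prod>q\<in>S. local_ratio q (e q))"
  define P where "P z = {q. prime q \<and> q \<le> z}" for z :: nat
  have fP: "finite (P z)" for z unfolding P_def by simp
  show ?thesis
  proof (rule exI[of _ "2 * C"], intro conjI allI impI)
    show "2 * C > 0" using C by simp
    fix Y :: nat assume Y: "Y \<ge> 1"
    let ?V = "\<Sum>T\<in>small_prime_sets Y. ?w T"
    have "(\<lambda>z. \<bar>?V - ?r * (\<Prod>q\<in>P z. real_of_rat (artin_factor q))\<bar>) \<longlonglongrightarrow> \<bar>?V - ?r * artin_constant\<bar>"
      unfolding P_def by (intro tendsto_intros artin_constant_LIMSEQ)
    moreover have "\<forall>z\<ge>max Y (Max (insert 0 S)). \<bar>?V - ?r * (\<Prod>q\<in>P z. real_of_rat (artin_factor q))\<bar> \<le> 2 * C / sqrt (real Y)"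
    proof (intro allI impI)
      fix z assume z: "max Y (Max (insert 0 S)) \<le> z"
      have SP: "S \<subseteq> P z"
      proof
        fix q assume "q \<in> S"
        then have "q \<le> Max (insert 0 S)" using S by simp
        then show "q \<in> P z" using z S(2)[OF \<open>q \<in> S\<close>] unfolding P_def by simp
      qed
      have e: "?r * (\<Prod>q\<in>P z. real_of_rat (artin_factor q)) = (\<Sum>T\<in>Pow (P z). ?w T)"
        by (rule sieve_euler_product[OF S(1) fP _ SP, symmetric]) (simp add: P_def)
      have sub: "small_prime_sets Y \<subseteq> Pow (P z)"
      proof
        fix T assume T: "T \<in> small_prime_sets Y"
        then have "T \<in> prime_sets" "\<Prod>T \<le> Y" unfolding small_prime_sets_def by auto
        then have "q \<le> z" "prime q" if "q \<in> T" for q using prime_sets_elem_le_prod[of T q] z that by (auto simp: prime_sets_def)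
        then show "T \<in> Pow (P z)" unfolding P_def by auto
      qed
      define W where "W = Pow (P z) - small_prime_sets Y"
      have WP: "W \<subseteq> prime_sets"
      proof
        fix T assume "T \<in> W"
        then have "T \<subseteq> P z" unfolding W_def by auto
        then show "T \<in> prime_sets" using finite_subset[OF _ fP] unfolding prime_sets_def P_def by auto
      qed
      have fW: "finite W" unfolding W_def using fP by simp
      have "(\<Sum>T\<in>Pow (P z). ?w T) = (\<Sum>T\<in>W. ?w T) + ?V" unfolding W_def using sum.subset_diff[OF sub] fP by simp
      then have "\<bar>?V - ?r * (\<Prod>q\<in>P z. real_of_rat (artin_factor q))\<bar> = \<bar>\<Sum>T\<in>W. ?w T\<bar>" unfolding e by simp
      also have "\<dots> \<le> (\<Sum>T\<in>W. \<bar>?w T\<bar>)" by (rule sum_abs)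
      also have "\<dots> \<le> (\<Sum>T\<in>W. C * (1 / (real (\<Prod>T) * sqrt (real (\<Prod>T)))))"
        by (rule sum_mono) (use C(2) WP in \<open>auto simp: abs_divide power_abs\<close>)
      also have "\<dots> = C * (\<Sum>T\<in>W. 1 / (real (\<Prod>T) * sqrt (real (\<Prod>T))))" by (rule sum_distrib_left[symmetric])
      also have "\<dots> \<le> C * (2 / sqrt (real Y))"
        using C(1) by (intro mult_left_mono prime_sets_tail[OF Y fW WP]) (auto simp: W_def)
      finally show "\<bar>?V - ?r * (\<Prod>q\<in>P z. real_of_rat (artin_factor q))\<bar> \<le> 2 * C / sqrt (real Y)" by (simp add: mult.commute)
    qed
    ultimately show "\<bar>?V - ?r * artin_constant\<bar> \<le> 2 * C / sqrt (real Y)"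
      by (rule LIMSEQ_le_const2[OF _ exI])
  qed
qed

text \<open>All prime factors of p - 1 are at most x, so the primes up to x serve as U for every p
  at once.\<close>

lemma prime_count_sieve:
  assumes S: "finite S" "\<And>q. q \<in> S \<Longrightarrow> prime q"
  shows "prime_count {p. valuation_good S e (p - 1)} x
    = (\<Sum>T\<in>Pow {q. prime q \<and> real q \<le> x}. (- 1) ^ card T * real (pi1 x (sieve_mod S e T)))"
proof -
  define U where "U = {q::nat. prime q \<and> real q \<le> x}"
  have fU: "finite U" unfolding U_def using finite_primes_le[of x "\<lambda>_. True"] by simp
  have cnt: "real (card {p. prime p \<and> real p \<le> x \<and> A p}) = (\<Sum>p\<in>U. of_bool (A p))" for A :: "nat \<Rightarrow> bool"
  proof -
    have "{p. prime p \<and> real p \<le> x \<and> A p} = U \<inter> {p. A p}" unfolding U_def by auto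
    then show ?thesis by (simp add: of_bool_def sum.If_cases fU Collect_conj_eq)
  qed
  have "prime_count {p. valuation_good S e (p - 1)} x = (\<Sum>p\<in>U. of_bool (valuation_good S e (p - 1)))"
    unfolding prime_count_def mem_Collect_eq by (rule cnt)
  also have "\<dots> = (\<Sum>p\<in>U. \<Sum>T\<in>Pow U. (- 1) ^ card T * of_bool (sieve_mod S e T dvd p - 1))"
  proof (rule sum.cong[OF refl])
    fix p assume p: "p \<in> U"
    show "of_bool (valuation_good S e (p - 1)) = (\<Sum>T\<in>Pow U. (- 1) ^ card T * of_bool (sieve_mod S e T dvd p - 1) :: real)"
    proof (rule valuation_good_sum[OF S fU])
      show "prime q" if "q \<in> U" for q using that unfolding U_def by simp
      show p1: "p - 1 > 0" using p prime_gt_1_nat[of p] unfolding U_def by auto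
      fix q assume q: "prime q" "q dvd p - 1"
      then have "q \<le> p - 1" using p1 by (intro dvd_imp_le) auto
      then have "real q \<le> real p" by simp
      then show "q \<in> U" using q p unfolding U_def by auto
    qed
  qed
  also have "\<dots> = (\<Sum>T\<in>Pow U. (- 1) ^ card T * (\<Sum>p\<in>U. of_bool (sieve_mod S e T dvd p - 1)))"
    unfolding sum_distrib_left by (rule sum.swap)
  also have "\<dots> = (\<Sum>T\<in>Pow U. (- 1) ^ card T * real (pi1 x (sieve_mod S e T)))"
    unfolding pi1_def cnt ..
  finally show ?thesis unfolding U_def .
qed

text \<open>Let l = ln x and truncate at Y of size l^(2 H). The at most Y small sets have moduli at
  most 4 K l^(4 H) <= l^(4 H + 1) and errors O(x/l^(3 H)) each. The large sets cost O(x/sqrt Y) by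
  the trivial bound x/D, and so does completing the series. Each part is O(x/l^H).\<close>

theorem valuation_good_count:
  assumes S: "finite S" "\<And>q. q \<in> S \<Longrightarrow> prime q"
  shows "\<exists>C>0. \<exists>x0\<ge>3. \<forall>x\<ge>x0. \<bar>prime_count {p. valuation_good S e (p - 1)} x
     - real_of_rat (\<Prod>q\<in>S. local_ratio q (e q)) * artin_constant * Li x\<bar> \<le> C * (x / ln x ^ H)"
proof -
  define K where "K = (\<Prod>q\<in>S. q ^ (e q + 2))"
  have K0: "K > 0" using sieve_mod_bounds(4)[OF S, of "{}" e] unfolding K_def by simp
  obtain C1 x1 where C1: "C1 > 0" "\<And>x d. x \<ge> x1 \<Longrightarrow> d > 0 \<Longrightarrow> real d \<le> ln x ^ (4 * H + 1) \<Longrightarrow>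
      \<bar>real (pi1 x d) - Li x / real (totient d)\<bar> \<le> C1 * (x / ln x ^ (3 * H))" using primes_1_mod[of "4 * H + 1" "3 * H"] by blast
  obtain C2 where C2: "C2 > 0" "\<And>Y. Y \<ge> 1 \<Longrightarrow> \<bar>(\<Sum>T\<in>small_prime_sets Y. (- 1) ^ card T / real (totient (sieve_mod S e T)))
     - real_of_rat (\<Prod>q\<in>S. local_ratio q (e q)) * artin_constant\<bar> \<le> C2 / sqrt (real Y)"
    using singular_series[OF S, of e] by blast
  have "eventually (\<lambda>x::real. 2 * ln x ^ (2 * H) \<le> x \<and> 4 * real K \<le> ln x \<and> x1 \<le> x \<and> 3 \<le> x \<and> 1 \<le> ln x) at_top"
    by (intro eventually_conj) real_asymp+
  then obtain x2 where x2: "\<And>x::real. x \<ge> x2 \<Longrightarrow> 2 * ln x ^ (2 * H) \<le> x \<and> 4 * real K \<le> ln x \<and> x1 \<le> x \<and> 3 \<le> x \<and> 1 \<le> ln x"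
    by (auto simp: eventually_at_top_linorder)
  let ?r = "real_of_rat (\<Prod>q\<in>S. local_ratio q (e q)) * artin_constant"
  define C where "C = 2 * C1 + 2 * real K + 2 * C2"
  show ?thesis
  proof (rule exI[of _ C], intro conjI exI[of _ "max 3 x2"] allI impI)
    show "C > 0" unfolding C_def using C1 C2 by (intro add_pos_pos add_pos_nonneg) auto
    show "3 \<le> max 3 x2" by simp
    fix x assume "max 3 x2 \<le> x"
    then have x: "2 * ln x ^ (2 * H) \<le> x" "4 * real K \<le> ln x" "x1 \<le> x" "3 \<le> x" "1 \<le> ln x" using x2[of x] by auto
    define l where "l = ln x"
    define E where "E = x / l ^ H"
    have l1: "1 \<le> l" using x unfolding l_def by simp
    have lp: "1 \<le> l ^ i" for i using l1 by (rule one_le_power)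
    define Y where "Y = nat \<lceil>l ^ (2 * H)\<rceil>"
    have Y: "l ^ (2 * H) \<le> real Y" "real Y \<le> 2 * l ^ (2 * H)" "Y \<ge> 1"
    proof -
      show a: "l ^ (2 * H) \<le> real Y" unfolding Y_def by (rule real_nat_ceiling_ge)
      have "real Y \<le> l ^ (2 * H) + 1" unfolding Y_def using lp[of "2 * H"] of_int_ceiling_le_add_one[of "l ^ (2 * H)"] by simp
      then show "real Y \<le> 2 * l ^ (2 * H)" using lp[of "2 * H"] by linarith
      have "1 \<le> real Y" using a lp[of "2 * H"] by linarith
      then show "Y \<ge> 1" by simp
    qed
    have sY: "l ^ H \<le> sqrt (real Y)"
    proof (rule real_le_rsqrt)
      show "(l ^ H)\<^sup>2 \<le> real Y" using Y(1) by (simp add: mult.commute flip: power_mult)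
    qed
    have lH: "l ^ H > 0" using l1 by simp
    have E0: "E \<ge> 0" unfolding E_def using x lH by simp
    define U where "U = {q::nat. prime q \<and> real q \<le> x}"
    have fU: "finite U" unfolding U_def using finite_primes_le[of x "\<lambda>_. True"] by simp
    define V where "V = small_prime_sets Y"
    have fV: "finite V" "card V \<le> Y" unfolding V_def by (rule small_prime_sets_card)+
    define W where "W = Pow U - V"
    have UP: "Pow U \<subseteq> prime_sets"
      unfolding prime_sets_def using finite_subset[OF _ fU] by (auto simp: U_def)
    have VU: "V \<subseteq> Pow U"
    proof
      fix T assume T: "T \<in> V"
      then have "T \<in> prime_sets" "\<Prod>T \<le> Y" unfolding V_def small_prime_sets_def by auto
      then have "q \<le> Y" "prime q" if "q \<in> T" for q using prime_sets_elem_le_prod[of T q] that by (auto simp: prime_sets_def)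
      moreover have "real Y \<le> x" using Y(2) x(1) unfolding l_def by linarith
      ultimately show "T \<in> Pow U" unfolding U_def by force
    qed
    let ?m = "sieve_mod S e" and ?w = "\<lambda>T. (- 1) ^ card T :: real"
    have bnd: "real (?m T) \<le> real K * real (\<Prod>T) ^ 2" "real (\<Prod>T) ^ 2 \<le> real K * real (?m T)" "?m T > 0" "1 \<le> real (\<Prod>T)" if "T \<in> prime_sets" for T
    proof -
      have T: "finite T" "\<And>q. q \<in> T \<Longrightarrow> prime q" using that unfolding prime_sets_def by auto
      note b = sieve_mod_bounds(1-3)[OF S T, of e, folded K_def]
      have "real (?m T) \<le> real (K * (\<Prod>T) ^ 2)" "real ((\<Prod>T) ^ 2) \<le> real (K * ?m T)" using b(1,2) by (simp_all only: of_nat_le_iff)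
      then show "real (?m T) \<le> real K * real (\<Prod>T) ^ 2" "real (\<Prod>T) ^ 2 \<le> real K * real (?m T)" by simp_all
      show "?m T > 0" by (rule b)
      have "1 \<le> \<Prod>T" using sieve_mod_bounds(5)[OF S T] by simp
      then show "1 \<le> real (\<Prod>T)" by linarith
    qed
    have tailW: "\<bar>\<Sum>T\<in>W. ?w T * real (pi1 x (?m T))\<bar> \<le> 2 * real K * E"
    proof -
      have "\<bar>\<Sum>T\<in>W. ?w T * real (pi1 x (?m T))\<bar> \<le> (\<Sum>T\<in>W. \<bar>?w T * real (pi1 x (?m T))\<bar>)" by (rule sum_abs)
      also have "\<dots> \<le> (\<Sum>T\<in>W. x * real K * (1 / (real (\<Prod>T) * sqrt (real (\<Prod>T)))))"
      proof (rule sum_mono)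
        fix T assume "T \<in> W"
        then have T: "T \<in> prime_sets" using UP unfolding W_def by auto
        define d where "d = real (\<Prod>T)"
        have d1: "1 \<le> d" unfolding d_def by (rule bnd[OF T])
        have m0: "0 < real (?m T)" using bnd(3)[OF T] by simp
        have "sqrt d \<le> d" using d1 by (intro real_le_lsqrt) (auto simp: power2_eq_square)
        then have "d * sqrt d \<le> d ^ 2" using d1 by (simp add: power2_eq_square)
        also have "\<dots> \<le> real K * real (?m T)" unfolding d_def by (rule bnd[OF T])
        finally have dd: "d * sqrt d \<le> real K * real (?m T)" .
        have "\<bar>?w T * real (pi1 x (?m T))\<bar> = real (pi1 x (?m T))" by (simp add: abs_mult power_abs)
        also have "\<dots> \<le> x / real (?m T)" using x bnd(3)[OF T] by (intro pi1_le) auto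
        also have "\<dots> = x * real K / (real K * real (?m T))" using K0 by simp
        also have "\<dots> \<le> x * real K / (d * sqrt d)" using dd d1 x K0 m0 by (intro divide_left_mono mult_pos_pos) auto
        finally show "\<bar>?w T * real (pi1 x (?m T))\<bar> \<le> x * real K * (1 / (real (\<Prod>T) * sqrt (real (\<Prod>T))))"
          unfolding d_def by simp
      qed
      also have "\<dots> = x * real K * (\<Sum>T\<in>W. 1 / (real (\<Prod>T) * sqrt (real (\<Prod>T))))" by (rule sum_distrib_left[symmetric])
      also have "\<dots> \<le> x * real K * (2 / sqrt (real Y))"
        using x UP fU by (intro mult_left_mono prime_sets_tail[OF Y(3)]) (auto simp: W_def V_def)
      also have "\<dots> \<le> x * real K * (2 / l ^ H)" using x sY lH by (intro mult_left_mono frac_le) auto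
      also have "\<dots> = 2 * real K * E" unfolding E_def by simp
      finally show ?thesis .
    qed
    have mainV: "\<bar>(\<Sum>T\<in>V. ?w T * real (pi1 x (?m T))) - (\<Sum>T\<in>V. ?w T / real (totient (?m T))) * Li x\<bar> \<le> 2 * C1 * E"
    proof -
      have "(\<Sum>T\<in>V. ?w T * real (pi1 x (?m T))) - (\<Sum>T\<in>V. ?w T / real (totient (?m T))) * Li x
         = (\<Sum>T\<in>V. ?w T * (real (pi1 x (?m T)) - Li x / real (totient (?m T))))"
        unfolding sum_distrib_right sum_subtractf[symmetric] by (intro sum.cong refl) (simp add: right_diff_distrib)
      then have "\<bar>(\<Sum>T\<in>V. ?w T * real (pi1 x (?m T))) - (\<Sum>T\<in>V. ?w T / real (totient (?m T))) * Li x\<bar>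
         \<le> (\<Sum>T\<in>V. \<bar>?w T * (real (pi1 x (?m T)) - Li x / real (totient (?m T)))\<bar>)" by (simp only: sum_abs)
      also have "\<dots> \<le> (\<Sum>T\<in>V. C1 * (x / l ^ (3 * H)))"
      proof (rule sum_mono)
        fix T assume "T \<in> V"
        then have T: "T \<in> prime_sets" "\<Prod>T \<le> Y" unfolding V_def small_prime_sets_def by auto
        have "real (?m T) \<le> real K * real (\<Prod>T) ^ 2" by (rule bnd[OF T(1)])
        also have "\<dots> \<le> real K * (2 * l ^ (2 * H)) ^ 2"
        proof (intro mult_left_mono power_mono)
          have "real (\<Prod>T) \<le> real Y" using T(2) by (rule of_nat_mono)
          then show "real (\<Prod>T) \<le> 2 * l ^ (2 * H)" using Y(2) by linarith
          show "0 \<le> real (\<Prod>T)" by (rule of_nat_0_le_iff)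
        qed auto
        also have "\<dots> = (4 * real K) * l ^ (4 * H)" by (simp add: power_mult_distrib flip: power_mult)
        also have "\<dots> \<le> l * l ^ (4 * H)" using x(2) l1 unfolding l_def by (intro mult_right_mono) auto
        finally have "real (?m T) \<le> ln x ^ (4 * H + 1)" unfolding l_def by simp
        from C1(2)[OF x(3) bnd(3)[OF T(1)] this]
        show "\<bar>?w T * (real (pi1 x (?m T)) - Li x / real (totient (?m T)))\<bar> \<le> C1 * (x / l ^ (3 * H))"
          unfolding l_def by (simp add: abs_mult power_abs)
      qed
      also have "\<dots> = real (card V) * (C1 * (x / l ^ (3 * H)))" by simp
      also have "\<dots> \<le> (2 * l ^ (2 * H)) * (C1 * (x / l ^ (3 * H)))"
      proof (rule mult_right_mono)
        have "real (card V) \<le> real Y" using fV(2) by (rule of_nat_mono)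
        then show "real (card V) \<le> 2 * l ^ (2 * H)" using Y(2) by linarith
        show "0 \<le> C1 * (x / l ^ (3 * H))" using C1(1) x l1 by simp
      qed
      also have "\<dots> = 2 * C1 * E"
      proof -
        have "l ^ (3 * H) = l ^ (2 * H) * l ^ H" by (simp flip: power_add)
        then show ?thesis unfolding E_def using lH l1 by simp
      qed
      finally show ?thesis .
    qed
    have ser: "\<bar>(\<Sum>T\<in>V. ?w T / real (totient (?m T))) * Li x - ?r * Li x\<bar> \<le> 2 * C2 * E"
    proof -
      have Li: "0 \<le> Li x" "Li x \<le> 2 * x" using x Li_nonneg[of x] Li_le[of x] by auto
      have "\<bar>(\<Sum>T\<in>V. ?w T / real (totient (?m T))) * Li x - ?r * Li x\<bar> = \<bar>(\<Sum>T\<in>V. ?w T / real (totient (?m T))) - ?r\<bar> * Li x"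
        unfolding left_diff_distrib[symmetric] abs_mult using Li(1) by simp
      also have "\<dots> \<le> (C2 / sqrt (real Y)) * (2 * x)"
        using C2(2)[OF Y(3)] Li C2(1) unfolding V_def by (intro mult_mono) auto
      also have "\<dots> \<le> (C2 / l ^ H) * (2 * x)" using C2(1) sY lH x by (intro mult_right_mono frac_le) auto
      also have "\<dots> = 2 * C2 * E" unfolding E_def by simp
      finally show ?thesis .
    qed
    have "prime_count {p. valuation_good S e (p - 1)} x = (\<Sum>T\<in>Pow U. ?w T * real (pi1 x (?m T)))"
      unfolding U_def by (rule prime_count_sieve[OF S])
    also have "\<dots> = (\<Sum>T\<in>W. ?w T * real (pi1 x (?m T))) + (\<Sum>T\<in>V. ?w T * real (pi1 x (?m T)))"
      unfolding W_def by (rule sum.subset_diff[OF VU]) (simp add: fU)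
    finally have "\<bar>prime_count {p. valuation_good S e (p - 1)} x - ?r * Li x\<bar> \<le> 2 * real K * E + 2 * C1 * E + 2 * C2 * E"
      using tailW mainV ser by linarith
    also have "\<dots> = C * (x / ln x ^ H)" unfolding C_def E_def l_def by (simp add: algebra_simps)
    finally show "\<bar>prime_count {p. valuation_good S e (p - 1)} x - ?r * Li x\<bar> \<le> C * (x / ln x ^ H)" .
  qed
qed

section \<open>Counts for all x and densities\<close>

lemma prime_count_le: "x \<ge> 0 \<Longrightarrow> prime_count P x \<le> x"
proof -
  assume x: "x \<ge> 0"
  have "{p. prime p \<and> real p \<le> x \<and> p \<in> P} \<subseteq> {1..nat \<lfloor>x\<rfloor>}"
    by (auto simp: le_nat_iff le_floor_iff Suc_le_eq prime_gt_0_nat)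
  then have "card {p. prime p \<and> real p \<le> x \<and> p \<in> P} \<le> card {1..nat \<lfloor>x\<rfloor>}" by (intro card_mono) auto
  then have "prime_count P x \<le> real (nat \<lfloor>x\<rfloor>)" unfolding prime_count_def by simp
  moreover have "real (nat \<lfloor>x\<rfloor>) \<le> x" using x by simp
  ultimately show ?thesis by linarith
qed

text \<open>Passes to a real exponent and to all x >= 2. Below x0 both quantities are at most a
  multiple of x, and ln x powr H is bounded by its value at x0.\<close>

lemma valuation_good_count_powr:
  assumes S: "finite S" "\<And>q. q \<in> S \<Longrightarrow> prime q" and H: "H > 0"
  shows "\<exists>C\<ge>0. \<forall>x\<ge>2. \<bar>prime_count {p. valuation_good S e (p - 1)} x
     - real_of_rat (\<Prod>q\<in>S. local_ratio q (e q)) * artin_constant * Li x\<bar> \<le> C * (x / ln x powr H)"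
proof -
  define h where "h = nat \<lceil>H\<rceil>"
  have hH: "H \<le> real h" unfolding h_def by (rule real_nat_ceiling_ge)
  let ?r = "real_of_rat (\<Prod>q\<in>S. local_ratio q (e q)) * artin_constant"
  let ?N = "\<lambda>x. prime_count {p. valuation_good S e (p - 1)} x"
  obtain C x0 where C: "C > 0" "x0 \<ge> 3" "\<And>x. x \<ge> x0 \<Longrightarrow> \<bar>?N x - ?r * Li x\<bar> \<le> C * (x / ln x ^ h)"
    using valuation_good_count[OF S, of e h] by blast
  define C' where "C' = (1 + \<bar>?r\<bar> * 2) * ln x0 powr H"
  have C': "C' \<ge> 0" unfolding C'_def by simp
  show ?thesis
  proof (rule exI[of _ "C + C'"], intro conjI allI impI)
    show "0 \<le> C + C'" using C C' by simp
    fix x :: real assume x: "2 \<le> x"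
    have l0: "ln x > 0" using x by simp
    define E where "E = x / ln x powr H"
    have E0: "E \<ge> 0" unfolding E_def using x by simp
    have split: "(C + C') * E = C * E + C' * E" "0 \<le> C * E" "0 \<le> C' * E" using E0 C(1) C' by (auto simp: distrib_right)
    show "\<bar>?N x - ?r * Li x\<bar> \<le> (C + C') * (x / ln x powr H)"
    proof (cases "x \<ge> x0")
      case True
      have "exp 1 \<le> x" using e_less_272 C(2) True by linarith
      then have l1: "1 \<le> ln x" using x by (subst ln_ge_iff) auto
      have "ln x powr H \<le> ln x powr real h" using l1 hH by (intro powr_mono)
      also have "\<dots> = ln x ^ h" using l0 by (rule powr_realpow)
      finally have "x / ln x ^ h \<le> E" unfolding E_def using x l0 by (intro divide_left_mono mult_pos_pos) auto
      then have "C * (x / ln x ^ h) \<le> C * E" using C(1) by (intro mult_left_mono) auto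
      then show ?thesis unfolding E_def[symmetric] split(1) using C(3)[OF True] split(3) by linarith
    next
      case False
      have N0: "0 \<le> ?N x" unfolding prime_count_def by simp
      have "\<bar>?N x - ?r * Li x\<bar> \<le> \<bar>?N x\<bar> + \<bar>?r * Li x\<bar>" by (rule abs_triangle_ineq4)
      also have "\<bar>?N x\<bar> \<le> x" using prime_count_le[of x "{p. valuation_good S e (p - 1)}"] x N0 by linarith
      also have "\<bar>?r * Li x\<bar> \<le> \<bar>?r\<bar> * (2 * x)" unfolding abs_mult using Li_nonneg[OF x] Li_le[OF x] by (intro mult_mono) auto
      finally have a: "\<bar>?N x - ?r * Li x\<bar> \<le> (1 + \<bar>?r\<bar> * 2) * x" by (simp add: algebra_simps)
      have "ln x powr H \<le> ln x0 powr H" using False x l0 H by (intro powr_mono2) auto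
      then have "ln x powr H * E \<le> ln x0 powr H * E" using E0 by (intro mult_right_mono)
      moreover have "ln x powr H * E = x" unfolding E_def using l0 by simp
      ultimately have "(1 + \<bar>?r\<bar> * 2) * x \<le> (1 + \<bar>?r\<bar> * 2) * (ln x0 powr H * E)" by (intro mult_left_mono) auto
      also have "\<dots> = C' * E" unfolding C'_def by simp
      finally show ?thesis unfolding E_def[symmetric] split(1) using a split(2) by linarith
    qed
  qed
qed

text \<open>The prime number theorem, as the modulus 1 of \<open>primes_1_mod\<close>.\<close>

lemma primes_pi_bound: "\<exists>C>0. \<exists>x0\<ge>4. \<forall>x\<ge>x0. \<bar>primes_pi x - Li x\<bar> \<le> C * (x / ln x ^ 2)"
proof -
  obtain C x0 where C: "C > 0" "\<And>x d. x \<ge> x0 \<Longrightarrow> d > 0 \<Longrightarrow> real d \<le> ln x ^ 0 \<Longrightarrow>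
      \<bar>real (pi1 x d) - Li x / real (totient d)\<bar> \<le> C * (x / ln x ^ 2)" using primes_1_mod[of 0 2] by blast
  have pp: "real (pi1 x 1) = primes_pi x" for x unfolding pi1_def primes_pi_def by simp
  show ?thesis
  proof (rule exI[of _ C], intro conjI exI[of _ "max 4 x0"] allI impI)
    fix x assume "max 4 x0 \<le> x"
    then show "\<bar>primes_pi x - Li x\<bar> \<le> C * (x / ln x ^ 2)" using C(2)[of x 1] pp[of x] by simp
  qed (use C in auto)
qed

lemma Li_over_primes_pi:
  "((\<lambda>x. Li x / primes_pi x) \<longlongrightarrow> 1) at_top"
  "((\<lambda>x. (x / ln x powr 2) / primes_pi x) \<longlongrightarrow> 0) at_top"
proof -
  obtain C x0 where C: "C > 0" "x0 \<ge> 4" "\<And>x. x \<ge> x0 \<Longrightarrow> \<bar>primes_pi x - Li x\<bar> \<le> C * (x / ln x ^ 2)"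
    using primes_pi_bound by blast
  have Lpos: "Li x > 0" "(x / ln x ^ 2) / Li x \<le> 2 / ln x" if x: "x \<ge> 4" for x
  proof -
    have l: "ln x > 0" using x by simp
    have lo: "x / (2 * ln x) \<le> Li x" by (rule Li_lower[OF x])
    have p: "0 < x / (2 * ln x)" using x l by simp
    then show Lp: "Li x > 0" using lo by linarith
    have "(x / ln x ^ 2) / Li x \<le> (x / ln x ^ 2) / (x / (2 * ln x))" by (intro divide_left_mono mult_pos_pos Lp p lo) (use x in auto)
    also have "\<dots> = 2 / ln x" using x l by (simp add: field_simps power2_eq_square)
    finally show "(x / ln x ^ 2) / Li x \<le> 2 / ln x" .
  qed
  have ev: "eventually (\<lambda>x. x \<ge> x0) at_top" by (rule eventually_ge_at_top)
  have "((\<lambda>x. primes_pi x / Li x - 1) \<longlongrightarrow> 0) at_top"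
  proof (rule tendsto_0_le[where K = 1])
    show "((\<lambda>x::real. C * (2 / ln x)) \<longlongrightarrow> 0) at_top" by real_asymp
    show "eventually (\<lambda>x. norm (primes_pi x / Li x - 1) \<le> norm (C * (2 / ln x)) * 1) at_top"
      using ev
    proof eventually_elim
      case (elim x)
      have x4: "x \<ge> 4" using elim C by simp
      have "norm (primes_pi x / Li x - 1) = \<bar>primes_pi x - Li x\<bar> / Li x" using Lpos(1)[OF x4] by (simp add: field_simps abs_divide)
      also have "\<dots> \<le> C * (x / ln x ^ 2) / Li x" using C(3)[OF elim] Lpos(1)[OF x4] by (intro divide_right_mono) auto
      also have "\<dots> = C * ((x / ln x ^ 2) / Li x)" by simp
      also have "\<dots> \<le> C * (2 / ln x)" using C(1) by (intro mult_left_mono Lpos(2)[OF x4]) auto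
      also have "\<dots> \<le> norm (C * (2 / ln x)) * 1" unfolding mult_1_right real_norm_def by (rule abs_ge_self)
      finally show ?case .
    qed
  qed
  then have "((\<lambda>x. primes_pi x / Li x - 1 + 1) \<longlongrightarrow> 0 + 1) at_top" by (intro tendsto_intros)
  then have "((\<lambda>x. inverse (primes_pi x / Li x)) \<longlongrightarrow> inverse 1) at_top" by (intro tendsto_inverse) auto
  then show one: "((\<lambda>x. Li x / primes_pi x) \<longlongrightarrow> 1) at_top" by simp
  have z: "((\<lambda>x. (x / ln x ^ 2) / Li x) \<longlongrightarrow> 0) at_top"
  proof (rule tendsto_0_le[where K = 1])
    show "((\<lambda>x::real. 2 / ln x) \<longlongrightarrow> 0) at_top" by real_asymp
    show "eventually (\<lambda>x. norm ((x / ln x ^ 2) / Li x) \<le> norm (2 / ln x) * 1) at_top"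
      using ev
    proof eventually_elim
      case (elim x)
      have x4: "x \<ge> 4" using elim C by simp
      have "norm ((x / ln x ^ 2) / Li x) = (x / ln x ^ 2) / Li x" using x4 Lpos(1)[OF x4] by simp
      also have "\<dots> \<le> 2 / ln x" by (rule Lpos(2)[OF x4])
      also have "\<dots> \<le> norm (2 / ln x) * 1" unfolding mult_1_right real_norm_def by (rule abs_ge_self)
      finally show ?case .
    qed
  qed
  have "((\<lambda>x. (x / ln x ^ 2) / Li x * (Li x / primes_pi x)) \<longlongrightarrow> 0 * 1) at_top" by (intro tendsto_mult z one)
  moreover have "eventually (\<lambda>x. (x / ln x ^ 2) / Li x * (Li x / primes_pi x) = (x / ln x powr 2) / primes_pi x) at_top"
    using ev
  proof eventually_elim
    case (elim x)
    have x4: "x \<ge> 4" using elim C by simp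
    have "ln x powr 2 = ln x ^ 2" using x4 powr_realpow[of "ln x" 2] by simp
    then show ?case using Lpos(1)[OF x4] by simp
  qed
  ultimately show "((\<lambda>x. (x / ln x powr 2) / primes_pi x) \<longlongrightarrow> 0) at_top"
    by (simp add: filterlim_cong[OF refl refl])
qed

lemma valuation_good_density:
  assumes S: "finite S" "\<And>q. q \<in> S \<Longrightarrow> prime q"
  shows "has_prime_density {p. valuation_good S e (p - 1)} (real_of_rat (\<Prod>q\<in>S. local_ratio q (e q)) * artin_constant)"
proof -
  let ?r = "real_of_rat (\<Prod>q\<in>S. local_ratio q (e q)) * artin_constant"
  let ?N = "\<lambda>x. prime_count {p. valuation_good S e (p - 1)} x"
  obtain C where C: "C \<ge> 0" "\<And>x. x \<ge> 2 \<Longrightarrow> \<bar>?N x - ?r * Li x\<bar> \<le> C * (x / ln x powr 2)"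
    using valuation_good_count_powr[OF S, of 2 e] by auto
  have "((\<lambda>x. (?N x - ?r * Li x) / primes_pi x) \<longlongrightarrow> 0) at_top"
  proof (rule tendsto_0_le[OF Li_over_primes_pi(2), where K = C])
    show "eventually (\<lambda>x. norm ((?N x - ?r * Li x) / primes_pi x) \<le> norm (x / ln x powr 2 / primes_pi x) * C) at_top"
      using eventually_ge_at_top[of 2]
    proof eventually_elim
      case (elim x)
      have p0: "primes_pi x \<ge> 0" unfolding primes_pi_def by simp
      have "norm ((?N x - ?r * Li x) / primes_pi x) = \<bar>?N x - ?r * Li x\<bar> / primes_pi x" using p0 by (simp add: abs_divide)
      also have "\<dots> \<le> C * (x / ln x powr 2) / primes_pi x" using C(2)[OF elim] p0 by (intro divide_right_mono)
      also have "\<dots> = norm (x / ln x powr 2 / primes_pi x) * C" using p0 elim by (simp add: abs_divide)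
      finally show ?case .
    qed
  qed
  then have "((\<lambda>x. (?N x - ?r * Li x) / primes_pi x + ?r * (Li x / primes_pi x)) \<longlongrightarrow> 0 + ?r * 1) at_top"
    by (intro tendsto_intros Li_over_primes_pi(1))
  moreover have "(?N x - ?r * Li x) / primes_pi x + ?r * (Li x / primes_pi x) = ?N x / primes_pi x" for x
    by (simp add: diff_divide_distrib)
  ultimately show ?thesis unfolding has_prime_density_def by simp
qed

section \<open>Values of Ramanujan sums at shifted primes\<close>

context
  fixes k :: nat
  assumes k: "k \<ge> 1"
begin

text \<open>Exponents above k + 1 have local value 0. Extensional functions let each tuple occur
  exactly once.\<close>

definition exponent_choices :: "(nat \<Rightarrow> nat) set" where
  "exponent_choices = (\<Pi>\<^sub>E q\<in>prime_factors k. {..k + 1})"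

definition tuple_value :: "(nat \<Rightarrow> nat) \<Rightarrow> int" where
  "tuple_value e = (\<Prod>q\<in>prime_factors k. local_value k q (e q))"

text \<open>Only |v| enters, so v and - v share their constant. The set may be empty, and the
  constant is then 0.\<close>

definition value_choices :: "int \<Rightarrow> (nat \<Rightarrow> nat) set" where
  "value_choices v = {e \<in> exponent_choices. \<bar>tuple_value e\<bar> = \<bar>v\<bar>}"

lemma finite_exponent_choices: "finite exponent_choices"
  unfolding exponent_choices_def by (intro finite_PiE) auto

lemma finite_value_choices: "finite (value_choices v)"
  unfolding value_choices_def using finite_exponent_choices by simp

text \<open>At most one tuple in the list is that of n, so each sum has at most one nonzero term. In
  the second identity the sign of \<open>tuple_value e * v\<close> says whether \<open>mu_S\<close>
  has to be 1 or -1, and for squarefree n half of 1 plus this sign times \<open>mu_S\<close> is the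
  indicator of that event.\<close>

lemma ramanujan_sum_indicators:
  assumes n: "n > 0" and v: "v \<noteq> 0"
  shows "of_bool (cmod (ramanujan_sum n k) = real_of_int \<bar>v\<bar>) = (\<Sum>e\<in>value_choices v. of_bool (valuation_good (prime_factors k) e n) :: real)"
    and "of_bool (ramanujan_sum n k = of_int v) = (\<Sum>e\<in>value_choices v. (of_bool (valuation_good (prime_factors k) e n)
        + real_of_int (sgn (tuple_value e * v)) * (of_bool (\<forall>q\<in>prime_factors k. multiplicity q n = e q) * real_of_int (mu_S (prime_factors k) n))) / 2)"
proof -
  define S where "S = prime_factors k"
  define \<epsilon> where "\<epsilon> = restrict (\<lambda>q. multiplicity q n) S"
  have ram: "ramanujan_sum n k = of_int (mu_S S n * tuple_value \<epsilon>)"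
    unfolding S_def \<epsilon>_def tuple_value_def using ramanujan_sum_eq_mu_S[of k n] k n by simp
  have only: "(\<forall>q\<in>S. multiplicity q n = e q) \<longleftrightarrow> e = \<epsilon>" if "e \<in> value_choices v" for e
  proof
    assume "\<forall>q\<in>S. multiplicity q n = e q"
    moreover have "e \<in> extensional S" using that unfolding value_choices_def exponent_choices_def S_def by (auto simp: PiE_def)
    ultimately show "e = \<epsilon>" unfolding \<epsilon>_def by (intro extensionalityI[of _ S]) auto
  qed (simp add: \<epsilon>_def)
  have in_choices: "\<epsilon> \<in> value_choices v \<longleftrightarrow> \<bar>tuple_value \<epsilon>\<bar> = \<bar>v\<bar>"
  proof
    assume tv: "\<bar>tuple_value \<epsilon>\<bar> = \<bar>v\<bar>"
    have "multiplicity q n \<le> k + 1" if q: "q \<in> S" for q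
    proof (rule ccontr)
      assume "\<not> multiplicity q n \<le> k + 1"
      then have "local_value k q (\<epsilon> q) = 0" using q k local_value_eq_0[of k q "multiplicity q n"] unfolding \<epsilon>_def S_def by auto
      then have "tuple_value \<epsilon> = 0" using q unfolding tuple_value_def S_def by (auto simp: prod_zero_iff)
      then show False using tv v by simp
    qed
    then have "\<epsilon> \<in> exponent_choices" unfolding exponent_choices_def \<epsilon>_def S_def[symmetric] by auto
    then show "\<epsilon> \<in> value_choices v" using tv unfolding value_choices_def by simp
  qed (simp add: value_choices_def)
  have mu: "mu_S S n = 1 \<or> mu_S S n = - 1" if "S_squarefree S n"
    using that unfolding mu_S_def by (simp add: minus_one_power_iff)
  have mu0: "mu_S S n = 0" if "\<not> S_squarefree S n" using that unfolding mu_S_def by simp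
  have collapse: "(\<Sum>e\<in>value_choices v. of_bool (e = \<epsilon>) * g e) = (if \<bar>tuple_value \<epsilon>\<bar> = \<bar>v\<bar> then g \<epsilon> else 0)" for g :: "(nat \<Rightarrow> nat) \<Rightarrow> real"
  proof -
    have "(\<Sum>e\<in>value_choices v. of_bool (e = \<epsilon>) * g e) = (\<Sum>e\<in>value_choices v. if e = \<epsilon> then g e else 0)" by (intro sum.cong) auto
    then show ?thesis using in_choices finite_value_choices by (simp add: sum.delta')
  qed
  have good: "valuation_good S e n \<longleftrightarrow> e = \<epsilon> \<and> S_squarefree S n" if "e \<in> value_choices v" for e
    unfolding valuation_good_def using only[OF that] by auto
  have "(\<Sum>e\<in>value_choices v. of_bool (valuation_good S e n) :: real) = (\<Sum>e\<in>value_choices v. of_bool (e = \<epsilon>) * of_bool (S_squarefree S n))"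
    by (intro sum.cong refl) (simp add: good)
  also have "\<dots> = (if \<bar>tuple_value \<epsilon>\<bar> = \<bar>v\<bar> then of_bool (S_squarefree S n) else 0)" by (rule collapse)
  also have "\<dots> = of_bool (cmod (ramanujan_sum n k) = real_of_int \<bar>v\<bar>)"
  proof -
    have "cmod (ramanujan_sum n k) = real_of_int \<bar>mu_S S n * tuple_value \<epsilon>\<bar>" unfolding ram norm_of_int by simp
    then have "cmod (ramanujan_sum n k) = real_of_int \<bar>v\<bar> \<longleftrightarrow> \<bar>mu_S S n * tuple_value \<epsilon>\<bar> = \<bar>v\<bar>" by (simp only: of_int_eq_iff)
    then show ?thesis using mu mu0 v by (cases "S_squarefree S n") (auto simp: abs_mult)
  qed
  finally show "of_bool (cmod (ramanujan_sum n k) = real_of_int \<bar>v\<bar>) = (\<Sum>e\<in>value_choices v. of_bool (valuation_good (prime_factors k) e n) :: real)"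
    unfolding S_def by simp
  have "(\<Sum>e\<in>value_choices v. (of_bool (valuation_good S e n) + real_of_int (sgn (tuple_value e * v)) * (of_bool (\<forall>q\<in>S. multiplicity q n = e q) * real_of_int (mu_S S n))) / 2)
     = (\<Sum>e\<in>value_choices v. of_bool (e = \<epsilon>) * ((of_bool (S_squarefree S n) + real_of_int (sgn (tuple_value e * v)) * real_of_int (mu_S S n)) / 2))"
    by (intro sum.cong refl) (simp add: good only)
  also have "\<dots> = (if \<bar>tuple_value \<epsilon>\<bar> = \<bar>v\<bar> then (of_bool (S_squarefree S n) + real_of_int (sgn (tuple_value \<epsilon> * v)) * real_of_int (mu_S S n)) / 2 else 0)"
    by (rule collapse)
  also have "\<dots> = of_bool (ramanujan_sum n k = of_int v)"
  proof -
    have r: "ramanujan_sum n k = of_int v \<longleftrightarrow> mu_S S n * tuple_value \<epsilon> = v" unfolding ram by (simp only: of_int_eq_iff)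
    show ?thesis
    proof (cases "S_squarefree S n")
      case False
      then show ?thesis unfolding r using mu0 v by auto
    next
      case True
      show ?thesis
      proof (cases "\<bar>tuple_value \<epsilon>\<bar> = \<bar>v\<bar>")
        case False
        then have "mu_S S n * tuple_value \<epsilon> \<noteq> v" using mu[OF True] by auto
        then show ?thesis unfolding r using False by simp
      next
        case tv: True
        then consider "tuple_value \<epsilon> = v" | "tuple_value \<epsilon> = - v" by linarith
        then show ?thesis
        proof cases
          case 1
          have "sgn (tuple_value \<epsilon> * v) = 1" unfolding 1 using v by (simp add: sgn_mult)
          then show ?thesis unfolding r using mu[OF True] True tv 1 v by auto
        next
          case 2
          have "sgn (tuple_value \<epsilon> * v) = - 1" unfolding 2 using v by (simp add: sgn_mult)
          then show ?thesis unfolding r using mu[OF True] True tv 2 v by auto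
        qed
      qed
    qed
  qed
  finally show "of_bool (ramanujan_sum n k = of_int v) = (\<Sum>e\<in>value_choices v. (of_bool (valuation_good (prime_factors k) e n)
        + real_of_int (sgn (tuple_value e * v)) * (of_bool (\<forall>q\<in>prime_factors k. multiplicity q n = e q) * real_of_int (mu_S (prime_factors k) n))) / 2)"
    unfolding S_def by simp
qed

definition ramanujan_density :: "int \<Rightarrow> rat" where
  "ramanujan_density v = (\<Sum>e\<in>value_choices v. \<Prod>q\<in>prime_factors k. local_ratio q (e q))"

lemma prime_count_eq_sum: "prime_count P x = (\<Sum>p | prime p \<and> real p \<le> x. of_bool (p \<in> P))"
proof -
  have f: "finite {p::nat. prime p \<and> real p \<le> x}" using finite_primes_le[of x "\<lambda>_. True"] by simp
  have "{p. prime p \<and> real p \<le> x \<and> p \<in> P} = {p. prime p \<and> real p \<le> x} \<inter> {p. p \<in> P}" by auto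
  moreover have "(\<Sum>p | prime p \<and> real p \<le> x. of_bool (p \<in> P)) = real (card ({p. prime p \<and> real p \<le> x} \<inter> {p. p \<in> P}))"
    unfolding of_bool_def sum.If_cases[OF f] by simp
  ultimately show ?thesis unfolding prime_count_def by (simp only:)
qed

lemma prime_count_norm_eq:
  assumes v: "v \<noteq> 0"
  shows "prime_count {p. cmod (ramanujan_sum (p - 1) k) = real_of_int \<bar>v\<bar>} x
    = (\<Sum>e\<in>value_choices v. prime_count {p. valuation_good (prime_factors k) e (p - 1)} x)"
proof -
  have "prime_count {p. cmod (ramanujan_sum (p - 1) k) = real_of_int \<bar>v\<bar>} x
     = (\<Sum>p | prime p \<and> real p \<le> x. \<Sum>e\<in>value_choices v. of_bool (valuation_good (prime_factors k) e (p - 1)))"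
    unfolding prime_count_eq_sum mem_Collect_eq
  proof (rule sum.cong[OF refl])
    fix p assume "p \<in> {p. prime p \<and> real p \<le> x}"
    then have "p - 1 > 0" using prime_gt_1_nat[of p] by simp
    then show "of_bool (cmod (ramanujan_sum (p - 1) k) = real_of_int \<bar>v\<bar>) = (\<Sum>e\<in>value_choices v. of_bool (valuation_good (prime_factors k) e (p - 1)) :: real)"
      by (rule ramanujan_sum_indicators(1)[OF _ v])
  qed
  then show ?thesis unfolding prime_count_eq_sum mem_Collect_eq by (subst sum.swap)
qed

text \<open>The constants are summed over all of \<open>exponent_choices\<close> and not only over
  the tuples belonging to v, which makes the bound independent of v.\<close>

lemma ramanujan_norm_count:
  assumes H: "H > 0"
  shows "\<exists>C. \<forall>v. v \<noteq> 0 \<longrightarrow> (\<forall>x\<ge>2.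
        \<bar>prime_count {p. cmod (ramanujan_sum (p - 1) k) = real_of_int \<bar>v\<bar>} x
           - real_of_rat (ramanujan_density v) * artin_constant * Li x\<bar> \<le> C * (x / ln x powr H))"
proof -
  let ?S = "prime_factors k"
  let ?r = "\<lambda>e. real_of_rat (\<Prod>q\<in>?S. local_ratio q (e q)) * artin_constant"
  let ?N = "\<lambda>e x. prime_count {p. valuation_good ?S e (p - 1)} x"
  have "\<forall>e. \<exists>C\<ge>0. \<forall>x\<ge>2. \<bar>?N e x - ?r e * Li x\<bar> \<le> C * (x / ln x powr H)"
    by (intro allI valuation_good_count_powr[OF _ _ H]) auto
  then obtain C where C: "\<And>e. C e \<ge> 0" "\<And>e x. x \<ge> 2 \<Longrightarrow> \<bar>?N e x - ?r e * Li x\<bar> \<le> C e * (x / ln x powr H)" by metis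
  show ?thesis
  proof (rule exI[of _ "\<Sum>e\<in>exponent_choices. C e"], intro allI impI)
    fix v :: int and x :: real assume v: "v \<noteq> 0" and x: "2 \<le> x"
    have "real_of_rat (ramanujan_density v) * artin_constant * Li x = (\<Sum>e\<in>value_choices v. ?r e * Li x)"
      unfolding ramanujan_density_def of_rat_sum sum_distrib_right ..
    then have "\<bar>prime_count {p. cmod (ramanujan_sum (p - 1) k) = real_of_int \<bar>v\<bar>} x - real_of_rat (ramanujan_density v) * artin_constant * Li x\<bar>
      = \<bar>\<Sum>e\<in>value_choices v. ?N e x - ?r e * Li x\<bar>" unfolding prime_count_norm_eq[OF v] sum_subtractf by simp
    also have "\<dots> \<le> (\<Sum>e\<in>value_choices v. \<bar>?N e x - ?r e * Li x\<bar>)" by (rule sum_abs)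
    also have "\<dots> \<le> (\<Sum>e\<in>value_choices v. C e * (x / ln x powr H))" by (intro sum_mono C(2)[OF x])
    also have "\<dots> \<le> (\<Sum>e\<in>exponent_choices. C e * (x / ln x powr H))"
      using C(1) x by (intro sum_mono2 finite_exponent_choices) (auto simp: value_choices_def)
    also have "\<dots> = (\<Sum>e\<in>exponent_choices. C e) * (x / ln x powr H)" by (rule sum_distrib_right[symmetric])
    finally show "\<bar>prime_count {p. cmod (ramanujan_sum (p - 1) k) = real_of_int \<bar>v\<bar>} x - real_of_rat (ramanujan_density v) * artin_constant * Li x\<bar>
       \<le> (\<Sum>e\<in>exponent_choices. C e) * (x / ln x powr H)" .
  qed
qed

text \<open>Summed over p, the unsigned half of the second indicator has the density found by the
  sieve. The signed half is, for each tuple, a sum from the conjecture, hence of smaller order than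
  \<pi>(x).\<close>

lemma ramanujan_value_density:
  assumes conj: conjecture1 and v: "v \<noteq> 0"
  shows "has_prime_density {p. ramanujan_sum (p - 1) k = of_int v} (real_of_rat (ramanujan_density v) * artin_constant / 2)"
proof -
  let ?S = "prime_factors k"
  let ?r = "\<lambda>e. real_of_rat (\<Prod>q\<in>?S. local_ratio q (e q)) * artin_constant"
  let ?N = "\<lambda>e x. prime_count {p. valuation_good ?S e (p - 1)} x"
  let ?U = "\<lambda>x. {p::nat. prime p \<and> real p \<le> x}"
  let ?M = "\<lambda>e x. \<Sum>p\<in>?U x. of_bool (\<forall>q\<in>?S. multiplicity q (p - 1) = e q) * real_of_int (mu_S ?S (p - 1))"
  let ?\<sigma> = "\<lambda>e. real_of_int (sgn (tuple_value e * v))"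
  have M: "((\<lambda>x. ?M e x / primes_pi x) \<longlongrightarrow> 0) at_top" for e
  proof -
    \<comment> \<open>\<open>nu_tuple\<close> lists valuations along the sorted primes, so the
      function e has to be read in the same order.\<close>
    define es where "es = map e (sorted_list_of_set ?S)"
    have nu: "nu_tuple ?S n = es \<longleftrightarrow> (\<forall>q\<in>?S. multiplicity q n = e q)" for n
      unfolding nu_tuple_def es_def by simp
    have "finite ?S \<and> (\<forall>q\<in>?S. prime q)" "length es = card ?S" unfolding es_def by auto
    then have "(\<lambda>x::real. real_of_int (\<Sum>p | prime p \<and> real p \<le> x \<and> nu_tuple ?S (p - 1) = es. mu_S ?S (p - 1))) \<in> o[at_top](primes_pi)"
      using conj unfolding conjecture1_def by blast
    then have "((\<lambda>x::real. real_of_int (\<Sum>p | prime p \<and> real p \<le> x \<and> nu_tuple ?S (p - 1) = es. mu_S ?S (p - 1)) / primes_pi x) \<longlongrightarrow> 0) at_top"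
      by (rule smalloD_tendsto)
    moreover have "real_of_int (\<Sum>p | prime p \<and> real p \<le> x \<and> nu_tuple ?S (p - 1) = es. mu_S ?S (p - 1)) = ?M e x" for x
    proof -
      have f: "finite (?U x)" using finite_primes_le[of x "\<lambda>_. True"] by simp
      have "(\<Sum>p | prime p \<and> real p \<le> x \<and> nu_tuple ?S (p - 1) = es. real_of_int (mu_S ?S (p - 1))) = ?M e x"
        unfolding nu by (intro sum.mono_neutral_cong_left f) auto
      then show ?thesis by simp
    qed
    ultimately show ?thesis by simp
  qed
  have pc: "prime_count {p. ramanujan_sum (p - 1) k = of_int v} x = (\<Sum>e\<in>value_choices v. (?N e x + ?\<sigma> e * ?M e x) / 2)" for x
  proof -
    have "prime_count {p. ramanujan_sum (p - 1) k = of_int v} x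
      = (\<Sum>p\<in>?U x. \<Sum>e\<in>value_choices v. (of_bool (valuation_good ?S e (p - 1))
        + ?\<sigma> e * (of_bool (\<forall>q\<in>?S. multiplicity q (p - 1) = e q) * real_of_int (mu_S ?S (p - 1)))) / 2)"
      unfolding prime_count_eq_sum mem_Collect_eq
    proof (rule sum.cong[OF refl])
      fix p assume "p \<in> ?U x"
      then have "p - 1 > 0" using prime_gt_1_nat[of p] by simp
      then show "of_bool (ramanujan_sum (p - 1) k = of_int v) = (\<Sum>e\<in>value_choices v. (of_bool (valuation_good ?S e (p - 1))
        + ?\<sigma> e * (of_bool (\<forall>q\<in>?S. multiplicity q (p - 1) = e q) * real_of_int (mu_S ?S (p - 1)))) / 2)"
        by (rule ramanujan_sum_indicators(2)[OF _ v])
    qed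
    also have "\<dots> = (\<Sum>e\<in>value_choices v. \<Sum>p\<in>?U x. (of_bool (valuation_good ?S e (p - 1))
        + ?\<sigma> e * (of_bool (\<forall>q\<in>?S. multiplicity q (p - 1) = e q) * real_of_int (mu_S ?S (p - 1)))) / 2)"
      by (rule sum.swap)
    also have "\<dots> = (\<Sum>e\<in>value_choices v. (?N e x + ?\<sigma> e * ?M e x) / 2)"
      unfolding prime_count_eq_sum mem_Collect_eq sum_divide_distrib[symmetric] sum.distrib sum_distrib_left[symmetric] ..
    finally show ?thesis .
  qed
  have frac: "(a + b * c) / 2 / d = (a / d + b * (c / d)) / 2" for a b c d :: real by (simp add: add_divide_distrib)
  have eq: "prime_count {p. ramanujan_sum (p - 1) k = of_int v} x / primes_pi x
      = (\<Sum>e\<in>value_choices v. (?N e x / primes_pi x + ?\<sigma> e * (?M e x / primes_pi x)) / 2)" for x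
    unfolding pc by (subst sum_divide_distrib) (intro sum.cong refl frac)
  have lim: "((\<lambda>x. \<Sum>e\<in>value_choices v. (?N e x / primes_pi x + ?\<sigma> e * (?M e x / primes_pi x)) / 2)
      \<longlongrightarrow> (\<Sum>e\<in>value_choices v. (?r e + ?\<sigma> e * 0) / 2)) at_top"
  proof (intro tendsto_sum tendsto_divide tendsto_add tendsto_mult tendsto_const M)
    fix e
    show "((\<lambda>x. ?N e x / primes_pi x) \<longlongrightarrow> ?r e) at_top"
      using valuation_good_density[of ?S e] unfolding has_prime_density_def by auto
  qed simp
  have val: "(\<Sum>e\<in>value_choices v. (?r e + ?\<sigma> e * 0) / 2) = real_of_rat (ramanujan_density v) * artin_constant / 2"
    unfolding ramanujan_density_def of_rat_sum by (simp add: sum_distrib_right sum_divide_distrib)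
  show ?thesis unfolding has_prime_density_def eq using lim unfolding val .
qed

end

theorem theorem5:
  fixes k :: nat
  assumes "k \<ge> 1"
  shows "\<exists>c :: int \<Rightarrow> rat.
    (\<forall>H::real. H > 0 \<longrightarrow>
      (\<exists>C. \<forall>v. v \<noteq> 0 \<longrightarrow> (\<forall>x\<ge>2.
        \<bar>prime_count {p. cmod (ramanujan_sum (p - 1) k) = real_of_int \<bar>v\<bar>} x
           - real_of_rat (c v) * artin_constant * Li x\<bar>
        \<le> C * (x / ln x powr H))))
    \<and> (conjecture1 \<longrightarrow>
      (\<forall>v. v \<noteq> 0 \<longrightarrow>
        has_prime_density {p. ramanujan_sum (p - 1) k = of_int v}
          (real_of_rat (c v) * artin_constant / 2)))"
  using ramanujan_norm_count[OF assms] ramanujan_value_density[OF assms]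
  by (intro exI[of _ "ramanujan_density k"] conjI allI impI) auto

end
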